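(* Let $k$ and $n$ be positive integers. The Khovanov homology group $\mathcal{H}^{i,j}(T'_{2k,2kn})$ is trivial if $i>0$ or $j>0$.
   Context: $T_{p,q}$ denotes the torus link which is the closure of the $p$-strand braid $(\sigma_1\sigma_2\cdots\sigma_{p-1})^q$, with all strands oriented in parallel, and with the sign of the generators chosen so that all $(p-1)q$ crossings are positive. $T'_{2k,2kn}$ denotes the $2k$-component link $T_{2k,2kn}$ with the orientation of exactly $k$ of its components reversed; its diagram then has $n_+=2k(k-1)n$ positive and $n_-=2k^2n$ negative crossings, and $\mathcal{H}^{i,j}(T'_{2k,2kn})=\mathcal{H}^{i+2k^2n,\,j+6k^2n}(T_{2k,2kn})$. $\mathcal{H}^{i,j}(L)$ denotes the integral Khovanov ($sl(2)$) homology of an oriented link $L$, with $i$ the homological degree and $j$ the $q$-degree. Conventions: for a diagram $D$ with $n_+$ positive and $n_-$ negative crossings, $C(D)$ is the cube-of-resolutions complex in homological degrees $0,\dots,n_++n_-$ (a circle is assigned the free module on $v_+,v_-$ of $q$-degrees $+1,-1$; the vertex with $r$ one-resolutions is placed in homological degree $r$ and its $q$-degree is shifted up by $r$), $H^{i,j}(D)$ is its homology, and $\mathcal{H}^{i-n_-,\,j+n_+-2n_-}(L)=H^{i,j}(D)$. With these conventions the graded Euler characteristic is the unnormalized Jones polynomial (value $q+q^{-1}$ on the unknot), and positive links have homology in nonnegative homological degrees; e.g. $T_{2,2}$ has Poincaré polynomial $1+q^2+t^2q^4+t^2q^6$. *)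

theory Defs
  imports "HOL-Algebra.Free_Abelian_Groups"
begin

section \<open>Oriented link diagrams\<close>

text \<open>
  Oriented link diagrams are given by signed planar diagram codes. The arcs of a diagram are the
  pieces into which it is cut by its crossings, where an arc that meets no crossing is a closed
  circle. The four arcs at a crossing are listed counterclockwise around it, starting from the
  incoming end of the under-strand. In \<open>Xp a b c d\<close> (a positive crossing) the under-strand runs
  from \<open>a\<close> to \<open>c\<close> and the over-strand from \<open>d\<close> to \<open>b\<close>; in \<open>Xm a b c d\<close> (a negative crossing)
  the under-strand runs from \<open>a\<close> to \<open>c\<close> and the over-strand from \<open>b\<close> to \<open>d\<close>.
\<close>

datatype 'a crossing = is_positive: Xp 'a 'a 'a 'a | is_negative: Xm 'a 'a 'a 'a

record 'a diagram =
  arcs :: "'a set"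
  crossings :: "'a crossing list"

definition n_plus :: "'a diagram \<Rightarrow> nat" where
  "n_plus D = length (filter is_positive (crossings D))"

definition n_minus :: "'a diagram \<Rightarrow> nat" where
  "n_minus D = length (filter is_negative (crossings D))"

definition connected_classes :: "'a set \<Rightarrow> ('a \<times> 'a) set \<Rightarrow> 'a set set" where
  "connected_classes A r = A // (r \<union> r\<inverse>)\<^sup>*"

fun through :: "'a crossing \<Rightarrow> ('a \<times> 'a) set" where
  "through (Xp a b c d) = {(a, c), (b, d)}"
| "through (Xm a b c d) = {(a, c), (b, d)}"

definition link_components :: "'a diagram \<Rightarrow> 'a set set" where
  "link_components D = connected_classes (arcs D) (\<Union>X \<in> set (crossings D). through X)"

text \<open>
  Reversing only one of the two strands at a crossing changes its sign; reversing the under-strand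
  moves the starting point of the list of arcs.
\<close>

fun reverse_crossing :: "'a set \<Rightarrow> 'a crossing \<Rightarrow> 'a crossing" where
  "reverse_crossing R (Xp a b c d) =
     (if a \<in> R then (if b \<in> R then Xp c d a b else Xm c d a b)
      else (if b \<in> R then Xm a b c d else Xp a b c d))"
| "reverse_crossing R (Xm a b c d) =
     (if a \<in> R then (if b \<in> R then Xm c d a b else Xp c d a b)
      else (if b \<in> R then Xp a b c d else Xm a b c d))"

definition reverse_components :: "'a set set \<Rightarrow> 'a diagram \<Rightarrow> 'a diagram" where
  "reverse_components K D = D\<lparr>crossings := map (reverse_crossing (\<Union>K)) (crossings D)\<rparr>"

section \<open>Closures of positive braids and torus links\<close>

text \<open>
  A positive braid word on the strand positions \<open>0, \<dots>, p - 1\<close> is a list of generator indices;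
  the generator with index \<open>g\<close> (\<open>1 \<le> g < p\<close>) crosses positions \<open>g - 1\<close> and \<open>g\<close>. With the braid
  running upwards, the arc \<open>(s, l)\<close> of the closure is the piece in position \<open>s\<close> that has passed
  \<open>l\<close> crossings since the bottom of the braid; as the braid is closed up, \<open>l\<close> is taken modulo the
  number of crossings which the position meets. At each crossing the over-strand runs from bottom
  left to top right.
\<close>

definition touches :: "nat list \<Rightarrow> nat \<Rightarrow> nat" where
  "touches w s = length (filter (\<lambda>g. s = g - 1 \<or> s = g) w)"

definition braid_arc :: "nat list \<Rightarrow> nat \<Rightarrow> nat \<Rightarrow> nat \<times> nat" where
  "braid_arc w t s = (s, touches (take t w) s mod touches w s)"

definition braid_crossing :: "nat list \<Rightarrow> nat \<Rightarrow> (nat \<times> nat) crossing" where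
  "braid_crossing w t =
     (let g = w ! t in
        Xp (braid_arc w t g) (braid_arc w (Suc t) g)
           (braid_arc w (Suc t) (g - 1)) (braid_arc w t (g - 1)))"

definition braid_closure :: "nat \<Rightarrow> nat list \<Rightarrow> (nat \<times> nat) diagram" where
  "braid_closure p w =
     \<lparr>arcs = {(s, l). s < p \<and> l < max 1 (touches w s)},
      crossings = map (braid_crossing w) [0..<length w]\<rparr>"

definition torus_link :: "nat \<Rightarrow> nat \<Rightarrow> (nat \<times> nat) diagram" where
  "torus_link p q = braid_closure p (concat (replicate q [1..<p]))"

section \<open>The cube of resolutions\<close>

text \<open>
  The 0-smoothing joins the two regions that the over-strand sweeps out when it is rotated
  counterclockwise; it does not depend on the orientation. It agrees with the oriented smoothing
  at a positive crossing.
\<close>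

fun smoothing0 :: "'a crossing \<Rightarrow> ('a \<times> 'a) set" where
  "smoothing0 (Xp a b c d) = {(a, b), (c, d)}"
| "smoothing0 (Xm a b c d) = {(a, b), (c, d)}"

fun smoothing1 :: "'a crossing \<Rightarrow> ('a \<times> 'a) set" where
  "smoothing1 (Xp a b c d) = {(a, d), (b, c)}"
| "smoothing1 (Xm a b c d) = {(a, d), (b, c)}"

text \<open>
  A vertex of the cube is the set \<open>v\<close> of (indices of) crossings at which the 1-smoothing is taken.
  A circle of a resolution is represented by the set of arcs of which it consists.
\<close>

definition circles :: "'a diagram \<Rightarrow> nat set \<Rightarrow> 'a set set" where
  "circles D v = connected_classes (arcs D)
     (\<Union>m < length (crossings D).
        if m \<in> v then smoothing1 (crossings D ! m) else smoothing0 (crossings D ! m))"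

datatype label = v_plus | v_minus

fun label_degree :: "label \<Rightarrow> int" where
  "label_degree v_plus = 1"
| "label_degree v_minus = -1"

type_synonym 'a labelling = "'a set \<Rightarrow> label"

text \<open>
  A labelling of the circles of the vertex \<open>v\<close> stands for a basis element of the tensor product
  of the modules assigned to these circles.
\<close>

definition labellings :: "'a diagram \<Rightarrow> nat set \<Rightarrow> 'a labelling set" where
  "labellings D v = circles D v \<rightarrow>\<^sub>E UNIV"

definition basis :: "'a diagram \<Rightarrow> int \<Rightarrow> int \<Rightarrow> (nat set \<times> 'a labelling) set" where
  "basis D i j =
     {(v, x). v \<subseteq> {..<length (crossings D)} \<and> x \<in> labellings D v \<and>
        i = int (card v) \<and> j = (\<Sum>C \<in> circles D v. label_degree (x C)) + int (card v)}"

text \<open>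
  The nonzero matrix entries, all equal to 1, of the multiplication
  \<open>v\<^sub>+ \<otimes> v\<^sub>+ \<mapsto> v\<^sub>+\<close>, \<open>v\<^sub>+ \<otimes> v\<^sub>- \<mapsto> v\<^sub>-\<close>, \<open>v\<^sub>- \<otimes> v\<^sub>+ \<mapsto> v\<^sub>-\<close>, \<open>v\<^sub>- \<otimes> v\<^sub>- \<mapsto> 0\<close>
  and of the comultiplication \<open>v\<^sub>+ \<mapsto> v\<^sub>+ \<otimes> v\<^sub>- + v\<^sub>- \<otimes> v\<^sub>+\<close>, \<open>v\<^sub>- \<mapsto> v\<^sub>- \<otimes> v\<^sub>-\<close>. In both, the
  first two components of a triple belong to the tensor product.
\<close>

definition merge_entries :: "(label \<times> label \<times> label) set" where
  "merge_entries =
     {(v_plus, v_plus, v_plus), (v_plus, v_minus, v_minus), (v_minus, v_plus, v_minus)}"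

definition split_entries :: "(label \<times> label \<times> label) set" where
  "split_entries =
     {(v_plus, v_minus, v_plus), (v_minus, v_plus, v_plus), (v_minus, v_minus, v_minus)}"

definition edge_entry ::
  "'a diagram \<Rightarrow> nat set \<Rightarrow> 'a labelling \<Rightarrow> nat set \<Rightarrow> 'a labelling \<Rightarrow> bool" where
  "edge_entry D v x w y \<longleftrightarrow>
     (\<forall>C \<in> circles D v \<inter> circles D w. x C = y C) \<and>
     (\<exists>C1 C2 C. C1 \<noteq> C2 \<and>
        (circles D v - circles D w = {C1, C2} \<and> circles D w - circles D v = {C} \<and>
           (x C1, x C2, y C) \<in> merge_entries \<or>
         circles D v - circles D w = {C} \<and> circles D w - circles D v = {C1, C2} \<and>
           (y C1, y C2, x C) \<in> split_entries))"

definition boundary_basis ::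
  "'a diagram \<Rightarrow> nat set \<times> 'a labelling \<Rightarrow> (nat set \<times> 'a labelling) \<Rightarrow>\<^sub>0 int" where
  "boundary_basis D = (\<lambda>(v, x).
     \<Sum>m \<in> {..<length (crossings D)} - v.
       frag_cmul ((-1) ^ card {l \<in> v. l < m})
         (\<Sum>y \<in> {y \<in> labellings D (insert m v). edge_entry D v x (insert m v) y}.
            frag_of (insert m v, y)))"

definition chain_group ::
  "'a diagram \<Rightarrow> int \<Rightarrow> int \<Rightarrow> ((nat set \<times> 'a labelling) \<Rightarrow>\<^sub>0 int) monoid" where
  "chain_group D i j = free_Abelian_group (basis D i j)"

definition boundary ::
  "'a diagram \<Rightarrow> ((nat set \<times> 'a labelling) \<Rightarrow>\<^sub>0 int) \<Rightarrow> ((nat set \<times> 'a labelling) \<Rightarrow>\<^sub>0 int)" where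
  "boundary D = frag_extend (boundary_basis D)"

section \<open>Khovanov homology\<close>

definition diagram_homology ::
  "'a diagram \<Rightarrow> int \<Rightarrow> int \<Rightarrow> ((nat set \<times> 'a labelling) \<Rightarrow>\<^sub>0 int) set monoid" where
  "diagram_homology D i j =
     subgroup_generated (chain_group D i j)
       (kernel (chain_group D i j) (chain_group D (i + 1) j) (boundary D))
     Mod (boundary D ` carrier (chain_group D (i - 1) j))"

definition khovanov_homology ::
  "'a diagram \<Rightarrow> int \<Rightarrow> int \<Rightarrow> ((nat set \<times> 'a labelling) \<Rightarrow>\<^sub>0 int) set monoid" where
  "khovanov_homology D i j =
     diagram_homology D (i + int (n_minus D)) (j - int (n_plus D) + 2 * int (n_minus D))"

end

theory Submission
  imports Defs
begin

text \<open>
  Reversing components does not change the cube of resolutions but only shifts the degrees, by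
  \<open>n\<^sub>- = 2k\<^sup>2n\<close>; hence one has to show that the complex of the torus diagram on \<open>2k\<close> strands is exact in
  homological degrees above \<open>2k\<^sup>2n\<close> and in \<open>q\<close>-degrees above \<open>(2k\<^sup>2 + 2k)n\<close>. Such bounds for
  \<open>(\<sigma>\<^sub>1\<cdots>\<sigma>\<^sub>2\<^sub>k\<^sub>-\<^sub>1)\<^sup>N \<sigma>\<^sub>1\<cdots>\<sigma>\<^sub>i\<close> are proved by resolving the last crossing. Its 0-smoothing shortens the word. Its
  1-smoothing is a cap followed by a cup, and the cup can be pulled through the rows of the braid closure, at a known cost
  in both degrees, until it meets the cap; this removes two strands.

  No invariance of Khovanov homology is needed: all intermediate diagrams are partial resolutions of the one torus diagram, and
  pulling the cup over a crossing amounts to cancelling three of the four smoothings of two crossings. That every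
  edge of the cube merges or splits circles follows from a source-sink orientation, which alternates with the
  parity of the column.
\<close>


section \<open>Exactness by cancellation\<close>

text \<open>The constants come from one count: pulling a cup through a full twist on
  \<open>m\<close> strands costs \<open>2 * m - 2\<close> homological degrees and
  \<open>2 * m\<close> q-degrees and leaves a full twist on \<open>m - 2\<close> strands. For
  \<open>m = 2 * k + 2\<close> these are the increments of \<open>2k^2\<close> and
  \<open>2k^2 + 2k\<close> when \<open>k\<close> grows by one, so an induction on \<open>k\<close>
  loses nothing on whole twists. The difficulty is the last, incomplete twist: its outcome depends
  on where the cup arrives relative to the cap, and it may leave the two at different positions.
  Therefore the induction carries two statements, one on torus words and one on torus words between
  a cup and a cap at possibly different positions. A circle used to cancel a curl or a kink survives
  with a fixed label and shifts the q-degree. So the objects of the induction are sets of cells with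
  some crossings resolved and some closed circles labelled, and a bound for a word is asserted for
  all sets of cells that the word describes, relative to that shift. Moves of words then take the
  place of isotopies of links.\<close>

definition chain_complex_on :: "('c \<Rightarrow> 'c \<Rightarrow> int) \<Rightarrow> 'c set \<Rightarrow> bool" where
  "chain_complex_on M U \<longleftrightarrow> finite U \<and> (\<forall>a\<in>U. \<forall>c\<in>U. (\<Sum>b\<in>U. M a b * M b c) = 0)"

definition graded_by :: "('c \<Rightarrow> int) \<Rightarrow> ('c \<Rightarrow> 'c \<Rightarrow> int) \<Rightarrow> bool" where
  "graded_by deg M \<longleftrightarrow> (\<forall>a b. M a b \<noteq> 0 \<longrightarrow> deg b = deg a + 1)"

text \<open>Chains are integer functions acting as row vectors, so exactness becomes a statement
  about finite sums; homology groups return only at the end. Entries of \<open>M\<close> leaving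
  \<open>U\<close> are ignored, so that subquotients of a complex are obtained by shrinking
  \<open>U\<close>.\<close>

definition exact_at ::
  "('c \<Rightarrow> int) \<Rightarrow> ('c \<Rightarrow> 'c \<Rightarrow> int) \<Rightarrow> 'c set \<Rightarrow> int \<Rightarrow> bool" where
  "exact_at deg M U i \<longleftrightarrow>
     (\<forall>z. (\<forall>a. z a \<noteq> 0 \<longrightarrow> a \<in> U \<and> deg a = i) \<and> (\<forall>b\<in>U. (\<Sum>a\<in>U. z a * M a b) = 0) \<longrightarrow>
       (\<exists>y. (\<forall>a. y a \<noteq> 0 \<longrightarrow> a \<in> U \<and> deg a = i - 1) \<and> (\<forall>b\<in>U. z b = (\<Sum>a\<in>U. y a * M a b))))"

lemma exact_at_empty: "(\<And>a. a \<in> U \<Longrightarrow> deg a \<noteq> i) \<Longrightarrow> exact_at deg M U i"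
  unfolding exact_at_def by (intro allI impI exI[of _ "\<lambda>_. 0"]) (simp, metis)

lemma exact_atD:
  assumes "exact_at deg M U i" "\<And>b. b \<in> U \<Longrightarrow> (\<Sum>a\<in>U. z a * M a b) = 0"
    and "\<And>a. z a \<noteq> 0 \<Longrightarrow> a \<in> U \<and> deg a = i"
  shows "\<exists>y. (\<forall>a. y a \<noteq> 0 \<longrightarrow> a \<in> U \<and> deg a = i - 1) \<and>
      (\<forall>b\<in>U. z b = (\<Sum>a\<in>U. y a * M a b))"
  using assms(1)[unfolded exact_at_def, THEN spec, of z] assms(2,3) by (elim mp) blast

lemma boundary_of_boundary:
  fixes M :: "'c \<Rightarrow> 'c \<Rightarrow> int"
  assumes "chain_complex_on M U" "c \<in> U"
  shows "(\<Sum>b\<in>U. (\<Sum>a\<in>U. y a * M a b) * M b c) = 0"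
proof -
  have "(\<Sum>b\<in>U. (\<Sum>a\<in>U. y a * M a b) * M b c) = (\<Sum>b\<in>U. \<Sum>a\<in>U. y a * (M a b * M b c))"
    by (simp add: sum_distrib_right mult.assoc)
  also have "\<dots> = (\<Sum>a\<in>U. y a * (\<Sum>b\<in>U. M a b * M b c))"
    by (subst sum.swap) (simp add: sum_distrib_left)
  also have "\<dots> = 0"
    using assms by (simp add: chain_complex_on_def)
  finally show ?thesis .
qed

lemma chain_complex_on_split:
  assumes "chain_complex_on M (U1 \<union> U2)" "U1 \<inter> U2 = {}"
    and zero: "\<And>a b. a \<in> U2 \<Longrightarrow> b \<in> U1 \<Longrightarrow> M a b = 0"
  shows "chain_complex_on M U1" "chain_complex_on M U2"
proof -
  have fin: "finite U1" "finite U2"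
    using assms(1) by (auto simp: chain_complex_on_def)
  have sq: "(\<Sum>b\<in>U1. M a b * M b c) + (\<Sum>b\<in>U2. M a b * M b c) = 0" if "a \<in> U1 \<union> U2" "c \<in> U1 \<union> U2" for a c
    using assms(1,2) that fin by (simp add: chain_complex_on_def sum.union_disjoint)
  show "chain_complex_on M U1"
    unfolding chain_complex_on_def
  proof (intro conjI ballI fin)
    fix a c assume "a \<in> U1" "c \<in> U1"
    with sq[of a c] zero show "(\<Sum>b\<in>U1. M a b * M b c) = 0" by simp
  qed
  show "chain_complex_on M U2"
    unfolding chain_complex_on_def
  proof (intro conjI ballI fin)
    fix a c assume "a \<in> U2" "c \<in> U2"
    with sq[of a c] zero show "(\<Sum>b\<in>U2. M a b * M b c) = 0" by simp
  qed
qed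

text \<open>Entries lead from \<open>U1\<close> to \<open>U2\<close> but not back, so
  \<open>U2\<close> is a subcomplex with quotient \<open>U1\<close>, and this is the middle term of
  the long exact sequence. The part of a cycle on \<open>U1\<close> is removed by a chain
  \<open>y1\<close> on \<open>U1\<close>; what remains is a cycle on \<open>U2\<close>.\<close>

lemma exact_at_extension:
  fixes M :: "'c \<Rightarrow> 'c \<Rightarrow> int"
  assumes cx: "chain_complex_on M (U1 \<union> U2)" and dis: "U1 \<inter> U2 = {}" and gr: "graded_by deg M"
    and zero: "\<And>a b. a \<in> U2 \<Longrightarrow> b \<in> U1 \<Longrightarrow> M a b = 0"
    and ex1: "exact_at deg M U1 i" and ex2: "exact_at deg M U2 i"
  shows "exact_at deg M (U1 \<union> U2) i"
  unfolding exact_at_def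
proof (intro allI impI, elim conjE)
  let ?U = "U1 \<union> U2"
  fix z assume supp: "\<forall>a. z a \<noteq> 0 \<longrightarrow> a \<in> ?U \<and> deg a = i"
    and cyc: "\<forall>b\<in>?U. (\<Sum>a\<in>?U. z a * M a b) = 0"
  have fin: "finite U1" "finite U2"
    using cx by (auto simp: chain_complex_on_def)
  have sumU: "(\<Sum>a\<in>?U. f a) = (\<Sum>a\<in>U1. f a) + (\<Sum>a\<in>U2. f a)" for f :: "'c \<Rightarrow> int"
    using fin dis by (rule sum.union_disjoint)
  define z1 where "z1 a = (if a \<in> U1 then z a else 0)" for a
  have "(\<Sum>a\<in>U1. z1 a * M a b) = 0" if "b \<in> U1" for b
  proof -
    have "(\<Sum>a\<in>U1. z1 a * M a b) = (\<Sum>a\<in>?U. z a * M a b)"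
      using zero that unfolding sumU by (simp add: z1_def)
    then show ?thesis using cyc that by simp
  qed
  moreover have "a \<in> U1 \<and> deg a = i" if "z1 a \<noteq> 0" for a
    using supp that by (auto simp: z1_def split: if_splits)
  ultimately have "\<exists>y. (\<forall>a. y a \<noteq> 0 \<longrightarrow> a \<in> U1 \<and> deg a = i - 1) \<and>
      (\<forall>b\<in>U1. z1 b = (\<Sum>a\<in>U1. y a * M a b))"
    by (intro exact_atD[OF ex1])
  then obtain y1 where "\<forall>a. y1 a \<noteq> 0 \<longrightarrow> a \<in> U1 \<and> deg a = i - 1"
      "\<forall>b\<in>U1. z1 b = (\<Sum>a\<in>U1. y1 a * M a b)"
    by (elim exE conjE) (rule that)
  note y1 = this[rule_format]
  have y1_0: "y1 a = 0" if "a \<notin> U1" for a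
    using y1(1)[of a] that by auto
  have y1U: "(\<Sum>a\<in>?U. y1 a * M a b) = (\<Sum>a\<in>U1. y1 a * M a b)" for b
  proof -
    have "(\<Sum>a\<in>U2. y1 a * M a b) = 0" using y1_0 dis by (intro sum.neutral) auto
    then show ?thesis by (simp add: sumU)
  qed
  define z2 where "z2 b = (if b \<in> ?U then z b - (\<Sum>a\<in>?U. y1 a * M a b) else 0)" for b
  have z2_U1: "z2 b = 0" if "b \<in> U1" for b
    using y1(2)[OF that] that by (simp add: z2_def y1U z1_def)
  have "b \<in> U2 \<and> deg b = i" if nz: "z2 b \<noteq> 0" for b
  proof -
    have bU: "b \<in> ?U"
      by (rule ccontr) (use nz in \<open>simp add: z2_def\<close>)
    have "b \<notin> U1" using nz z2_U1 by metis
    then have b: "b \<in> U2" using bU by simp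
    show "b \<in> U2 \<and> deg b = i"
    proof (cases "z b = 0")
      case True
      then have "(\<Sum>a\<in>?U. y1 a * M a b) \<noteq> 0" using nz bU by (simp only: z2_def) simp
      then obtain a where "y1 a * M a b \<noteq> 0" by (rule sum.not_neutral_contains_not_neutral)
      then have "deg a = i - 1" "deg b = deg a + 1"
        using y1(1)[of a] gr[unfolded graded_by_def, rule_format, of a b] by auto
      then show ?thesis using b by simp
    qed (use supp b in auto)
  qed
  moreover have "(\<Sum>b\<in>U2. z2 b * M b c) = 0" if "c \<in> U2" for c
  proof -
    have "(\<Sum>b\<in>U2. z2 b * M b c) = (\<Sum>b\<in>?U. z2 b * M b c)"
      using z2_U1 unfolding sumU by simp
    also have "\<dots> = (\<Sum>b\<in>?U. z b * M b c) - (\<Sum>b\<in>?U. (\<Sum>a\<in>?U. y1 a * M a b) * M b c)"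
      by (simp add: z2_def left_diff_distrib sum_subtractf)
    also have "\<dots> = 0"
      using cyc that boundary_of_boundary[OF cx] by simp
    finally show ?thesis .
  qed
  ultimately have "\<exists>y. (\<forall>a. y a \<noteq> 0 \<longrightarrow> a \<in> U2 \<and> deg a = i - 1) \<and>
      (\<forall>b\<in>U2. z2 b = (\<Sum>a\<in>U2. y a * M a b))"
    by (intro exact_atD[OF ex2])
  then obtain y2 where "\<forall>a. y2 a \<noteq> 0 \<longrightarrow> a \<in> U2 \<and> deg a = i - 1"
      "\<forall>b\<in>U2. z2 b = (\<Sum>a\<in>U2. y2 a * M a b)"
    by (elim exE conjE) (rule that)
  note y2 = this[rule_format]
  have y2_0: "y2 a = 0" if "a \<notin> U2" for a
    using y2(1)[of a] that by auto
  have y2U: "(\<Sum>a\<in>?U. y2 a * M a b) = (\<Sum>a\<in>U2. y2 a * M a b)" for b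
  proof -
    have "(\<Sum>a\<in>U1. y2 a * M a b) = 0" using y2_0 dis by (intro sum.neutral) auto
    then show ?thesis by (simp add: sumU)
  qed
  show "\<exists>y. (\<forall>a. y a \<noteq> 0 \<longrightarrow> a \<in> ?U \<and> deg a = i - 1) \<and>
      (\<forall>b\<in>?U. z b = (\<Sum>a\<in>?U. y a * M a b))"
  proof (intro exI conjI allI impI ballI)
    fix a assume "y1 a + y2 a \<noteq> 0"
    then have "y1 a \<noteq> 0 \<or> y2 a \<noteq> 0" by auto
    then show "a \<in> ?U" "deg a = i - 1" using y1(1)[of a] y2(1)[of a] by auto
  next
    fix b assume b: "b \<in> ?U"
    have "(\<Sum>a\<in>?U. (y1 a + y2 a) * M a b) = (\<Sum>a\<in>?U. y1 a * M a b) + (\<Sum>a\<in>U2. y2 a * M a b)"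
      using y2U by (simp add: distrib_right sum.distrib)
    also have "\<dots> = z b"
    proof (cases "b \<in> U1")
      case True
      then have "(\<Sum>a\<in>U2. y2 a * M a b) = 0" using zero by simp
      then show ?thesis using z2_U1[OF True] b by (simp add: z2_def)
    next
      case False
      then have "b \<in> U2" using b by simp
      then show ?thesis using y2(2)[of b] b by (simp add: z2_def)
    qed
    finally show "z b = (\<Sum>a\<in>?U. (y1 a + y2 a) * M a b)" by simp
  qed
qed

text \<open>The block from \<open>A\<close> to \<open>B\<close> is a bijection up to signs and
  nothing leads back, so the complex is the mapping cone of an isomorphism. The blocks inside
  \<open>A\<close> and inside \<open>B\<close> are arbitrary, which makes this a cancellation
  principle.\<close>

lemma exact_at_matching:
  fixes M :: "'c \<Rightarrow> 'c \<Rightarrow> int"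
  assumes cx: "chain_complex_on M (A \<union> B)" and dis: "A \<inter> B = {}" and gr: "graded_by deg M"
    and zero: "\<And>a b. a \<in> A \<Longrightarrow> b \<in> B \<Longrightarrow> M b a = 0"
    and unit: "\<And>a b. a \<in> A \<Longrightarrow> b \<in> B \<Longrightarrow> M a b \<noteq> 0 \<Longrightarrow> \<bar>M a b\<bar> = 1"
    and ex1: "\<And>a. a \<in> A \<Longrightarrow> \<exists>!b. b \<in> B \<and> M a b \<noteq> 0"
    and ex2: "\<And>b. b \<in> B \<Longrightarrow> \<exists>!a. a \<in> A \<and> M a b \<noteq> 0"
  shows "exact_at deg M (A \<union> B) i"
  unfolding exact_at_def
proof (intro allI impI, elim conjE)
  let ?U = "A \<union> B"
  fix z assume supp: "\<forall>a. z a \<noteq> 0 \<longrightarrow> a \<in> ?U \<and> deg a = i"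
    and cyc: "\<forall>b\<in>?U. (\<Sum>a\<in>?U. z a * M a b) = 0"
  have fin: "finite A" "finite B"
    using cx by (auto simp: chain_complex_on_def)
  have sumU: "(\<Sum>a\<in>?U. f a) = (\<Sum>a\<in>A. f a) + (\<Sum>a\<in>B. f a)" for f :: "'c \<Rightarrow> int"
    using fin dis by (rule sum.union_disjoint)
  define f where "f a = (THE b. b \<in> B \<and> M a b \<noteq> 0)" for a
  have f: "f a \<in> B" "M a (f a) \<noteq> 0" if "a \<in> A" for a
    using theI'[OF ex1[OF that]] by (auto simp: f_def)
  have f_eq: "b = f a" if "a \<in> A" "b \<in> B" "M a b \<noteq> 0" for a b
    using the1_equality[OF ex1[OF that(1)]] that by (simp add: f_def)
  have sumA: "(\<Sum>a\<in>A. g a * M a (f a0)) = g a0 * M a0 (f a0)" if "a0 \<in> A" for g :: "'c \<Rightarrow> int" and a0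
  proof -
    have "M a (f a0) = 0" if "a \<in> A" "a \<noteq> a0" for a
      using ex2[OF f(1)[OF \<open>a0 \<in> A\<close>]] f[OF \<open>a0 \<in> A\<close>] \<open>a0 \<in> A\<close> that by metis
    then show ?thesis
      using that fin(1) by (subst sum.remove[of _ a0]) auto
  qed
  have sqr: "M a (f a) * M a (f a) = 1" if "a \<in> A" for a
    using unit[OF that f[OF that]] by (metis abs_mult_self_eq mult_1)
  have f_surj: "\<exists>a\<in>A. b = f a" if "b \<in> B" for b
  proof -
    obtain a where "a \<in> A" "M a b \<noteq> 0" using ex2[OF \<open>b \<in> B\<close>] by auto
    then show ?thesis using f_eq[of a b] \<open>b \<in> B\<close> by auto
  qed
  \<comment> \<open>Inverting the signed bijection gives a chain whose boundary agrees with
    \<open>z\<close> on \<open>B\<close>. The difference is a cycle supported on \<open>A\<close>,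
    and the \<open>B\<close>-components of its boundary force it to vanish.\<close>
  define y where "y a = (if a \<in> A then z (f a) * M a (f a) else 0)" for a
  have sumB: "(\<Sum>a\<in>B. y a * g a) = 0" for g
    using dis by (auto simp: y_def intro!: sum.neutral)
  have y_bd: "(\<Sum>a\<in>?U. y a * M a b) = z b" if b: "b \<in> B" for b
  proof -
    obtain a0 where a0: "a0 \<in> A" "b = f a0" using f_surj[OF b] by blast
    have "(\<Sum>a\<in>?U. y a * M a b) = y a0 * M a0 (f a0)"
      using sumA[OF a0(1), of y] by (simp add: sumU sumB a0(2))
    also have "\<dots> = z b" using a0 sqr[OF a0(1)] by (simp add: y_def mult.assoc)
    finally show ?thesis .
  qed
  define z' where "z' b = z b - (\<Sum>a\<in>?U. y a * M a b)" for b
  have z'B: "z' b = 0" if "b \<in> B" for b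
    using y_bd[OF that] by (simp add: z'_def)
  have z'A: "z' a0 = 0" if a0: "a0 \<in> A" for a0
  proof -
    have "(\<Sum>b\<in>?U. z' b * M b (f a0)) = (\<Sum>b\<in>?U. z b * M b (f a0)) -
        (\<Sum>b\<in>?U. (\<Sum>a\<in>?U. y a * M a b) * M b (f a0))"
      by (simp add: z'_def left_diff_distrib sum_subtractf)
    also have "\<dots> = 0"
      using cyc f(1)[OF a0] boundary_of_boundary[OF cx] by simp
    finally have "(\<Sum>b\<in>A. z' b * M b (f a0)) = 0"
      using z'B by (simp add: sumU)
    then show ?thesis using sumA[OF a0, of z'] f(2)[OF a0] by simp
  qed
  show "\<exists>y. (\<forall>a. y a \<noteq> 0 \<longrightarrow> a \<in> ?U \<and> deg a = i - 1) \<and>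
      (\<forall>b\<in>?U. z b = (\<Sum>a\<in>?U. y a * M a b))"
  proof (intro exI conjI allI impI ballI)
    fix a assume "y a \<noteq> 0"
    then have a: "a \<in> A" "z (f a) \<noteq> 0" by (auto simp: y_def split: if_splits)
    then show "a \<in> ?U" by simp
    have "deg (f a) = deg a + 1" using f(2)[OF a(1)] gr by (auto simp: graded_by_def)
    moreover have "deg (f a) = i" using supp a(2) by blast
    ultimately show "deg a = i - 1" by simp
  next
    fix b assume "b \<in> ?U"
    then have "z' b = 0" using z'A z'B by blast
    then show "z b = (\<Sum>a\<in>?U. y a * M a b)" by (simp add: z'_def)
  qed
qed


section \<open>Equivalence relations generated by gluing, and the effect on their classes\<close>

definition eq_closure :: "('a \<times> 'a) set \<Rightarrow> ('a \<times> 'a) set" where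
  "eq_closure r = (r \<union> r\<inverse>)\<^sup>*"

text \<open>For an equivalence relation \<open>R\<close> this is the smallest one containing
  \<open>R\<close> and the pair; the explicit form makes classes computable when generators are
  added one at a time, see \<open>eq_closure_insert\<close>.\<close>

definition glue :: "('a \<times> 'a) set \<Rightarrow> 'a \<Rightarrow> 'a \<Rightarrow> ('a \<times> 'a) set" where
  "glue R p q = R \<union> (R `` {p, q}) \<times> (R `` {p, q})"

lemma equiv_eq_closure: "equiv UNIV (eq_closure r)"
proof -
  have "sym (eq_closure r)"
    unfolding eq_closure_def by (intro sym_rtrancl sym_Un_converse)
  then show ?thesis
    by (simp add: equiv_def eq_closure_def refl_rtrancl trans_rtrancl)
qed

lemma eq_closure_least: "r \<subseteq> R \<Longrightarrow> equiv UNIV R \<Longrightarrow> eq_closure r \<subseteq> R"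
proof
  fix z assume r: "r \<subseteq> R" and R: "equiv UNIV R" and "z \<in> eq_closure r"
  then have "(fst z, snd z) \<in> (r \<union> r\<inverse>)\<^sup>*" by (simp add: eq_closure_def)
  then have "(fst z, snd z) \<in> R"
  proof (induction rule: rtrancl_induct)
    case base
    show ?case using R by (auto simp: equiv_def refl_on_def)
  next
    case (step y w)
    then have "(y, w) \<in> R" using r R by (auto simp: equiv_def sym_def)
    then show ?case using step R by (auto simp: equiv_def elim: transE)
  qed
  then show "z \<in> R" by simp
qed

lemma eq_closure_superset: "r \<subseteq> eq_closure r"
  by (auto simp: eq_closure_def)

lemma equivD:
  assumes "equiv UNIV R"
  shows "(a, a) \<in> R" "(a, b) \<in> R \<Longrightarrow> (b, a) \<in> R" "(a, b) \<in> R \<Longrightarrow> (b, c) \<in> R \<Longrightarrow> (a, c) \<in> R"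
  using assms by (auto simp: equiv_def refl_on_def elim: symE transE)

lemma equiv_glue: "equiv UNIV R \<Longrightarrow> equiv UNIV (glue R p q)"
proof -
  assume R: "equiv UNIV R"
  note e = equivD[OF R]
  have "refl (glue R p q)" using e(1) by (auto simp: glue_def refl_on_def)
  moreover have "sym (glue R p q)" using e(2) by (auto simp: glue_def sym_def)
  moreover have "trans (glue R p q)"
  proof (rule transI)
    let ?C = "R `` {p, q}"
    have C: "y \<in> ?C" if "x \<in> ?C" "(x, y) \<in> R" for x y using that e(3) by auto
    have C': "x \<in> ?C" if "y \<in> ?C" "(x, y) \<in> R" for x y using that C e(2) by metis
    fix x y z assume "(x, y) \<in> glue R p q" "(y, z) \<in> glue R p q"
    then have "(x, y) \<in> R \<or> x \<in> ?C \<and> y \<in> ?C" "(y, z) \<in> R \<or> y \<in> ?C \<and> z \<in> ?C"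
      by (auto simp only: glue_def)
    then have "(x, z) \<in> R \<or> x \<in> ?C \<and> z \<in> ?C"
      using e(3)[of x y z] C[of y z] C'[of y x] by argo
    then show "(x, z) \<in> glue R p q" by (auto simp only: glue_def)
  qed
  ultimately show ?thesis by (simp add: equiv_def)
qed

lemma eq_closure_insert: "eq_closure (insert (p, q) r) = glue (eq_closure r) p q"
proof
  have sup: "r \<subseteq> eq_closure r" by (rule eq_closure_superset)
  show "eq_closure (insert (p, q) r) \<subseteq> glue (eq_closure r) p q"
  proof (rule eq_closure_least)
    show "insert (p, q) r \<subseteq> glue (eq_closure r) p q"
      using sup equivD(1)[OF equiv_eq_closure[of r]] by (auto simp: glue_def)
  qed (intro equiv_glue equiv_eq_closure)
  let ?Q = "eq_closure (insert (p, q) r)"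
  have Q: "equiv UNIV ?Q" by (rule equiv_eq_closure)
  have rQ: "eq_closure r \<subseteq> ?Q"
    by (rule eq_closure_least[OF _ Q]) (use eq_closure_superset[of "insert (p, q) r"] in auto)
  have pq: "(p, q) \<in> ?Q" using eq_closure_superset[of "insert (p, q) r"] by auto
  have px: "(p, x) \<in> ?Q" if "x \<in> eq_closure r `` {p, q}" for x
    using that rQ pq equivD(3)[OF Q, of p q x] by auto
  have "(x, y) \<in> ?Q" if "x \<in> eq_closure r `` {p, q}" "y \<in> eq_closure r `` {p, q}" for x y
    using equivD(3)[OF Q equivD(2)[OF Q px[OF that(1)]] px[OF that(2)]] .
  then show "glue (eq_closure r) p q \<subseteq> ?Q"
    using rQ by (auto simp: glue_def)
qed

lemma Image_glue:
  assumes R: "equiv UNIV R"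
  shows "glue R p q `` {x} = (if x \<in> R `` {p, q} then R `` {p, q} else R `` {x})"
proof -
  have "R `` {x} \<subseteq> R `` {p, q}" if "x \<in> R `` {p, q}"
    using that equivD(3)[OF R, of _ x] by auto
  then show ?thesis unfolding glue_def by auto
qed

lemma class_eq_iff: "equiv UNIV R \<Longrightarrow> R `` {x} = R `` {y} \<longleftrightarrow> (x, y) \<in> R"
  by (simp add: eq_equiv_class_iff)

text \<open>Requiring the union to be new lets the differences of the two families be computed
  without any appeal to partitions.\<close>

definition merging :: "'a set set \<Rightarrow> 'a set set \<Rightarrow> 'a set \<Rightarrow> 'a set \<Rightarrow> bool" where
  "merging V W C1 C2 \<longleftrightarrow> C1 \<in> V \<and> C2 \<in> V \<and> C1 \<noteq> C2 \<and> C1 \<union> C2 \<notin> V \<and> W = insert (C1 \<union> C2) (V - {C1, C2})"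

lemma merging_glue:
  assumes R: "equiv UNIV R" and pq: "p \<in> A" "q \<in> A" "(p, q) \<notin> R"
  shows "merging (A // R) (A // glue R p q) (R `` {p}) (R `` {q})"
proof -
  note e = equivD[OF R]
  have U: "R `` {p, q} = R `` {p} \<union> R `` {q}" by auto
  have "R `` {p} \<union> R `` {q} \<notin> A // R"
  proof
    assume "R `` {p} \<union> R `` {q} \<in> A // R"
    then obtain x where "R `` {p} \<union> R `` {q} = R `` {x}" by (auto simp: quotient_def)
    then have "p \<in> R `` {x}" "q \<in> R `` {x}" using e(1) by blast+
    then show False using e(2,3) pq(3) by blast
  qed
  moreover have "A // glue R p q = insert (R `` {p} \<union> R `` {q}) (A // R - {R `` {p}, R `` {q}})"
  proof (intro equalityI subsetI)
    fix C assume "C \<in> A // glue R p q"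
    then obtain x where x: "x \<in> A" "C = glue R p q `` {x}" by (auto simp: quotient_def)
    show "C \<in> insert (R `` {p} \<union> R `` {q}) (A // R - {R `` {p}, R `` {q}})"
    proof (cases "x \<in> R `` {p, q}")
      case False
      then have "R `` {x} \<noteq> R `` {p}" "R `` {x} \<noteq> R `` {q}" using e(1,2) by blast+
      then show ?thesis using x False by (auto simp: Image_glue[OF R] quotientI)
    qed (use x in \<open>simp add: Image_glue[OF R] U\<close>)
  next
    fix C assume C: "C \<in> insert (R `` {p} \<union> R `` {q}) (A // R - {R `` {p}, R `` {q}})"
    show "C \<in> A // glue R p q"
    proof (cases "C = R `` {p} \<union> R `` {q}")
      case True
      have "glue R p q `` {p} = C" using True e(1)[of p] by (simp add: Image_glue[OF R] U)
      then show ?thesis using pq(1) by (auto simp: quotient_def)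
    next
      case False
      then obtain x where x: "x \<in> A" "C = R `` {x}" "C \<noteq> R `` {p}" "C \<noteq> R `` {q}"
        using C by (auto simp: quotient_def)
      then have "(p, x) \<notin> R" "(q, x) \<notin> R" by (auto simp: class_eq_iff[OF R] dest: e(2))
      then have "x \<notin> R `` {p, q}" by auto
      then have "glue R p q `` {x} = C" using x by (simp only: Image_glue[OF R] if_False)
      then show ?thesis using x(1) by (auto simp: quotient_def)
    qed
  qed
  moreover have "R `` {p} \<noteq> R `` {q}" using pq(3) by (simp add: class_eq_iff[OF R])
  ultimately show ?thesis using pq by (simp add: merging_def quotientI)
qed

section \<open>Ends at crossings, partial resolutions, and the pairing of loose ends\<close>

fun crossing_arc :: "'a crossing \<Rightarrow> nat \<Rightarrow> 'a" where
  "crossing_arc (Xp a b c d) k = [a, b, c, d] ! k"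
| "crossing_arc (Xm a b c d) k = [a, b, c, d] ! k"

definition end_arc :: "'a diagram \<Rightarrow> nat \<times> nat \<Rightarrow> 'a" where
  "end_arc D = (\<lambda>(l, k). crossing_arc (crossings D ! l) k)"

lemma smoothing0_arcs: "smoothing0 X = {(crossing_arc X 0, crossing_arc X 1), (crossing_arc X 2, crossing_arc X 3)}"
  by (cases X) (simp_all add: numeral_eq_Suc)

lemma smoothing1_arcs: "smoothing1 X = {(crossing_arc X 0, crossing_arc X 3), (crossing_arc X 1, crossing_arc X 2)}"
  by (cases X) (simp_all add: numeral_eq_Suc)

definition ends :: "nat set \<Rightarrow> (nat \<times> nat) set" where
  "ends S = S \<times> {..<4}"

definition smoothing :: "'a diagram \<Rightarrow> nat \<Rightarrow> bool \<Rightarrow> ('a \<times> 'a) set" where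
  "smoothing D l s = (if s then smoothing1 (crossings D ! l) else smoothing0 (crossings D ! l))"

abbreviation (input) ncross :: "'a diagram \<Rightarrow> nat" where
  "ncross D \<equiv> length (crossings D)"

text \<open>Crossings in \<open>S\<close> contribute nothing, so the classes of arcs are the open
  strands and closed circles of a partially resolved diagram; for \<open>S = {}\<close> they are the
  circles of a vertex.\<close>

definition conn :: "'a diagram \<Rightarrow> nat set \<Rightarrow> nat set \<Rightarrow> ('a \<times> 'a) set" where
  "conn D S v = eq_closure (\<Union>l \<in> {..<ncross D} - S. smoothing D l (l \<in> v))"

lemma circles_conn: "circles D v = arcs D // conn D {} v"
  unfolding circles_def connected_classes_def conn_def eq_closure_def smoothing_def lessThan_def
  by simp

lemma equiv_conn: "equiv UNIV (conn D S v)"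
  unfolding conn_def by (rule equiv_eq_closure)

lemma conn_cong: "v - S = w - S \<Longrightarrow> conn D S v = conn D S w"
proof -
  assume "v - S = w - S"
  then have "l \<in> v \<longleftrightarrow> l \<in> w" if "l \<notin> S" for l using that by blast
  then show ?thesis unfolding conn_def by (intro arg_cong[of _ _ eq_closure]) auto
qed

lemma conn_remove:
  assumes "l \<in> S" "l < ncross D"
  shows "conn D (S - {l}) v =
    (if l \<in> v then glue (glue (conn D S v) (end_arc D (l, 1)) (end_arc D (l, 2))) (end_arc D (l, 0)) (end_arc D (l, 3))
     else glue (glue (conn D S v) (end_arc D (l, 2)) (end_arc D (l, 3))) (end_arc D (l, 0)) (end_arc D (l, 1)))"
proof -
  have "{..<ncross D} - (S - {l}) = insert l ({..<ncross D} - S)" using assms by auto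
  then have "conn D (S - {l}) v = eq_closure (smoothing D l (l \<in> v) \<union> (\<Union>l \<in> {..<ncross D} - S. smoothing D l (l \<in> v)))"
    by (simp add: conn_def)
  then show ?thesis
    by (simp add: smoothing_def smoothing0_arcs smoothing1_arcs end_arc_def eq_closure_insert conn_def)
qed

lemma conn_mono: "S' \<subseteq> S \<Longrightarrow> v - S = w - S \<Longrightarrow> conn D S v \<subseteq> conn D S' w"
proof -
  assume S: "S' \<subseteq> S" "v - S = w - S"
  have "conn D S w \<subseteq> conn D S' w"
    unfolding conn_def using S(1)
    by (intro eq_closure_least equiv_eq_closure order_trans[OF _ eq_closure_superset]) auto
  then show ?thesis using conn_cong[OF S(2)] by metis
qed

text \<open>
  At a crossing with \<open>out l\<close> the arcs \<open>a, c\<close> point towards the crossing and \<open>b, d\<close> away from it;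
  otherwise it is the other way round. These directions are those of a source-sink orientation
  of the diagram, with which both smoothings are compatible; they have nothing to do with the
  orientation of the link.
\<close>

locale source_sink_diagram =
  fixes D :: "'a diagram" and out :: "nat \<Rightarrow> bool"
  assumes finite_arcs: "finite (arcs D)"
    and end_arc_in: "e \<in> ends {..<ncross D} \<Longrightarrow> end_arc D e \<in> arcs D"
    and end_arc_inj: "\<lbrakk>e \<in> ends {..<ncross D}; e' \<in> ends {..<ncross D};
        (even (snd e) = out (fst e)) = (even (snd e') = out (fst e')); end_arc D e = end_arc D e'\<rbrakk>
        \<Longrightarrow> e = e'"
    and end_arc_partner: "e \<in> ends {..<ncross D} \<Longrightarrow>
        \<exists>e' \<in> ends {..<ncross D}. (even (snd e') = out (fst e')) \<noteq> (even (snd e) = out (fst e)) \<and>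
          end_arc D e = end_arc D e'"
begin

abbreviation "inward e \<equiv> (even (snd e) = out (fst e))"

text \<open>Each strand has either no loose end in \<open>Es\<close> or exactly one inward and one
  outward loose end.\<close>

definition paired :: "(nat \<times> nat) set \<Rightarrow> ('a \<times> 'a) set \<Rightarrow> bool" where
  "paired Es R \<longleftrightarrow>
     (\<forall>e\<in>Es. \<forall>e'\<in>Es. inward e = inward e' \<and> (end_arc D e, end_arc D e') \<in> R \<longrightarrow> e = e') \<and>
     (\<forall>e\<in>Es. \<exists>e'\<in>Es. inward e' \<noteq> inward e \<and> (end_arc D e, end_arc D e') \<in> R)"

text \<open>Joining an inward to an outward end concatenates two strands: the partner of
  \<open>x\<close> and the partner of \<open>y\<close> become partners, and they point in opposite
  directions because \<open>x\<close> and \<open>y\<close> do. If \<open>x\<close> and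
  \<open>y\<close> were partners already, a closed circle splits off.\<close>

lemma paired_glue:
  assumes R: "equiv UNIV R" and p: "paired Es R" and x: "x \<in> Es" and y: "y \<in> Es" and xy: "inward x \<noteq> inward y"
  shows "paired (Es - {x, y}) (glue R (end_arc D x) (end_arc D y))"
proof -
  note e = equivD[OF R]
  define rel where "rel a b \<longleftrightarrow> (end_arc D a, end_arc D b) \<in> R" for a b
  have rs: "rel a b \<Longrightarrow> rel b a" for a b using e(2) by (auto simp: rel_def)
  have rt: "rel a b \<Longrightarrow> rel b c \<Longrightarrow> rel a c" for a b c using e(3) by (auto simp: rel_def)
  have uniq: "a = b" if "a \<in> Es" "b \<in> Es" "inward a = inward b" "rel a b" for a b
    using p that unfolding paired_def rel_def by blast
  have part: "\<exists>b\<in>Es. inward b \<noteq> inward a \<and> rel a b" if "a \<in> Es" for a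
    using p that unfolding paired_def rel_def by blast
  have gl: "(end_arc D a, end_arc D b) \<in> glue R (end_arc D x) (end_arc D y) \<longleftrightarrow>
      rel a b \<or> (rel x a \<or> rel y a) \<and> (rel x b \<or> rel y b)" for a b
    by (auto simp: glue_def rel_def)
  have ne: "a \<noteq> b" if "inward a \<noteq> inward b" for a b :: "nat \<times> nat" using that by auto
  have "a = b" if "a \<in> Es - {x, y}" "b \<in> Es - {x, y}" "inward a = inward b"
     "rel a b \<or> (rel x a \<or> rel y a) \<and> (rel x b \<or> rel y b)" for a b
  proof -
    have ab: "a \<in> Es" "b \<in> Es" "a \<noteq> x" "a \<noteq> y" "b \<noteq> x" "b \<noteq> y" using that by auto
    have 1: "inward c \<noteq> inward x" if "c \<in> Es" "c \<noteq> x" "rel x c" for c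
      using uniq[OF x that(1)] that by blast
    have 2: "inward c \<noteq> inward y" if "c \<in> Es" "c \<noteq> y" "rel y c" for c
      using uniq[OF y that(1)] that by blast
    have "rel a b"
      using that(4) that(3) 1[OF ab(1,3)] 1[OF ab(2,5)] 2[OF ab(1,4)] 2[OF ab(2,6)] xy
        rs[of x a] rs[of y a] rt[of a x b] rt[of a y b] by blast
    then show ?thesis using uniq[OF ab(1,2) that(3)] by simp
  qed
  moreover have "\<exists>b\<in>Es - {x, y}. inward b \<noteq> inward a \<and> (rel a b \<or> (rel x a \<or> rel y a) \<and> (rel x b \<or> rel y b))"
    if a: "a \<in> Es - {x, y}" for a
  proof -
    have aE: "a \<in> Es" "a \<noteq> x" "a \<noteq> y" using a by auto
    obtain b where b: "b \<in> Es" "inward b \<noteq> inward a" "rel a b" using part[OF aE(1)] by blast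
    \<comment> \<open>If the old partner of \<open>a\<close> is the glued end \<open>u\<close>, its
      new partner is the old partner of the other glued end \<open>v\<close>.\<close>
    have other: "\<exists>b\<in>Es - {x, y}. inward b \<noteq> inward a \<and> rel v b"
      if h: "rel a u" "u \<in> Es" "v \<in> Es" "inward u \<noteq> inward a" "inward u \<noteq> inward v" "a \<noteq> v" "{u, v} = {x, y}" for u v
    proof -
      obtain w where w: "w \<in> Es" "inward w \<noteq> inward v" "rel v w" using part[OF h(3)] by blast
      have "w \<noteq> u"
      proof
        assume "w = u"
        then have "rel a v" using w(3) that(1) rs rt by blast
        then show False using uniq[OF aE(1) that(3)] that by blast
      qed
      moreover have "w \<noteq> v" using w(2) by auto
      ultimately have "w \<in> Es - {x, y}" using w(1) that(7) by blast
      moreover have "inward w \<noteq> inward a" using w(2) that by blast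
      ultimately show ?thesis using w(3) by blast
    qed
    consider "b = x" | "b = y" | "b \<in> Es - {x, y}" using b(1) by blast
    then show ?thesis
    proof cases
      case 1
      then show ?thesis using other[of x y] b x y xy aE rs[of a x] by blast
    next
      case 2
      then show ?thesis using other[of y x] b x y xy aE rs[of a y] by blast
    next
      case 3
      then show ?thesis using b by blast
    qed
  qed
  ultimately show ?thesis unfolding paired_def gl by blast
qed

text \<open>With nothing resolved this is the assumption on arcs. Both smoothings join corners of
  different parity, 0-1 and 2-3 or 0-3 and 1-2, hence inward ends to outward ones, so each resolved
  crossing amounts to two applications of \<open>paired_glue\<close>.\<close>

lemma paired_conn:
  assumes "T \<subseteq> {..<ncross D}"
  shows "paired (ends ({..<ncross D} - T)) (eq_closure (\<Union>l\<in>T. smoothing D l (l \<in> v)))"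
proof -
  have "finite T" using assms finite_subset by blast
  then show ?thesis using assms
  proof (induction T)
    case empty
    have Id: "eq_closure {} = Id" by (simp add: eq_closure_def)
    have "e = e'" if "e \<in> ends {..<ncross D}" "e' \<in> ends {..<ncross D}" "inward e = inward e'"
       "end_arc D e = end_arc D e'" for e e'
      using end_arc_inj[OF that] .
    then show ?case
      using end_arc_partner unfolding paired_def by (simp add: Id)
  next
    case (insert l T)
    let ?r = "\<Union>l\<in>T. smoothing D l (l \<in> v)" and ?E = "ends ({..<ncross D} - T)"
    have IH: "paired ?E (eq_closure ?r)" using insert by simp
    have lE: "(l, k) \<in> ?E" if "k < 4" for k using insert that by (simp add: ends_def)
    have E: "ends ({..<ncross D} - insert l T) = ?E - {(l, 0), (l, 1), (l, 2), (l, 3)}"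
      by (auto simp: ends_def)
    have two: "paired (?E - {x, y} - {x', y'}) (glue (glue (eq_closure ?r) (end_arc D x) (end_arc D y)) (end_arc D x') (end_arc D y'))"
      if "x \<in> ?E" "y \<in> ?E" "x' \<in> ?E - {x, y}" "y' \<in> ?E - {x, y}" "inward x \<noteq> inward y" "inward x' \<noteq> inward y'"
      for x y x' y'
      using that by (intro paired_glue equiv_glue equiv_eq_closure IH)
    show ?case
    proof (cases "l \<in> v")
      case True
      have "eq_closure (\<Union>l\<in>insert l T. smoothing D l (l \<in> v)) =
          glue (glue (eq_closure ?r) (end_arc D (l, 1)) (end_arc D (l, 2))) (end_arc D (l, 0)) (end_arc D (l, 3))"
        using True by (simp add: smoothing_def smoothing1_arcs end_arc_def eq_closure_insert)
      moreover have "?E - {(l, 0), (l, 1), (l, 2), (l, 3)} = ?E - {(l, 1), (l, 2)} - {(l, 0), (l, 3)}" by auto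
      ultimately show ?thesis
        using two[of "(l, 1)" "(l, 2)" "(l, 0)" "(l, 3)"] lE unfolding E by simp
    next
      case False
      have "eq_closure (\<Union>l\<in>insert l T. smoothing D l (l \<in> v)) =
          glue (glue (eq_closure ?r) (end_arc D (l, 2)) (end_arc D (l, 3))) (end_arc D (l, 0)) (end_arc D (l, 1))"
        using False by (simp add: smoothing_def smoothing0_arcs end_arc_def eq_closure_insert)
      moreover have "?E - {(l, 0), (l, 1), (l, 2), (l, 3)} = ?E - {(l, 2), (l, 3)} - {(l, 0), (l, 1)}" by auto
      ultimately show ?thesis
        using two[of "(l, 2)" "(l, 3)" "(l, 0)" "(l, 1)"] lE unfolding E by simp
    qed
  qed
qed

lemma paired_ends: "S \<subseteq> {..<ncross D} \<Longrightarrow> paired (ends S) (conn D S v)"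
  using paired_conn[of "{..<ncross D} - S" v] by (simp add: conn_def double_diff)

end


section \<open>The differential of the cube\<close>

text \<open>The condition of \<open>edge_entry\<close> with the two families of circles as the only
  data, so that the algebra of an edge can be studied apart from the diagram.\<close>

definition merge_or_split :: "'a set set \<Rightarrow> 'a set set \<Rightarrow> 'a labelling \<Rightarrow> 'a labelling \<Rightarrow> bool" where
  "merge_or_split V W x y \<longleftrightarrow>
     (\<forall>C \<in> V \<inter> W. x C = y C) \<and>
     (\<exists>C1 C2 C. C1 \<noteq> C2 \<and>
        (V - W = {C1, C2} \<and> W - V = {C} \<and> (x C1, x C2, y C) \<in> merge_entries \<or>
         V - W = {C} \<and> W - V = {C1, C2} \<and> (y C1, y C2, x C) \<in> split_entries))"

lemma merge_entries_sym: "(a, b, c) \<in> merge_entries \<longleftrightarrow> (b, a, c) \<in> merge_entries"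
  by (auto simp: merge_entries_def)

lemma split_entries_sym: "(a, b, c) \<in> split_entries \<longleftrightarrow> (b, a, c) \<in> split_entries"
  by (auto simp: split_entries_def)

lemma merging_diffs:
  assumes "merging V W C1 C2"
  shows "V - W = {C1, C2}" "W - V = {C1 \<union> C2}" "V \<inter> W = V - {C1, C2}" "C1 \<union> C2 \<noteq> C1" "C1 \<union> C2 \<noteq> C2"
  using assms unfolding merging_def by auto

text \<open>The sizes of the two differences decide which alternative of an edge applies, and the
  two circles of the pair are determined up to order.\<close>

lemma ex_doubleton:
  assumes "a \<noteq> b"
  shows "(\<exists>C1 C2 C. C1 \<noteq> C2 \<and> ({a, b} = {C1, C2} \<and> {c} = {C} \<and> P C1 C2 C \<or> {a, b} = {C} \<and> {c} = {C1, C2} \<and> Q C1 C2 C)) \<longleftrightarrow> P a b c \<or> P b a c"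
    (is "?L1 \<longleftrightarrow> ?R1")
    and "(\<exists>C1 C2 C. C1 \<noteq> C2 \<and> ({c} = {C1, C2} \<and> {a, b} = {C} \<and> P C1 C2 C \<or> {c} = {C} \<and> {a, b} = {C1, C2} \<and> Q C1 C2 C)) \<longleftrightarrow> Q a b c \<or> Q b a c"
    (is "?L2 \<longleftrightarrow> ?R2")
proof -
  have ba: "{a, b} = {b, a}" "b \<noteq> a" using assms by auto
  have two: "{c} = {u, v} \<longleftrightarrow> c = u \<and> c = v" "{u, v} = {c} \<longleftrightarrow> u = c \<and> v = c" for u v c by auto
  show "?L1 \<longleftrightarrow> ?R1"
  proof
    assume ?L1
    then show ?R1 using assms unfolding two doubleton_eq_iff by blast
  next
    assume ?R1
    then show ?L1 using assms ba by blast
  qed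
  show "?L2 \<longleftrightarrow> ?R2"
  proof
    assume ?L2
    then show ?R2 using assms unfolding two doubleton_eq_iff by blast
  next
    assume ?R2
    then show ?L2 using assms ba by blast
  qed
qed

lemma glue_trivial:
  assumes R: "equiv UNIV R" and pq: "(p, q) \<in> R"
  shows "glue R p q = R"
proof -
  have "R `` {q} = R `` {p}" using equiv_class_eq[OF R pq] by simp
  then have "R `` {p, q} = R `` {p}" by auto
  moreover have "R `` {p} \<times> R `` {p} \<subseteq> R"
  proof clarsimp
    fix x y assume "(p, x) \<in> R" "(p, y) \<in> R"
    then show "(x, y) \<in> R" using equivD(3)[OF R equivD(2)[OF R]] by metis
  qed
  ultimately show ?thesis unfolding glue_def by auto
qed

lemma merge_or_split_merging:
  assumes "merging V W C1 C2"
  shows "merge_or_split V W x y \<longleftrightarrow>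
    (\<forall>C \<in> V - {C1, C2}. x C = y C) \<and> (x C1, x C2, y (C1 \<union> C2)) \<in> merge_entries"
proof -
  have ne: "C1 \<noteq> C2" using assms by (simp add: merging_def)
  show ?thesis
    unfolding merge_or_split_def merging_diffs[OF assms] ex_doubleton(1)[OF ne]
    by (simp add: merge_entries_sym[of "x C2" "x C1"])
qed

lemma merge_or_split_splitting:
  assumes "merging W V C1 C2"
  shows "merge_or_split V W x y \<longleftrightarrow>
    (\<forall>C \<in> W - {C1, C2}. x C = y C) \<and> (y C1, y C2, x (C1 \<union> C2)) \<in> split_entries"
proof -
  have ne: "C1 \<noteq> C2" using assms by (simp add: merging_def)
  show ?thesis
    unfolding merge_or_split_def Int_commute[of V W] merging_diffs[OF assms] ex_doubleton(2)[OF ne]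
    by (simp add: split_entries_sym[of "y C2" "y C1"])
qed

lemma label_not: "l \<noteq> v_plus \<longleftrightarrow> l = v_minus" "l \<noteq> v_minus \<longleftrightarrow> l = v_plus"
  by (cases l; simp)+

lemma merge_entries_mult:
  "(v_minus, b, c) \<in> merge_entries \<longleftrightarrow> c = v_minus \<and> (v_plus, b, v_plus) \<in> merge_entries"
  "(v_minus, b, c) \<in> merge_entries \<Longrightarrow> c = v_minus"
  by (cases b; cases c; simp add: merge_entries_def)+

text \<open>The comultiplication is a map of modules: a factor \<open>X\<close> before it may be
  moved to one tensor factor after it. The previous lemma says the same of the
  multiplication.\<close>

lemma split_entries_mult:
  "(a, b, v_minus) \<in> split_entries \<longleftrightarrow> a = v_minus \<and> (v_plus, b, v_plus) \<in> split_entries"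
  "(a, b, v_minus) \<in> split_entries \<Longrightarrow> a = v_minus"
  by (cases a; cases b; simp add: split_entries_def)+

lemma agree_update_other: "C \<notin> A \<Longrightarrow> (\<forall>K\<in>A. (x(C := a)) K = z K) \<longleftrightarrow> (\<forall>K\<in>A. x K = z K)"
  "C \<notin> A \<Longrightarrow> (\<forall>K\<in>A. x K = (z(C := a)) K) \<longleftrightarrow> (\<forall>K\<in>A. x K = z K)"
  by (metis fun_upd_other)+

lemma agree_update:
  fixes x z :: "'b \<Rightarrow> label"
  assumes "C \<in> A" "x C = v_plus"
  shows "(\<forall>K\<in>A. (x(C := v_minus)) K = z K) \<longleftrightarrow> z C = v_minus \<and> (\<forall>K\<in>A. x K = (z(C := v_plus)) K)"
  using assms by (auto simp: fun_upd_apply)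

text \<open>
  The label \<open>v_minus\<close> stands for the generator \<open>X\<close> of \<open>\<int>[X]/(X\<^sup>2)\<close>, and the next lemma says that the
  maps of the edges commute with multiplication by \<open>X\<close> at a circle \<open>C\<close> that meets the circle \<open>C'\<close>.
\<close>

lemma merge_or_split_mult:
  assumes m: "merging V W C1 C2 \<or> merging W V C1 C2"
    and C: "C \<in> V" "C' \<in> W" "C = C' \<or> C \<in> {C1, C2} \<and> C' = C1 \<union> C2 \<or> C' \<in> {C1, C2} \<and> C = C1 \<union> C2"
  shows "x C = v_plus \<Longrightarrow> merge_or_split V W (x(C := v_minus)) z \<longleftrightarrow>
      z C' = v_minus \<and> merge_or_split V W x (z(C' := v_plus))" (is "_ \<Longrightarrow> ?A")
    and "x C = v_minus \<Longrightarrow> merge_or_split V W x z \<Longrightarrow> z C' = v_minus" (is "_ \<Longrightarrow> _ \<Longrightarrow> ?B")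
proof -
  \<comment> \<open>Only the first of the two merged circles is treated; the case of the second
    follows by exchanging \<open>C1\<close> and \<open>C2\<close>.\<close>
  have merge_case: "(x C = v_plus \<longrightarrow> ?A) \<and> (x C = v_minus \<longrightarrow> merge_or_split V W x z \<longrightarrow> ?B)"
    if m: "merging V W C1 C2"  "C = C' \<and> C \<noteq> C1 \<and> C \<noteq> C2 \<or> C = C1 \<and> C' = C1 \<union> C2" for C1 C2
  proof -
    note d = merging_diffs[OF m(1)]
    have k: "C1 \<in> V" "C2 \<in> V" "C1 \<noteq> C2" "C1 \<union> C2 \<notin> V" using m(1) by (auto simp: merging_def)
    have n: "C1 \<notin> V - {C1, C2}" "C1 \<union> C2 \<notin> V - {C1, C2}" using k by auto
    from m(2) show ?thesis
    proof (elim disjE conjE)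
      assume 1: "C = C'" "C \<noteq> C1" "C \<noteq> C2"
      have CA: "C \<in> V - {C1, C2}" using 1 C(1) by simp
      have "C \<noteq> C1 \<union> C2" using C(1) k(4) by auto
      then have u: "(x(C := v_minus)) C1 = x C1" "(x(C := v_minus)) C2 = x C2"
        "(z(C := v_plus)) (C1 \<union> C2) = z (C1 \<union> C2)" using 1 by simp_all
      show ?thesis
        unfolding merge_or_split_merging[OF m(1)] 1(1)[symmetric] u
        using agree_update[OF CA, of x z] CA by metis
    next
      assume 2: "C = C1" "C' = C1 \<union> C2"
      have u: "(x(C1 := v_minus)) C1 = v_minus" "(x(C1 := v_minus)) C2 = x C2"
        "(z(C1 \<union> C2 := v_plus)) (C1 \<union> C2) = v_plus" using k(3) by simp_all
      show ?thesis
        unfolding merge_or_split_merging[OF m(1)] 2 u agree_update_other[OF n(1)] agree_update_other[OF n(2)]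
        using merge_entries_mult[of "x C2" "z (C1 \<union> C2)"] by metis
    qed
  qed
  have split_case: "(x C = v_plus \<longrightarrow> ?A) \<and> (x C = v_minus \<longrightarrow> merge_or_split V W x z \<longrightarrow> ?B)"
    if m: "merging W V C1 C2"  "C = C' \<and> C \<noteq> C1 \<and> C \<noteq> C2 \<or> C' = C1 \<and> C = C1 \<union> C2" for C1 C2
  proof -
    note d = merging_diffs[OF m(1)]
    have k: "C1 \<in> W" "C2 \<in> W" "C1 \<noteq> C2" "C1 \<union> C2 \<notin> W" using m(1) by (auto simp: merging_def)
    have n: "C1 \<notin> W - {C1, C2}" "C1 \<union> C2 \<notin> W - {C1, C2}" using k by auto
    from m(2) show ?thesis
    proof (elim disjE conjE)
      assume 1: "C = C'" "C \<noteq> C1" "C \<noteq> C2"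
      have CA: "C \<in> W - {C1, C2}" using 1 C(2) by simp
      have "C \<noteq> C1 \<union> C2" using C(2) k(4) 1 by auto
      then have u: "(x(C := v_minus)) (C1 \<union> C2) = x (C1 \<union> C2)"
        "(z(C := v_plus)) C1 = z C1" "(z(C := v_plus)) C2 = z C2" using 1 by simp_all
      show ?thesis
        unfolding merge_or_split_splitting[OF m(1)] 1(1)[symmetric] u
        using agree_update[OF CA, of x z] CA by metis
    next
      assume 2: "C' = C1" "C = C1 \<union> C2"
      have u: "(z(C1 := v_plus)) C1 = v_plus" "(z(C1 := v_plus)) C2 = z C2"
        "(x(C1 \<union> C2 := v_minus)) (C1 \<union> C2) = v_minus" using k(3) by simp_all
      show ?thesis
        unfolding merge_or_split_splitting[OF m(1)] 2 u agree_update_other[OF n(1)] agree_update_other[OF n(2)]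
        using split_entries_mult[of "z C1" "z C2"] by metis
    qed
  qed
  have comm: "merging X Y C2 C1" if "merging X Y C1 C2" for X Y :: "'a set set"
    using that unfolding merging_def by (metis Un_commute insert_commute)
  have "(x C = v_plus \<longrightarrow> ?A) \<and> (x C = v_minus \<longrightarrow> merge_or_split V W x z \<longrightarrow> ?B)"
    using m
  proof
    assume m: "merging V W C1 C2"
    have "C1 \<notin> W" "C2 \<notin> W" "C1 \<union> C2 \<notin> V" using m merging_diffs[OF m] by (auto simp: merging_def)
    then consider "C = C'" "C \<noteq> C1" "C \<noteq> C2" | "C = C1" "C' = C1 \<union> C2" | "C = C2" "C' = C1 \<union> C2"
      using C by blast
    then show ?thesis
    proof cases
      case 1
      then show ?thesis by (intro merge_case[OF m]) simp
    next
      case 2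
      then show ?thesis by (intro merge_case[OF m]) simp
    next
      case 3
      then show ?thesis by (intro merge_case[OF comm[OF m]]) (simp add: Un_commute)
    qed
  next
    assume m: "merging W V C1 C2"
    have "C1 \<notin> V" "C2 \<notin> V" "C1 \<union> C2 \<notin> W" using m merging_diffs[OF m] by (auto simp: merging_def)
    then consider "C = C'" "C \<noteq> C1" "C \<noteq> C2" | "C' = C1" "C = C1 \<union> C2" | "C' = C2" "C = C1 \<union> C2"
      using C by blast
    then show ?thesis
    proof cases
      case 1
      then show ?thesis by (intro split_case[OF m]) simp
    next
      case 2
      then show ?thesis by (intro split_case[OF m]) simp
    next
      case 3
      then show ?thesis by (intro split_case[OF comm[OF m]]) (simp add: Un_commute)
    qed
  qed
  then show "x C = v_plus \<Longrightarrow> ?A" and "x C = v_minus \<Longrightarrow> merge_or_split V W x z \<Longrightarrow> ?B" by blast+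
qed

section \<open>Circles through a given arc, and the dichotomy between merging and splitting\<close>

context source_sink_diagram
begin

definition circ :: "nat set \<Rightarrow> 'a \<Rightarrow> 'a set" where
  "circ v p = conn D {} v `` {p}"

lemma circ_self: "p \<in> circ v p"
  using equivD(1)[OF equiv_conn] by (simp add: circ_def)

lemma circ_in: "p \<in> arcs D \<Longrightarrow> circ v p \<in> circles D v"
  by (simp add: circ_def circles_conn quotientI)

lemma circ_unique: "C \<in> circles D v \<Longrightarrow> p \<in> C \<Longrightarrow> C = circ v p"
proof -
  assume C: "C \<in> circles D v" and p: "p \<in> C"
  then obtain q where q: "C = conn D {} v `` {q}" by (auto simp: circles_conn elim!: quotientE)
  then have "conn D {} v `` {q} = conn D {} v `` {p}"
    using p by (intro equiv_class_eq[OF equiv_conn]) simp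
  then show ?thesis using q by (simp add: circ_def)
qed

lemma circ_eq: "p \<in> circ v q \<Longrightarrow> circ v p = circ v q"
  using equivD(2)[OF equiv_conn] by (auto simp: circ_def class_eq_iff[OF equiv_conn])

lemma finite_circles: "finite (circles D v)"
  using finite_arcs unfolding circles_conn quotient_def by simp

lemma circle_obtain:
  assumes "C \<in> circles D v" obtains p where "p \<in> arcs D" "C = circ v p"
  using assms unfolding circ_def circles_conn by (auto elim!: quotientE)

abbreviation "pt l k \<equiv> end_arc D (l, k)"

lemma pt_in: "l < ncross D \<Longrightarrow> k < 4 \<Longrightarrow> pt l k \<in> arcs D"
  by (rule end_arc_in) (simp add: ends_def)

definition merges :: "nat set \<Rightarrow> nat \<Rightarrow> bool" where
  "merges v l \<longleftrightarrow> circ v (pt l 0) \<noteq> circ v (pt l 2)"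

text \<open>With the crossing \<open>l\<close> removed, its four ends are paired, and the diagonal
  pairs 0-2 and 1-3 are excluded because their ends have equal direction. If they are paired as by
  the 0-smoothing, that smoothing gives two circles and the 1-smoothing one; if as by the
  1-smoothing, it is the other way round. An edge preserving the number of circles cannot
  occur.\<close>

lemma edge_cases:
  assumes l: "l < ncross D" "l \<notin> v"
  shows "(circ v (pt l 0) = circ v (pt l 1) \<and> circ v (pt l 2) = circ v (pt l 3)) \<and>
    (circ (insert l v) (pt l 0) = circ (insert l v) (pt l 3) \<and> circ (insert l v) (pt l 1) = circ (insert l v) (pt l 2)) \<and>
    (merges v l \<longrightarrow> merging (circles D v) (circles D (insert l v)) (circ v (pt l 0)) (circ v (pt l 2)) \<and>
        circ (insert l v) (pt l 0) = circ v (pt l 0) \<union> circ v (pt l 2) \<and>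
        circ (insert l v) (pt l 1) = circ v (pt l 0) \<union> circ v (pt l 2)) \<and>
    (\<not> merges v l \<longrightarrow> merging (circles D (insert l v)) (circles D v) (circ (insert l v) (pt l 0)) (circ (insert l v) (pt l 1)) \<and>
        circ v (pt l 0) = circ (insert l v) (pt l 0) \<union> circ (insert l v) (pt l 1) \<and>
        circ v (pt l 2) = circ v (pt l 0))"
proof -
  define R where "R = conn D {l} v"
  have R: "equiv UNIV R" by (simp add: R_def equiv_conn)
  note e = equivD[OF R]
  have P: "paired (ends {l}) R" unfolding R_def using l by (intro paired_ends) auto
  have E: "ends {l} = {(l, 0), (l, 1), (l, 2), (l, 3)}" by (auto simp: ends_def)
  define r where "r i j \<longleftrightarrow> (pt l i, pt l j) \<in> R" for i j
  have rs: "r i j \<Longrightarrow> r j i" for i j using e(2) by (simp add: r_def)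
  have rt: "r i j \<Longrightarrow> r j k \<Longrightarrow> r i k" for i j k using e(3) by (simp add: r_def)
  have n02: "\<not> r 0 2" and n13: "\<not> r 1 3"
    using P unfolding paired_def E r_def by fastforce+
  have "r 0 1 \<or> r 0 3" "r 1 0 \<or> r 1 2" "r 2 1 \<or> r 2 3" "r 3 0 \<or> r 3 2"
    using P unfolding paired_def E r_def by auto
  then have cases: "r 0 1 \<and> r 2 3 \<and> \<not> r 0 3 \<and> \<not> r 1 2 \<or> r 0 3 \<and> r 1 2 \<and> \<not> r 0 1 \<and> \<not> r 2 3"
    using rs rt n02 n13 by metis
  have Rv: "conn D {} v = glue (glue R (pt l 2) (pt l 3)) (pt l 0) (pt l 1)"
    using conn_remove[of l "{l}" D v] l by (simp add: R_def)
  have R': "conn D {l} (insert l v) = R" unfolding R_def by (rule conn_cong) auto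
  have Rw: "conn D {} (insert l v) = glue (glue R (pt l 1) (pt l 2)) (pt l 0) (pt l 3)"
    using conn_remove[of l "{l}" D "insert l v"] l by (simp add: R')
  note triv = glue_trivial[OF R]
  have cl: "R `` {pt l i} = R `` {pt l j} \<longleftrightarrow> r i j" for i j
    by (simp add: class_eq_iff[OF R] r_def)
  have A: "pt l k \<in> arcs D" if "k < 4" for k using pt_in l that by simp
  from cases show ?thesis
  proof
    assume c: "r 0 1 \<and> r 2 3 \<and> \<not> r 0 3 \<and> \<not> r 1 2"
    have Rv': "conn D {} v = R" using c by (simp add: Rv triv r_def)
    define G where "G = glue R (pt l 1) (pt l 2)"
    have G: "equiv UNIV G" unfolding G_def by (rule equiv_glue[OF R])
    have "(pt l 0, pt l 3) \<in> G"
      using c rs[of 0 1] by (auto simp: G_def glue_def r_def)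
    then have Rw': "conn D {} (insert l v) = G"
      unfolding Rw G_def[symmetric] by (rule glue_trivial[OF G])
    have m: "merging (circles D v) (circles D (insert l v)) (R `` {pt l 1}) (R `` {pt l 2})"
      unfolding circles_conn Rv' Rw' G_def by (rule merging_glue[OF R]) (use A c in \<open>auto simp: r_def\<close>)
    have im: "G `` {pt l k} = R `` {pt l 1} \<union> R `` {pt l 2}" if "k < 4" for k
    proof -
      have "k = 0 \<or> k = 1 \<or> k = 2 \<or> k = 3" using that by auto
      then have "pt l k \<in> R `` {pt l 1, pt l 2}"
        using c rs[of 0 1] e(1) by (auto simp: r_def)
      then show ?thesis unfolding G_def Image_glue[OF R] by auto
    qed
    show ?thesis
      using c m n02 im[of 0] im[of 1] im[of 2] im[of 3] cl[of 0 1] cl[of 2 3] cl[of 0 2]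
      by (simp add: circ_def Rv' Rw' merges_def)
  next
    assume c: "r 0 3 \<and> r 1 2 \<and> \<not> r 0 1 \<and> \<not> r 2 3"
    have Rw': "conn D {} (insert l v) = R" using c by (simp add: Rw triv r_def)
    define G where "G = glue R (pt l 2) (pt l 3)"
    have G: "equiv UNIV G" unfolding G_def by (rule equiv_glue[OF R])
    have "(pt l 0, pt l 1) \<in> G"
      using c rs[of 0 3] rs[of 1 2] by (auto simp: G_def glue_def r_def)
    then have Rv': "conn D {} v = G"
      unfolding Rv G_def[symmetric] by (rule glue_trivial[OF G])
    have cls: "R `` {pt l 3} = R `` {pt l 0}" "R `` {pt l 2} = R `` {pt l 1}"
      using c rs[of 0 3] rs[of 1 2] cl by auto
    have "G = glue R (pt l 0) (pt l 1)"
    proof -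
      have "R `` {pt l 2, pt l 3} = R `` {pt l 0, pt l 1}" using cls by auto
      then show ?thesis unfolding G_def glue_def by simp
    qed
    then have m: "merging (circles D (insert l v)) (circles D v) (R `` {pt l 0}) (R `` {pt l 1})"
      unfolding circles_conn Rv' Rw' using merging_glue[OF R, of "pt l 0" "arcs D" "pt l 1"] A c
      by (simp add: r_def)
    have im: "G `` {pt l k} = R `` {pt l 0} \<union> R `` {pt l 1}" if "k < 4" for k
    proof -
      have "k = 0 \<or> k = 1 \<or> k = 2 \<or> k = 3" using that by auto
      then have "pt l k \<in> R `` {pt l 2, pt l 3}"
        using c rs[of 0 3] rs[of 1 2] e(1) by (auto simp: r_def)
      then show ?thesis unfolding G_def Image_glue[OF R] using cls by auto
    qed
    show ?thesis
      using c m im[of 0] im[of 1] im[of 2] im[of 3] cls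
      by (simp add: circ_def Rv' Rw' merges_def)
  qed
qed

end


text \<open>Each edge of a square changes the number of circles by one, and both ways round have the
  same total. \<open>P\<close> and \<open>R\<close> stand for a merge on the first edge of either
  way, \<open>Q\<close> and \<open>S\<close> for one on the second.\<close>

lemma two_step_parity:
  fixes a b b' d :: nat
  assumes "if P then a = b + 1 else b = a + 1" "if R then a = b' + 1 else b' = a + 1"
    "if Q then b = d + 1 else d = b + 1" "if S then b' = d + 1 else d = b' + 1"
  shows "((P \<longleftrightarrow> Q) \<and> (R \<longleftrightarrow> S) \<and> (P \<longleftrightarrow> R)) \<or> ((P \<longleftrightarrow> \<not> Q) \<and> (R \<longleftrightarrow> \<not> S))"
proof -
  define e where "e X = (if X then 1 else (-1::int))" for X
  have step: "int m - int n = e X" if "if X then m = n + 1 else n = m + 1" for X m n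
    using that unfolding e_def by (cases X; simp only: if_True if_False; linarith)
  have "e P + e Q = e R + e S"
    using step[OF assms(1)] step[OF assms(2)] step[OF assms(3)] step[OF assms(4)] by linarith
  then show ?thesis unfolding e_def by (cases P; cases Q; cases R; cases S; simp)
qed

section \<open>Commutativity of the squares of the cube\<close>

context source_sink_diagram
begin

abbreviation "edge v l x y \<equiv> merge_or_split (circles D v) (circles D (insert l v)) x y"

definition plus_labelling :: "nat set \<Rightarrow> 'a labelling" where
  "plus_labelling v = (\<lambda>C\<in>circles D v. v_plus)"

text \<open>The unit multiplied by \<open>X\<close> at the circle through \<open>p\<close>.\<close>

definition minus_at :: "nat set \<Rightarrow> 'a \<Rightarrow> 'a labelling" where
  "minus_at v p = (plus_labelling v)(circ v p := v_minus)"

lemma labellings_update: "x \<in> labellings D v \<Longrightarrow> C \<in> circles D v \<Longrightarrow> x(C := a) \<in> labellings D v"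
  by (auto simp: labellings_def PiE_def extensional_def)

lemma labellings_eqI:
  "x \<in> labellings D v \<Longrightarrow> y \<in> labellings D v \<Longrightarrow> (\<And>C. C \<in> circles D v \<Longrightarrow> x C = y C) \<Longrightarrow> x = y"
  unfolding labellings_def by (rule PiE_ext)

lemma plus_labelling_in: "plus_labelling v \<in> labellings D v"
  by (auto simp: plus_labelling_def labellings_def)

lemma minus_at_in: "p \<in> arcs D \<Longrightarrow> minus_at v p \<in> labellings D v"
  unfolding minus_at_def by (intro labellings_update plus_labelling_in circ_in)

lemma plus_labelling_at: "C \<in> circles D v \<Longrightarrow> plus_labelling v C = v_plus"
  by (simp add: plus_labelling_def)

lemma finite_labellings: "finite (labellings D v)"
proof -
  have "(UNIV :: label set) = {v_plus, v_minus}" by (auto simp: label_not)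
  then have "finite (UNIV :: label set)" by (metis finite.emptyI finite_insert)
  then show ?thesis unfolding labellings_def by (intro finite_PiE finite_circles) 
qed

text \<open>The module structure is attached to arcs instead of circles: multiplication by
  \<open>X\<close> at \<open>p\<close> makes sense at every vertex, and all edge maps commute with
  it.\<close>

lemma edge_mult:
  assumes l: "l < ncross D" "l \<notin> v" and p: "p \<in> arcs D"
  shows "x (circ v p) = v_plus \<Longrightarrow> edge v l (x(circ v p := v_minus)) z \<longleftrightarrow>
      z (circ (insert l v) p) = v_minus \<and> edge v l x (z(circ (insert l v) p := v_plus))"
    and "x (circ v p) = v_minus \<Longrightarrow> edge v l x z \<Longrightarrow> z (circ (insert l v) p) = v_minus"
proof -
  let ?V = "circles D v" and ?W = "circles D (insert l v)"
  let ?C = "circ v p" and ?C' = "circ (insert l v) p"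
  have C: "?C \<in> ?V" "?C' \<in> ?W" using p by (auto intro: circ_in)
  have rel: "?C = ?C' \<or> ?C \<in> {C1, C2} \<and> ?C' = C1 \<union> C2 \<or> ?C' \<in> {C1, C2} \<and> ?C = C1 \<union> C2"
    if "merging ?V ?W C1 C2 \<or> merging ?W ?V C1 C2" for C1 C2
    using that
  proof
    assume m: "merging ?V ?W C1 C2"
    show ?thesis
    proof (cases "?C' \<in> ?V")
      case True
      then show ?thesis using circ_unique[OF True circ_self] by simp
    next
      case False
      then have 1: "?C' = C1 \<union> C2" using m C(2) by (auto simp: merging_def)
      then have "p \<in> C1 \<or> p \<in> C2" using circ_self by blast
      then have "?C = C1 \<or> ?C = C2" using circ_unique m unfolding merging_def by metis
      then show ?thesis using 1 by blast
    qed
  next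
    assume m: "merging ?W ?V C1 C2"
    show ?thesis
    proof (cases "?C \<in> ?W")
      case True
      then show ?thesis using circ_unique[OF True circ_self] by simp
    next
      case False
      then have 1: "?C = C1 \<union> C2" using m C(1) by (auto simp: merging_def)
      then have "p \<in> C1 \<or> p \<in> C2" using circ_self by blast
      then have "?C' = C1 \<or> ?C' = C2" using circ_unique m unfolding merging_def by metis
      then show ?thesis using 1 by blast
    qed
  qed
  obtain C1 C2 where m: "merging ?V ?W C1 C2 \<or> merging ?W ?V C1 C2"
    using edge_cases[OF l] by blast
  show "x ?C = v_plus \<Longrightarrow> edge v l (x(?C := v_minus)) z \<longleftrightarrow> z ?C' = v_minus \<and> edge v l x (z(?C' := v_plus))"
    by (rule merge_or_split_mult(1)[OF m C rel[OF m]])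
  show "x ?C = v_minus \<Longrightarrow> edge v l x z \<Longrightarrow> z ?C' = v_minus"
    by (rule merge_or_split_mult(2)[OF m C rel[OF m]])
qed

text \<open>All nonzero entries of the unsigned edge maps are 1, so this count is an entry of the
  composite of two of them.\<close>

definition paths :: "nat set \<Rightarrow> nat \<Rightarrow> nat \<Rightarrow> 'a labelling \<Rightarrow> 'a labelling \<Rightarrow> nat" where
  "paths v l m x z = card {y \<in> labellings D (insert l v). edge v l x y \<and> edge (insert l v) m y z}"

text \<open>Changing the label of the circle through \<open>p\<close> at the intermediate vertex is
  a bijection between the intermediate labellings of both sides; there are none if \<open>z\<close>
  lacks the factor \<open>X\<close> at \<open>p\<close>.\<close>

lemma paths_mult:
  assumes lm: "l < ncross D" "m < ncross D" "l \<notin> v" "m \<notin> v" "l \<noteq> m" and p: "p \<in> arcs D"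
    and x: "x (circ v p) = v_plus"
  shows "paths v l m (x(circ v p := v_minus)) z =
    (if z (circ (insert m (insert l v)) p) = v_minus
     then paths v l m x (z(circ (insert m (insert l v)) p := v_plus)) else 0)"
proof -
  let ?u = "insert l v" and ?w = "insert m (insert l v)"
  let ?c = "circ ?u p" and ?z = "z(circ ?w p := v_plus)"
  let ?A = "{y \<in> labellings D ?u. edge v l (x(circ v p := v_minus)) y \<and> edge ?u m y z}"
  let ?B = "{y \<in> labellings D ?u. z (circ ?w p) = v_minus \<and> edge v l x y \<and> edge ?u m y ?z}"
  have c: "?c \<in> circles D ?u" by (rule circ_in[OF p])
  note e1 = edge_mult[OF lm(1,3) p] and e2 = edge_mult[OF lm(2) _ p, of ?u]
  have m: "m \<notin> ?u" using lm by auto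
  have "bij_betw (\<lambda>y. y(?c := v_plus)) ?A ?B"
  proof (rule bij_betw_byWitness[where f' = "\<lambda>y. y(?c := v_minus)"])
    have upd_twice: "y(?c := a, ?c := b) = y" if "y ?c = b" for y :: "'a labelling" and a b
      using that by (simp add: fun_upd_idem)
    have Ac: "y ?c = v_minus" if "y \<in> ?A" for y
    proof -
      have "edge v l (x(circ v p := v_minus)) y" using that by simp
      then show ?thesis using e1(1)[of x y, OF x] by blast
    qed
    have Bc: "y ?c = v_plus" if "y \<in> ?B" for y
    proof (rule ccontr)
      assume "y ?c \<noteq> v_plus"
      then have "y ?c = v_minus" by (simp add: label_not)
      moreover have "edge ?u m y ?z" using that by simp
      ultimately have "?z (circ ?w p) = v_minus" by (rule e2(2)[OF m])
      then show False by simp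
    qed
    show "\<forall>y\<in>?A. y(?c := v_plus, ?c := v_minus) = y" using Ac upd_twice by blast
    show "\<forall>y\<in>?B. y(?c := v_minus, ?c := v_plus) = y" using Bc upd_twice by blast
    show "(\<lambda>y. y(?c := v_plus)) ` ?A \<subseteq> ?B"
    proof clarify
      fix y assume y: "y \<in> labellings D ?u" "edge v l (x(circ v p := v_minus)) y" "edge ?u m y z"
      then have "y ?c = v_minus" "edge v l x (y(?c := v_plus))" using e1(1)[of x, OF x] by auto
      moreover from this have "y(?c := v_plus, ?c := v_minus) = y" by (metis fun_upd_triv fun_upd_upd)
      ultimately show "y(?c := v_plus) \<in> labellings D ?u \<and> z (circ ?w p) = v_minus \<and>
          edge v l x (y(?c := v_plus)) \<and> edge ?u m (y(?c := v_plus)) ?z"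
        using e2(1)[OF m, of "y(?c := v_plus)" z] y labellings_update[OF y(1) c] by simp
    qed
    show "(\<lambda>y. y(?c := v_minus)) ` ?B \<subseteq> ?A"
    proof clarify
      fix y assume y: "y \<in> labellings D ?u" "z (circ ?w p) = v_minus" "edge v l x y" "edge ?u m y ?z"
      then have yc: "y ?c = v_plus" using Bc by simp
      then have "y(?c := v_minus, ?c := v_plus) = y" by (metis fun_upd_triv fun_upd_upd)
      then show "y(?c := v_minus) \<in> labellings D ?u \<and> edge v l (x(circ v p := v_minus)) (y(?c := v_minus)) \<and>
          edge ?u m (y(?c := v_minus)) z"
        using e1(1)[of x "y(?c := v_minus)", OF x] e2(1)[OF m, of y z, OF yc] y labellings_update[OF y(1) c] by simp
    qed
  qed
  then have "card ?A = card ?B" by (rule bij_betw_same_card)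
  then show ?thesis unfolding paths_def by (auto split: if_splits)
qed

text \<open>A merge sends the unit to the unit. A split sends it to the sum of the two elements with
  one factor \<open>X\<close>; the corners 0 and 1 of \<open>l\<close> lie on the two circles
  created by the 1-smoothing.\<close>

lemma edge_plus:
  assumes l: "l < ncross D" "l \<notin> v" and y: "y \<in> labellings D (insert l v)"
  shows "edge v l (plus_labelling v) y \<longleftrightarrow>
    (if merges v l then y = plus_labelling (insert l v)
     else y = minus_at (insert l v) (pt l 0) \<or> y = minus_at (insert l v) (pt l 1))"
proof -
  let ?V = "circles D v" and ?W = "circles D (insert l v)"
  let ?C1 = "circ (insert l v) (pt l 0)" and ?C2 = "circ (insert l v) (pt l 1)"
  note ec = edge_cases[OF l]
  have A: "pt l 0 \<in> arcs D" "pt l 1 \<in> arcs D" using pt_in l by simp_all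
  show ?thesis
  proof (cases "merges v l")
    case True
    define C1 C2 where "C1 = circ v (pt l 0)" and "C2 = circ v (pt l 2)"
    have m: "merging ?V ?W C1 C2" using ec True unfolding C1_def C2_def by blast
    have k: "C1 \<in> ?V" "C2 \<in> ?V" "?W = insert (C1 \<union> C2) (?V - {C1, C2})" using m by (auto simp: merging_def)
    have "edge v l (plus_labelling v) y \<longleftrightarrow> (\<forall>C\<in>?V - {C1, C2}. y C = v_plus) \<and> y (C1 \<union> C2) = v_plus"
    proof -
      have "(\<forall>C\<in>?V - {C1, C2}. plus_labelling v C = y C) \<longleftrightarrow> (\<forall>C\<in>?V - {C1, C2}. y C = v_plus)"
        using plus_labelling_at by (metis DiffD1)
      then show ?thesis
        unfolding merge_or_split_merging[OF m]
        by (cases "y (C1 \<union> C2)") (simp_all add: plus_labelling_at k(1,2) merge_entries_def)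
    qed
    also have "\<dots> \<longleftrightarrow> (\<forall>C\<in>?W. y C = v_plus)" unfolding k(3) by auto
    also have "\<dots> \<longleftrightarrow> y = plus_labelling (insert l v)"
      using labellings_eqI[OF y plus_labelling_in] by (auto simp: plus_labelling_at)
    finally show ?thesis using True by simp
  next
    case False
    then have m: "merging ?W ?V ?C1 ?C2" using ec by blast
    have k: "?C1 \<in> ?W" "?C2 \<in> ?W" "?C1 \<noteq> ?C2" "?V = insert (?C1 \<union> ?C2) (?W - {?C1, ?C2})" using m by (auto simp: merging_def)
    have CV: "?C1 \<union> ?C2 \<in> ?V" by (subst k(4)) simp
    have "C \<in> ?V" if "C \<in> ?W - {?C1, ?C2}" for C by (subst k(4)) (use that in simp)
    then have "(\<forall>C\<in>?W - {?C1, ?C2}. plus_labelling v C = y C) \<longleftrightarrow> (\<forall>C\<in>?W - {?C1, ?C2}. y C = v_plus)"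
      using plus_labelling_at by metis
    then have 1: "edge v l (plus_labelling v) y \<longleftrightarrow> (\<forall>C\<in>?W - {?C1, ?C2}. y C = v_plus) \<and>
        (y ?C1 = v_minus \<and> y ?C2 = v_plus \<or> y ?C1 = v_plus \<and> y ?C2 = v_minus)"
      unfolding merge_or_split_splitting[OF m] plus_labelling_at[OF CV]
      by (cases "y ?C1"; cases "y ?C2"; simp add: split_entries_def)
    have ma: "y = minus_at (insert l v) p \<longleftrightarrow> (\<forall>C\<in>?W - {circ (insert l v) p}. y C = v_plus) \<and> y (circ (insert l v) p) = v_minus"
      if "p \<in> arcs D" for p
    proof
      assume "y = minus_at (insert l v) p"
      then show "(\<forall>C\<in>?W - {circ (insert l v) p}. y C = v_plus) \<and> y (circ (insert l v) p) = v_minus"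
        by (simp add: minus_at_def plus_labelling_at)
    next
      assume h: "(\<forall>C\<in>?W - {circ (insert l v) p}. y C = v_plus) \<and> y (circ (insert l v) p) = v_minus"
      show "y = minus_at (insert l v) p"
        by (rule labellings_eqI[OF y minus_at_in[OF that]]) (use h in \<open>simp add: minus_at_def plus_labelling_at\<close>)
    qed
    have "(\<forall>C\<in>?W - {?C1, ?C2}. y C = v_plus) \<and>
        (y ?C1 = v_minus \<and> y ?C2 = v_plus \<or> y ?C1 = v_plus \<and> y ?C2 = v_minus) \<longleftrightarrow>
        (\<forall>C\<in>?W - {?C1}. y C = v_plus) \<and> y ?C1 = v_minus \<or> (\<forall>C\<in>?W - {?C2}. y C = v_plus) \<and> y ?C2 = v_minus"
    proof -
      have s: "?W - {?C1} = insert ?C2 (?W - {?C1, ?C2})" "?W - {?C2} = insert ?C1 (?W - {?C1, ?C2})"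
        using k(1-3) by blast+
      show ?thesis unfolding s by (cases "y ?C1"; cases "y ?C2"; simp)
    qed
    then show ?thesis using 1 ma[OF A(1)] ma[OF A(2)] False by simp
  qed
qed

lemma card_circles_edge:
  assumes "l < ncross D" "l \<notin> v"
  shows "if merges v l then card (circles D v) = card (circles D (insert l v)) + 1
    else card (circles D (insert l v)) = card (circles D v) + 1"
proof -
  have card: "card V = card W + 1" if "merging V W C1 C2" "finite V" for V W :: "'a set set" and C1 C2
  proof -
    have k: "C1 \<in> V" "C2 \<in> V" "C1 \<noteq> C2" "C1 \<union> C2 \<notin> V" "W = insert (C1 \<union> C2) (V - {C1, C2})"
      using that by (auto simp: merging_def)
    have "card W = card (V - {C1, C2}) + 1" using k that by simp
    moreover have "card (V - {C1, C2}) = card V - 2" using k that by (subst card_Diff_subset) auto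
    moreover have "2 \<le> card V" using k that card_mono[of V "{C1, C2}"] by simp
    ultimately show ?thesis by simp
  qed
  show ?thesis
    using edge_cases[OF assms] card[OF _ finite_circles] by (auto split: if_splits)
qed

lemma minus_at_eq_iff: "p \<in> arcs D \<Longrightarrow> q \<in> arcs D \<Longrightarrow> minus_at v p = minus_at v q \<longleftrightarrow> circ v p = circ v q"
  unfolding minus_at_def
  by (metis circ_in fun_upd_other fun_upd_same label.distinct(1) plus_labelling_at)

text \<open>The coefficient of \<open>z\<close> in the sum of \<open>X\<close> at corner 0 and
  \<open>X\<close> at corner 1 of \<open>l\<close>; it can be 2, when both corners lie on one
  circle.\<close>

definition minus_pairs :: "nat set \<Rightarrow> nat \<Rightarrow> 'a labelling \<Rightarrow> nat" where
  "minus_pairs w l z = of_bool (z = minus_at w (pt l 0)) + of_bool (z = minus_at w (pt l 1))"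

text \<open>\<open>edge_plus\<close> describes the first edge; for the second, the factor
  \<open>X\<close> is pulled out by \<open>edge_mult\<close> and \<open>edge_plus\<close> applies
  again. Two splits give a product of two sums, in which terms with both factors on one circle
  vanish because \<open>X\<close> squares to zero; hence the inequality of circles in the last
  formula.\<close>

lemma paths_plus:
  assumes lm: "l < ncross D" "m < ncross D" "l \<notin> v" "m \<notin> v" "l \<noteq> m"
    and w: "w = insert m (insert l v)" and z: "z \<in> labellings D w"
  shows "merges v l \<Longrightarrow> merges (insert l v) m \<Longrightarrow> paths v l m (plus_labelling v) z = of_bool (z = plus_labelling w)"
    and "merges v l \<Longrightarrow> \<not> merges (insert l v) m \<Longrightarrow> paths v l m (plus_labelling v) z = minus_pairs w m z"
    and "\<not> merges v l \<Longrightarrow> merges (insert l v) m \<Longrightarrow> paths v l m (plus_labelling v) z = minus_pairs w l z"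
    and "\<not> merges v l \<Longrightarrow> \<not> merges (insert l v) m \<Longrightarrow> paths v l m (plus_labelling v) z =
      (\<Sum>p\<in>{0, 1}. \<Sum>q\<in>{0, 1}. of_bool (circ w (pt l p) \<noteq> circ w (pt m q) \<and>
        z = (plus_labelling w)(circ w (pt l p) := v_minus, circ w (pt m q) := v_minus)))"
proof -
  let ?u = "insert l v"
  have m: "m \<notin> ?u" using lm by auto
  have A: "pt l 0 \<in> arcs D" "pt l 1 \<in> arcs D" "pt m 0 \<in> arcs D" "pt m 1 \<in> arcs D"
    using pt_in lm by simp_all
  note e1 = edge_plus[OF lm(1,3)]
  have e2: "edge ?u m (plus_labelling ?u) y \<longleftrightarrow> (if merges ?u m then y = plus_labelling w
     else y = minus_at w (pt m 0) \<or> y = minus_at w (pt m 1))" if "y \<in> labellings D w" for y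
    unfolding w by (rule edge_plus[OF lm(2) m that[unfolded w]])
  have merge_first: "paths v l m (plus_labelling v) z = of_bool (edge ?u m (plus_labelling ?u) z)" if "merges v l"
  proof -
    have "{y \<in> labellings D ?u. edge v l (plus_labelling v) y \<and> edge ?u m y z} =
        (if edge ?u m (plus_labelling ?u) z then {plus_labelling ?u} else {})"
      using e1 that plus_labelling_in by auto
    then show ?thesis by (simp add: paths_def)
  qed
  have split_first: "paths v l m (plus_labelling v) z =
     of_bool (edge ?u m (minus_at ?u (pt l 0)) z) + of_bool (edge ?u m (minus_at ?u (pt l 1)) z)"
    if "\<not> merges v l"
  proof -
    have ne: "minus_at ?u (pt l 0) \<noteq> minus_at ?u (pt l 1)"
    proof -
      have "circ ?u (pt l 0) \<noteq> circ ?u (pt l 1)"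
        using edge_cases[OF lm(1,3)] that unfolding merging_def by blast
      then show ?thesis using minus_at_eq_iff[OF A(1,2)] by blast
    qed
    have "{y \<in> labellings D ?u. edge v l (plus_labelling v) y \<and> edge ?u m y z} =
        (if edge ?u m (minus_at ?u (pt l 0)) z then {minus_at ?u (pt l 0)} else {}) \<union>
        (if edge ?u m (minus_at ?u (pt l 1)) z then {minus_at ?u (pt l 1)} else {})"
      using e1 that minus_at_in[OF A(1)] minus_at_in[OF A(2)] by auto
    then show ?thesis using ne by (simp add: paths_def)
  qed
  have second: "edge ?u m (minus_at ?u p) z \<longleftrightarrow> z (circ w p) = v_minus \<and> edge ?u m (plus_labelling ?u) (z(circ w p := v_plus))"
    if "p \<in> arcs D" for p
    unfolding minus_at_def w by (rule edge_mult(1)[OF lm(2) m that]) (simp add: plus_labelling_at circ_in that)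
  have zu: "z(circ w p := v_plus) \<in> labellings D w" if "p \<in> arcs D" for p
    by (rule labellings_update[OF z circ_in[OF that]])
  have upd_back: "z (circ w p) = v_minus \<and> z(circ w p := v_plus) = f \<longleftrightarrow> f (circ w p) = v_plus \<and> z = f(circ w p := v_minus)" for p f
    by (metis fun_upd_same fun_upd_triv fun_upd_upd)
  show "paths v l m (plus_labelling v) z = of_bool (z = plus_labelling w)" if "merges v l" "merges ?u m"
    using merge_first[OF that(1)] e2[OF z] that by simp
  have ne: "circ w (pt m 0) \<noteq> circ w (pt m 1)" if "\<not> merges ?u m"
    using edge_cases[OF lm(2) m] that unfolding merging_def w by blast
  show "paths v l m (plus_labelling v) z = minus_pairs w m z" if "merges v l" "\<not> merges ?u m"
    using merge_first[OF that(1)] e2[OF z] that ne A by (auto simp: minus_pairs_def minus_at_eq_iff)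
  show "paths v l m (plus_labelling v) z = minus_pairs w l z" if "\<not> merges v l" "merges ?u m"
  proof -
    have "edge ?u m (minus_at ?u p) z \<longleftrightarrow> z = minus_at w p" if p: "p \<in> arcs D" for p
      using second[OF p] e2[OF zu[OF p]] \<open>merges ?u m\<close> upd_back[of p "plus_labelling w"] circ_in[OF p]
      by (simp add: minus_at_def plus_labelling_at)
    then show ?thesis using split_first[OF that(1)] A by (simp add: minus_pairs_def)
  qed
  show "paths v l m (plus_labelling v) z =
      (\<Sum>p\<in>{0, 1}. \<Sum>q\<in>{0, 1}. of_bool (circ w (pt l p) \<noteq> circ w (pt m q) \<and>
        z = (plus_labelling w)(circ w (pt l p) := v_minus, circ w (pt m q) := v_minus)))"
    if "\<not> merges v l" "\<not> merges ?u m"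
  proof -
    define T where "T p q \<longleftrightarrow> circ w p \<noteq> circ w q \<and> z = (plus_labelling w)(circ w p := v_minus, circ w q := v_minus)" for p q
    have T: "T p q \<longleftrightarrow> z (circ w p) = v_minus \<and> z(circ w p := v_plus) = minus_at w q"
      if "p \<in> arcs D" for p q
      unfolding upd_back T_def minus_at_def using circ_in[OF that]
      by (auto simp: plus_labelling_at fun_upd_twist)
    \<comment> \<open>The corners 0 and 1 of \<open>m\<close> lie on different circles after a
      split, so the two alternatives exclude each other and the disjunction can be counted as a
      sum.\<close>
    have excl: "\<not> (T p (pt m 0) \<and> T p (pt m 1))" for p
    proof
      assume "T p (pt m 0) \<and> T p (pt m 1)"
      then have a: "circ w (pt m 1) \<noteq> circ w p"
         "z = (plus_labelling w)(circ w p := v_minus, circ w (pt m 0) := v_minus)"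
         "z = (plus_labelling w)(circ w p := v_minus, circ w (pt m 1) := v_minus)"
        unfolding T_def by metis+
      have "z (circ w (pt m 1)) = v_minus" by (subst a(3)) simp
      moreover have "z (circ w (pt m 1)) = plus_labelling w (circ w (pt m 1))"
        by (subst a(2)) (simp only: fun_upd_other[OF a(1)] fun_upd_other[OF ne[OF that(2), symmetric]])
      ultimately show False using circ_in[OF A(4), of w] by (simp add: plus_labelling_at)
    qed
    have "edge ?u m (minus_at ?u p) z \<longleftrightarrow> T p (pt m 0) \<or> T p (pt m 1)" if p: "p \<in> arcs D" for p
      using second[OF p] e2[OF zu[OF p]] \<open>\<not> merges ?u m\<close> T[OF p] by auto
    then have "(of_bool (edge ?u m (minus_at ?u p) z) :: nat) = of_bool (T p (pt m 0)) + of_bool (T p (pt m 1))" if "p \<in> arcs D" for p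
      using excl[of p] that by auto
    note T_sum = this
    have s: "(\<Sum>p\<in>{0, 1}. f p) = f 0 + f (1 :: nat)" for f :: "nat \<Rightarrow> nat" by simp
    show ?thesis unfolding split_first[OF that(1)] T_sum[OF A(1)] T_sum[OF A(2)] s T_def ..
  qed
qed

text \<open>The circle counts leave six combinations, and only two need geometry. If both ways merge
  and then split, the corners of \<open>l\<close> and of \<open>m\<close> lie on the same two
  circles at the last vertex; if both split and then merge, all these corners lie on one
  circle.\<close>

lemma paths_plus_sym:
  assumes lm: "l < ncross D" "m < ncross D" "l \<notin> v" "m \<notin> v" "l \<noteq> m"
    and z: "z \<in> labellings D (insert m (insert l v))"
  shows "paths v l m (plus_labelling v) z = paths v m l (plus_labelling v) z"
proof -
  let ?u = "insert l v" and ?u' = "insert m v"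
  define w where "w = insert m (insert l v)"
  have w': "w = insert l (insert m v)" by (auto simp: w_def)
  have z': "z \<in> labellings D w" using z by (simp add: w_def)
  have ml: "m \<notin> ?u" "l \<notin> ?u'" using lm by auto
  note P = paths_plus[OF lm w_def z'] and P' = paths_plus[OF lm(2,1,4,3) lm(5)[symmetric] w' z']
  note c = card_circles_edge[OF lm(1,3)] card_circles_edge[OF lm(2,4)]
    card_circles_edge[OF lm(2) ml(1), folded w_def] card_circles_edge[OF lm(1) ml(2), folded w']
  note ec = edge_cases[OF lm(1,3)] edge_cases[OF lm(2,4)]
    edge_cases[OF lm(2) ml(1), folded w_def] edge_cases[OF lm(1) ml(2), folded w']
  have A: "pt l k \<in> arcs D" "pt m k \<in> arcs D" if "k < 4" for k using pt_in lm that by simp_all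
  have swap: "minus_pairs w l z = minus_pairs w m z"
    if "circ w (pt l 0) = circ w (pt m 0) \<and> circ w (pt l 1) = circ w (pt m 1) \<or>
        circ w (pt l 0) = circ w (pt m 1) \<and> circ w (pt l 1) = circ w (pt m 0)"
  proof -
    have h: "minus_at w p = minus_at w q" if "circ w p = circ w q" for p q
      using that by (simp only: minus_at_def)
    from that show ?thesis
    proof (elim disjE conjE)
      assume a: "circ w (pt l 0) = circ w (pt m 0)" "circ w (pt l 1) = circ w (pt m 1)"
      show ?thesis unfolding minus_pairs_def h[OF a(1)] h[OF a(2)] ..
    next
      assume a: "circ w (pt l 0) = circ w (pt m 1)" "circ w (pt l 1) = circ w (pt m 0)"
      show ?thesis unfolding minus_pairs_def h[OF a(1)] h[OF a(2)] by (rule add.commute)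
    qed
  qed
  \<comment> \<open>The circle \<open>F\<close> that \<open>m\<close> splits is the one just merged
    by \<open>l\<close>: otherwise it would exist at \<open>v\<close> already, and \<open>m\<close>
    could not merge two circles there.\<close>
  have MSMS: "minus_pairs w l z = minus_pairs w m z"
    if "merges v l" "\<not> merges ?u m" "merges v m" "\<not> merges ?u' l"
  proof -
    define C1 C2 where "C1 = circ v (pt l 0)" and "C2 = circ v (pt l 2)"
    define F where "F = circ ?u (pt m 0)"
    have m1: "merging (circles D v) (circles D ?u) C1 C2" using ec(1) that(1) unfolding C1_def C2_def by blast
    have F: "circ ?u (pt m 2) = F" "F = circ w (pt m 0) \<union> circ w (pt m 1)" using ec(3) that(2) unfolding F_def by blast+
    have Fin: "F \<in> circles D ?u" using A by (simp add: F_def circ_in)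
    have "F \<notin> circles D v"
    proof
      assume "F \<in> circles D v"
      moreover have "pt m 0 \<in> F" "pt m 2 \<in> F" using circ_self F by (metis F_def)+
      ultimately have "circ v (pt m 0) = circ v (pt m 2)" using circ_unique by metis
      then show False using that(3) by (simp add: merges_def)
    qed
    then have "F = C1 \<union> C2" using Fin m1 by (auto simp: merging_def)
    moreover have "pt l 0 \<in> C1" using circ_self by (simp add: C1_def)
    moreover have "pt l 1 \<in> C1" using ec(1) circ_self by (metis C1_def)
    ultimately have "pt l 0 \<in> circ w (pt m 0) \<union> circ w (pt m 1)" "pt l 1 \<in> circ w (pt m 0) \<union> circ w (pt m 1)"
      using F by auto
    then have "circ w (pt l 0) = circ w (pt m 0) \<or> circ w (pt l 0) = circ w (pt m 1)"
       "circ w (pt l 1) = circ w (pt m 0) \<or> circ w (pt l 1) = circ w (pt m 1)"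
      using circ_eq by blast+
    moreover have "circ w (pt l 0) \<noteq> circ w (pt l 1)" using ec(4) that(4) unfolding merging_def by blast
    ultimately have "circ w (pt l 0) = circ w (pt m 0) \<and> circ w (pt l 1) = circ w (pt m 1) \<or>
        circ w (pt l 0) = circ w (pt m 1) \<and> circ w (pt l 1) = circ w (pt m 0)" by metis
    then show ?thesis by (rule swap)
  qed
  have SMSM: "minus_pairs w l z = minus_pairs w m z"
    if "\<not> merges v l" "merges ?u m" "\<not> merges v m" "merges ?u' l"
  proof -
    define C1 C2 where "C1 = circ ?u (pt l 0)" and "C2 = circ ?u (pt l 1)"
    define G where "G = circ v (pt m 0)"
    have m1: "merging (circles D ?u) (circles D v) C1 C2" using ec(1) that(1) unfolding C1_def C2_def by blast
    have G: "circ v (pt m 2) = G" using that(3) by (simp add: merges_def G_def)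
    have Gin: "G \<in> circles D v" using A by (simp add: G_def circ_in)
    have Gm: "pt m 0 \<in> G" "pt m 2 \<in> G" using circ_self G by (metis G_def)+
    have "G \<notin> circles D ?u"
    proof
      assume "G \<in> circles D ?u"
      then have "circ ?u (pt m 0) = circ ?u (pt m 2)" using circ_unique Gm by metis
      then show False using that(2) by (simp add: merges_def)
    qed
    then have "G = C1 \<union> C2" using Gin m1 by (auto simp: merging_def)
    then have "circ ?u (pt m 0) \<in> {C1, C2}" "circ ?u (pt m 2) \<in> {C1, C2}"
      using Gm circ_eq unfolding C1_def C2_def by blast+
    then have "circ ?u (pt m 0) \<union> circ ?u (pt m 2) = C1 \<union> C2" using that(2) by (auto simp: merges_def)
    then have "circ w (pt m 0) = C1 \<union> C2" "circ w (pt m 1) = C1 \<union> C2" using ec(3) that(2) by auto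
    moreover have "pt l 0 \<in> C1 \<union> C2" "pt l 1 \<in> C1 \<union> C2" using circ_self by (auto simp: C1_def C2_def)
    ultimately have "circ w (pt l 0) = circ w (pt m 0)" "circ w (pt l 1) = circ w (pt m 1)"
      using circ_eq[of "pt l 0" w "pt m 0"] circ_eq[of "pt l 1" w "pt m 1"] by simp_all
    then show ?thesis by (intro swap) simp
  qed
  consider "merges v l" "merges ?u m" "merges v m" "merges ?u' l" |
    "\<not> merges v l" "\<not> merges ?u m" "\<not> merges v m" "\<not> merges ?u' l" |
    "merges v l" "\<not> merges ?u m" "merges v m" "\<not> merges ?u' l" |
    "merges v l" "\<not> merges ?u m" "\<not> merges v m" "merges ?u' l" |
    "\<not> merges v l" "merges ?u m" "merges v m" "\<not> merges ?u' l" |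
    "\<not> merges v l" "merges ?u m" "\<not> merges v m" "merges ?u' l"
  proof -
    have "((merges v l \<longleftrightarrow> merges ?u m) \<and> (merges v m \<longleftrightarrow> merges ?u' l) \<and> (merges v l \<longleftrightarrow> merges v m)) \<or>
      ((merges v l \<longleftrightarrow> \<not> merges ?u m) \<and> (merges v m \<longleftrightarrow> \<not> merges ?u' l))"
      using c by (rule two_step_parity)
    then show thesis using that by argo
  qed
  then show ?thesis
  proof cases
    case 2
    have sym: "(circ w (pt l p) \<noteq> circ w (pt m q) \<and> z = (plus_labelling w)(circ w (pt l p) := v_minus, circ w (pt m q) := v_minus)) \<longleftrightarrow>
        (circ w (pt m q) \<noteq> circ w (pt l p) \<and> z = (plus_labelling w)(circ w (pt m q) := v_minus, circ w (pt l p) := v_minus))" for p q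
      using fun_upd_twist[of "circ w (pt l p)" "circ w (pt m q)" "plus_labelling w"] by metis
    have "(\<Sum>p\<in>{0, 1}. \<Sum>q\<in>{0, 1}. of_bool (circ w (pt l p) \<noteq> circ w (pt m q) \<and>
        z = (plus_labelling w)(circ w (pt l p) := v_minus, circ w (pt m q) := v_minus)) :: nat) =
        (\<Sum>p\<in>{0, 1}. \<Sum>q\<in>{0, 1}. of_bool (circ w (pt m p) \<noteq> circ w (pt l q) \<and>
        z = (plus_labelling w)(circ w (pt m p) := v_minus, circ w (pt l q) := v_minus)))"
      unfolding sym by (rule sum.swap)
    then show ?thesis unfolding P(4)[OF 2(1,2)] P'(4)[OF 2(3,4)] .
  next
    case 1
    show ?thesis unfolding P(1)[OF 1(1,2)] P'(1)[OF 1(3,4)] ..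
  next
    case 3
    show ?thesis unfolding P(2)[OF 3(1,2)] P'(2)[OF 3(3,4)] by (rule MSMS[OF 3, symmetric])
  next
    case 4
    show ?thesis unfolding P(2)[OF 4(1,2)] P'(3)[OF 4(3,4)] ..
  next
    case 5
    show ?thesis unfolding P(3)[OF 5(1,2)] P'(2)[OF 5(3,4)] ..
  next
    case 6
    show ?thesis unfolding P(3)[OF 6(1,2)] P'(3)[OF 6(3,4)] by (rule SMSM[OF 6])
  qed
qed

text \<open>Every labelling arises from the unit by multiplications by \<open>X\<close> at arcs, and
  composites of edge maps are linear over these. Induction on the number of factors \<open>X\<close>
  reduces the claim to the unit.\<close>

lemma paths_sym:
  assumes lm: "l < ncross D" "m < ncross D" "l \<notin> v" "m \<notin> v" "l \<noteq> m"
    and x: "x \<in> labellings D v" and z: "z \<in> labellings D (insert m (insert l v))"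
  shows "paths v l m x z = paths v m l x z"
  using x z
proof (induction "card {C \<in> circles D v. x C = v_minus}" arbitrary: x z)
  case 0
  then have "{C \<in> circles D v. x C = v_minus} = {}" using finite_circles by simp
  then have "x C = v_plus" if "C \<in> circles D v" for C using that label_not by blast
  then have "x = plus_labelling v"
    using labellings_eqI[OF 0(2) plus_labelling_in] plus_labelling_at by metis
  then show ?case using paths_plus_sym[OF lm 0(3)] by simp
next
  case (Suc n)
  then have "{C \<in> circles D v. x C = v_minus} \<noteq> {}" by (metis card.empty nat.distinct(1))
  then obtain C where C: "C \<in> circles D v" "x C = v_minus" by blast
  from C(1) obtain p where p: "p \<in> arcs D" "C = circ v p" by (rule circle_obtain)
  let ?x = "x(C := v_plus)" and ?c = "circ (insert m (insert l v)) p"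
  have xeq: "?x(circ v p := v_minus) = x" using C(2) p(2) by (metis fun_upd_triv fun_upd_upd)
  have xp: "?x (circ v p) = v_plus" by (simp add: p(2))
  have "{K \<in> circles D v. ?x K = v_minus} = {K \<in> circles D v. x K = v_minus} - {C}" by auto
  then have "n = card {K \<in> circles D v. ?x K = v_minus}"
    using Suc(2) C finite_circles by simp
  moreover have "?x \<in> labellings D v" by (rule labellings_update[OF Suc(3) C(1)])
  moreover have "z(?c := v_plus) \<in> labellings D (insert m (insert l v))"
    by (rule labellings_update[OF Suc(4) circ_in[OF p(1)]])
  ultimately have "paths v l m ?x (z(?c := v_plus)) = paths v m l ?x (z(?c := v_plus))"
    by (rule Suc(1))
  moreover have "insert l (insert m v) = insert m (insert l v)" by auto
  ultimately show ?case
    using paths_mult[OF lm p(1), of ?x z, OF xp] paths_mult[OF lm(2,1,4,3) lm(5)[symmetric] p(1), of ?x z, OF xp]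
    unfolding xeq by simp
qed


section \<open>The signed matrix of the differential and its square\<close>

definition coeff :: "nat set \<times> 'a labelling \<Rightarrow> nat set \<times> 'a labelling \<Rightarrow> int" where
  "coeff a b = (\<Sum>m\<in>{..<ncross D} - fst a.
     if fst b = insert m (fst a) \<and> snd b \<in> labellings D (fst b) \<and> edge (fst a) m (snd a) (snd b)
     then (-1) ^ card {l \<in> fst a. l < m} else 0)"

definition cells :: "(nat set \<times> 'a labelling) set" where
  "cells = {(v, x). v \<subseteq> {..<ncross D} \<and> x \<in> labellings D v}"

lemma finite_cells: "finite cells"
proof -
  have "cells \<subseteq> Sigma (Pow {..<ncross D}) (labellings D)" by (auto simp: cells_def)
  then show ?thesis by (rule finite_subset) (intro finite_SigmaI finite_labellings; simp)
qed

lemma coeff_edge: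
  assumes "m < ncross D" "m \<notin> v"
  shows "coeff (v, x) (insert m v, y) =
    (if y \<in> labellings D (insert m v) \<and> edge v m x y then (-1) ^ card {l \<in> v. l < m} else 0)"
proof -
  have ins: "insert m v = insert m' v \<longleftrightarrow> m' = m" if "m' \<notin> v" for m'
    using that assms(2) by blast
  have "coeff (v, x) (insert m v, y) = (\<Sum>m'\<in>{..<ncross D} - v. if m' = m then
      (if y \<in> labellings D (insert m v) \<and> edge v m x y then (-1) ^ card {l \<in> v. l < m} else 0) else 0)"
    unfolding coeff_def fst_conv snd_conv
  proof (rule sum.cong[OF refl])
    fix m' assume "m' \<in> {..<ncross D} - v"
    then have "m' \<notin> v" by simp
    then show "(if insert m v = insert m' v \<and> y \<in> labellings D (insert m v) \<and>
           merge_or_split (circles D v) (circles D (insert m' v)) x y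
         then (-1) ^ card {l \<in> v. l < m'} else (0::int)) =
        (if m' = m then (if y \<in> labellings D (insert m v) \<and> edge v m x y then (-1) ^ card {l \<in> v. l < m} else 0) else 0)"
      unfolding ins[OF \<open>m' \<notin> v\<close>] by (cases "m' = m") simp_all
  qed
  then show ?thesis using assms by simp
qed

lemma coeff_nonzeroD:
  assumes "coeff (v, x) (w, y) \<noteq> 0"
  obtains m where "m < ncross D" "m \<notin> v" "w = insert m v" "y \<in> labellings D w" "edge v m x y"
proof -
  from assms obtain m where m: "m \<in> {..<ncross D} - v"
    "(if w = insert m v \<and> y \<in> labellings D w \<and> edge v m x y then (-1) ^ card {l \<in> v. l < m} else (0::int)) \<noteq> 0"
    unfolding coeff_def fst_conv snd_conv by (rule sum.not_neutral_contains_not_neutral)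
  from m(2) have "w = insert m v \<and> y \<in> labellings D w \<and> edge v m x y" by (rule contrapos_np) simp
  then show thesis using that[of m] m(1) by blast
qed

lemma coeff_path:
  assumes lm: "l < ncross D" "m < ncross D" "l \<notin> v" "m \<notin> v" "l \<noteq> m"
    and z: "z \<in> labellings D (insert m (insert l v))"
  shows "(\<Sum>y\<in>labellings D (insert l v). coeff (v, x) (insert l v, y) * coeff (insert l v, y) (insert m (insert l v), z)) =
    (-1) ^ (card {j \<in> v. j < l} + card {j \<in> insert l v. j < m}) * int (paths v l m x z)"
proof -
  have "(\<Sum>y\<in>labellings D (insert l v). coeff (v, x) (insert l v, y) * coeff (insert l v, y) (insert m (insert l v), z)) =
      (\<Sum>y\<in>labellings D (insert l v). if edge v l x y \<and> edge (insert l v) m y z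
        then (-1) ^ (card {j \<in> v. j < l} + card {j \<in> insert l v. j < m}) else 0)"
    using lm z by (intro sum.cong refl) (simp add: coeff_edge power_add)
  also have "\<dots> = (-1) ^ (card {j \<in> v. j < l} + card {j \<in> insert l v. j < m}) * int (paths v l m x z)"
    unfolding paths_def by (subst sum.inter_filter[symmetric]) (simp_all add: finite_labellings)
  finally show ?thesis .
qed

text \<open>Only two paths lead from \<open>v\<close> to the vertex with \<open>l\<close> and
  \<open>m\<close> added, and their counts agree by \<open>paths_sym\<close>. Adding
  \<open>l\<close> first raises the number of indices below \<open>m\<close> by one, while adding
  \<open>m\<close> first does not affect those below \<open>l\<close>; so the signs are
  opposite.\<close>

lemma coeff_square_aux:
  assumes lm: "l < m" "m < ncross D" "l \<notin> v" "m \<notin> v" "v \<subseteq> {..<ncross D}"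
    and x: "x \<in> labellings D v" and z: "z \<in> labellings D (insert m (insert l v))"
  shows "(\<Sum>b\<in>cells. coeff (v, x) b * coeff b (insert m (insert l v), z)) = 0"
proof -
  define w where "w = insert m (insert l v)"
  have w': "w = insert l (insert m v)" unfolding w_def by (rule insert_commute)
  let ?f = "\<lambda>b. coeff (v, x) b * coeff b (w, z)"
  let ?L = "Pair (insert l v) ` labellings D (insert l v)" and ?M = "Pair (insert m v) ` labellings D (insert m v)"
  have l: "l < ncross D" using lm by simp
  have z1: "z \<in> labellings D (insert m (insert l v))" "z \<in> labellings D (insert l (insert m v))"
    by (rule z) (rule z[unfolded w_def[symmetric], unfolded w'])
  have "sum ?f cells = sum ?f (?L \<union> ?M)"
  proof (rule sum.mono_neutral_right[OF finite_cells])
    show "?L \<union> ?M \<subseteq> cells" using lm l by (auto simp: cells_def)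
    show "\<forall>b\<in>cells - (?L \<union> ?M). ?f b = 0"
    proof (rule ballI, rule ccontr)
      fix b assume b: "b \<in> cells - (?L \<union> ?M)" and nz: "?f b \<noteq> 0"
      obtain u y where uy: "b = (u, y)" by (cases b)
      have n: "coeff (v, x) (u, y) \<noteq> 0" "coeff (u, y) (w, z) \<noteq> 0" using nz uy by auto
      obtain j where j: "j \<notin> v" "u = insert j v" "y \<in> labellings D u" using n(1) by (elim coeff_nonzeroD)
      obtain k where k: "k \<notin> u" "w = insert k u" using n(2) by (elim coeff_nonzeroD)
      have "j \<in> w" using j(2) k(2) by simp
      then have "j \<in> {l, m}" using j(1) by (auto simp: w_def)
      then show False using b uy j by auto
    qed
  qed
  also have "\<dots> = sum ?f ?L + sum ?f ?M"
  proof (intro sum.union_disjoint finite_imageI finite_labellings)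
    have "l \<notin> insert m v" using lm by simp
    then have "insert l v \<noteq> insert m v" by blast
    then show "?L \<inter> ?M = {}" by auto
  qed
  also have "sum ?f ?L = (-1) ^ (card {j \<in> v. j < l} + card {j \<in> insert l v. j < m}) * int (paths v l m x z)"
    using coeff_path[OF l lm(2,3,4) _ z1(1), of x] lm by (simp add: sum.reindex inj_on_def w_def)
  also have "sum ?f ?M = (-1) ^ (card {j \<in> v. j < m} + card {j \<in> insert m v. j < l}) * int (paths v m l x z)"
    using coeff_path[OF lm(2) l lm(4,3) _ z1(2), of x] lm by (simp add: sum.reindex inj_on_def w')
  also have "paths v m l x z = paths v l m x z"
    using paths_sym[OF l lm(2,3,4) _ x z1(1)] lm by simp
  also have "{j \<in> insert m v. j < l} = {j \<in> v. j < l}" using lm by auto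
  also have "card {j \<in> insert l v. j < m} = Suc (card {j \<in> v. j < m})"
  proof -
    have "{j \<in> insert l v. j < m} = insert l {j \<in> v. j < m}" using lm by auto
    moreover have "finite v" using lm(5) finite_subset by blast
    ultimately show ?thesis using lm by simp
  qed
  finally show ?thesis unfolding w_def by (simp add: power_add)
qed

lemma coeff_square:
  assumes a: "a \<in> cells" and c: "c \<in> cells"
  shows "(\<Sum>b\<in>cells. coeff a b * coeff b c) = 0"
proof (rule ccontr)
  assume nz: "(\<Sum>b\<in>cells. coeff a b * coeff b c) \<noteq> 0"
  then obtain b where "coeff a b * coeff b c \<noteq> 0" by (rule sum.not_neutral_contains_not_neutral)
  then have n: "coeff a b \<noteq> 0" "coeff b c \<noteq> 0" by auto
  obtain v x where e1: "a = (v, x)" by (rule prod.exhaust)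
  obtain u y where e2: "b = (u, y)" by (rule prod.exhaust)
  obtain w z where e3: "c = (w, z)" by (rule prod.exhaust)
  note e = e1 e2 e3
  have "coeff (v, x) (u, y) \<noteq> 0" "coeff (u, y) (w, z) \<noteq> 0" using n by (simp_all add: e)
  note n' = this
  obtain l where l: "l < ncross D" "l \<notin> v" "u = insert l v" using n'(1) by (rule coeff_nonzeroD)
  obtain m where m: "m < ncross D" "m \<notin> u" "w = insert m u" using n'(2) by (rule coeff_nonzeroD)
  have x: "x \<in> labellings D v" "v \<subseteq> {..<ncross D}" and z: "z \<in> labellings D w"
    using a c e by (auto simp: cells_def)
  have w: "w = insert m (insert l v)" "w = insert l (insert m v)" using l m by auto
  have "l \<noteq> m" "m \<notin> v" using l m by auto
  then consider "l < m" | "m < l" by linarith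
  then have "(\<Sum>b\<in>cells. coeff (v, x) b * coeff b (w, z)) = 0"
  proof cases
    case 1
    show ?thesis unfolding w(1)
      by (rule coeff_square_aux[OF 1 m(1) l(2) \<open>m \<notin> v\<close> x(2,1) z[unfolded w(1)]])
  next
    case 2
    show ?thesis unfolding w(2)
      by (rule coeff_square_aux[OF 2 l(1) \<open>m \<notin> v\<close> l(2) x(2,1) z[unfolded w(2)]])
  qed
  then show False using nz by (simp only: e)
qed

lemma chain_complex_cells: "chain_complex_on coeff cells"
  unfolding chain_complex_on_def using finite_cells coeff_square by blast

end


section \<open>Partially resolved diagrams\<close>

lemma merging_comm: "merging V W C1 C2 \<Longrightarrow> merging V W C2 C1"
  unfolding merging_def by (metis Un_commute insert_commute)

text \<open>The part of the comultiplication with factor \<open>X\<close> at the new circle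
  \<open>C\<close> copies the old label to the other new circle, so it is an isomorphism. This is
  one source of cancellations.\<close>

lemma split_unique:
  assumes m: "merging W V C1 C2" and C: "C = C1 \<or> C = C2"
  shows "x \<in> V \<rightarrow>\<^sub>E UNIV \<Longrightarrow> \<exists>!y. y \<in> W \<rightarrow>\<^sub>E UNIV \<and> merge_or_split V W x y \<and> y C = v_minus"
    and "y \<in> W \<rightarrow>\<^sub>E UNIV \<Longrightarrow> y C = v_minus \<Longrightarrow> \<exists>!x. x \<in> V \<rightarrow>\<^sub>E UNIV \<and> merge_or_split V W x y"
proof -
  have main: "(x \<in> V \<rightarrow>\<^sub>E UNIV \<longrightarrow> (\<exists>!y. y \<in> W \<rightarrow>\<^sub>E UNIV \<and> merge_or_split V W x y \<and> y C = v_minus)) \<and>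
      (y \<in> W \<rightarrow>\<^sub>E UNIV \<longrightarrow> y C = v_minus \<longrightarrow> (\<exists>!x. x \<in> V \<rightarrow>\<^sub>E UNIV \<and> merge_or_split V W x y))"
    if m: "merging W V C C'" for C C'
  proof (intro conjI impI)
    have k: "C \<in> W" "C' \<in> W" "C \<noteq> C'" "C \<union> C' \<notin> W" "V = insert (C \<union> C') (W - {C, C'})"
      using m by (simp_all add: merging_def)
    have split: "(v_minus, b, c) \<in> split_entries \<longleftrightarrow> b = c" for b c
      by (cases b; cases c; simp add: split_entries_def)
    note mos = merge_or_split_splitting[OF m]
    have Vm: "K \<in> V \<longleftrightarrow> K = C \<union> C' \<or> K \<in> W - {C, C'}" for K unfolding k(5) by simp
    have U: "K \<noteq> C \<union> C'" if "K \<in> W - {C, C'}" for K using that k(4) by auto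
    {
      assume x: "x \<in> V \<rightarrow>\<^sub>E UNIV"
      let ?y = "\<lambda>K\<in>W. if K = C then v_minus else if K = C' then x (C \<union> C') else x K"
      show "\<exists>!y. y \<in> W \<rightarrow>\<^sub>E UNIV \<and> merge_or_split V W x y \<and> y C = v_minus"
      proof (rule ex1I[of _ ?y])
        show "?y \<in> W \<rightarrow>\<^sub>E UNIV \<and> merge_or_split V W x ?y \<and> ?y C = v_minus"
          unfolding mos using k(1-3) by (simp add: split)
      next
        fix y assume y: "y \<in> W \<rightarrow>\<^sub>E UNIV \<and> merge_or_split V W x y \<and> y C = v_minus"
        then have a: "\<forall>K\<in>W - {C, C'}. x K = y K" "y C' = x (C \<union> C')" "y C = v_minus"
          unfolding mos by (auto simp: split)
        show "y = ?y"
        proof (rule PiE_ext[where k = W and s = "\<lambda>_. UNIV"])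
          fix K assume "K \<in> W"
          then show "y K = ?y K" using a by auto
        qed (use y in auto)
      qed
    next
      assume y: "y \<in> W \<rightarrow>\<^sub>E UNIV" "y C = v_minus"
      let ?x = "\<lambda>K\<in>V. if K = C \<union> C' then y C' else y K"
      show "\<exists>!x. x \<in> V \<rightarrow>\<^sub>E UNIV \<and> merge_or_split V W x y"
      proof (rule ex1I[of _ ?x])
        have "\<forall>K\<in>W - {C, C'}. ?x K = y K" using U Vm by simp
        moreover have "?x (C \<union> C') = y C'" using Vm by simp
        ultimately show "?x \<in> V \<rightarrow>\<^sub>E UNIV \<and> merge_or_split V W ?x y"
          unfolding mos y(2) split by auto
      next
        fix x assume x: "x \<in> V \<rightarrow>\<^sub>E UNIV \<and> merge_or_split V W x y"
        then have a: "\<forall>K\<in>W - {C, C'}. x K = y K" "y C' = x (C \<union> C')"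
          unfolding mos y(2) split by simp_all
        show "x = ?x"
        proof (rule PiE_ext[where k = V and s = "\<lambda>_. UNIV"])
          fix K assume "K \<in> V"
          then show "x K = ?x K"
            by (cases "K = C \<union> C'") (use a Vm[of K] in simp_all)
        qed (use x in auto)
      qed
    }
  qed
  from C have "\<exists>C'. merging W V C C'"
    using m merging_comm by metis
  then obtain C' where m': "merging W V C C'" ..
  show "x \<in> V \<rightarrow>\<^sub>E UNIV \<Longrightarrow> \<exists>!y. y \<in> W \<rightarrow>\<^sub>E UNIV \<and> merge_or_split V W x y \<and> y C = v_minus"
    and "y \<in> W \<rightarrow>\<^sub>E UNIV \<Longrightarrow> y C = v_minus \<Longrightarrow> \<exists>!x. x \<in> V \<rightarrow>\<^sub>E UNIV \<and> merge_or_split V W x y"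
    using main[OF m'] by simp_all
qed

text \<open>The other source of cancellations: multiplication with the unit at \<open>C\<close>
  copies the label of the other circle.\<close>

lemma merge_unique:
  assumes m: "merging V W C1 C2" and C: "C = C1 \<or> C = C2"
  shows "x \<in> V \<rightarrow>\<^sub>E UNIV \<Longrightarrow> x C = v_plus \<Longrightarrow> \<exists>!y. y \<in> W \<rightarrow>\<^sub>E UNIV \<and> merge_or_split V W x y"
    and "y \<in> W \<rightarrow>\<^sub>E UNIV \<Longrightarrow> \<exists>!x. x \<in> V \<rightarrow>\<^sub>E UNIV \<and> merge_or_split V W x y \<and> x C = v_plus"
proof -
  have main: "(y \<in> W \<rightarrow>\<^sub>E UNIV \<longrightarrow> (\<exists>!x. x \<in> V \<rightarrow>\<^sub>E UNIV \<and> merge_or_split V W x y \<and> x C = v_plus)) \<and>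
      (x \<in> V \<rightarrow>\<^sub>E UNIV \<longrightarrow> x C = v_plus \<longrightarrow> (\<exists>!y. y \<in> W \<rightarrow>\<^sub>E UNIV \<and> merge_or_split V W x y))"
    if m: "merging V W C C'" for C C'
  proof (intro conjI impI)
    have k: "C \<in> V" "C' \<in> V" "C \<noteq> C'" "C \<union> C' \<notin> V" "W = insert (C \<union> C') (V - {C, C'})"
      using m by (simp_all add: merging_def)
    have merge: "(v_plus, b, c) \<in> merge_entries \<longleftrightarrow> b = c" for b c
      by (cases b; cases c; simp add: merge_entries_def)
    note mos = merge_or_split_merging[OF m]
    have Wm: "K \<in> W \<longleftrightarrow> K = C \<union> C' \<or> K \<in> V - {C, C'}" for K unfolding k(5) by simp
    have U: "K \<noteq> C \<union> C'" if "K \<in> V - {C, C'}" for K using that k(4) by auto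
    {
      assume y: "y \<in> W \<rightarrow>\<^sub>E UNIV"
      let ?x = "\<lambda>K\<in>V. if K = C then v_plus else if K = C' then y (C \<union> C') else y K"
      show "\<exists>!x. x \<in> V \<rightarrow>\<^sub>E UNIV \<and> merge_or_split V W x y \<and> x C = v_plus"
      proof (rule ex1I[of _ ?x])
        show "?x \<in> V \<rightarrow>\<^sub>E UNIV \<and> merge_or_split V W ?x y \<and> ?x C = v_plus"
          unfolding mos using k(1-3) by (simp add: merge)
      next
        fix x assume x: "x \<in> V \<rightarrow>\<^sub>E UNIV \<and> merge_or_split V W x y \<and> x C = v_plus"
        then have a: "\<forall>K\<in>V - {C, C'}. x K = y K" "x C' = y (C \<union> C')" "x C = v_plus"
          unfolding mos by (auto simp: merge)
        show "x = ?x"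
        proof (rule PiE_ext[where k = V and s = "\<lambda>_. UNIV"])
          fix K assume "K \<in> V"
          then show "x K = ?x K" using a by auto
        qed (use x in auto)
      qed
    next
      assume x: "x \<in> V \<rightarrow>\<^sub>E UNIV" "x C = v_plus"
      let ?y = "\<lambda>K\<in>W. if K = C \<union> C' then x C' else x K"
      show "\<exists>!y. y \<in> W \<rightarrow>\<^sub>E UNIV \<and> merge_or_split V W x y"
      proof (rule ex1I[of _ ?y])
        have "\<forall>K\<in>V - {C, C'}. x K = ?y K" using U Wm by simp
        moreover have "?y (C \<union> C') = x C'" using Wm by simp
        ultimately show "?y \<in> W \<rightarrow>\<^sub>E UNIV \<and> merge_or_split V W x ?y"
          unfolding mos x(2) merge by auto
      next
        fix y assume y: "y \<in> W \<rightarrow>\<^sub>E UNIV \<and> merge_or_split V W x y"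
        then have a: "\<forall>K\<in>V - {C, C'}. x K = y K" "x C' = y (C \<union> C')"
          unfolding mos x(2) merge by simp_all
        show "y = ?y"
        proof (rule PiE_ext[where k = W and s = "\<lambda>_. UNIV"])
          fix K assume "K \<in> W"
          then show "y K = ?y K"
            by (cases "K = C \<union> C'") (use a Wm[of K] in simp_all)
        qed (use y in auto)
      qed
    }
  qed
  from C have "\<exists>C'. merging V W C C'"
    using m merging_comm by metis
  then obtain C' where m': "merging V W C C'" ..
  show "x \<in> V \<rightarrow>\<^sub>E UNIV \<Longrightarrow> x C = v_plus \<Longrightarrow> \<exists>!y. y \<in> W \<rightarrow>\<^sub>E UNIV \<and> merge_or_split V W x y"
    and "y \<in> W \<rightarrow>\<^sub>E UNIV \<Longrightarrow> \<exists>!x. x \<in> V \<rightarrow>\<^sub>E UNIV \<and> merge_or_split V W x y \<and> x C = v_plus"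
    using main[OF m'] by simp_all
qed

text \<open>The drop by one is what the shift by the number of 1-smoothings compensates, so that the
  differential preserves the q-degree.\<close>

lemma merge_or_split_degree:
  assumes m: "merging V W C1 C2 \<or> merging W V C1 C2" and e: "merge_or_split V W x y"
    and fin: "finite V" "finite W"
  shows "(\<Sum>C\<in>W. label_degree (y C)) + 1 = (\<Sum>C\<in>V. label_degree (x C))"
  using m
proof
  assume m: "merging V W C1 C2"
  let ?K = "V - {C1, C2}"
  have k: "C1 \<in> V" "C2 \<in> V" "C1 \<noteq> C2" "C1 \<union> C2 \<notin> V" "W = insert (C1 \<union> C2) ?K"
    using m by (simp_all add: merging_def)
  have V: "V = insert C1 (insert C2 ?K)" using k by auto
  have e': "\<forall>C\<in>?K. x C = y C" "(x C1, x C2, y (C1 \<union> C2)) \<in> merge_entries"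
    using e unfolding merge_or_split_merging[OF m] by simp_all
  have "(\<Sum>C\<in>W. label_degree (y C)) = label_degree (y (C1 \<union> C2)) + (\<Sum>C\<in>?K. label_degree (y C))"
    unfolding k(5) using fin k(4) by simp
  moreover have "(\<Sum>C\<in>V. label_degree (x C)) = label_degree (x C1) + label_degree (x C2) + (\<Sum>C\<in>?K. label_degree (x C))"
    by (subst V) (use fin k(3) in simp)
  moreover have "(\<Sum>C\<in>?K. label_degree (x C)) = (\<Sum>C\<in>?K. label_degree (y C))" using e'(1) by simp
  moreover have "label_degree (y (C1 \<union> C2)) + 1 = label_degree (x C1) + label_degree (x C2)"
    using e'(2) by (auto simp: merge_entries_def)
  ultimately show ?thesis by simp
next
  assume m: "merging W V C1 C2"
  let ?K = "W - {C1, C2}"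
  have k: "C1 \<in> W" "C2 \<in> W" "C1 \<noteq> C2" "C1 \<union> C2 \<notin> W" "V = insert (C1 \<union> C2) ?K"
    using m by (simp_all add: merging_def)
  have W: "W = insert C1 (insert C2 ?K)" using k by auto
  have e': "\<forall>C\<in>?K. x C = y C" "(y C1, y C2, x (C1 \<union> C2)) \<in> split_entries"
    using e unfolding merge_or_split_splitting[OF m] by simp_all
  have "(\<Sum>C\<in>V. label_degree (x C)) = label_degree (x (C1 \<union> C2)) + (\<Sum>C\<in>?K. label_degree (x C))"
    unfolding k(5) using fin k(4) by simp
  moreover have "(\<Sum>C\<in>W. label_degree (y C)) = label_degree (y C1) + label_degree (y C2) + (\<Sum>C\<in>?K. label_degree (y C))"
    by (subst W) (use fin k(3) in simp)
  moreover have "(\<Sum>C\<in>?K. label_degree (x C)) = (\<Sum>C\<in>?K. label_degree (y C))" using e'(1) by simp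
  moreover have "label_degree (x (C1 \<union> C2)) = label_degree (y C1) + label_degree (y C2) + 1"
    using e'(2) by (auto simp: split_entries_def)
  ultimately show ?thesis by simp
qed

context source_sink_diagram
begin

text \<open>\<open>coeff\<close> cut down to cells, so that the statements about degrees, in
  particular \<open>graded_by\<close>, hold for all arguments.\<close>

definition bd :: "nat set \<times> 'a labelling \<Rightarrow> nat set \<times> 'a labelling \<Rightarrow> int" where
  "bd a b = (if a \<in> cells \<and> b \<in> cells then coeff a b else 0)"

definition hdeg :: "nat set \<times> 'a labelling \<Rightarrow> int" where
  "hdeg a = int (card (fst a))"

definition qdeg :: "nat set \<times> 'a labelling \<Rightarrow> int" where
  "qdeg a = (\<Sum>C\<in>circles D (fst a). label_degree (snd a C)) + int (card (fst a))"

lemma chain_complex_bd: "chain_complex_on bd cells"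
  using chain_complex_cells unfolding chain_complex_on_def by (simp add: bd_def)

lemma bd_nonzeroD:
  assumes "bd (v, x) (w, y) \<noteq> 0"
  obtains m where "m < ncross D" "m \<notin> v" "w = insert m v" "y \<in> labellings D w" "x \<in> labellings D v"
    "v \<subseteq> {..<ncross D}" "edge v m x y"
proof -
  have "coeff (v, x) (w, y) \<noteq> 0" "(v, x) \<in> cells" using assms by (auto simp: bd_def split: if_splits)
  then show thesis using that by (elim coeff_nonzeroD) (simp add: cells_def)
qed

lemma bd_edge:
  assumes "m < ncross D" "m \<notin> v" "v \<subseteq> {..<ncross D}" "x \<in> labellings D v" "y \<in> labellings D (insert m v)"
  shows "bd (v, x) (insert m v, y) \<noteq> 0 \<longleftrightarrow> edge v m x y" "\<bar>bd (v, x) (insert m v, y)\<bar> \<le> 1"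
  using assms coeff_edge[OF assms(1,2), of x y] by (auto simp: bd_def cells_def power_abs)

lemma graded_bd: "graded_by hdeg bd"
  unfolding graded_by_def
proof (intro allI impI)
  fix a b assume "bd a b \<noteq> 0"
  moreover obtain v x w y where "a = (v, x)" "b = (w, y)" by (cases a, cases b)
  ultimately show "hdeg b = hdeg a + 1"
    by (auto simp: hdeg_def elim!: bd_nonzeroD dest: finite_subset)
qed

lemma qdeg_bd: "bd a b \<noteq> 0 \<Longrightarrow> qdeg b = qdeg a"
proof -
  assume nz: "bd a b \<noteq> 0"
  obtain v x where a: "a = (v, x)" by (cases a)
  obtain w y where b: "b = (w, y)" by (cases b)
  obtain m where m: "m < ncross D" "m \<notin> v" "w = insert m v" "v \<subseteq> {..<ncross D}" "edge v m x y"
    using nz unfolding a b by (elim bd_nonzeroD)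
  have "finite v" using m(4) finite_subset by blast
  moreover obtain C1 C2 where "merging (circles D v) (circles D w) C1 C2 \<or> merging (circles D w) (circles D v) C1 C2"
    using edge_cases[OF m(1,2)] unfolding m(3) by blast
  then have "(\<Sum>C\<in>circles D w. label_degree (y C)) + 1 = (\<Sum>C\<in>circles D v. label_degree (x C))"
    using m(3,5) finite_circles by (intro merge_or_split_degree) auto
  ultimately show "qdeg b = qdeg a" using m by (simp add: a b qdeg_def)
qed

text \<open>Classes that meet no unresolved crossing. They remain circles, with the same arcs,
  however the crossings in \<open>S\<close> are resolved.\<close>

definition closed_circles :: "nat set \<Rightarrow> nat set \<Rightarrow> 'a set set" where
  "closed_circles S v = {C \<in> arcs D // conn D S v. \<forall>e\<in>ends S. end_arc D e \<notin> C}"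

lemma conn_saturated:
  assumes "\<And>l a b. l < ncross D \<Longrightarrow> l \<notin> S \<Longrightarrow> (a, b) \<in> smoothing D l (l \<in> w) \<Longrightarrow> a \<in> Y \<longleftrightarrow> b \<in> Y"
  shows "conn D S w \<subseteq> {(a, b). a \<in> Y \<longleftrightarrow> b \<in> Y}"
  unfolding conn_def
proof (rule eq_closure_least)
  show "equiv UNIV {(a, b). (a \<in> Y) = (b \<in> Y)}"
    by (auto simp: equiv_def refl_on_def sym_def trans_def)
qed (use assms in blast)

lemma smoothing_ends: "(a, b) \<in> smoothing D l s \<Longrightarrow> l \<in> S \<Longrightarrow> \<exists>e\<in>ends S. \<exists>e'\<in>ends S. a = end_arc D e \<and> b = end_arc D e'"
proof -
  assume h: "(a, b) \<in> smoothing D l s" "l \<in> S"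
  have "\<exists>i<4. \<exists>j<4. a = pt l i \<and> b = pt l j"
    using h(1) unfolding smoothing_def smoothing0_arcs smoothing1_arcs end_arc_def prod.case
    by (cases s) force+
  then show ?thesis using h(2) by (auto simp: ends_def)
qed

lemma smoothing_conn: "(a, b) \<in> smoothing D l (l \<in> w) \<Longrightarrow> l < ncross D \<Longrightarrow> l \<notin> S \<Longrightarrow> (a, b) \<in> conn D S w"
  unfolding conn_def by (rule subsetD[OF eq_closure_superset]) blast

text \<open>\<open>C\<close> has no corner of a crossing in \<open>S\<close>, so the smoothings of
  such crossings cannot enlarge it.\<close>

lemma closed_circles_mono:
  assumes C: "C \<in> closed_circles S v" and S: "S' \<subseteq> S" and w: "w - S = v - S"
  shows "C \<in> closed_circles S' w"
proof -
  obtain p where p: "p \<in> arcs D" "C = conn D S v `` {p}"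
    using C by (auto simp: closed_circles_def elim!: quotientE)
  have cong: "conn D S v = conn D S w" using w by (intro conn_cong) simp
  have sub: "conn D S' w \<subseteq> {(a, b). a \<in> C \<longleftrightarrow> b \<in> C}"
  proof (rule conn_saturated)
    fix l a b assume l: "l < ncross D" "l \<notin> S'" "(a, b) \<in> smoothing D l (l \<in> w)"
    show "a \<in> C \<longleftrightarrow> b \<in> C"
    proof (cases "l \<in> S")
      case True
      then show ?thesis using smoothing_ends[OF l(3)] C by (auto simp: closed_circles_def)
    next
      case False
      then have "(a, b) \<in> conn D S v" using smoothing_conn[OF l(3,1)] cong by simp
      then have "(p, a) \<in> conn D S v \<longleftrightarrow> (p, b) \<in> conn D S v"
        using equivD(2,3)[OF equiv_conn] by metis
      then show ?thesis by (simp add: p(2))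
    qed
  qed
  have "conn D S' w `` {p} = C"
  proof
    have "p \<in> C" using p equivD(1)[OF equiv_conn] by simp
    then show "conn D S' w `` {p} \<subseteq> C" using sub by blast
    show "C \<subseteq> conn D S' w `` {p}" unfolding p(2) using conn_mono[OF S w[symmetric], of D] by blast
  qed
  then have "C \<in> arcs D // conn D S' w" using p(1) by (metis quotientI)
  then show ?thesis using C S by (auto simp: closed_circles_def ends_def)
qed

lemma closed_circle_in_circles:
  "C \<in> closed_circles S v \<Longrightarrow> w - S = v - S \<Longrightarrow> C \<in> circles D w"
  using closed_circles_mono[of C S v "{}" w] by (simp add: closed_circles_def circles_conn ends_def)

text \<open>The complex of a partially resolved diagram as a set of cells of the one cube:
  \<open>v1\<close> records the 1-smoothings outside \<open>S\<close>. Labels of closed circles are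
  prescribed because each cancellation keeps one label of a circle and discards the other.\<close>

definition state_cells :: "nat set \<Rightarrow> nat set \<Rightarrow> 'a set set \<Rightarrow> 'a labelling \<Rightarrow> (nat set \<times> 'a labelling) set" where
  "state_cells S v1 P lab = {(v, x) \<in> cells. v - S = v1 \<and> (\<forall>C\<in>P. x C = lab C)}"

definition layer :: "int \<Rightarrow> (nat set \<times> 'a labelling) set" where
  "layer j = {c. qdeg c = j}"

definition bounded_by :: "(nat set \<times> 'a labelling) set \<Rightarrow> int \<Rightarrow> int \<Rightarrow> bool" where
  "bounded_by U I J \<longleftrightarrow> (\<forall>i j. i > I \<or> j > J \<longrightarrow> exact_at hdeg bd (U \<inter> layer j) i)"

lemma edge_keeps_label:
  assumes "bd (v, x) (w, y) \<noteq> 0" "C \<in> closed_circles S v1" "v - S = v1 - S" "w - S = v1 - S"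
  shows "x C = y C"
proof -
  obtain m where "w = insert m v" "edge v m x y" using assms(1) by (elim bd_nonzeroD)
  then show ?thesis
    using closed_circle_in_circles[OF assms(2,3)] closed_circle_in_circles[OF assms(2,4)]
    by (auto simp: merge_or_split_def)
qed

text \<open>A set of cells inherits the vanishing of the square when every cell between two of its
  members belongs to it. Here 1-smoothings are only ever added along edges, and labels of closed
  circles do not change.\<close>

lemma chain_complex_state:
  assumes P: "P \<subseteq> closed_circles S v1"
  shows "chain_complex_on bd (state_cells S v1 P lab \<inter> layer j)"
  unfolding chain_complex_on_def
proof (intro conjI ballI)
  let ?U = "state_cells S v1 P lab \<inter> layer j"
  have sub: "?U \<subseteq> cells" by (auto simp: state_cells_def)
  then show "finite ?U" using finite_cells finite_subset by blast
  fix a c assume a: "a \<in> ?U" and c: "c \<in> ?U"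
  have "(\<Sum>b\<in>?U. bd a b * bd b c) = (\<Sum>b\<in>cells. bd a b * bd b c)"
  proof (rule sum.mono_neutral_left[OF finite_cells sub], rule ballI, rule ccontr)
    fix b assume b: "b \<in> cells - ?U" and nz: "bd a b * bd b c \<noteq> 0"
    obtain v x where av: "a = (v, x)" by (cases a)
    obtain u y where bv: "b = (u, y)" by (cases b)
    obtain w z where cv: "c = (w, z)" by (cases c)
    have n: "bd (v, x) (u, y) \<noteq> 0" "bd (u, y) (w, z) \<noteq> 0" using nz by (simp_all add: av bv cv)
    obtain m where m: "u = insert m v" using n(1) by (elim bd_nonzeroD)
    obtain m' where m': "w = insert m' u" using n(2) by (elim bd_nonzeroD)
    have vS: "v - S = v1" "w - S = v1" using a c by (auto simp: state_cells_def av cv)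
    then have uS: "u - S = v1" using m m' by blast
    have v1S: "v1 - S = v1" using vS by blast
    have "y C = lab C" if "C \<in> P" for C
    proof -
      have "x C = y C" by (rule edge_keeps_label[OF n(1), of _ S v1]) (use that P vS uS v1S in auto)
      then show ?thesis using a that by (auto simp: state_cells_def av)
    qed
    moreover have "qdeg b = qdeg a" using n(1) qdeg_bd by (simp add: av bv)
    ultimately have "b \<in> ?U" using b uS a by (auto simp: state_cells_def bv layer_def)
    then show False using b by simp
  qed
  then show "(\<Sum>b\<in>?U. bd a b * bd b c) = 0"
    using chain_complex_bd a c sub by (auto simp: chain_complex_on_def)
qed


section \<open>Subcomplexes, quotients and matched blocks of cells\<close>

definition no_entries :: "(nat set \<times> 'a labelling) set \<Rightarrow> (nat set \<times> 'a labelling) set \<Rightarrow> bool" where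
  "no_entries U U' \<longleftrightarrow> (\<forall>a\<in>U. \<forall>b\<in>U'. bd a b = 0)"

definition layered_complex :: "(nat set \<times> 'a labelling) set \<Rightarrow> bool" where
  "layered_complex U \<longleftrightarrow> (\<forall>j. chain_complex_on bd (U \<inter> layer j))"

definition acyclic_cells :: "(nat set \<times> 'a labelling) set \<Rightarrow> bool" where
  "acyclic_cells U \<longleftrightarrow> (\<forall>i j. exact_at hdeg bd (U \<inter> layer j) i)"

lemma acyclic_bounded: "acyclic_cells U \<Longrightarrow> bounded_by U I J"
  by (simp add: acyclic_cells_def bounded_by_def)

lemma bounded_by_mono: "bounded_by U I J \<Longrightarrow> I \<le> I' \<Longrightarrow> J \<le> J' \<Longrightarrow> bounded_by U I' J'"
  unfolding bounded_by_def by (meson order_le_less_trans)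

lemma layered_complex_split:
  assumes "layered_complex (U1 \<union> U2)" "U1 \<inter> U2 = {}" "no_entries U2 U1"
  shows "layered_complex U1" "layered_complex U2"
proof -
  have "chain_complex_on bd (U1 \<inter> layer j) \<and> chain_complex_on bd (U2 \<inter> layer j)" for j
  proof -
    have "chain_complex_on bd (U1 \<inter> layer j \<union> U2 \<inter> layer j)"
      using assms(1) by (simp add: layered_complex_def Int_Un_distrib2)
    moreover have "(U1 \<inter> layer j) \<inter> (U2 \<inter> layer j) = {}" using assms(2) by blast
    moreover have "bd a b = 0" if "a \<in> U2 \<inter> layer j" "b \<in> U1 \<inter> layer j" for a b
      using assms(3) that by (simp add: no_entries_def)
    ultimately show ?thesis using chain_complex_on_split[of bd "U1 \<inter> layer j" "U2 \<inter> layer j"] by blast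
  qed
  then show "layered_complex U1" "layered_complex U2" by (simp_all add: layered_complex_def)
qed

lemma bounded_extension:
  assumes "layered_complex (U1 \<union> U2)" "U1 \<inter> U2 = {}" "no_entries U2 U1"
    and "bounded_by U1 I J" "bounded_by U2 I J"
  shows "bounded_by (U1 \<union> U2) I J"
  unfolding bounded_by_def
proof (intro allI impI)
  fix i j assume ij: "i > I \<or> j > J"
  have "exact_at hdeg bd (U1 \<inter> layer j \<union> U2 \<inter> layer j) i"
  proof (rule exact_at_extension)
    show "chain_complex_on bd (U1 \<inter> layer j \<union> U2 \<inter> layer j)"
      using assms(1) by (simp add: layered_complex_def Int_Un_distrib2)
    show "(U1 \<inter> layer j) \<inter> (U2 \<inter> layer j) = {}" using assms(2) by blast
    show "graded_by hdeg bd" by (rule graded_bd)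
    show "bd a b = 0" if "a \<in> U2 \<inter> layer j" "b \<in> U1 \<inter> layer j" for a b
      using assms(3) that by (simp add: no_entries_def)
    show "exact_at hdeg bd (U1 \<inter> layer j) i" "exact_at hdeg bd (U2 \<inter> layer j) i"
      using assms(4,5) ij unfolding bounded_by_def by blast+
  qed
  then show "exact_at hdeg bd ((U1 \<union> U2) \<inter> layer j) i" by (simp add: Int_Un_distrib2)
qed

lemma layered_complex_state: "P \<subseteq> closed_circles S v1 \<Longrightarrow> layered_complex (state_cells S v1 P lab)"
  by (simp add: layered_complex_def chain_complex_state)

lemma state_cells_mem:
  assumes "l \<notin> S" "a \<in> state_cells S v1 P lab"
  shows "l \<in> fst a \<longleftrightarrow> l \<in> v1"
  using assms by (auto simp: state_cells_def)

text \<open>Edges only add 1-smoothings, so the cells with a 1-smoothing at \<open>l\<close> form a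
  subcomplex.\<close>

lemma no_entries_crossing:
  assumes "\<And>a. a \<in> U \<Longrightarrow> l \<in> fst a" "\<And>b. b \<in> U' \<Longrightarrow> l \<notin> fst b"
  shows "no_entries U U'"
  unfolding no_entries_def
proof (intro ballI, rule ccontr)
  fix a b assume ab: "a \<in> U" "b \<in> U'" "bd a b \<noteq> 0"
  obtain v x where a: "a = (v, x)" by (cases a)
  obtain w y where b: "b = (w, y)" by (cases b)
  obtain m where "w = insert m v" using ab(3) unfolding a b by (elim bd_nonzeroD)
  then show False using assms(1)[OF ab(1)] assms(2)[OF ab(2)] by (simp add: a b)
qed

text \<open>Edges within one partial resolution leave a closed circle alone, so cells with different
  labels on it do not interact.\<close>

lemma no_entries_label:
  assumes "C \<in> closed_circles S v1" "v1 \<inter> S = {}" "C \<in> P" "C \<in> P'" "lab C \<noteq> lab' C"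
  shows "no_entries (state_cells S v1 P lab) (state_cells S v1 P' lab')"
  unfolding no_entries_def
proof (intro ballI, rule ccontr)
  fix a b assume ab: "a \<in> state_cells S v1 P lab" "b \<in> state_cells S v1 P' lab'" "bd a b \<noteq> 0"
  obtain v x where a: "a = (v, x)" by (cases a)
  obtain w y where b: "b = (w, y)" by (cases b)
  have "v1 - S = v1" using assms(2) by auto
  then have "x C = y C"
    using edge_keeps_label[OF ab(3)[unfolded a b] assms(1)] ab by (simp add: state_cells_def a b)
  then show False using ab assms by (simp add: state_cells_def a b)
qed

lemma no_entries_Un: "no_entries (U \<union> U') V \<longleftrightarrow> no_entries U V \<and> no_entries U' V"
  "no_entries U (V \<union> V') \<longleftrightarrow> no_entries U V \<and> no_entries U V'"
  by (auto simp: no_entries_def)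

lemma bd_unit: "bd a b \<noteq> 0 \<Longrightarrow> \<bar>bd a b\<bar> = 1"
proof -
  assume nz: "bd a b \<noteq> 0"
  obtain v x where a: "a = (v, x)" by (cases a)
  obtain w y where b: "b = (w, y)" by (cases b)
  obtain m where m: "m < ncross D" "m \<notin> v" "w = insert m v" "v \<subseteq> {..<ncross D}" "x \<in> labellings D v" "y \<in> labellings D w"
    using nz unfolding a b by (elim bd_nonzeroD)
  then have "\<bar>bd a b\<bar> \<le> 1" using bd_edge(2)[OF m(1,2,4,5)] by (simp add: a b)
  then show ?thesis using nz by linarith
qed

text \<open>Ensures that changing the smoothing of \<open>l\<close> really creates or removes
  \<open>C\<close>: of the two circles before a merge or after a split, each contains some but not
  all of the four corners.\<close>

definition partly_touches :: "'a set \<Rightarrow> nat \<Rightarrow> bool" where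
  "partly_touches C l \<longleftrightarrow> (\<exists>i<4. pt l i \<in> C) \<and> (\<exists>i<4. pt l i \<notin> C)"

lemma less_4: "i < (4 :: nat) \<longleftrightarrow> i = 0 \<or> i = 1 \<or> i = 2 \<or> i = 3"
  by auto

lemma edge_circ:
  assumes "l < ncross D" "l \<notin> v"
  shows "circ v (pt l 1) = circ v (pt l 0)" "circ v (pt l 3) = circ v (pt l 2)"
    and "circ (insert l v) (pt l 3) = circ (insert l v) (pt l 0)" "circ (insert l v) (pt l 2) = circ (insert l v) (pt l 1)"
    and "merges v l \<Longrightarrow> circ (insert l v) (pt l 0) = circ v (pt l 0) \<union> circ v (pt l 2)"
    and "merges v l \<Longrightarrow> circ (insert l v) (pt l 1) = circ v (pt l 0) \<union> circ v (pt l 2)"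
    and "\<not> merges v l \<Longrightarrow> circ v (pt l 2) = circ v (pt l 0)"
proof -
  note ec = edge_cases[OF assms]
  note 1 = ec[THEN conjunct1] and 2 = ec[THEN conjunct2, THEN conjunct1]
    and 3 = ec[THEN conjunct2, THEN conjunct2, THEN conjunct1, rule_format, THEN conjunct2]
    and 4 = ec[THEN conjunct2, THEN conjunct2, THEN conjunct2, rule_format, THEN conjunct2, THEN conjunct2]
  show "circ v (pt l 1) = circ v (pt l 0)" by (rule 1[THEN conjunct1, symmetric])
  show "circ v (pt l 3) = circ v (pt l 2)" by (rule 1[THEN conjunct2, symmetric])
  show "circ (insert l v) (pt l 3) = circ (insert l v) (pt l 0)" by (rule 2[THEN conjunct1, symmetric])
  show "circ (insert l v) (pt l 2) = circ (insert l v) (pt l 1)" by (rule 2[THEN conjunct2, symmetric])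
  show "merges v l \<Longrightarrow> circ (insert l v) (pt l 0) = circ v (pt l 0) \<union> circ v (pt l 2)"
    by (rule 3[THEN conjunct1])
  show "merges v l \<Longrightarrow> circ (insert l v) (pt l 1) = circ v (pt l 0) \<union> circ v (pt l 2)"
    by (rule 3[THEN conjunct2])
  show "\<not> merges v l \<Longrightarrow> circ v (pt l 2) = circ v (pt l 0)" by (rule 4)
qed

text \<open>If the edge were a merge, all four corners would lie on one circle after it. The dual
  argument gives \<open>partly_touches_merge\<close>.\<close>

lemma partly_touches_split:
  assumes l: "l < ncross D" "l \<notin> v" and C: "C \<in> circles D (insert l v)" "partly_touches C l"
  obtains C1 C2 where "merging (circles D (insert l v)) (circles D v) C1 C2" "C = C1 \<or> C = C2"
proof -
  note ec = edge_cases[OF l]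
  obtain i j where i: "i < 4" "pt l i \<in> C" and j: "j < 4" "pt l j \<notin> C"
    using C(2) by (auto simp: partly_touches_def)
  have Ci: "C = circ (insert l v) (pt l i)" by (rule circ_unique[OF C(1) i(2)])
  have nm: "\<not> merges v l"
  proof
    assume "merges v l"
    then have "circ (insert l v) (pt l k) = circ v (pt l 0) \<union> circ v (pt l 2)" if "k < 4" for k
      using that[unfolded less_4] \<open>merges v l\<close> by (elim disjE) (simp_all only: edge_circ[OF l] simp_thms)
    then have "circ (insert l v) (pt l j) = C" using i(1) j(1) Ci by simp
    then show False using circ_self j(2) by metis
  qed
  then have "merging (circles D (insert l v)) (circles D v) (circ (insert l v) (pt l 0)) (circ (insert l v) (pt l 1))"
    by (rule ec[THEN conjunct2, THEN conjunct2, THEN conjunct2, rule_format, THEN conjunct1])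
  moreover have "C = circ (insert l v) (pt l 0) \<or> C = circ (insert l v) (pt l 1)"
    using i(1) unfolding less_4 Ci by (elim disjE) (simp_all only: edge_circ[OF l] simp_thms)
  ultimately show thesis by (rule that)
qed

lemma partly_touches_merge:
  assumes l: "l < ncross D" "l \<notin> v" and C: "C \<in> circles D v" "partly_touches C l"
  obtains C1 C2 where "merging (circles D v) (circles D (insert l v)) C1 C2" "C = C1 \<or> C = C2"
proof -
  note ec = edge_cases[OF l]
  obtain i j where i: "i < 4" "pt l i \<in> C" and j: "j < 4" "pt l j \<notin> C"
    using C(2) by (auto simp: partly_touches_def)
  have Ci: "C = circ v (pt l i)" by (rule circ_unique[OF C(1) i(2)])
  have m: "merges v l"
  proof (rule ccontr)
    assume "\<not> merges v l"
    then have h: "circ v (pt l k) = circ v (pt l 0)" if "k < 4" for k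
      using that[unfolded less_4] \<open>\<not> merges v l\<close> by (elim disjE) (simp_all only: edge_circ[OF l] simp_thms)
    have "circ v (pt l j) = C" unfolding Ci h[OF i(1)] by (rule h[OF j(1)])
    then show False using circ_self j(2) by metis
  qed
  then have "merging (circles D v) (circles D (insert l v)) (circ v (pt l 0)) (circ v (pt l 2))"
    by (rule ec[THEN conjunct2, THEN conjunct2, THEN conjunct1, rule_format, THEN conjunct1])
  moreover have "C = circ v (pt l 0) \<or> C = circ v (pt l 2)"
    using i(1) unfolding less_4 Ci by (elim disjE) (simp_all only: edge_circ[OF l] simp_thms)
  ultimately show thesis by (rule that)
qed

text \<open>Matched cells have equal q-degree because entries preserve it, so the cancellation can
  be carried out in each layer separately.\<close>

lemma acyclic_matching:
  assumes cx: "layered_complex (A \<union> B)" and dis: "A \<inter> B = {}" and zero: "no_entries B A"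
    and ex1: "\<And>a. a \<in> A \<Longrightarrow> \<exists>!b. b \<in> B \<and> bd a b \<noteq> 0"
    and ex2: "\<And>b. b \<in> B \<Longrightarrow> \<exists>!a. a \<in> A \<and> bd a b \<noteq> 0"
  shows "acyclic_cells (A \<union> B)"
  unfolding acyclic_cells_def
proof (intro allI)
  fix i j
  have "exact_at hdeg bd (A \<inter> layer j \<union> B \<inter> layer j) i"
  proof (rule exact_at_matching)
    show "chain_complex_on bd (A \<inter> layer j \<union> B \<inter> layer j)"
      using cx by (simp add: layered_complex_def Int_Un_distrib2)
    show "(A \<inter> layer j) \<inter> (B \<inter> layer j) = {}" using dis by blast
    show "graded_by hdeg bd" by (rule graded_bd)
    show "bd b a = 0" if "a \<in> A \<inter> layer j" "b \<in> B \<inter> layer j" for a b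
      using zero that by (simp add: no_entries_def)
    show "\<bar>bd a b\<bar> = 1" if "bd a b \<noteq> 0" for a b by (rule bd_unit[OF that])
    have lay: "a \<in> layer j \<longleftrightarrow> b \<in> layer j" if "bd a b \<noteq> 0" for a b
      using qdeg_bd[OF that] by (simp add: layer_def)
    show "\<exists>!b. b \<in> B \<inter> layer j \<and> bd a b \<noteq> 0" if "a \<in> A \<inter> layer j" for a
    proof -
      have "b \<in> B \<inter> layer j \<and> bd a b \<noteq> 0 \<longleftrightarrow> b \<in> B \<and> bd a b \<noteq> 0" for b using lay[of a b] that by auto
      then show ?thesis using ex1[of a] that by simp
    qed
    show "\<exists>!a. a \<in> A \<inter> layer j \<and> bd a b \<noteq> 0" if "b \<in> B \<inter> layer j" for b
    proof -
      have "a \<in> A \<inter> layer j \<and> bd a b \<noteq> 0 \<longleftrightarrow> a \<in> A \<and> bd a b \<noteq> 0" for a using lay[of a b] that by auto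
      then show ?thesis using ex2[of b] that by simp
    qed
  qed
  then show "exact_at hdeg bd ((A \<union> B) \<inter> layer j) i" by (simp add: Int_Un_distrib2)
qed

lemma bd_across:
  assumes l: "l < ncross D" "l \<notin> v" "l \<in> w" and a: "(v, x) \<in> cells" and b: "(w, y) \<in> cells"
  shows "bd (v, x) (w, y) \<noteq> 0 \<longleftrightarrow> w = insert l v \<and> edge v l x y"
proof
  assume "bd (v, x) (w, y) \<noteq> 0"
  then obtain m where "w = insert m v" "edge v m x y" by (elim bd_nonzeroD)
  then show "w = insert l v \<and> edge v l x y" using l by auto
next
  assume "w = insert l v \<and> edge v l x y"
  then show "bd (v, x) (w, y) \<noteq> 0"
    using bd_edge(1)[OF l(1,2), of x y] a b by (auto simp: cells_def)
qed

lemma ex1_pair: "\<exists>!y. P y \<Longrightarrow> (\<And>u y. Q (u, y) \<longleftrightarrow> u = w \<and> P y) \<Longrightarrow> \<exists>!b. Q b"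
  by (metis surj_pair)

text \<open>
  In the next two lemmas the common circle \<open>C\<close> is created (resp. removed) by the 1-smoothing of the crossing \<open>l\<close>.
\<close>

lemma acyclic_split:
  assumes l: "l < ncross D" "l \<notin> S" "l \<notin> v1" and v1: "v1 \<inter> S = {}"
    and P: "P \<subseteq> closed_circles S v1" "P \<subseteq> closed_circles S (insert l v1)" "C \<notin> P"
    and C: "C \<in> closed_circles S (insert l v1)" "partly_touches C l"
    and cx: "layered_complex (state_cells S v1 P lab \<union> state_cells S (insert l v1) (insert C P) (lab(C := v_minus)))"
      (is "layered_complex (?A \<union> ?B)")
  shows "acyclic_cells (?A \<union> ?B)"
proof (rule acyclic_matching[OF cx])
  have lA: "l \<notin> fst a" if "a \<in> ?A" for a using state_cells_mem[OF l(2) that] l(3) by simp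
  have lB: "l \<in> fst b" if "b \<in> ?B" for b using state_cells_mem[OF l(2) that] by simp
  show "?A \<inter> ?B = {}" using lA lB by blast
  show "no_entries ?B ?A" by (rule no_entries_crossing[OF lB lA])
  have same: "x K = y K" if "K \<in> P" "edge v l x y" "v - S = v1" "l \<notin> v" for K x y v
  proof -
    have "v1 - S = v1" "insert l v - S = insert l v1 - S" using v1 that(3) l by auto
    then have "K \<in> circles D v" "K \<in> circles D (insert l v)"
      using that P closed_circle_in_circles[of K S v1 v] closed_circle_in_circles[of K S "insert l v1" "insert l v"] by auto
    then show ?thesis using that(2) by (simp add: merge_or_split_def)
  qed
  have Cin: "C \<in> circles D (insert l v)" if "v - S = v1" for v
    using closed_circle_in_circles[OF C(1), of "insert l v"] that v1 l by auto
  show "\<exists>!b. b \<in> ?B \<and> bd a b \<noteq> 0" if a: "a \<in> ?A" for a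
  proof -
    obtain v x where av: "a = (v, x)" by (cases a)
    have v: "v - S = v1" "l \<notin> v" "v \<subseteq> {..<ncross D}" "x \<in> labellings D v" "\<forall>K\<in>P. x K = lab K"
      using a lA[OF a] by (auto simp: av state_cells_def cells_def)
    obtain C1 C2 where m: "merging (circles D (insert l v)) (circles D v) C1 C2" "C = C1 \<or> C = C2"
      by (rule partly_touches_split[OF l(1) v(2) Cin[OF v(1)] C(2)])
    have "\<exists>!y. y \<in> labellings D (insert l v) \<and> edge v l x y \<and> y C = v_minus"
      using split_unique(1)[OF m, of x] v(4) by (simp add: labellings_def)
    then show ?thesis
    proof (rule ex1_pair[where w = "insert l v"])
      fix u y
      have iv: "insert l v - S = insert l v1" "insert l v \<subseteq> {..<ncross D}" using v l by auto
      show "(u, y) \<in> ?B \<and> bd a (u, y) \<noteq> 0 \<longleftrightarrow> u = insert l v \<and> y \<in> labellings D (insert l v) \<and> edge v l x y \<and> y C = v_minus"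
      proof
        assume h: "(u, y) \<in> ?B \<and> bd a (u, y) \<noteq> 0"
        then have "u = insert l v \<and> edge v l x y"
          using bd_across[OF l(1) v(2), of u x y] lB[of "(u, y)"] a by (simp add: av state_cells_def)
        then show "u = insert l v \<and> y \<in> labellings D (insert l v) \<and> edge v l x y \<and> y C = v_minus"
          using h by (simp add: state_cells_def cells_def)
      next
        assume h: "u = insert l v \<and> y \<in> labellings D (insert l v) \<and> edge v l x y \<and> y C = v_minus"
        then have "y K = lab K" if "K \<in> P" for K using same[OF that _ v(1,2), of x y] v(5) that by simp
        moreover have "bd a (u, y) \<noteq> 0" using h bd_edge(1)[OF l(1) v(2,3,4), of y] by (simp add: av)
        ultimately show "(u, y) \<in> ?B \<and> bd a (u, y) \<noteq> 0"
          using h iv P(3) by (auto simp: state_cells_def cells_def)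
      qed
    qed
  qed
  show "\<exists>!a. a \<in> ?A \<and> bd a b \<noteq> 0" if b: "b \<in> ?B" for b
  proof -
    obtain w y where bw: "b = (w, y)" by (cases b)
    define v where "v = w - {l}"
    have w: "w = insert l v" using lB[OF b] by (auto simp: bw v_def)
    have lv: "l \<notin> v" by (simp add: v_def)
    have vS: "v - S = v1" "v \<subseteq> {..<ncross D}"
      using b l by (auto simp: bw state_cells_def cells_def v_def)
    have y: "y \<in> labellings D (insert l v)" "y C = v_minus" "\<forall>K\<in>P. y K = lab K"
      using b P(3) by (auto simp: bw state_cells_def cells_def w)
    obtain C1 C2 where m: "merging (circles D (insert l v)) (circles D v) C1 C2" "C = C1 \<or> C = C2"
      by (rule partly_touches_split[OF l(1) lv Cin[OF vS(1)] C(2)])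
    have "\<exists>!x. x \<in> labellings D v \<and> edge v l x y"
      using split_unique(2)[OF m, of y] y by (simp add: labellings_def)
    then show ?thesis
    proof (rule ex1_pair[where w = v])
      fix u x
      show "(u, x) \<in> ?A \<and> bd (u, x) b \<noteq> 0 \<longleftrightarrow> u = v \<and> x \<in> labellings D v \<and> edge v l x y"
      proof
        assume h: "(u, x) \<in> ?A \<and> bd (u, x) b \<noteq> 0"
        then have "w = insert l u \<and> edge u l x y" "l \<notin> u"
          using bd_across[OF l(1), of u w x y] lA[of "(u, x)"] lB[OF b] b by (auto simp: bw state_cells_def)
        moreover from this have "u = v" by (auto simp: v_def)
        ultimately show "u = v \<and> x \<in> labellings D v \<and> edge v l x y"
          using h by (simp add: state_cells_def cells_def)
      next
        assume h: "u = v \<and> x \<in> labellings D v \<and> edge v l x y"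
        then have "x K = lab K" if "K \<in> P" for K using same[OF that _ vS(1) lv, of x y] y(3) that by simp
        moreover have "bd (u, x) b \<noteq> 0" using h y(1) bd_edge(1)[OF l(1) lv vS(2), of x y] by (simp add: bw w)
        ultimately show "(u, x) \<in> ?A \<and> bd (u, x) b \<noteq> 0"
          using h vS by (auto simp: state_cells_def cells_def)
      qed
    qed
  qed
qed

lemma acyclic_merge:
  assumes l: "l < ncross D" "l \<notin> S" "l \<notin> v1" and v1: "v1 \<inter> S = {}"
    and P: "P \<subseteq> closed_circles S v1" "P \<subseteq> closed_circles S (insert l v1)" "C \<notin> P"
    and C: "C \<in> closed_circles S v1" "partly_touches C l"
    and cx: "layered_complex (state_cells S v1 (insert C P) (lab(C := v_plus)) \<union> state_cells S (insert l v1) P lab)"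
      (is "layered_complex (?A \<union> ?B)")
  shows "acyclic_cells (?A \<union> ?B)"
proof (rule acyclic_matching[OF cx])
  have lA: "l \<notin> fst a" if "a \<in> ?A" for a using state_cells_mem[OF l(2) that] l(3) by simp
  have lB: "l \<in> fst b" if "b \<in> ?B" for b using state_cells_mem[OF l(2) that] by simp
  show "?A \<inter> ?B = {}" using lA lB by blast
  show "no_entries ?B ?A" by (rule no_entries_crossing[OF lB lA])
  have same: "x K = y K" if "K \<in> P" "edge v l x y" "v - S = v1" "l \<notin> v" for K x y v
  proof -
    have "v1 - S = v1" "insert l v - S = insert l v1 - S" using v1 that(3) l by auto
    then have "K \<in> circles D v" "K \<in> circles D (insert l v)"
      using that P closed_circle_in_circles[of K S v1 v] closed_circle_in_circles[of K S "insert l v1" "insert l v"] by auto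
    then show ?thesis using that(2) by (simp add: merge_or_split_def)
  qed
  have Cin: "C \<in> circles D v" if "v - S = v1" for v
    using closed_circle_in_circles[OF C(1), of v] that v1 by auto
  show "\<exists>!b. b \<in> ?B \<and> bd a b \<noteq> 0" if a: "a \<in> ?A" for a
  proof -
    obtain v x where av: "a = (v, x)" by (cases a)
    have v: "v - S = v1" "l \<notin> v" "v \<subseteq> {..<ncross D}" "x \<in> labellings D v" "\<forall>K\<in>P. x K = lab K" "x C = v_plus"
      using a lA[OF a] P(3) by (auto simp: av state_cells_def cells_def)
    obtain C1 C2 where m: "merging (circles D v) (circles D (insert l v)) C1 C2" "C = C1 \<or> C = C2"
      by (rule partly_touches_merge[OF l(1) v(2) Cin[OF v(1)] C(2)])
    have "\<exists>!y. y \<in> labellings D (insert l v) \<and> edge v l x y"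
      using merge_unique(1)[OF m, of x] v(4,6) by (simp add: labellings_def)
    then show ?thesis
    proof (rule ex1_pair[where w = "insert l v"])
      fix u y
      have iv: "insert l v - S = insert l v1" "insert l v \<subseteq> {..<ncross D}" using v l by auto
      show "(u, y) \<in> ?B \<and> bd a (u, y) \<noteq> 0 \<longleftrightarrow> u = insert l v \<and> y \<in> labellings D (insert l v) \<and> edge v l x y"
      proof
        assume h: "(u, y) \<in> ?B \<and> bd a (u, y) \<noteq> 0"
        then have "u = insert l v \<and> edge v l x y"
          using bd_across[OF l(1) v(2), of u x y] lB[of "(u, y)"] a by (simp add: av state_cells_def)
        then show "u = insert l v \<and> y \<in> labellings D (insert l v) \<and> edge v l x y"
          using h by (simp add: state_cells_def cells_def)
      next
        assume h: "u = insert l v \<and> y \<in> labellings D (insert l v) \<and> edge v l x y"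
        then have "y K = lab K" if "K \<in> P" for K using same[OF that _ v(1,2), of x y] v(5) that by simp
        moreover have "bd a (u, y) \<noteq> 0" using h bd_edge(1)[OF l(1) v(2,3,4), of y] by (simp add: av)
        ultimately show "(u, y) \<in> ?B \<and> bd a (u, y) \<noteq> 0"
          using h iv by (auto simp: state_cells_def cells_def)
      qed
    qed
  qed
  show "\<exists>!a. a \<in> ?A \<and> bd a b \<noteq> 0" if b: "b \<in> ?B" for b
  proof -
    obtain w y where bw: "b = (w, y)" by (cases b)
    define v where "v = w - {l}"
    have w: "w = insert l v" using lB[OF b] by (auto simp: bw v_def)
    have lv: "l \<notin> v" by (simp add: v_def)
    have vS: "v - S = v1" "v \<subseteq> {..<ncross D}"
      using b l by (auto simp: bw state_cells_def cells_def v_def)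
    have y: "y \<in> labellings D (insert l v)" "\<forall>K\<in>P. y K = lab K"
      using b by (auto simp: bw state_cells_def cells_def w)
    obtain C1 C2 where m: "merging (circles D v) (circles D (insert l v)) C1 C2" "C = C1 \<or> C = C2"
      by (rule partly_touches_merge[OF l(1) lv Cin[OF vS(1)] C(2)])
    have "\<exists>!x. x \<in> labellings D v \<and> edge v l x y \<and> x C = v_plus"
      using merge_unique(2)[OF m, of y] y by (simp add: labellings_def)
    then show ?thesis
    proof (rule ex1_pair[where w = v])
      fix u x
      show "(u, x) \<in> ?A \<and> bd (u, x) b \<noteq> 0 \<longleftrightarrow> u = v \<and> x \<in> labellings D v \<and> edge v l x y \<and> x C = v_plus"
      proof
        assume h: "(u, x) \<in> ?A \<and> bd (u, x) b \<noteq> 0"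
        then have "w = insert l u \<and> edge u l x y" "l \<notin> u"
          using bd_across[OF l(1), of u w x y] lA[of "(u, x)"] lB[OF b] b by (auto simp: bw state_cells_def)
        moreover from this have "u = v" by (auto simp: v_def)
        ultimately show "u = v \<and> x \<in> labellings D v \<and> edge v l x y \<and> x C = v_plus"
          using h by (simp add: state_cells_def cells_def)
      next
        assume h: "u = v \<and> x \<in> labellings D v \<and> edge v l x y \<and> x C = v_plus"
        then have "x K = lab K" if "K \<in> P" for K using same[OF that _ vS(1) lv, of x y] y(2) that by simp
        moreover have "bd (u, x) b \<noteq> 0" using h y(1) bd_edge(1)[OF l(1) lv vS(2), of x y] by (simp add: bw w)
        ultimately show "(u, x) \<in> ?A \<and> bd (u, x) b \<noteq> 0"
          using h vS P(3) by (auto simp: state_cells_def cells_def)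
      qed
    qed
  qed
qed


lemma state_cells_resolve:
  assumes "l \<in> S" "l \<notin> v1"
  shows "state_cells S v1 P lab = state_cells (S - {l}) v1 P lab \<union> state_cells (S - {l}) (insert l v1) P lab"
proof -
  have "v - S = v1 \<longleftrightarrow> v - (S - {l}) = v1 \<or> v - (S - {l}) = insert l v1" for v
  proof (cases "l \<in> v")
    case True
    have "v - (S - {l}) = insert l (v - S)" using True assms by auto
    moreover have "insert l (v - S) \<noteq> v1" using assms by blast
    moreover have "insert l (v - S) = insert l v1 \<longleftrightarrow> v - S = v1"
      by (rule insert_ident) (use assms in auto)
    ultimately show ?thesis by simp
  next
    case False
    have "v - (S - {l}) = v - S" using False by auto
    moreover have "v - S \<noteq> insert l v1" using False by blast
    ultimately show ?thesis by simp
  qed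
  then show ?thesis unfolding state_cells_def by blast
qed

lemma state_cells_label:
  assumes "C \<notin> P"
  shows "state_cells S v1 P lab =
    state_cells S v1 (insert C P) (lab(C := v_plus)) \<union> state_cells S v1 (insert C P) (lab(C := v_minus))"
proof -
  have "x C = v_plus \<or> x C = v_minus" for x :: "'a labelling" using label_not by blast
  then show ?thesis using assms by (auto simp: state_cells_def)
qed

lemma closed_circles_remove:
  assumes "P \<subseteq> closed_circles S v1" "v1 \<inter> S = {}" "w - S = v1" "S' \<subseteq> S"
  shows "P \<subseteq> closed_circles S' w"
proof -
  have "w - S = v1 - S" using assms(2,3) by blast
  then show ?thesis using closed_circles_mono[OF _ assms(4)] assms(1) by blast
qed

section \<open>Resolving crossings of a piece with labelled circles\<close>

context
  fixes S v1 P and lab :: "'a labelling"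
  assumes v1S: "v1 \<inter> S = {}" and P: "P \<subseteq> closed_circles S v1" and SL: "S \<subseteq> {..<ncross D}"
begin

lemma in_crossing_disjoint:
  assumes "l \<notin> S1" "l \<notin> w1" "l \<notin> S2" "l \<in> w2"
  shows "state_cells S1 w1 P1 lab1 \<inter> state_cells S2 w2 P2 lab2 = {}"
    "no_entries (state_cells S2 w2 P2 lab2) (state_cells S1 w1 P1 lab1)"
proof -
  have 1: "l \<notin> fst a" if "a \<in> state_cells S1 w1 P1 lab1" for a using state_cells_mem[OF assms(1) that] assms by simp
  have 2: "l \<in> fst a" if "a \<in> state_cells S2 w2 P2 lab2" for a using state_cells_mem[OF assms(3) that] assms by simp
  show "state_cells S1 w1 P1 lab1 \<inter> state_cells S2 w2 P2 lab2 = {}" using 1 2 by blast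
  show "no_entries (state_cells S2 w2 P2 lab2) (state_cells S1 w1 P1 lab1)" by (rule no_entries_crossing[OF 2 1])
qed

lemma labels_disjoint: "lab1 C \<noteq> lab2 C \<Longrightarrow> state_cells S' w (insert C P') lab1 \<inter> state_cells S' w (insert C P') lab2 = {}"
  by (auto simp: state_cells_def)

text \<open>Both smoothings are kept. This serves for the last crossing of a word, where no circle
  is at hand for a cancellation.\<close>

lemma bounded_resolve:
  assumes l: "l \<in> S"
    and b: "bounded_by (state_cells (S - {l}) v1 P lab) I J" "bounded_by (state_cells (S - {l}) (insert l v1) P lab) I J"
  shows "bounded_by (state_cells S v1 P lab) I J"
proof -
  have l': "l \<notin> v1" using l v1S by blast
  note dis = in_crossing_disjoint[of l "S - {l}" v1 "S - {l}" "insert l v1" P lab P lab]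
  show ?thesis
    unfolding state_cells_resolve[OF l l']
    by (rule bounded_extension[OF _ dis b])
      (use layered_complex_state[OF P] state_cells_resolve[OF l l'] l' in simp_all)
qed

lemma bounded_label:
  assumes C: "C \<in> closed_circles S v1" "C \<notin> P"
    and b: "bounded_by (state_cells S v1 (insert C P) (lab(C := v_plus))) I J"
      "bounded_by (state_cells S v1 (insert C P) (lab(C := v_minus))) I J"
  shows "bounded_by (state_cells S v1 P lab) I J"
  unfolding state_cells_label[OF C(2)]
proof (rule bounded_extension[OF _ _ _ b])
  show "layered_complex (state_cells S v1 (insert C P) (lab(C := v_plus)) \<union> state_cells S v1 (insert C P) (lab(C := v_minus)))"
    unfolding state_cells_label[OF C(2), symmetric] by (rule layered_complex_state[OF P])
  show "state_cells S v1 (insert C P) (lab(C := v_plus)) \<inter> state_cells S v1 (insert C P) (lab(C := v_minus)) = {}"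
    by (rule labels_disjoint) simp
  show "no_entries (state_cells S v1 (insert C P) (lab(C := v_minus))) (state_cells S v1 (insert C P) (lab(C := v_plus)))"
    by (rule no_entries_label[OF C(1) v1S]) simp_all
qed

lemma touching_not_closed: "partly_touches C l \<Longrightarrow> l \<in> S \<Longrightarrow> C \<notin> P"
  using P by (auto simp: partly_touches_def closed_circles_def ends_def)

text \<open>As for the first Reidemeister move: \<open>C\<close> appears with the 1-smoothing, and
  the 0-smoothing cancels against the half where \<open>C\<close> is labelled
  \<open>v_minus\<close>. The 1-smoothing with \<open>C\<close> labelled \<open>v_plus\<close> is
  left.\<close>

lemma bounded_split:
  assumes l: "l \<in> S" and C: "C \<in> closed_circles (S - {l}) (insert l v1)" "partly_touches C l"
    and b: "bounded_by (state_cells (S - {l}) (insert l v1) (insert C P) (lab(C := v_plus))) I J"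
  shows "bounded_by (state_cells S v1 P lab) I J"
proof -
  let ?A = "state_cells (S - {l}) v1 P lab"
  let ?B = "\<lambda>s. state_cells (S - {l}) (insert l v1) (insert C P) (lab(C := s))"
  have l': "l \<notin> v1" "l < ncross D" using l v1S SL by auto
  have CP: "C \<notin> P" by (rule touching_not_closed[OF C(2) l])
  have eq: "state_cells S v1 P lab = (?A \<union> ?B v_minus) \<union> ?B v_plus"
    unfolding state_cells_resolve[OF l l'(1)] state_cells_label[OF CP, of "S - {l}" "insert l v1"] by blast
  have cx: "layered_complex ((?A \<union> ?B v_minus) \<union> ?B v_plus)"
    unfolding eq[symmetric] by (rule layered_complex_state[OF P])
  have v1': "insert l v1 \<inter> (S - {l}) = {}" using v1S by blast
  have dis: "(?A \<union> ?B v_minus) \<inter> ?B v_plus = {}"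
    unfolding Int_Un_distrib2 using l'(1)
    by (simp add: in_crossing_disjoint(1)[of l] labels_disjoint)
  have zero: "no_entries (?B v_plus) (?A \<union> ?B v_minus)"
    unfolding no_entries_Un
    by (intro conjI in_crossing_disjoint(2)[of l] no_entries_label[OF C(1) v1']) (use l' in simp_all)
  have acyc: "acyclic_cells (?A \<union> ?B v_minus)"
  proof (rule acyclic_split[OF l'(2) _ l'(1) _ _ _ CP C])
    show "P \<subseteq> closed_circles (S - {l}) v1" by (rule closed_circles_remove[OF P v1S]) (use v1S in auto)
    show "P \<subseteq> closed_circles (S - {l}) (insert l v1)" by (rule closed_circles_remove[OF P v1S]) (use v1S l in auto)
  qed (use v1S layered_complex_split(1)[OF cx dis zero] in auto)
  show ?thesis
    unfolding eq by (rule bounded_extension[OF cx dis zero acyclic_bounded[OF acyc] b])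
qed

text \<open>The curl of the other kind: \<open>C\<close> is present with the 0-smoothing, and the
  half where it is labelled \<open>v_plus\<close> cancels against the 1-smoothing. The 0-smoothing
  with \<open>C\<close> labelled \<open>v_minus\<close> is left.\<close>

lemma bounded_merge:
  assumes l: "l \<in> S" and C: "C \<in> closed_circles (S - {l}) v1" "partly_touches C l"
    and b: "bounded_by (state_cells (S - {l}) v1 (insert C P) (lab(C := v_minus))) I J"
  shows "bounded_by (state_cells S v1 P lab) I J"
proof -
  let ?A = "\<lambda>s. state_cells (S - {l}) v1 (insert C P) (lab(C := s))"
  let ?B = "state_cells (S - {l}) (insert l v1) P lab"
  have l': "l \<notin> v1" "l < ncross D" using l v1S SL by auto
  have CP: "C \<notin> P" by (rule touching_not_closed[OF C(2) l])
  have eq: "state_cells S v1 P lab = ?A v_minus \<union> (?A v_plus \<union> ?B)"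
    unfolding state_cells_resolve[OF l l'(1)] state_cells_label[OF CP, of "S - {l}" "v1"] by blast
  have cx: "layered_complex (?A v_minus \<union> (?A v_plus \<union> ?B))"
    unfolding eq[symmetric] by (rule layered_complex_state[OF P])
  have v1': "v1 \<inter> (S - {l}) = {}" using v1S by blast
  have dis: "?A v_minus \<inter> (?A v_plus \<union> ?B) = {}"
    unfolding Int_Un_distrib using l'(1)
    by (simp add: in_crossing_disjoint(1)[of l] labels_disjoint)
  have zero: "no_entries (?A v_plus \<union> ?B) (?A v_minus)"
    unfolding no_entries_Un
    by (intro conjI in_crossing_disjoint(2)[of l] no_entries_label[OF C(1) v1']) (use l' in simp_all)
  have acyc: "acyclic_cells (?A v_plus \<union> ?B)"
  proof (rule acyclic_merge[OF l'(2) _ l'(1) _ _ _ CP C])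
    show "P \<subseteq> closed_circles (S - {l}) v1" by (rule closed_circles_remove[OF P v1S]) (use v1S in auto)
    show "P \<subseteq> closed_circles (S - {l}) (insert l v1)" by (rule closed_circles_remove[OF P v1S]) (use v1S l in auto)
  qed (use v1S layered_complex_split(2)[OF cx dis zero] in auto)
  show ?thesis
    unfolding eq by (rule bounded_extension[OF cx dis zero b acyclic_bounded[OF acyc]])
qed

text \<open>
  A circle that only exists when \<open>l\<close> has its 1-smoothing and \<open>l'\<close> its 0-smoothing can be used to cancel
  three of the four smoothings of \<open>l\<close> and \<open>l'\<close>, as in the invariance proof for the second Reidemeister move.
\<close>

lemma bounded_slide:
  assumes l: "l \<in> S" "l' \<in> S" "l \<noteq> l'"
    and C: "C \<in> closed_circles (S - {l, l'}) (insert l v1)" "partly_touches C l" "partly_touches C l'"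
    and b: "bounded_by (state_cells (S - {l, l'}) (insert l' v1) P lab) I J"
  shows "bounded_by (state_cells S v1 P lab) I J"
proof -
  let ?S = "S - {l, l'}"
  let ?A00 = "state_cells ?S v1 P lab" and ?A01 = "state_cells ?S (insert l' v1) P lab"
  let ?A10 = "\<lambda>s. state_cells ?S (insert l v1) (insert C P) (lab(C := s))"
  let ?A11 = "state_cells ?S (insert l' (insert l v1)) P lab"
  have l': "l \<notin> v1" "l < ncross D" "l' \<notin> v1" "l' < ncross D" using l v1S SL by auto
  have CP: "C \<notin> P" by (rule touching_not_closed[OF C(2) l(1)])
  have S1: "S - {l} - {l'} = ?S" by auto
  have "state_cells S v1 P lab = (?A00 \<union> ?A01) \<union> (state_cells ?S (insert l v1) P lab \<union> ?A11)"
    unfolding state_cells_resolve[OF l(1) l'(1)]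
    using l l' state_cells_resolve[of l' "S - {l}" v1 P lab] state_cells_resolve[of l' "S - {l}" "insert l v1" P lab]
    unfolding S1 by simp
  \<comment> \<open>The order of the blocks matters: first the pair 00 and 10 with label
    \<open>v_minus\<close>, then 01, then the pair 10 with label \<open>v_plus\<close> and 11.
    Entries lead only from left to right.\<close>
  then have eq: "state_cells S v1 P lab = ((?A00 \<union> ?A10 v_minus) \<union> ?A01) \<union> (?A10 v_plus \<union> ?A11)"
    unfolding state_cells_label[OF CP, of ?S "insert l v1"] by blast
  have cx: "layered_complex (((?A00 \<union> ?A10 v_minus) \<union> ?A01) \<union> (?A10 v_plus \<union> ?A11))"
    unfolding eq[symmetric] by (rule layered_complex_state[OF P])
  have v1': "insert l v1 \<inter> ?S = {}" using v1S by blast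
  have d: "?A00 \<inter> ?A10 s = {}" "?A00 \<inter> ?A11 = {}" "?A01 \<inter> ?A10 s = {}" "?A01 \<inter> ?A11 = {}" for s
    by (rule in_crossing_disjoint(1)[of l]; use l l' in simp)+
  have d': "?A10 s \<inter> ?A11 = {}" "?A10 s \<inter> ?A01 = {}" "?A00 \<inter> ?A01 = {}" for s
    by (rule in_crossing_disjoint(1)[of l']; use l l' in simp)+
  have dl: "?A10 v_minus \<inter> ?A10 v_plus = {}" by (rule labels_disjoint) simp
  have z: "no_entries (?A10 s) ?A00" "no_entries (?A10 s) ?A01" "no_entries ?A11 ?A00" "no_entries ?A11 ?A01" for s
    by (rule in_crossing_disjoint(2)[of l]; use l l' in simp)+
  have z': "no_entries ?A11 (?A10 s)" "no_entries ?A01 (?A10 s)" "no_entries ?A01 ?A00" for s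
    by (rule in_crossing_disjoint(2)[of l']; use l l' in simp)+
  have zl: "no_entries (?A10 v_plus) (?A10 v_minus)"
    by (rule no_entries_label[OF C(1) v1']) simp_all
  have dis: "((?A00 \<union> ?A10 v_minus) \<union> ?A01) \<inter> (?A10 v_plus \<union> ?A11) = {}"
    unfolding Int_Un_distrib2 Int_Un_distrib using d d' dl by simp
  have zero: "no_entries (?A10 v_plus \<union> ?A11) ((?A00 \<union> ?A10 v_minus) \<union> ?A01)"
    unfolding no_entries_Un using z z' zl by simp
  note cx1 = layered_complex_split(1)[OF cx dis zero] and cx2 = layered_complex_split(2)[OF cx dis zero]
  have dis1: "(?A00 \<union> ?A10 v_minus) \<inter> ?A01 = {}"
    unfolding Int_Un_distrib2 using d' by simp
  have zero1: "no_entries ?A01 (?A00 \<union> ?A10 v_minus)"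
    unfolding no_entries_Un using z' by simp
  have Pc: "P \<subseteq> closed_circles ?S v1" "P \<subseteq> closed_circles ?S (insert l v1)" "P \<subseteq> closed_circles ?S (insert l' (insert l v1))"
    by (rule closed_circles_remove[OF P v1S]; use v1S l in auto)+
  have acyc1: "acyclic_cells (?A00 \<union> ?A10 v_minus)"
    by (rule acyclic_split[OF l'(2) _ l'(1) _ Pc(1,2) CP C(1,2) layered_complex_split(1)[OF cx1 dis1 zero1]]) (use v1S in auto)
  have acyc2: "acyclic_cells (?A10 v_plus \<union> ?A11)"
    by (rule acyclic_merge[OF l'(4) _ _ _ Pc(2,3) CP C(1,3) cx2]) (use v1S l l' in auto)
  show ?thesis
    unfolding eq
    by (intro bounded_extension[OF cx dis zero] bounded_extension[OF cx1 dis1 zero1] acyclic_bounded acyc1 acyc2 b)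
qed

end

section \<open>Closed circles created by smoothing one or two crossings\<close>

lemma two_ends:
  assumes S: "S \<subseteq> {..<ncross D}" and e: "e1 \<in> ends S" "e2 \<in> ends S" "e \<in> ends S" "e1 \<noteq> e2"
    and c: "(end_arc D e1, end_arc D e2) \<in> conn D S v" "(end_arc D e1, end_arc D e) \<in> conn D S v"
  shows "e = e1 \<or> e = e2"
proof -
  have u: "a = b" if "a \<in> ends S" "b \<in> ends S" "inward a = inward b" "(end_arc D a, end_arc D b) \<in> conn D S v" for a b
    using paired_ends[OF S, of v] that unfolding paired_def by blast
  have n: "inward e1 \<noteq> inward e2" using u[OF e(1,2) _ c(1)] e(4) by blast
  show ?thesis
  proof (cases "inward e = inward e1")
    case True
    then show ?thesis using u[OF e(1,3) _ c(2)] by simp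
  next
    case False
    then have "inward e2 = inward e" using n by blast
    moreover have "(end_arc D e2, end_arc D e) \<in> conn D S v"
      by (rule equivD(3)[OF equiv_conn equivD(2)[OF equiv_conn c(1)] c(2)])
    ultimately show ?thesis using u[OF e(2,3)] by simp
  qed
qed

definition joined :: "bool \<Rightarrow> nat \<Rightarrow> nat \<Rightarrow> bool" where
  "joined s i j \<longleftrightarrow> (if s then (i, j) \<in> {(0, 3), (3, 0), (1, 2), (2, 1)} else (i, j) \<in> {(0, 1), (1, 0), (2, 3), (3, 2)})"

lemma other_corner: "\<exists>k<(4::nat). k \<notin> {a, b}"
proof (rule ccontr)
  assume h: "\<not> (\<exists>k<(4::nat). k \<notin> {a, b})"
  have "(0::nat) < 4" "(1::nat) < 4" "(2::nat) < 4" by simp_all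
  then have "0 \<in> {a, b}" "1 \<in> {a, b}" "2 \<in> {a, b}" using h by blast+
  then show False by auto
qed

lemma smoothing_pairs:
  "smoothing D l s = (if s then {(pt l 0, pt l 3), (pt l 1, pt l 2)} else {(pt l 0, pt l 1), (pt l 2, pt l 3)})"
  by (simp add: smoothing_def smoothing0_arcs smoothing1_arcs end_arc_def)

lemma smoothing_joined:
  assumes "(a, b) \<in> smoothing D l s"
  shows "\<exists>i j. joined s i j \<and> a = pt l i \<and> b = pt l j"
proof -
  have j: "joined True 0 3" "joined True 1 2" "joined False 0 1" "joined False 2 3" by (simp_all add: joined_def)
  show ?thesis
  proof (cases s)
    case True
    then have s: "s = True" by simp
    have "a = pt l 0 \<and> b = pt l 3 \<or> a = pt l 1 \<and> b = pt l 2"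
      using assms unfolding s by (simp only: smoothing_pairs if_True) blast
    then show ?thesis unfolding s using j(1,2) by blast
  next
    case False
    then have s: "s = False" by simp
    have "a = pt l 0 \<and> b = pt l 1 \<or> a = pt l 2 \<and> b = pt l 3"
      using assms unfolding s by (simp only: smoothing_pairs if_False) blast
    then show ?thesis unfolding s using j(3,4) by blast
  qed
qed

lemma joined_smoothing:
  assumes "joined s i j"
  shows "(pt l i, pt l j) \<in> smoothing D l s \<or> (pt l j, pt l i) \<in> smoothing D l s"
proof (cases s)
  case True
  then have "i = 0 \<and> j = 3 \<or> i = 3 \<and> j = 0 \<or> i = 1 \<and> j = 2 \<or> i = 2 \<and> j = 1"
    using assms by (simp add: joined_def)
  then show ?thesis unfolding smoothing_pairs using True by (elim disjE conjE) simp_all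
next
  case False
  then have "i = 0 \<and> j = 1 \<or> i = 1 \<and> j = 0 \<or> i = 2 \<and> j = 3 \<or> i = 3 \<and> j = 2"
    using assms by (simp add: joined_def)
  then show ?thesis unfolding smoothing_pairs using False by (elim disjE conjE) simp_all
qed

lemma joined_less: "joined s i j \<Longrightarrow> i < 4 \<and> j < 4 \<and> i \<noteq> j"
  by (auto simp: joined_def split: if_splits)

lemma joined_pair: "joined s i j \<Longrightarrow> joined s a b \<Longrightarrow> a \<in> {i, j} \<longleftrightarrow> b \<in> {i, j}"
  by (auto simp: joined_def split: if_splits)

lemma joined_conn: "joined (l \<in> w) i j \<Longrightarrow> l < ncross D \<Longrightarrow> l \<notin> S \<Longrightarrow> (pt l i, pt l j) \<in> conn D S w"
proof -
  assume j: "joined (l \<in> w) i j" and l: "l < ncross D" "l \<notin> S"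
  from joined_smoothing[OF j, of l] show ?thesis
  proof
    assume "(pt l i, pt l j) \<in> smoothing D l (l \<in> w)"
    then show ?thesis by (rule smoothing_conn[OF _ l])
  next
    assume "(pt l j, pt l i) \<in> smoothing D l (l \<in> w)"
    then show ?thesis by (rule equivD(2)[OF equiv_conn smoothing_conn[OF _ l]])
  qed
qed

text \<open>The first group of assumptions says that \<open>Y\<close> is connected once
  \<open>T\<close> is resolved; saturation under the old relation and under the new smoothings gives
  the converse inclusion, so \<open>Y\<close> is a full class.\<close>

lemma closed_new:
  assumes p: "p \<in> arcs D" "p \<in> Y" "Y \<subseteq> conn D (S - T) w `` {p}"
    and sat: "\<And>a b. (a, b) \<in> conn D S w \<Longrightarrow> a \<in> Y \<longleftrightarrow> b \<in> Y"
    and T: "\<And>l i j. l \<in> T \<Longrightarrow> joined (l \<in> w) i j \<Longrightarrow> pt l i \<in> Y \<longleftrightarrow> pt l j \<in> Y"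
    and ends: "\<And>e. e \<in> ends (S - T) \<Longrightarrow> end_arc D e \<notin> Y"
  shows "Y \<in> closed_circles (S - T) w"
proof -
  have "conn D (S - T) w \<subseteq> {(a, b). a \<in> Y \<longleftrightarrow> b \<in> Y}"
  proof (rule conn_saturated)
    fix l a b assume l: "l < ncross D" "l \<notin> S - T" "(a, b) \<in> smoothing D l (l \<in> w)"
    show "a \<in> Y \<longleftrightarrow> b \<in> Y"
    proof (cases "l \<in> S")
      case True
      then show ?thesis using T smoothing_joined[OF l(3)] l(2) by auto
    next
      case False
      then show ?thesis using sat smoothing_conn[OF l(3,1)] by blast
    qed
  qed
  then have "conn D (S - T) w `` {p} \<subseteq> Y" using p(2) by blast
  then have "Y = conn D (S - T) w `` {p}" using p(3) by blast
  then have "Y \<in> arcs D // conn D (S - T) w" using p(1) by (simp add: quotientI)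
  then show ?thesis using ends by (simp add: closed_circles_def)
qed

text \<open>The corners \<open>i\<close> and \<open>j\<close> are joined by the smoothing and also
  outside the crossing. By \<open>two_ends\<close> this strand has no further loose end, so it
  closes up, and the other two corners of \<open>l\<close> are not on it.\<close>

lemma closed_one:
  assumes S: "S \<subseteq> {..<ncross D}" and l: "l \<in> S" and j: "joined (l \<in> w) i j"
    and c: "(pt l i, pt l j) \<in> conn D S w"
  shows "conn D S w `` {pt l i} \<in> closed_circles (S - {l}) w" "partly_touches (conn D S w `` {pt l i}) l"
proof -
  let ?Y = "conn D S w `` {pt l i}"
  note e = equivD[OF equiv_conn[of D S w]]
  have lt: "i < 4" "j < 4" "i \<noteq> j" using joined_less[OF j] by auto
  have only: "x \<in> {(l, i), (l, j)}" if "x \<in> ends S" "end_arc D x \<in> ?Y" for x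
    using two_ends[OF S, of "(l, i)" "(l, j)" x w] that l lt c by (auto simp: ends_def)
  have mem: "pt l k \<in> ?Y \<longleftrightarrow> k \<in> {i, j}" if "k < 4" for k
    using only[of "(l, k)"] that l c e(1)[of "pt l i"] by (auto simp: ends_def)
  have lL: "l < ncross D" using S l by auto
  show "?Y \<in> closed_circles (S - {l}) w"
  proof (rule closed_new[where p = "pt l i"])
    show "pt l i \<in> arcs D" by (rule pt_in[OF lL lt(1)])
    show "pt l i \<in> ?Y" using e(1) by simp
    show "?Y \<subseteq> conn D (S - {l}) w `` {pt l i}" using conn_mono[of "S - {l}" S w w D] by auto
    show "a \<in> ?Y \<longleftrightarrow> b \<in> ?Y" if "(a, b) \<in> conn D S w" for a b
      using e(3)[of "pt l i" a b] e(3)[of "pt l i" b a] e(2)[OF that] that by auto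
    show "pt l' a \<in> ?Y \<longleftrightarrow> pt l' b \<in> ?Y" if "l' \<in> {l}" "joined (l' \<in> w) a b" for l' a b
      using that mem[of a] mem[of b] joined_pair[OF j, of a b] joined_less[of "l \<in> w" a b] by auto
    show "end_arc D x \<notin> ?Y" if "x \<in> ends (S - {l})" for x
      using only[of x] that by (auto simp: ends_def)
  qed
  have "\<exists>k<4. k \<notin> {i, j}" by (rule other_corner)
  then show "partly_touches ?Y l"
    unfolding partly_touches_def using mem lt by blast
qed

text \<open>A bigon: two strands connect corners of \<open>l'\<close> with corners of
  \<open>l\<close>, and the two smoothings close them up to one circle.\<close>

lemma closed_two:
  assumes S: "S \<subseteq> {..<ncross D}" and l: "l \<in> S" "l' \<in> S" "l \<noteq> l'"
    and j: "joined (l \<in> w) i j" and j': "joined (l' \<in> w) i' j'"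
    and c: "(pt l' i', pt l i) \<in> conn D S w" "(pt l' j', pt l j) \<in> conn D S w"
  shows "\<exists>Y. Y \<in> closed_circles (S - {l, l'}) w \<and> partly_touches Y l \<and> partly_touches Y l'"
proof -
  let ?R = "conn D S w"
  let ?Y = "?R `` {pt l' i'} \<union> ?R `` {pt l' j'}"
  note e = equivD[OF equiv_conn[of D S w]]
  have lt: "i < 4" "j < 4" "i \<noteq> j" "i' < 4" "j' < 4" "i' \<noteq> j'" using joined_less[OF j] joined_less[OF j'] by auto
  have "x \<in> {(l', i'), (l, i)}" if "x \<in> ends S" "(pt l' i', end_arc D x) \<in> ?R" for x
    using two_ends[OF S, of "(l', i')" "(l, i)" x w] that l lt c by (auto simp: ends_def)
  moreover have "x \<in> {(l', j'), (l, j)}" if "x \<in> ends S" "(pt l' j', end_arc D x) \<in> ?R" for x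
    using two_ends[OF S, of "(l', j')" "(l, j)" x w] that l lt c by (auto simp: ends_def)
  ultimately have only: "x \<in> {(l', i'), (l, i), (l', j'), (l, j)}" if "x \<in> ends S" "end_arc D x \<in> ?Y" for x
    using that by blast
  have mem: "pt l k \<in> ?Y \<longleftrightarrow> k \<in> {i, j}" if "k < 4" for k
    using only[of "(l, k)"] that l c by (auto simp: ends_def)
  have mem': "pt l' k \<in> ?Y \<longleftrightarrow> k \<in> {i', j'}" if "k < 4" for k
    using only[of "(l', k)"] that l e(1)[of "pt l' i'"] e(1)[of "pt l' j'"] by (auto simp: ends_def)
  have lL: "l < ncross D" "l' < ncross D" using S l by auto
  have "?Y \<in> closed_circles (S - {l, l'}) w"
  proof (rule closed_new[where p = "pt l' i'"])
    show "pt l' i' \<in> arcs D" by (rule pt_in[OF lL(2) lt(4)])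
    show "pt l' i' \<in> ?Y" using e(1) by simp
    have sub: "?R \<subseteq> conn D (S - {l, l'}) w" by (rule conn_mono) auto
    have "(pt l' i', pt l' j') \<in> conn D (S - {l, l'}) w"
      by (rule joined_conn[OF j' lL(2)]) simp
    then show "?Y \<subseteq> conn D (S - {l, l'}) w `` {pt l' i'}"
      using sub equivD(3)[OF equiv_conn[of D "S - {l, l'}" w], of "pt l' i'" "pt l' j'"] by auto
    show "a \<in> ?Y \<longleftrightarrow> b \<in> ?Y" if "(a, b) \<in> ?R" for a b
      using e(3)[of "pt l' i'" a b] e(3)[of "pt l' i'" b a] e(3)[of "pt l' j'" a b] e(3)[of "pt l' j'" b a] e(2)[OF that] that
      by auto
    show "pt k a \<in> ?Y \<longleftrightarrow> pt k b \<in> ?Y" if "k \<in> {l, l'}" "joined (k \<in> w) a b" for k a b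
    proof (cases "k = l")
      case True
      then show ?thesis
        using that mem[of a] mem[of b] joined_pair[OF j, of a b] joined_less[of "l \<in> w" a b] by simp
    next
      case False
      then show ?thesis
        using that mem'[of a] mem'[of b] joined_pair[OF j', of a b] joined_less[of "l' \<in> w" a b] by simp
    qed
    show "end_arc D x \<notin> ?Y" if "x \<in> ends (S - {l, l'})" for x
      using only[of x] that by (auto simp: ends_def)
  qed
  moreover have "partly_touches ?Y l" "partly_touches ?Y l'"
    unfolding partly_touches_def using mem mem' lt other_corner[of i j] other_corner[of i' j'] by blast+
  ultimately show ?thesis by blast
qed

end


section \<open>Tangle words\<close>

text \<open>The label of a \<open>Cross\<close> names a crossing of the diagram. Bounds are stated
  for erased words, which record only the shape of the tangle.\<close>

datatype 'l letter = Cross 'l nat | Cup nat | Cap nat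

fun position :: "'l letter \<Rightarrow> nat" where
  "position (Cross l g) = g"
| "position (Cup g) = g"
| "position (Cap g) = g"

fun reposition :: "nat \<Rightarrow> 'l letter \<Rightarrow> 'l letter" where
  "reposition h (Cross l g) = Cross l h"
| "reposition h (Cup g) = Cup h"
| "reposition h (Cap g) = Cap h"

fun width_in :: "'l letter \<Rightarrow> nat" where
  "width_in (Cross l g) = 2"
| "width_in (Cup g) = 0"
| "width_in (Cap g) = 2"

fun width_out :: "'l letter \<Rightarrow> nat" where
  "width_out (Cross l g) = 2"
| "width_out (Cup g) = 2"
| "width_out (Cap g) = 0"

fun letter_labels :: "'l letter \<Rightarrow> 'l list" where
  "letter_labels (Cross l g) = [l]"
| "letter_labels (Cup g) = []"
| "letter_labels (Cap g) = []"

definition labels :: "'l letter list \<Rightarrow> 'l list" where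
  "labels W = concat (map letter_labels W)"

abbreviation erase :: "'l letter list \<Rightarrow> unit letter list" where
  "erase W \<equiv> map (map_letter (\<lambda>_. ())) W"

lemma labels_simps [simp]: "labels [] = []" "labels (x # W) = letter_labels x @ labels W" "labels (W @ W') = labels W @ labels W'"
  by (simp_all add: labels_def)

lemma map_letter_simps:
  "map_letter f x = Cross k g \<longleftrightarrow> (\<exists>l. x = Cross l g \<and> k = f l)"
  "map_letter f x = Cup g \<longleftrightarrow> x = Cup g" "map_letter f x = Cap g \<longleftrightarrow> x = Cap g"
  by (cases x; auto)+

context source_sink_diagram
begin

text \<open>
  A word describes a tangle read from left to right, i.e. from the bottom to the top, where a letter at position \<open>g\<close>
  involves the strands \<open>g\<close> and \<open>g + 1\<close>. Strands are represented by classes of arcs that are connected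
  by the smoothings chosen so far. The arguments of \<open>corners\<close> are the bottom left, bottom right,
  top left and top right strand at a crossing, which may be rotated by a half turn.
\<close>

definition corners :: "('a \<times> 'a) set \<Rightarrow> nat \<Rightarrow> 'a set \<Rightarrow> 'a set \<Rightarrow> 'a set \<Rightarrow> 'a set \<Rightarrow> bool" where
  "corners R l a b c d \<longleftrightarrow>
     b = R `` {pt l 0} \<and> d = R `` {pt l 1} \<and> c = R `` {pt l 2} \<and> a = R `` {pt l 3} \<or>
     b = R `` {pt l 2} \<and> d = R `` {pt l 3} \<and> c = R `` {pt l 0} \<and> a = R `` {pt l 1}"

text \<open>\<open>N\<close> collects the strands appearing on top of the letter; accumulated along
  a run, these sets keep track of circles lying entirely inside the word.\<close>

fun local_step :: "('a \<times> 'a) set \<Rightarrow> nat letter \<Rightarrow> 'a set list \<Rightarrow> 'a set list \<Rightarrow> 'a set set \<Rightarrow> bool" where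
  "local_step R (Cross l g) u u' N \<longleftrightarrow> (\<exists>a b c d. u = [a, b] \<and> u' = [c, d] \<and> corners R l a b c d \<and> N = {c, d})"
| "local_step R (Cup g) u u' N \<longleftrightarrow> (\<exists>q. u = [] \<and> u' = [q, q] \<and> N = {q})"
| "local_step R (Cap g) u u' N \<longleftrightarrow> (\<exists>q. u = [q, q] \<and> u' = [] \<and> N = {})"

definition step :: "('a \<times> 'a) set \<Rightarrow> nat letter \<Rightarrow> 'a set list \<Rightarrow> 'a set list \<Rightarrow> 'a set set \<Rightarrow> bool" where
  "step R x xs zs N \<longleftrightarrow>
     (\<exists>p s u u'. length p = position x \<and> xs = p @ u @ s \<and> zs = p @ u' @ s \<and> local_step R x u u' N)"

fun run :: "('a \<times> 'a) set \<Rightarrow> nat letter list \<Rightarrow> 'a set list \<Rightarrow> 'a set list \<Rightarrow> 'a set set \<Rightarrow> bool" where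
  "run R [] xs ys V \<longleftrightarrow> ys = xs \<and> V = {}"
| "run R (x # W) xs ys V \<longleftrightarrow> (\<exists>zs N V'. step R x xs zs N \<and> run R W zs ys V' \<and> V = N \<union> V')"

lemma local_step_length: "local_step R x u u' N \<Longrightarrow> length u = width_in x \<and> length u' = width_out x"
  by (cases x) auto

lemma local_step_new: "local_step R x u u' N \<Longrightarrow> N = set u'"
  by (cases x) auto

lemma local_step_reposition: "local_step R (reposition h x) = local_step R x"
  by (cases x) (auto simp: fun_eq_iff)

lemma position_reposition [simp]: "position (reposition h x) = h"
  by (cases x) auto

lemma letter_labels_reposition [simp]: "letter_labels (reposition h x) = letter_labels x"
  by (cases x) auto

lemma run_append:
  "run R (W @ W') xs ys V \<longleftrightarrow> (\<exists>zs V1 V2. run R W xs zs V1 \<and> run R W' zs ys V2 \<and> V = V1 \<union> V2)"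
proof (induction W arbitrary: xs V)
  case Nil
  show ?case by simp
next
  case (Cons x W)
  show ?case
  proof
    assume "run R ((x # W) @ W') xs ys V"
    then obtain zs N V' where 1: "step R x xs zs N" "run R (W @ W') zs ys V'" "V = N \<union> V'" by auto
    obtain us V1 V2 where 2: "run R W zs us V1" "run R W' us ys V2" "V' = V1 \<union> V2" using 1(2) unfolding Cons.IH by blast
    have "run R (x # W) xs us (N \<union> V1)" using 1(1) 2(1) by auto
    moreover have "V = (N \<union> V1) \<union> V2" using 1(3) 2(3) by (simp add: Un_assoc)
    ultimately show "\<exists>zs V1 V2. run R (x # W) xs zs V1 \<and> run R W' zs ys V2 \<and> V = V1 \<union> V2" using 2(2) by blast
  next
    assume "\<exists>zs V1 V2. run R (x # W) xs zs V1 \<and> run R W' zs ys V2 \<and> V = V1 \<union> V2"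
    then obtain us V1 V2 where 1: "run R (x # W) xs us V1" "run R W' us ys V2" "V = V1 \<union> V2" by blast
    obtain zs N V' where 2: "step R x xs zs N" "run R W zs us V'" "V1 = N \<union> V'" using 1(1) by auto
    have r: "run R (W @ W') zs ys (V' \<union> V2)"
      unfolding Cons.IH by (intro exI[of _ us] exI[of _ V'] exI[of _ V2] conjI 2(2) 1(2) refl)
    have v: "V = N \<union> (V' \<union> V2)" unfolding 1(3) 2(3) by (rule Un_assoc)
    show "run R ((x # W) @ W') xs ys V"
      unfolding append_Cons run.simps(2)
      by (intro exI[of _ zs] exI[of _ N] exI[of _ "V' \<union> V2"] conjI 2(1) r v)
  qed
qed

lemma step_visited: "step R x xs zs N \<Longrightarrow> set zs \<subseteq> set xs \<union> N \<and> N \<subseteq> set zs"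
  unfolding step_def using local_step_new by fastforce

lemma run_visited: "run R W xs ys V \<Longrightarrow> set ys \<subseteq> set xs \<union> V"
proof (induction W arbitrary: xs V)
  case (Cons x W)
  then obtain zs N V' where "step R x xs zs N" "run R W zs ys V'" "V = N \<union> V'" by auto
  then show ?case using Cons.IH step_visited by blast
qed simp

lemma step_width: "step R x xs zs N \<Longrightarrow> length zs + width_in x = length xs + width_out x"
  unfolding step_def using local_step_length by fastforce

lemma run_width:
  "run R W xs ys V \<Longrightarrow> length ys + sum_list (map width_in W) = length xs + sum_list (map width_out W)"
proof (induction W arbitrary: xs V)
  case (Cons x W)
  then obtain zs N V' where "step R x xs zs N" "run R W zs ys V'" by auto
  then show ?case using Cons.IH step_width by fastforce
qed simp

lemma step_at:
  assumes "length p = position x"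
  shows "step R x (p @ r) zs N \<longleftrightarrow> (\<exists>s u u'. r = u @ s \<and> zs = p @ u' @ s \<and> local_step R x u u' N)"
proof
  assume "step R x (p @ r) zs N"
  then obtain p' s u u' where h: "length p' = position x" "p @ r = p' @ u @ s" "zs = p' @ u' @ s" "local_step R x u u' N"
    unfolding step_def by blast
  then have "p = p'" "r = u @ s" using assms by simp_all
  then show "\<exists>s u u'. r = u @ s \<and> zs = p @ u' @ s \<and> local_step R x u u' N" using h by blast
next
  assume "\<exists>s u u'. r = u @ s \<and> zs = p @ u' @ s \<and> local_step R x u u' N"
  then show "step R x (p @ r) zs N" unfolding step_def using assms by blast
qed

lemma step_Cross:
  assumes "length p = g"
  shows "step R (Cross l g) (p @ r) zs N \<longleftrightarrow> (\<exists>a b s c d. r = a # b # s \<and> zs = p @ c # d # s \<and> corners R l a b c d \<and> N = {c, d})"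
proof -
  have p: "length p = position (Cross l g)" using assms by simp
  show ?thesis
  proof
    assume "step R (Cross l g) (p @ r) zs N"
    then show "\<exists>a b s c d. r = a # b # s \<and> zs = p @ c # d # s \<and> corners R l a b c d \<and> N = {c, d}"
      unfolding step_at[OF p] by auto
  next
    assume "\<exists>a b s c d. r = a # b # s \<and> zs = p @ c # d # s \<and> corners R l a b c d \<and> N = {c, d}"
    then obtain a b s c d where h: "r = a # b # s" "zs = p @ c # d # s" "corners R l a b c d" "N = {c, d}" by blast
    show "step R (Cross l g) (p @ r) zs N"
      unfolding step_at[OF p]
      by (rule exI[of _ s], rule exI[of _ "[a, b]"], rule exI[of _ "[c, d]"]) (use h in auto)
  qed
qed

lemma step_Cup:
  assumes "length p = g"
  shows "step R (Cup g) (p @ r) zs N \<longleftrightarrow> (\<exists>q. zs = p @ q # q # r \<and> N = {q})"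
proof -
  have p: "length p = position (Cup g)" using assms by simp
  show ?thesis unfolding step_at[OF p] by auto
qed

lemma step_Cap:
  assumes "length p = g"
  shows "step R (Cap g) (p @ r) zs N \<longleftrightarrow> (\<exists>q s. r = q # q # s \<and> zs = p @ s \<and> N = {})"
proof -
  have p: "length p = position (Cap g)" using assms by simp
  show ?thesis unfolding step_at[OF p] by auto
qed

lemma step_Cross_Suc: "length p = g \<Longrightarrow>
    step R (Cross l (Suc g)) (p @ x # r) zs N \<longleftrightarrow> (\<exists>a b s c d. r = a # b # s \<and> zs = p @ x # c # d # s \<and> corners R l a b c d \<and> N = {c, d})"
  using step_Cross[of "p @ [x]" "Suc g" R l r zs N] by simp

lemma step_Cap_Suc: "length p = g \<Longrightarrow>
    step R (Cap (Suc g)) (p @ x # r) zs N \<longleftrightarrow> (\<exists>q s. r = q # q # s \<and> zs = p @ x # s \<and> N = {})"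
  using step_Cap[of "p @ [x]" "Suc g" R r zs N] by simp

lemma step_Cup_Suc: "length p = g \<Longrightarrow>
    step R (Cup (Suc g)) (p @ x # r) zs N \<longleftrightarrow> (\<exists>q. zs = p @ x # q # q # r \<and> N = {q})"
  using step_Cup[of "p @ [x]" "Suc g" R r zs N] by simp

lemma step_prefix:
  assumes "step R x xs zs N"
  obtains p r where "length p = position x" "xs = p @ r"
  using assms unfolding step_def by blast

lemma step_Suc_prefix:
  assumes "step R x xs zs N" "position x = Suc g"
  obtains p z r where "length p = g" "xs = p @ z # r"
proof -
  obtain p r where p: "length p = Suc g" "xs = p @ r" using step_prefix[OF assms(1)] assms(2) by metis
  then obtain p' z where "p = p' @ [z]" by (metis length_greater_0_conv rev_exhaust zero_less_Suc)
  then show thesis using p that by simp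
qed

lemma class_of_class:
  assumes "equiv UNIV R'" "R \<subseteq> R'" "equiv UNIV R"
  shows "R' `` (R `` {p}) = R' `` {p}"
  using assms(2) equivD[OF assms(1)] equivD(1)[OF assms(3)] by blast

lemma corners_coarsen:
  assumes "equiv UNIV R'" "R \<subseteq> R'" "equiv UNIV R" "corners R l a b c d"
  shows "corners R' l (R' `` a) (R' `` b) (R' `` c) (R' `` d)"
  using assms(4) unfolding corners_def by (elim disjE conjE) (simp_all only: class_of_class[OF assms(1-3)] simp_thms)

lemma step_coarsen:
  assumes R: "equiv UNIV R'" "R \<subseteq> R'" "equiv UNIV R" and s: "step R x xs zs N"
  shows "step R' x (map ((``) R') xs) (map ((``) R') zs) ((``) R' ` N)"
proof -
  obtain p s u u' where h: "length p = position x" "xs = p @ u @ s" "zs = p @ u' @ s" "local_step R x u u' N"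
    using s unfolding step_def by blast
  have "local_step R' x (map ((``) R') u) (map ((``) R') u') ((``) R' ` N)"
    using h(4) corners_coarsen[OF R] by (cases x) auto
  then show ?thesis unfolding step_def h(2,3) using h(1)
    by (intro exI[of _ "map ((``) R') p"] exI[of _ "map ((``) R') s"] exI[of _ "map ((``) R') u"] exI[of _ "map ((``) R') u'"]) simp
qed

text \<open>Resolving further crossings enlarges the relation; replacing each strand by its larger
  class turns a run into a run.\<close>

lemma run_coarsen:
  assumes R: "equiv UNIV R'" "R \<subseteq> R'" "equiv UNIV R" and r: "run R W xs ys V"
  shows "run R' W (map ((``) R') xs) (map ((``) R') ys) ((``) R' ` V)"
  using r
proof (induction W arbitrary: xs V)
  case (Cons x W)
  then obtain zs N V' where h: "step R x xs zs N" "run R W zs ys V'" "V = N \<union> V'" by auto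
  have "(``) R' ` V = (``) R' ` N \<union> (``) R' ` V'" unfolding h(3) by (rule image_Un)
  then show ?case using step_coarsen[OF R h(1)] Cons.IH[OF h(2)] by auto
qed simp

text \<open>Equal lists at bottom and top express that the word is closed up. The last condition
  says that a closed circle without prescribed label is seen somewhere along the word; it bounds the
  number of circles once no crossing is left.\<close>

definition represents :: "nat \<Rightarrow> unit letter list \<Rightarrow> nat set \<Rightarrow> nat set \<Rightarrow> 'a set set \<Rightarrow> bool" where
  "represents m W S v1 P \<longleftrightarrow>
     S \<subseteq> {..<ncross D} \<and> v1 \<inter> S = {} \<and> v1 \<subseteq> {..<ncross D} \<and> P \<subseteq> closed_circles S v1 \<and>
     (\<exists>lw xs V. erase lw = W \<and> length xs = m \<and> run (conn D S v1) lw xs xs V \<and>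
        distinct (labels lw) \<and> set (labels lw) = S \<and> closed_circles S v1 \<subseteq> P \<union> set xs \<union> V)"

text \<open>The bounds are relative to the 1-smoothings already made and to the labels already
  fixed, so \<open>a\<close> and \<open>b\<close> can be computed from the word alone. Quantifying
  over everything the word describes takes the place of isotopy invariance.\<close>

definition bounded_word :: "nat \<Rightarrow> unit letter list \<Rightarrow> int \<Rightarrow> int \<Rightarrow> bool" where
  "bounded_word m W a b \<longleftrightarrow> (\<forall>S v1 P lab. represents m W S v1 P \<longrightarrow>
     bounded_by (state_cells S v1 P lab) (int (card v1) + a)
       (int (card v1) + (\<Sum>C\<in>P. label_degree (lab C)) + b))"

lemma bounded_wordD: "bounded_word m W a b \<Longrightarrow> represents m W S v1 P \<Longrightarrow>
    int (card v1) + a \<le> I \<Longrightarrow> int (card v1) + (\<Sum>C\<in>P. label_degree (lab C)) + b \<le> J \<Longrightarrow>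
    bounded_by (state_cells S v1 P lab) I J"
  unfolding bounded_word_def using bounded_by_mono by blast

lemma bounded_word_mono: "bounded_word m W a b \<Longrightarrow> a \<le> a' \<Longrightarrow> b \<le> b' \<Longrightarrow> bounded_word m W a' b'"
  unfolding bounded_word_def[of m W a' b'] by (intro allI impI bounded_wordD) auto

lemma finite_closed: "finite (closed_circles S v)"
  using finite_arcs by (simp add: closed_circles_def quotient_def)

text \<open>New closed circles can only arise through corners of the crossings just
  resolved.\<close>

lemma closed_circles_cases:
  assumes Q: "Q \<in> closed_circles (S - T) w" and w: "w - S = v - S"
  shows "Q \<in> closed_circles S v \<or> (\<exists>e\<in>ends T. Q = conn D (S - T) w `` {end_arc D e})"
proof (cases "\<exists>e\<in>ends T. end_arc D e \<in> Q")
  case True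
  then obtain e where e: "e \<in> ends T" "end_arc D e \<in> Q" by blast
  obtain p where p: "Q = conn D (S - T) w `` {p}" using Q by (auto simp: closed_circles_def elim!: quotientE)
  have "Q = conn D (S - T) w `` {end_arc D e}"
    using equiv_class_eq[OF equiv_conn, of p "end_arc D e"] e(2) p by auto
  then show ?thesis using e(1) by blast
next
  case False
  obtain p where p: "p \<in> arcs D" "Q = conn D (S - T) w `` {p}" using Q by (auto simp: closed_circles_def elim!: quotientE)
  let ?K = "conn D S v `` {p}"
  have "conn D S v \<subseteq> conn D (S - T) w" by (rule conn_mono) (use w in auto)
  then have KQ: "?K \<subseteq> Q" unfolding p(2) by blast
  have "end_arc D e \<notin> Q" if "e \<in> ends S" for e
    using that False Q by (cases "e \<in> ends T") (auto simp: closed_circles_def ends_def)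
  then have "?K \<in> closed_circles S v" using KQ p(1) by (auto simp: closed_circles_def quotientI)
  moreover from this have "?K \<in> closed_circles (S - T) w" by (rule closed_circles_mono) (use w in auto)
  then obtain p' where "?K = conn D (S - T) w `` {p'}" by (auto simp: closed_circles_def elim!: quotientE)
  moreover have "p \<in> ?K" using equivD(1)[OF equiv_conn] by simp
  ultimately show ?thesis using equiv_class_eq[OF equiv_conn, of p' p D "S - T" w] p(2) by auto
qed

text \<open>The bookkeeping common to all local moves: the middle piece \<open>w\<close> becomes
  \<open>w'\<close> while the crossings in \<open>T\<close> are resolved. The outer pieces are
  carried over by \<open>run_coarsen\<close>; only circles seen inside \<open>w\<close> or passing
  through corners of \<open>T\<close> have to be located again, which is the last
  assumption.\<close>

lemma represents_replace:
  assumes S: "S \<subseteq> {..<ncross D}" "v1 \<inter> S = {}" "v1 \<subseteq> {..<ncross D}"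
    and R: "R = conn D S v1"
    and runs: "run R u xs y1 V1" "run R w y1 y2 V2" "run R v y2 xs V3"
    and dist: "distinct (labels (u @ w @ v))" "set (labels (u @ w @ v)) = S"
    and cov: "closed_circles S v1 \<subseteq> P \<union> set xs \<union> (V1 \<union> V2 \<union> V3)"
    and T: "T \<subseteq> set (labels w)" "w1 - S = v1" "w1 \<inter> (S - T) = {}" "w1 \<subseteq> {..<ncross D}"
    and R': "R' = conn D (S - T) w1"
    and run': "run R' w' (map ((``) R') y1) (map ((``) R') y2) V2'"
    and dist': "distinct (labels w')" "set (labels w') = set (labels w) - T"
    and P': "P \<subseteq> P'" "P' \<subseteq> closed_circles (S - T) w1"
    and cov': "\<And>q. q \<in> V2 \<union> (\<lambda>e. R `` {end_arc D e}) ` ends T \<Longrightarrow> R' `` q \<in> closed_circles (S - T) w1 \<Longrightarrow>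
        R' `` q \<in> P' \<union> (``) R' ` set y1 \<union> V2'"
  shows "represents (length xs) (erase u @ erase w' @ erase v) (S - T) w1 P'"
proof -
  have eq: "equiv UNIV R" "equiv UNIV R'" using R R' equiv_conn by simp_all
  have sub: "R \<subseteq> R'" unfolding R R' by (rule conn_mono) (use T(2) S(2) in auto)
  let ?f = "map ((``) R')"
  have r: "run R' (u @ w' @ v) (?f xs) (?f xs) ((``) R' ` V1 \<union> (V2' \<union> (``) R' ` V3))"
    unfolding run_append using run_coarsen[OF eq(2) sub eq(1) runs(1)] run' run_coarsen[OF eq(2) sub eq(1) runs(3)] by blast
  have d: "distinct (labels (u @ w' @ v))" "set (labels (u @ w' @ v)) = S - T"
    using dist dist' T(1) by auto
  have y1: "set y1 \<subseteq> set xs \<union> V1" by (rule run_visited[OF runs(1)])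
  have "Q \<in> P' \<union> set (?f xs) \<union> ((``) R' ` V1 \<union> (V2' \<union> (``) R' ` V3))" if Q: "Q \<in> closed_circles (S - T) w1" for Q
  proof -
    have img: "(``) R' ` set y1 \<subseteq> set (?f xs) \<union> (``) R' ` V1" using y1 by auto
    have main: "R' `` q \<in> P' \<union> set (?f xs) \<union> ((``) R' ` V1 \<union> (V2' \<union> (``) R' ` V3))"
      if "q \<in> V2 \<union> (\<lambda>e. R `` {end_arc D e}) ` ends T" "R' `` q \<in> closed_circles (S - T) w1" for q
      using cov'[OF that] img by blast
    have "w1 - S = v1 - S" using T(2) by blast
    then consider "Q \<in> closed_circles S v1" | e where "e \<in> ends T" "Q = R' `` {end_arc D e}"
      using closed_circles_cases[OF Q] unfolding R' by blast
    then show ?thesis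
    proof cases
      case 1
      obtain p where p: "Q = R' `` {p}" using Q by (auto simp: closed_circles_def R' elim!: quotientE)
      then have self: "R' `` Q = Q" using class_of_class[OF eq(2) _ eq(2)] by simp
      have "Q \<in> P \<or> Q \<in> set xs \<or> Q \<in> V1 \<or> Q \<in> V2 \<or> Q \<in> V3" using 1 cov by blast
      then show ?thesis
      proof (elim disjE)
        assume "Q \<in> V2"
        then show ?thesis using main[of Q] self Q by simp
      next
        assume "Q \<in> P"
        then show ?thesis using P'(1) by blast
      next
        assume "Q \<in> set xs"
        then have "R' `` Q \<in> set (?f xs)" by simp
        then show ?thesis unfolding self by blast
      next
        assume "Q \<in> V1"
        then have "R' `` Q \<in> (``) R' ` V1" by (rule imageI)
        then show ?thesis unfolding self by blast
      next
        assume "Q \<in> V3"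
        then have "R' `` Q \<in> (``) R' ` V3" by (rule imageI)
        then show ?thesis unfolding self by blast
      qed
    next
      case 2
      then have "Q = R' `` (R `` {end_arc D e})" using class_of_class[OF eq(2) sub eq(1)] by simp
      then show ?thesis using main[of "R `` {end_arc D e}"] 2(1) Q by blast
    qed
  qed
  then have c: "closed_circles (S - T) w1 \<subseteq> P' \<union> set (?f xs) \<union> ((``) R' ` V1 \<union> (V2' \<union> (``) R' ` V3))" by blast
  show ?thesis
    unfolding represents_def R'[symmetric]
  proof (intro conjI exI)
    show "erase (u @ w' @ v) = erase u @ erase w' @ erase v" by simp
    show "length (?f xs) = length xs" by simp
    show "S - T \<subseteq> {..<ncross D}" using S by blast
  qed (use T P' r d c in blast)+
qed

lemma representsE:
  assumes "represents m (u @ w @ v) S v1 P"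
  obtains u' w' v' xs y1 y2 V1 V2 V3 where "erase u' = u" "erase w' = w" "erase v' = v" "length xs = m"
    "S \<subseteq> {..<ncross D}" "v1 \<inter> S = {}" "v1 \<subseteq> {..<ncross D}" "P \<subseteq> closed_circles S v1"
    "run (conn D S v1) u' xs y1 V1" "run (conn D S v1) w' y1 y2 V2" "run (conn D S v1) v' y2 xs V3"
    "distinct (labels (u' @ w' @ v'))" "set (labels (u' @ w' @ v')) = S"
    "closed_circles S v1 \<subseteq> P \<union> set xs \<union> (V1 \<union> V2 \<union> V3)"
proof -
  obtain lw xs V where h: "erase lw = u @ w @ v" "length xs = m" "run (conn D S v1) lw xs xs V"
    "distinct (labels lw)" "set (labels lw) = S" "closed_circles S v1 \<subseteq> P \<union> set xs \<union> V"
    and st: "S \<subseteq> {..<ncross D}" "v1 \<inter> S = {}" "v1 \<subseteq> {..<ncross D}" "P \<subseteq> closed_circles S v1"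
    using assms unfolding represents_def by blast
  obtain u' t where ut: "lw = u' @ t" "erase u' = u" "erase t = w @ v"
    using h(1) map_eq_append_conv[of _ lw u "w @ v"] by auto
  obtain w' v' where wv: "t = w' @ v'" "erase w' = w" "erase v' = v"
    using ut(3) map_eq_append_conv[of _ t w v] by auto
  note uwv = ut(1)[unfolded wv(1)] ut(2) wv(2,3)
  obtain y1 V1 V1' where r1: "run (conn D S v1) u' xs y1 V1" "run (conn D S v1) (w' @ v') y1 xs V1'" "V = V1 \<union> V1'"
    using h(3) unfolding uwv(1) run_append[of _ u'] by blast
  obtain y2 V2 V3 where r2: "run (conn D S v1) w' y1 y2 V2" "run (conn D S v1) v' y2 xs V3" "V1' = V2 \<union> V3"
    using r1(2) unfolding run_append by blast
  have "closed_circles S v1 \<subseteq> P \<union> set xs \<union> (V1 \<union> V2 \<union> V3)" using h(6) r1(3) r2(3) by blast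
  then show thesis
    using that[OF uwv(2-4) h(2) st r1(1) r2(1,2)] h(4,5) uwv(1) by blast
qed


text \<open>The 0-smoothing consists of two vertical strands, the 1-smoothing of a cap below a cup;
  both descriptions are invariant under the half turn allowed in \<open>corners\<close>.\<close>

lemma corners_resolved:
  assumes R: "R = conn D S v1" and R': "R' = conn D (S - T) w1" "R \<subseteq> R'"
    and l: "l < ncross D" "l \<in> T" and c: "corners R l a b c d"
  shows "l \<notin> w1 \<Longrightarrow> R' `` a = R' `` c" "l \<notin> w1 \<Longrightarrow> R' `` b = R' `` d"
    and "l \<in> w1 \<Longrightarrow> R' `` a = R' `` b" "l \<in> w1 \<Longrightarrow> R' `` c = R' `` d"
proof -
  have eq: "equiv UNIV R" "equiv UNIV R'" using R R' equiv_conn by simp_all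
  have j: "R' `` {pt l i} = R' `` {pt l j}" if "joined (l \<in> w1) i j" for i j
    unfolding R'(1) by (rule equiv_class_eq[OF equiv_conn joined_conn[OF that l(1)]]) (use l in simp)
  have cl: "R' `` (R `` {x}) = R' `` {x}" for x by (rule class_of_class[OF eq(2) R'(2) eq(1)])
  have e0: "R' `` {pt l 0} = R' `` {pt l 1}" "R' `` {pt l 2} = R' `` {pt l 3}" if "l \<notin> w1"
    using that by (auto intro!: j simp: joined_def)
  have e1: "R' `` {pt l 0} = R' `` {pt l 3}" "R' `` {pt l 1} = R' `` {pt l 2}" if "l \<in> w1"
    using that by (auto intro!: j simp: joined_def)
  show "R' `` a = R' `` c" "R' `` b = R' `` d" if "l \<notin> w1"
    using c e0[OF that] unfolding corners_def by (elim disjE conjE; simp only: cl)+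
  show "R' `` a = R' `` b" "R' `` c = R' `` d" if "l \<in> w1"
    using c e1[OF that] unfolding corners_def by (elim disjE conjE; simp only: cl)+
qed

lemma corners_ends:
  assumes "corners R l a b c d" "q \<in> (\<lambda>e. R `` {end_arc D e}) ` ends {l}"
  shows "q = a \<or> q = b \<or> q = c \<or> q = d"
proof -
  obtain k where "k < 4" "q = R `` {pt l k}" using assms(2) by (auto simp: ends_def)
  then show ?thesis using assms(1) unfolding corners_def less_4 by (elim disjE conjE) simp_all
qed

lemma sum_insert_label:
  assumes "finite P" "C \<notin> P"
  shows "(\<Sum>K\<in>insert C P. label_degree ((lab(C := s)) K)) = label_degree s + (\<Sum>K\<in>P. label_degree (lab K))"
proof -
  have "(\<Sum>K\<in>P. label_degree ((lab(C := s)) K)) = (\<Sum>K\<in>P. label_degree (lab K))"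
    using assms(2) by (intro sum.cong) auto
  then show ?thesis using assms by simp
qed

lemma represents_basic:
  assumes "represents m W S v1 P"
  shows "S \<subseteq> {..<ncross D}" "v1 \<inter> S = {}" "finite v1" "P \<subseteq> closed_circles S v1" "finite P"
  using assms finite_closed unfolding represents_def by (auto intro: finite_subset)

lemma erase_conv:
  "erase w = [] \<longleftrightarrow> w = []"
  "erase w = x # W \<longleftrightarrow> (\<exists>y w'. w = y # w' \<and> map_letter (\<lambda>_. ()) y = x \<and> erase w' = W)"
  by (auto simp: map_eq_Cons_conv)

lemma run_single: "run R [x] xs ys V \<longleftrightarrow> step R x xs ys V"
  by auto

lemma run_two: "run R [x, y] xs ys V \<longleftrightarrow> (\<exists>zs N N'. step R x xs zs N \<and> step R y zs ys N' \<and> V = N \<union> N')"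
  by auto

lemma run_three: "run R [x, y, w] xs ys V \<longleftrightarrow>
  (\<exists>zs us N N' N''. step R x xs zs N \<and> step R y zs us N' \<and> step R w us ys N'' \<and> V = N \<union> (N' \<union> N''))"
  unfolding run.simps(2)[of R x] run_two by blast

section \<open>Local moves on words and their cost in both degrees\<close>

lemma represents_naive:
  assumes "represents m (u @ [Cross () g] @ v) S v1 P"
  shows "\<exists>l\<in>S. represents m (u @ v) (S - {l}) v1 P \<and> represents m (u @ [Cap g, Cup g] @ v) (S - {l}) (insert l v1) P"
  using assms
proof (rule representsE)
  fix u' w' v' xs y1 y2 V1 V2 V3
  assume er: "erase u' = u" "erase w' = [Cross () g]" "erase v' = v" and xs: "length xs = m"
    and S: "S \<subseteq> {..<ncross D}" "v1 \<inter> S = {}" "v1 \<subseteq> {..<ncross D}" and P: "P \<subseteq> closed_circles S v1"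
    and runs: "run (conn D S v1) u' xs y1 V1" "run (conn D S v1) w' y1 y2 V2" "run (conn D S v1) v' y2 xs V3"
    and dist: "distinct (labels (u' @ w' @ v'))" "set (labels (u' @ w' @ v')) = S"
    and cov: "closed_circles S v1 \<subseteq> P \<union> set xs \<union> (V1 \<union> V2 \<union> V3)"
  let ?R = "conn D S v1"
  obtain l where w': "w' = [Cross l g]" using er(2) by (auto simp: erase_conv map_letter_simps)
  have l: "l \<in> S" "l < ncross D" "l \<notin> v1" using dist(2) S w' by auto
  have st: "step ?R (Cross l g) y1 y2 V2" using runs(2) unfolding w' run_single .
  obtain p r where p: "length p = g" "y1 = p @ r" using step_prefix[OF st] by auto
  obtain a b s c d where r: "r = a # b # s" "y2 = p @ c # d # s" "corners ?R l a b c d" "V2 = {c, d}"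
    using st unfolding p(2) step_Cross[OF p(1)] by blast
  have lab: "set (labels w') = {l}" by (simp add: w')
  have "represents (length xs) (erase u' @ erase ([] :: nat letter list) @ erase v') (S - {l}) v1 P"
  proof (rule represents_replace[OF S refl runs dist cov, where V2' = "{}"])
    let ?R' = "conn D (S - {l}) v1"
    have sub: "?R \<subseteq> ?R'" by (rule conn_mono) auto
    note c = corners_resolved[OF refl refl sub l(2) _ r(3)]
    show "run ?R' [] (map ((``) ?R') y1) (map ((``) ?R') y2) {}"
      using c(1,2) l(3) by (simp add: p(2) r(1,2))
    show "P \<subseteq> closed_circles (S - {l}) v1" by (rule closed_circles_remove[OF P S(2)]) (use S in auto)
    fix q assume "q \<in> V2 \<union> (\<lambda>e. ?R `` {end_arc D e}) ` ends {l}"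
    then have "q = a \<or> q = b \<or> q = c \<or> q = d" using corners_ends[OF r(3)] r(4) by blast
    then show "?R' `` q \<in> P \<union> (``) ?R' ` set y1 \<union> {}"
      using c(1,2) l(3) by (auto simp: p(2) r(1))
  qed (use S lab l in auto)
  moreover have "represents (length xs) (erase u' @ erase ([Cap g, Cup g] :: nat letter list) @ erase v') (S - {l}) (insert l v1) P"
  proof (rule represents_replace[OF S refl runs dist cov, where V2' = "{conn D (S - {l}) (insert l v1) `` c}"])
    let ?R' = "conn D (S - {l}) (insert l v1)"
    have sub: "?R \<subseteq> ?R'" by (rule conn_mono) (use l in auto)
    note c = corners_resolved[OF refl refl sub l(2) _ r(3)]
    have lp: "length (map ((``) ?R') p) = g" using p by simp
    show "run ?R' [Cap g, Cup g] (map ((``) ?R') y1) (map ((``) ?R') y2) {?R' `` c}"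
      unfolding run_two p(2) r(1,2) map_append step_Cap[OF lp] using c(3,4) step_Cup[OF lp] by auto
    show "P \<subseteq> closed_circles (S - {l}) (insert l v1)" by (rule closed_circles_remove[OF P S(2)]) (use S l in auto)
    fix q assume "q \<in> V2 \<union> (\<lambda>e. ?R `` {end_arc D e}) ` ends {l}"
    then have "q = a \<or> q = b \<or> q = c \<or> q = d" using corners_ends[OF r(3)] r(4) by blast
    then show "?R' `` q \<in> P \<union> (``) ?R' ` set y1 \<union> {?R' `` c}"
      using c(4) by (auto simp: p(2) r(1))
  qed (use S lab l in auto)
  ultimately show ?thesis using l(1) er xs by auto
qed

text \<open>The second word comes with one more 1-smoothing, which counts in both degrees; hence
  \<open>a - 1\<close> and \<open>b - 1\<close>.\<close>

lemma bounded_naive: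
  assumes "bounded_word m (u @ v) a b" "bounded_word m (u @ [Cap g, Cup g] @ v) (a - 1) (b - 1)"
  shows "bounded_word m (u @ [Cross () g] @ v) a b"
  unfolding bounded_word_def
proof (intro allI impI)
  fix S v1 P and lab :: "'a labelling"
  assume rep: "represents m (u @ [Cross () g] @ v) S v1 P"
  note basic = represents_basic[OF rep]
  obtain l where l: "l \<in> S" "represents m (u @ v) (S - {l}) v1 P"
    "represents m (u @ [Cap g, Cup g] @ v) (S - {l}) (insert l v1) P"
    using represents_naive[OF rep] by blast
  have "l \<notin> v1" using basic(2) l(1) by blast
  then have "card (insert l v1) = card v1 + 1" using basic(3) by simp
  then show "bounded_by (state_cells S v1 P lab) (int (card v1) + a) (int (card v1) + (\<Sum>C\<in>P. label_degree (lab C)) + b)"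
    by (intro bounded_resolve[OF basic(2,4,1) l(1)] bounded_wordD[OF assms(1) l(2)] bounded_wordD[OF assms(2) l(3)]) simp_all
qed

lemma corners_bottom:
  assumes "corners R l a b c d"
  shows "\<exists>i j. joined True i j \<and> a = R `` {pt l i} \<and> b = R `` {pt l j}"
  using assms unfolding corners_def
proof (elim disjE conjE)
  assume "a = R `` {pt l 3}" "b = R `` {pt l 0}" "c = R `` {pt l 2}" "d = R `` {pt l 1}"
  then show ?thesis by (intro exI[of _ 3] exI[of _ 0]) (simp add: joined_def)
next
  assume "a = R `` {pt l 1}" "b = R `` {pt l 2}" "c = R `` {pt l 0}" "d = R `` {pt l 3}"
  then show ?thesis by (intro exI[of _ 1] exI[of _ 2]) (simp add: joined_def)
qed

lemma corners_left:
  assumes "corners R l a b c d"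
  shows "\<exists>i j. joined False i j \<and> a = R `` {pt l i} \<and> c = R `` {pt l j}"
  using assms unfolding corners_def
proof (elim disjE conjE)
  assume "a = R `` {pt l 3}" "b = R `` {pt l 0}" "c = R `` {pt l 2}" "d = R `` {pt l 1}"
  then show ?thesis by (intro exI[of _ 3] exI[of _ 2]) (simp add: joined_def)
next
  assume "a = R `` {pt l 1}" "b = R `` {pt l 2}" "c = R `` {pt l 0}" "d = R `` {pt l 3}"
  then show ?thesis by (intro exI[of _ 1] exI[of _ 0]) (simp add: joined_def)
qed

lemma corners_right:
  assumes "corners R l a b c d"
  shows "\<exists>i j. joined False i j \<and> b = R `` {pt l i} \<and> d = R `` {pt l j}"
  using assms unfolding corners_def
proof (elim disjE conjE)
  assume "a = R `` {pt l 3}" "b = R `` {pt l 0}" "c = R `` {pt l 2}" "d = R `` {pt l 1}"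
  then show ?thesis by (intro exI[of _ 0] exI[of _ 1]) (simp add: joined_def)
next
  assume "a = R `` {pt l 1}" "b = R `` {pt l 2}" "c = R `` {pt l 0}" "d = R `` {pt l 3}"
  then show ?thesis by (intro exI[of _ 2] exI[of _ 3]) (simp add: joined_def)
qed

lemma class_eqD: "conn D S v `` {x} = conn D S v `` {y} \<Longrightarrow> (x, y) \<in> conn D S v"
  by (simp add: class_eq_iff[OF equiv_conn])

lemma closed_class_self:
  assumes "C \<in> closed_circles S v" shows "conn D S v `` C = C"
proof -
  obtain p where "C = conn D S v `` {p}" using assms by (auto simp: closed_circles_def elim!: quotientE)
  then show ?thesis using class_of_class[OF equiv_conn order_refl equiv_conn] by simp
qed

text \<open>The cup ends in the two lower corners, which the 1-smoothing joins: a circle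
  \<open>q\<close> splits off and a new cup is left above it.\<close>

lemma represents_curl:
  assumes "represents m (u @ [Cup g, Cross () g] @ v) S v1 P"
  shows "\<exists>l\<in>S. \<exists>C. C \<in> closed_circles (S - {l}) (insert l v1) \<and> partly_touches C l \<and>
    represents m (u @ [Cup g] @ v) (S - {l}) (insert l v1) (insert C P)"
  using assms
proof (rule representsE)
  fix u' w' v' xs y1 y2 V1 V2 V3
  assume er: "erase u' = u" "erase w' = [Cup g, Cross () g]" "erase v' = v" and xs: "length xs = m"
    and S: "S \<subseteq> {..<ncross D}" "v1 \<inter> S = {}" "v1 \<subseteq> {..<ncross D}" and P: "P \<subseteq> closed_circles S v1"
    and runs: "run (conn D S v1) u' xs y1 V1" "run (conn D S v1) w' y1 y2 V2" "run (conn D S v1) v' y2 xs V3"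
    and dist: "distinct (labels (u' @ w' @ v'))" "set (labels (u' @ w' @ v')) = S"
    and cov: "closed_circles S v1 \<subseteq> P \<union> set xs \<union> (V1 \<union> V2 \<union> V3)"
  let ?R = "conn D S v1"
  obtain l where w': "w' = [Cup g, Cross l g]" using er(2) by (auto simp: erase_conv map_letter_simps)
  have l: "l \<in> S" "l < ncross D" "l \<notin> v1" using dist(2) S w' by auto
  obtain zs N N' where st: "step ?R (Cup g) y1 zs N" "step ?R (Cross l g) zs y2 N'" "V2 = N \<union> N'"
    using runs(2) unfolding w' run_two by blast
  obtain p r where p: "length p = g" "y1 = p @ r" using step_prefix[OF st(1)] by auto
  obtain q where q: "zs = p @ q # q # r" "N = {q}" using st(1) unfolding p(2) step_Cup[OF p(1)] by blast
  obtain c d where c: "y2 = p @ c # d # r" "corners ?R l q q c d" "N' = {c, d}"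
    using st(2) unfolding q(1) step_Cross[OF p(1)] by auto
  obtain i j where ij: "joined True i j" "q = ?R `` {pt l i}" "q = ?R `` {pt l j}"
    using corners_bottom[OF c(2)] by blast
  let ?w = "insert l v1"
  have Rw: "conn D S ?w = ?R" by (rule conn_cong) (use l in auto)
  have "(pt l i, pt l j) \<in> conn D S ?w" using class_eqD[of S v1 "pt l i" "pt l j"] ij Rw by simp
  then have C: "q \<in> closed_circles (S - {l}) ?w" "partly_touches q l"
    using closed_one[OF S(1) l(1), of ?w i j] ij Rw by simp_all
  have lab: "set (labels w') = {l}" by (simp add: w')
  have "represents (length xs) (erase u' @ erase ([Cup g] :: nat letter list) @ erase v') (S - {l}) ?w (insert q P)"
  proof (rule represents_replace[OF S refl runs dist cov, where V2' = "{conn D (S - {l}) ?w `` c}"])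
    let ?R' = "conn D (S - {l}) ?w"
    have sub: "?R \<subseteq> ?R'" by (rule conn_mono) (use l in auto)
    note cr = corners_resolved[OF refl refl sub l(2) _ c(2)]
    have lp: "length (map ((``) ?R') p) = g" using p by simp
    show "run ?R' [Cup g] (map ((``) ?R') y1) (map ((``) ?R') y2) {?R' `` c}"
      unfolding run_single p(2) c(1) map_append step_Cup[OF lp] using cr(4) by auto
    show "insert q P \<subseteq> closed_circles (S - {l}) ?w"
      using C(1) closed_circles_remove[OF P S(2), of ?w "S - {l}"] S l by auto
    fix k assume "k \<in> V2 \<union> (\<lambda>e. ?R `` {end_arc D e}) ` ends {l}"
    then have "k = q \<or> k = c \<or> k = d" using corners_ends[OF c(2)] c(3) q(2) st(3) by blast
    then show "?R' `` k \<in> insert q P \<union> (``) ?R' ` set y1 \<union> {?R' `` c}"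
      using cr(4) closed_class_self[OF C(1)] by auto
  qed (use S lab l in auto)
  then show ?thesis using l(1) C er xs by auto
qed

text \<open>\<open>bounded_split\<close> keeps the 1-smoothing with the circle labelled
  \<open>v_plus\<close>. The former costs one in both degrees, the latter another one in the
  q-degree.\<close>

lemma bounded_curl:
  assumes "bounded_word m (u @ [Cup g] @ v) (a - 1) (b - 2)"
  shows "bounded_word m (u @ [Cup g, Cross () g] @ v) a b"
  unfolding bounded_word_def
proof (intro allI impI)
  fix S v1 P and lab :: "'a labelling"
  assume rep: "represents m (u @ [Cup g, Cross () g] @ v) S v1 P"
  note basic = represents_basic[OF rep]
  obtain l C where l: "l \<in> S" "C \<in> closed_circles (S - {l}) (insert l v1)" "partly_touches C l"
    "represents m (u @ [Cup g] @ v) (S - {l}) (insert l v1) (insert C P)"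
    using represents_curl[OF rep] by blast
  have "l \<notin> v1" using basic(2) l(1) by blast
  then have card: "card (insert l v1) = card v1 + 1" using basic(3) by simp
  have "C \<notin> P" by (rule touching_not_closed[OF basic(2,4,1) l(3,1)])
  note sum = sum_insert_label[OF basic(5) this]
  show "bounded_by (state_cells S v1 P lab) (int (card v1) + a) (int (card v1) + (\<Sum>C\<in>P. label_degree (lab C)) + b)"
  proof (rule bounded_split[OF basic(2,4,1) l(1-3)], rule bounded_wordD[OF assms l(4)])
    show "int (card (insert l v1)) + (a - 1) \<le> int (card v1) + a" unfolding card by simp
    show "int (card (insert l v1)) + (\<Sum>K\<in>insert C P. label_degree ((lab(C := v_plus)) K)) + (b - 2)
        \<le> int (card v1) + (\<Sum>C\<in>P. label_degree (lab C)) + b"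
      unfolding card sum by simp
  qed
qed

text \<open>Cup and cap connect the two corners on one side of the crossing, so it is the
  0-smoothing that splits off a circle; a single vertical strand is left.\<close>

lemma represents_kink:
  assumes w: "w = [Cup (Suc g), Cross () g, Cap (Suc g)] \<or> w = [Cup g, Cross () (Suc g), Cap g]"
    and rep: "represents m (u @ w @ v) S v1 P"
  shows "\<exists>l\<in>S. \<exists>C. C \<in> closed_circles (S - {l}) v1 \<and> partly_touches C l \<and>
    represents m (u @ v) (S - {l}) v1 (insert C P)"
  using rep
proof (rule representsE)
  fix u' w' v' xs y1 y2 V1 V2 V3
  assume er: "erase u' = u" "erase w' = w" "erase v' = v" and xs: "length xs = m"
    and S: "S \<subseteq> {..<ncross D}" "v1 \<inter> S = {}" "v1 \<subseteq> {..<ncross D}" and P: "P \<subseteq> closed_circles S v1"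
    and runs: "run (conn D S v1) u' xs y1 V1" "run (conn D S v1) w' y1 y2 V2" "run (conn D S v1) v' y2 xs V3"
    and dist: "distinct (labels (u' @ w' @ v'))" "set (labels (u' @ w' @ v')) = S"
    and cov: "closed_circles S v1 \<subseteq> P \<union> set xs \<union> (V1 \<union> V2 \<union> V3)"
  let ?R = "conn D S v1"
  \<comment> \<open>Common form of the two mirror images: \<open>q\<close> is the circle,
    \<open>z\<close> the strand entering from below and \<open>t\<close> the strand leaving
    above.\<close>
  have core: ?thesis
    if lab: "labels w' = [l]" and y: "y1 = p @ z # s" "y2 = p @ t # s"
      and ij: "joined False i j" "q = ?R `` {pt l i}" "q = ?R `` {pt l j}" and c: "corners ?R l a b c d"
      and V2: "V2 = {q, c, d}" and sets: "{a, b} = {q, z}" "{c, d} = {q, t}" and zt: "a = z \<and> c = t \<or> b = z \<and> d = t"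
    for l q p z t s i j a b c d
  proof -
  have l: "l \<in> S" "l < ncross D" "l \<notin> v1" using dist(2) S lab by auto
  have "(pt l i, pt l j) \<in> ?R" using class_eqD[of S v1 "pt l i" "pt l j"] ij by simp
  then have C: "q \<in> closed_circles (S - {l}) v1" "partly_touches q l"
    using closed_one[OF S(1) l(1), of v1 i j] ij l by simp_all
  have "represents (length xs) (erase u' @ erase ([] :: nat letter list) @ erase v') (S - {l}) v1 (insert q P)"
  proof (rule represents_replace[OF S refl runs dist cov, where V2' = "{}"])
    let ?R' = "conn D (S - {l}) v1"
    have sub: "?R \<subseteq> ?R'" by (rule conn_mono) auto
    note cr = corners_resolved[OF refl refl sub l(2) _ c]
    have zt': "?R' `` z = ?R' `` t" using cr(1,2) l(3) zt by auto
    show "run ?R' [] (map ((``) ?R') y1) (map ((``) ?R') y2) {}"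
      using zt' by (simp add: y)
    show "insert q P \<subseteq> closed_circles (S - {l}) v1"
      using C(1) closed_circles_remove[OF P S(2), of v1 "S - {l}"] S l by auto
    fix k assume "k \<in> V2 \<union> (\<lambda>e. ?R `` {end_arc D e}) ` ends {l}"
    then have "k \<in> {q, c, d} \<or> k \<in> (\<lambda>e. ?R `` {end_arc D e}) ` ends {l}" by (simp only: V2 Un_iff)
    then have "k \<in> {q, a, b, c, d}" using corners_ends[OF c, of k] by auto
    moreover have "a \<in> {q, z}" "b \<in> {q, z}" unfolding sets(1)[symmetric] by simp_all
    moreover have "c \<in> {q, t}" "d \<in> {q, t}" unfolding sets(2)[symmetric] by simp_all
    ultimately have "k = q \<or> k = z \<or> k = t" by blast
    then show "?R' `` k \<in> insert q P \<union> (``) ?R' ` set y1 \<union> {}"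
      using zt' closed_class_self[OF C(1)] by (auto simp: y)
  qed (use S lab l in auto)
  then show ?thesis using l(1) C er xs by auto
qed
  show ?thesis
    using w
  proof
    assume "w = [Cup (Suc g), Cross () g, Cap (Suc g)]"
    then obtain l where w': "w' = [Cup (Suc g), Cross l g, Cap (Suc g)]" using er(2) by (auto simp: erase_conv map_letter_simps)
    obtain zs us N N' N'' where st: "step ?R (Cup (Suc g)) y1 zs N" "step ?R (Cross l g) zs us N'" "step ?R (Cap (Suc g)) us y2 N''" "V2 = N \<union> (N' \<union> N'')"
      using runs(2) unfolding w' run_three by blast
    obtain p z s where p: "length p = g" "y1 = p @ z # s" by (rule step_Suc_prefix[OF st(1), of g]) auto
    obtain q where q: "zs = p @ z # q # q # s" "N = {q}" using st(1) unfolding p(2) step_Cup_Suc[OF p(1)] by blast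
    obtain c d where c: "us = p @ c # d # q # s" "corners ?R l z q c d" "N' = {c, d}"
      using st(2) unfolding q(1) step_Cross[OF p(1)] by auto
    have y2: "d = q" "y2 = p @ c # s" "N'' = {}" using st(3) unfolding c(1) step_Cap_Suc[OF p(1)] by auto
    obtain i j where ij: "joined False i j" "q = ?R `` {pt l i}" "d = ?R `` {pt l j}"
      using corners_right[OF c(2)] by blast
    have "labels w' = [l]" "V2 = {q, c, d}" by (auto simp: w' st(4) q(2) c(3) y2(3))
    then show ?thesis
      by (intro core[of l p z s c i j q z q c d]) (use p(2) y2(1,2) ij c(2) in auto)
  next
    assume "w = [Cup g, Cross () (Suc g), Cap g]"
    then obtain l where w': "w' = [Cup g, Cross l (Suc g), Cap g]" using er(2) by (auto simp: erase_conv map_letter_simps)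
    obtain zs us N N' N'' where st: "step ?R (Cup g) y1 zs N" "step ?R (Cross l (Suc g)) zs us N'" "step ?R (Cap g) us y2 N''" "V2 = N \<union> (N' \<union> N'')"
      using runs(2) unfolding w' run_three by blast
    obtain p r where p: "length p = g" "y1 = p @ r" using step_prefix[OF st(1)] by auto
    obtain q where q: "zs = p @ q # q # r" "N = {q}" using st(1) unfolding p(2) step_Cup[OF p(1)] by blast
    obtain z s c d where c: "r = z # s" "us = p @ q # c # d # s" "corners ?R l q z c d" "N' = {c, d}"
      using st(2) unfolding q(1) step_Cross_Suc[OF p(1)] by auto
    have y2: "c = q" "y2 = p @ d # s" "N'' = {}" using st(3) unfolding c(2) step_Cap[OF p(1)] by auto
    obtain i j where ij: "joined False i j" "q = ?R `` {pt l i}" "c = ?R `` {pt l j}"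
      using corners_left[OF c(3)] by blast
    have "labels w' = [l]" "V2 = {q, c, d}" by (auto simp: w' st(4) q(2) c(4) y2(3))
    then show ?thesis
      by (intro core[of l p z s d i j q q z c d]) (use p(2) y2(1,2) ij c(1,3) in auto)
  qed
qed

text \<open>The circle is left with the label \<open>v_minus\<close> of degree -1 and no 1-smoothing
  is made, so the shorter word may exceed the q-bound by one.\<close>

lemma bounded_kink:
  assumes w: "w = [Cup (Suc g), Cross () g, Cap (Suc g)] \<or> w = [Cup g, Cross () (Suc g), Cap g]"
    and "bounded_word m (u @ v) a (b + 1)"
  shows "bounded_word m (u @ w @ v) a b"
  unfolding bounded_word_def
proof (intro allI impI)
  fix S v1 P and lab :: "'a labelling"
  assume rep: "represents m (u @ w @ v) S v1 P"
  note basic = represents_basic[OF rep]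
  obtain l C where l: "l \<in> S" "C \<in> closed_circles (S - {l}) v1" "partly_touches C l"
    "represents m (u @ v) (S - {l}) v1 (insert C P)"
    using represents_kink[OF w rep] by blast
  have "C \<notin> P" by (rule touching_not_closed[OF basic(2,4,1) l(3,1)])
  note sum = sum_insert_label[OF basic(5) this]
  show "bounded_by (state_cells S v1 P lab) (int (card v1) + a) (int (card v1) + (\<Sum>C\<in>P. label_degree (lab C)) + b)"
  proof (rule bounded_merge[OF basic(2,4,1) l(1-3)], rule bounded_wordD[OF assms(2) l(4)])
    show "int (card v1) + (\<Sum>K\<in>insert C P. label_degree ((lab(C := v_minus)) K)) + (b + 1)
        \<le> int (card v1) + (\<Sum>C\<in>P. label_degree (lab C)) + b"
      unfolding sum by simp
  qed simp
qed


text \<open>Here \<open>l'\<close> is the first crossing above the cup and \<open>l\<close> the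
  second. The 0-smoothing of \<open>l'\<close> and the 1-smoothing of \<open>l\<close> close the cup
  to a circle; \<open>bounded_slide\<close> leaves only the opposite smoothings, which give the cup
  displaced by one strand.\<close>

lemma represents_slide:
  assumes w: "w = [Cup (Suc g), Cross () g, Cross () (Suc g)] \<and> h = g \<or> w = [Cup g, Cross () (Suc g), Cross () g] \<and> h = Suc g"
    and rep: "represents m (u @ w @ v) S v1 P"
  shows "\<exists>l\<in>S. \<exists>l'\<in>S. l \<noteq> l' \<and> (\<exists>C. C \<in> closed_circles (S - {l, l'}) (insert l v1) \<and> partly_touches C l \<and> partly_touches C l') \<and>
    represents m (u @ [Cup h] @ v) (S - {l, l'}) (insert l' v1) P"
  using rep
proof (rule representsE)
  fix u' w' v' xs y1 y2 V1 V2 V3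
  assume er: "erase u' = u" "erase w' = w" "erase v' = v" and xs: "length xs = m"
    and S: "S \<subseteq> {..<ncross D}" "v1 \<inter> S = {}" "v1 \<subseteq> {..<ncross D}" and P: "P \<subseteq> closed_circles S v1"
    and runs: "run (conn D S v1) u' xs y1 V1" "run (conn D S v1) w' y1 y2 V2" "run (conn D S v1) v' y2 xs V3"
    and dist: "distinct (labels (u' @ w' @ v'))" "set (labels (u' @ w' @ v')) = S"
    and cov: "closed_circles S v1 \<subseteq> P \<union> set xs \<union> (V1 \<union> V2 \<union> V3)"
  let ?R = "conn D S v1"
  have core: ?thesis
    if lab: "labels w' = [l', l]"
      and c': "corners ?R l' a' b' c' d'" and c: "corners ?R l a b c d"
      and j': "joined False i' j'" and j: "joined True i j"
      and e: "?R `` {pt l' i'} = ?R `` {pt l i}" "?R `` {pt l' j'} = ?R `` {pt l j}"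
      and V2: "V2 = {q, c', d', c, d}"
      and mem: "{a', b'} = {q, z}" "{a, b} \<subseteq> {q, c', d'}"
      and y1: "y1 = p @ z # s" and p: "length p = g"
      and y2: "\<And>f. f a' = f b' \<Longrightarrow> f c' = f d' \<Longrightarrow> f a = f c \<Longrightarrow> f b = f d \<Longrightarrow>
        step (conn D (S - {l, l'}) (insert l' v1)) (Cup h) (map f y1) (map f y2) {f c'}"
    for l l' a' b' c' d' a b c d i' j' i j q z p s
  proof -
    have dl: "l \<noteq> l'" using dist(1) lab by auto
    have l: "l \<in> S" "l < ncross D" "l \<notin> v1" "l' \<in> S" "l' < ncross D" "l' \<notin> v1" using dist(2) S lab by auto
    let ?w = "insert l v1"
    have Rw: "conn D S ?w = ?R" by (rule conn_cong) (use l in auto)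
    have "\<exists>Y. Y \<in> closed_circles (S - {l, l'}) ?w \<and> partly_touches Y l \<and> partly_touches Y l'"
    proof (rule closed_two[OF S(1) l(1,4) dl])
      show "joined (l \<in> ?w) i j" "joined (l' \<in> ?w) i' j'" using j j' l dl by auto
      show "(pt l' i', pt l i) \<in> conn D S ?w" "(pt l' j', pt l j) \<in> conn D S ?w"
        unfolding Rw by (rule class_eqD[OF e(1)], rule class_eqD[OF e(2)])
    qed
    moreover have "represents (length xs) (erase u' @ erase ([Cup h] :: nat letter list) @ erase v') (S - {l, l'}) (insert l' v1) P"
    proof (rule represents_replace[OF S refl runs dist cov, where V2' = "{conn D (S - {l, l'}) (insert l' v1) `` c'}"])
      let ?R' = "conn D (S - {l, l'}) (insert l' v1)"
      have sub: "?R \<subseteq> ?R'" by (rule conn_mono) (use l in auto)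
      have cr': "?R' `` a' = ?R' `` b'" "?R' `` c' = ?R' `` d'"
        by (rule corners_resolved(3)[OF refl refl sub l(5) _ c'] corners_resolved(4)[OF refl refl sub l(5) _ c']; simp)+
      have cr: "?R' `` a = ?R' `` c" "?R' `` b = ?R' `` d"
        by (rule corners_resolved(1)[OF refl refl sub l(2) _ c] corners_resolved(2)[OF refl refl sub l(2) _ c]; use l dl in simp)+
      show "run ?R' [Cup h] (map ((``) ?R') y1) (map ((``) ?R') y2) {?R' `` c'}"
        unfolding run_single by (rule y2[OF cr' cr])
      show "P \<subseteq> closed_circles (S - {l, l'}) (insert l' v1)"
        by (rule closed_circles_remove[OF P S(2)]) (use S l in auto)
      have fz: "?R' `` x = ?R' `` z" if "x \<in> {a', b'}" for x
      proof -
        have "z \<in> {a', b'}" unfolding mem(1) by simp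
        then show ?thesis using that cr'(1) by auto
      qed
      have fq: "?R' `` q = ?R' `` z"
      proof -
        have "q \<in> {a', b'}" unfolding mem(1) by simp
        then show ?thesis by (rule fz)
      qed
      have ab: "?R' `` x \<in> {?R' `` z, ?R' `` c'}" if "x \<in> {a, b}" for x
      proof -
        have "x \<in> {q, c', d'}" using that mem(2) by blast
        then show ?thesis using fq cr'(2) by auto
      qed
      fix k assume "k \<in> V2 \<union> (\<lambda>e. ?R `` {end_arc D e}) ` ends {l, l'}"
      then have "k \<in> {q, c', d', c, d} \<or> k \<in> (\<lambda>e. ?R `` {end_arc D e}) ` ends {l} \<or> k \<in> (\<lambda>e. ?R `` {end_arc D e}) ` ends {l'}"
        unfolding V2 ends_def by blast
      then have "k \<in> {q} \<or> k \<in> {a, b} \<or> k \<in> {c, d} \<or> k \<in> {a', b'} \<or> k \<in> {c', d'}"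
      proof (elim disjE)
        assume "k \<in> {q, c', d', c, d}"
        then show ?thesis by auto
      next
        assume "k \<in> (\<lambda>e. ?R `` {end_arc D e}) ` ends {l}"
        from corners_ends[OF c this] show ?thesis by (elim disjE) simp_all
      next
        assume "k \<in> (\<lambda>e. ?R `` {end_arc D e}) ` ends {l'}"
        from corners_ends[OF c' this] show ?thesis by (elim disjE) simp_all
      qed
      then have "?R' `` k \<in> {?R' `` z, ?R' `` c'}"
      proof (elim disjE)
        assume "k \<in> {c, d}"
        then consider "k = c" | "k = d" by blast
        then show ?thesis
        proof cases
          case 1
          show ?thesis unfolding 1 cr(1)[symmetric] by (rule ab) simp
        next
          case 2
          show ?thesis unfolding 2 cr(2)[symmetric] by (rule ab) simp
        qed
      next
        assume "k \<in> {q}"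
        then show ?thesis using fq by simp
      next
        assume "k \<in> {a, b}"
        then show ?thesis by (rule ab)
      next
        assume "k \<in> {a', b'}"
        then show ?thesis using fz[of k] by simp
      next
        assume "k \<in> {c', d'}"
        then show ?thesis using cr'(2) by auto
      qed
      then show "?R' `` k \<in> P \<union> (``) ?R' ` set y1 \<union> {?R' `` c'}" unfolding y1 by auto
    qed (use S lab l in auto)
    ultimately show ?thesis using l(1,4) dl er xs by auto
  qed
  from w show ?thesis
  proof (elim disjE conjE)
    assume "w = [Cup (Suc g), Cross () g, Cross () (Suc g)]" and h: "h = g"
    then obtain l l' where w': "w' = [Cup (Suc g), Cross l' g, Cross l (Suc g)]" using er(2) by (auto simp: erase_conv map_letter_simps)
    obtain zs us N N' N'' where st: "step ?R (Cup (Suc g)) y1 zs N" "step ?R (Cross l' g) zs us N'" "step ?R (Cross l (Suc g)) us y2 N''" "V2 = N \<union> (N' \<union> N'')"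
      using runs(2) unfolding w' run_three by blast
    obtain p z s where p: "length p = g" "y1 = p @ z # s" by (rule step_Suc_prefix[OF st(1), of g]) auto
    obtain q where q: "zs = p @ z # q # q # s" "N = {q}" using st(1) unfolding p(2) step_Cup_Suc[OF p(1)] by blast
    obtain c' d' where c': "us = p @ c' # d' # q # s" "corners ?R l' z q c' d'" "N' = {c', d'}"
      using st(2) unfolding q(1) step_Cross[OF p(1)] by auto
    obtain c d where c: "y2 = p @ c' # c # d # s" "corners ?R l d' q c d" "N'' = {c, d}"
      using st(3) unfolding c'(1) step_Cross_Suc[OF p(1)] by auto
    obtain i' j' where j': "joined False i' j'" "q = ?R `` {pt l' i'}" "d' = ?R `` {pt l' j'}" using corners_right[OF c'(2)] by blast
    obtain j i where j: "joined True j i" "d' = ?R `` {pt l j}" "q = ?R `` {pt l i}" using corners_bottom[OF c(2)] by blast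
    have ji: "joined True i j" using j(1) by (auto simp: joined_def)
    show ?thesis
    proof (rule core[OF _ c'(2) c(2) j'(1) ji, of q z p s])
      show "labels w' = [l', l]" by (simp add: w')
      show "V2 = {q, c', d', c, d}" by (auto simp: st(4) q(2) c'(3) c(3))
      fix f :: "'a set \<Rightarrow> 'a set" assume f: "f z = f q" "f c' = f d'" "f d' = f c" "f q = f d"
      have "length (map f p) = g" using p(1) by simp
      from step_Cup[OF this] show "step (conn D (S - {l, l'}) (insert l' v1)) (Cup h) (map f y1) (map f y2) {f c'}"
        unfolding h p(2) c(1) map_append using f by simp
    qed (use j' j p in auto)
  next
    assume "w = [Cup g, Cross () (Suc g), Cross () g]" and h: "h = Suc g"
    then obtain l l' where w': "w' = [Cup g, Cross l' (Suc g), Cross l g]" using er(2) by (auto simp: erase_conv map_letter_simps)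
    obtain zs us N N' N'' where st: "step ?R (Cup g) y1 zs N" "step ?R (Cross l' (Suc g)) zs us N'" "step ?R (Cross l g) us y2 N''" "V2 = N \<union> (N' \<union> N'')"
      using runs(2) unfolding w' run_three by blast
    obtain p r where p: "length p = g" "y1 = p @ r" using step_prefix[OF st(1)] by auto
    obtain q where q: "zs = p @ q # q # r" "N = {q}" using st(1) unfolding p(2) step_Cup[OF p(1)] by blast
    obtain z s c' d' where c': "r = z # s" "us = p @ q # c' # d' # s" "corners ?R l' q z c' d'" "N' = {c', d'}"
      using st(2) unfolding q(1) step_Cross_Suc[OF p(1)] by auto
    obtain c d where c: "y2 = p @ c # d # d' # s" "corners ?R l q c' c d" "N'' = {c, d}"
      using st(3) unfolding c'(2) step_Cross[OF p(1)] by auto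
    obtain i' j' where j': "joined False i' j'" "q = ?R `` {pt l' i'}" "c' = ?R `` {pt l' j'}" using corners_left[OF c'(3)] by blast
    obtain i j where j: "joined True i j" "q = ?R `` {pt l i}" "c' = ?R `` {pt l j}" using corners_bottom[OF c(2)] by blast
    show ?thesis
    proof (rule core[OF _ c'(3) c(2) j'(1) j(1), of q z p s])
      show "labels w' = [l', l]" by (simp add: w')
      show "V2 = {q, c', d', c, d}" by (auto simp: st(4) q(2) c'(4) c(3))
      fix f :: "'a set \<Rightarrow> 'a set" assume f: "f q = f z" "f c' = f d'" "f q = f c" "f c' = f d"
      have "length (map f p) = g" using p(1) by simp
      from step_Cup_Suc[OF this] show "step (conn D (S - {l, l'}) (insert l' v1)) (Cup h) (map f y1) (map f y2) {f c'}"
        unfolding h p(2) c(1) c'(1) using f by simp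
    qed (use j' j p c'(1) in auto)
  qed
qed

lemma bounded_slide_word:
  assumes w: "w = [Cup (Suc g), Cross () g, Cross () (Suc g)] \<and> h = g \<or> w = [Cup g, Cross () (Suc g), Cross () g] \<and> h = Suc g"
    and b: "bounded_word m (u @ [Cup h] @ v) (a - 1) (b - 1)"
  shows "bounded_word m (u @ w @ v) a b"
  unfolding bounded_word_def
proof (intro allI impI)
  fix S v1 P and lab :: "'a labelling"
  assume rep: "represents m (u @ w @ v) S v1 P"
  note basic = represents_basic[OF rep]
  obtain l l' C where l: "l \<in> S" "l' \<in> S" "l \<noteq> l'" "C \<in> closed_circles (S - {l, l'}) (insert l v1)" "partly_touches C l" "partly_touches C l'"
    "represents m (u @ [Cup h] @ v) (S - {l, l'}) (insert l' v1) P"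
    using represents_slide[OF w rep] by blast
  have "l' \<notin> v1" using basic(2) l(2) by blast
  then have card: "card (insert l' v1) = card v1 + 1" using basic(3) by simp
  show "bounded_by (state_cells S v1 P lab) (int (card v1) + a) (int (card v1) + (\<Sum>C\<in>P. label_degree (lab C)) + b)"
    by (rule bounded_slide[OF basic(2,4,1) l(1-6)], rule bounded_wordD[OF b l(7)]; simp add: card)
qed

lemma bounded_circle:
  assumes b: "bounded_word m (u @ v) a (b - 1)"
  shows "bounded_word m (u @ [Cup g, Cap g] @ v) a b"
  unfolding bounded_word_def
proof (intro allI impI)
  fix S v1 P and lab :: "'a labelling"
  assume rep: "represents m (u @ [Cup g, Cap g] @ v) S v1 P"
  note basic = represents_basic[OF rep]
  from rep show "bounded_by (state_cells S v1 P lab) (int (card v1) + a) (int (card v1) + (\<Sum>C\<in>P. label_degree (lab C)) + b)"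
  proof (rule representsE)
    fix u' w' v' xs y1 y2 V1 V2 V3
    assume er: "erase u' = u" "erase w' = [Cup g, Cap g]" "erase v' = v" and xs: "length xs = m"
      and S: "S \<subseteq> {..<ncross D}" "v1 \<inter> S = {}" "v1 \<subseteq> {..<ncross D}" and P: "P \<subseteq> closed_circles S v1"
      and runs: "run (conn D S v1) u' xs y1 V1" "run (conn D S v1) w' y1 y2 V2" "run (conn D S v1) v' y2 xs V3"
      and dist: "distinct (labels (u' @ w' @ v'))" "set (labels (u' @ w' @ v')) = S"
      and cov: "closed_circles S v1 \<subseteq> P \<union> set xs \<union> (V1 \<union> V2 \<union> V3)"
    let ?R = "conn D S v1"
    have w': "w' = [Cup g, Cap g]" using er(2) by (auto simp: erase_conv map_letter_simps)
    obtain zs N N' where st: "step ?R (Cup g) y1 zs N" "step ?R (Cap g) zs y2 N'" "V2 = N \<union> N'"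
      using runs(2) unfolding w' run_two by blast
    obtain p r where p: "length p = g" "y1 = p @ r" using step_prefix[OF st(1)] by auto
    obtain q where q: "zs = p @ q # q # r" "N = {q}" using st(1) unfolding p(2) step_Cup[OF p(1)] by blast
    have y2: "y2 = y1" "N' = {}" using st(2) unfolding q(1) p(2) step_Cap[OF p(1)] by auto
    have sub: "S - {} = S" by simp
    have rep': "represents m (u @ v) S v1 P'"
      if P': "P \<subseteq> P'" "P' \<subseteq> closed_circles S v1" "?R `` q \<in> closed_circles S v1 \<Longrightarrow> ?R `` q \<in> P'" for P'
    proof -
      have "represents (length xs) (erase u' @ erase ([] :: nat letter list) @ erase v') (S - {}) v1 P'"
      proof (rule represents_replace[OF S refl runs dist cov, where V2' = "{}"])
        show "run (conn D (S - {}) v1) [] (map ((``) (conn D (S - {}) v1)) y1) (map ((``) (conn D (S - {}) v1)) y2) {}"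
          by (simp add: y2)
        show "P' \<subseteq> closed_circles (S - {}) v1" using P'(2) by simp
        fix k assume "k \<in> V2 \<union> (\<lambda>e. ?R `` {end_arc D e}) ` ends {}" "conn D (S - {}) v1 `` k \<in> closed_circles (S - {}) v1"
        then show "conn D (S - {}) v1 `` k \<in> P' \<union> (``) (conn D (S - {}) v1) ` set y1 \<union> {}"
          using P'(3) by (auto simp: st(3) q(2) y2(2) ends_def)
      qed (use S P' w' in auto)
      then show ?thesis using er xs by simp
    qed
    show ?thesis
    proof (cases "?R `` q \<in> closed_circles S v1 \<and> ?R `` q \<notin> P")
      case True
      let ?C = "?R `` q"
      have r: "represents m (u @ v) S v1 (insert ?C P)" by (rule rep') (use True P in auto)
      note sum = sum_insert_label[OF basic(5), of ?C lab]
      show ?thesis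
      proof (rule bounded_label[OF S(2) P S(1) True[THEN conjunct1] True[THEN conjunct2]])
        show "bounded_by (state_cells S v1 (insert ?C P) (lab(?C := v_plus))) (int (card v1) + a) (int (card v1) + (\<Sum>C\<in>P. label_degree (lab C)) + b)"
          by (rule bounded_wordD[OF b r]) (use sum[of v_plus] True in simp_all)
        show "bounded_by (state_cells S v1 (insert ?C P) (lab(?C := v_minus))) (int (card v1) + a) (int (card v1) + (\<Sum>C\<in>P. label_degree (lab C)) + b)"
          by (rule bounded_wordD[OF b r]) (use sum[of v_minus] True in simp_all)
      qed
    next
      case False
      have r: "represents m (u @ v) S v1 P" by (rule rep') (use False P in auto)
      show ?thesis by (rule bounded_wordD[OF b r]) simp_all
    qed
  qed
qed

text \<open>No crossing is left, so all cells have the same homological degree. Apart from the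
  labelled circles, only the at most \<open>m\<close> circles formed by the strands contribute to
  the q-degree.\<close>

lemma bounded_Nil: "bounded_word m [] 0 (int m)"
  unfolding bounded_word_def
proof (intro allI impI)
  fix S v1 P and lab :: "'a labelling"
  assume rep: "represents m [] S v1 P"
  note basic = represents_basic[OF rep]
  obtain xs where xs: "length xs = m" "S = {}" "closed_circles S v1 \<subseteq> P \<union> set xs"
    using rep unfolding represents_def by auto
  have cl: "closed_circles S v1 = circles D v1"
    by (simp add: closed_circles_def circles_conn xs(2) ends_def)
  have degs: "hdeg c = int (card v1) \<and> qdeg c \<le> int (card v1) + (\<Sum>C\<in>P. label_degree (lab C)) + int m"
    if "c \<in> state_cells S v1 P lab" for c
  proof -
    obtain v x where vx: "c = (v, x)" by (cases c)
    have c: "c = (v1, x)" "\<forall>C\<in>P. x C = lab C" using that xs(2) by (auto simp: state_cells_def vx)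
    have le: "label_degree t \<le> 1" for t by (cases t) auto
    have "(\<Sum>C\<in>circles D v1 - P. label_degree (x C)) \<le> (\<Sum>C\<in>circles D v1 - P. 1)"
      by (intro sum_mono le)
    also have "\<dots> = int (card (circles D v1 - P))" by simp
    also have "card (circles D v1 - P) \<le> card (set xs)" using xs(3) unfolding cl by (intro card_mono) auto
    also have "card (set xs) \<le> m" using card_length[of xs] xs(1) by simp
    finally have "(\<Sum>C\<in>circles D v1 - P. label_degree (x C)) \<le> int m" by simp
    moreover have "(\<Sum>C\<in>circles D v1. label_degree (x C)) = (\<Sum>C\<in>circles D v1 - P. label_degree (x C)) + (\<Sum>C\<in>P. label_degree (x C))"
      using basic(4) finite_circles unfolding cl by (intro sum.subset_diff) auto
    moreover have "(\<Sum>C\<in>P. label_degree (x C)) = (\<Sum>C\<in>P. label_degree (lab C))" using c(2) by simp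
    ultimately show ?thesis by (simp add: c(1) hdeg_def qdeg_def)
  qed
  have "exact_at hdeg bd (state_cells S v1 P lab \<inter> layer j) i"
    if "i > int (card v1) \<or> j > int (card v1) + (\<Sum>C\<in>P. label_degree (lab C)) + int m" for i j
  proof (rule exact_at_empty)
    fix c assume "c \<in> state_cells S v1 P lab \<inter> layer j"
    then have "c \<in> state_cells S v1 P lab" "qdeg c = j" by (simp_all add: layer_def)
    then show "hdeg c \<noteq> i" using degs[of c] that by linarith
  qed
  then show "bounded_by (state_cells S v1 P lab) (int (card v1) + 0) (int (card v1) + (\<Sum>C\<in>P. label_degree (lab C)) + int m)"
    by (simp add: bounded_by_def)
qed

end


section \<open>Planar isotopy of words\<close>

lemma map_letter_pos [simp]:
  "position (map_letter f x) = position x" "width_in (map_letter f x) = width_in x" "width_out (map_letter f x) = width_out x"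
  by (cases x; simp)+

lemma map_letter_reposition: "map_letter f (reposition h x) = reposition h (map_letter f x)"
  by (cases x) simp_all

context source_sink_diagram
begin

text \<open>One direction suffices: whatever \<open>W\<close> describes is also described by
  \<open>W'\<close>, so bounds pass from \<open>W'\<close> to \<open>W\<close>. The strands seen may
  change, but none outside \<open>xs\<close> may be lost.\<close>

definition isotopic :: "unit letter list \<Rightarrow> unit letter list \<Rightarrow> bool" where
  "isotopic W W' \<longleftrightarrow> (\<forall>R lw xs ys V. erase lw = W \<longrightarrow> run R lw xs ys V \<longrightarrow>
     (\<exists>lw' V'. erase lw' = W' \<and> run R lw' xs ys V' \<and> set (labels lw') = set (labels lw) \<and>
        (distinct (labels lw) \<longrightarrow> distinct (labels lw')) \<and> V \<subseteq> set xs \<union> V'))"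

lemma isotopicE:
  assumes "isotopic W W'" "erase lw = W" "run R lw xs ys V"
  obtains lw' V' where "erase lw' = W'" "run R lw' xs ys V'" "set (labels lw') = set (labels lw)"
    "distinct (labels lw) \<longrightarrow> distinct (labels lw')" "V \<subseteq> set xs \<union> V'"
  using assms unfolding isotopic_def by blast

lemma isotopic_refl: "isotopic W W"
  unfolding isotopic_def by blast

lemma isotopic_trans:
  assumes "isotopic W W'" "isotopic W' W''" shows "isotopic W W''"
  unfolding isotopic_def
proof (intro allI impI)
  fix R lw xs ys V assume h: "erase lw = W" "run R lw xs ys V"
  obtain l1 V1 where 1: "erase l1 = W'" "run R l1 xs ys V1" "set (labels l1) = set (labels lw)"
    "distinct (labels lw) \<longrightarrow> distinct (labels l1)" "V \<subseteq> set xs \<union> V1"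
    by (rule isotopicE[OF assms(1) h]) (rule that)
  obtain l2 V2 where 2: "erase l2 = W''" "run R l2 xs ys V2" "set (labels l2) = set (labels l1)"
    "distinct (labels l1) \<longrightarrow> distinct (labels l2)" "V1 \<subseteq> set xs \<union> V2"
    by (rule isotopicE[OF assms(2) 1(1,2)]) (rule that)
  have s: "set (labels l2) = set (labels lw)" using 1(3) 2(3) by simp
  have d: "distinct (labels lw) \<longrightarrow> distinct (labels l2)" using 1(4) 2(4) by blast
  have v: "V \<subseteq> set xs \<union> V2" using 1(5) 2(5) by blast
  show "\<exists>lw' V'. erase lw' = W'' \<and> run R lw' xs ys V' \<and> set (labels lw') = set (labels lw) \<and>
        (distinct (labels lw) \<longrightarrow> distinct (labels lw')) \<and> V \<subseteq> set xs \<union> V'"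
    by (intro exI[of _ l2] exI[of _ V2] conjI 2(1,2) s d v)
qed

lemma isotopic_context:
  assumes "isotopic W W'" shows "isotopic (u @ W @ v) (u @ W' @ v)"
  unfolding isotopic_def
proof (intro allI impI)
  fix R lw xs ys V assume h: "erase lw = u @ W @ v" "run R lw xs ys V"
  obtain u' t where ut: "lw = u' @ t" "erase u' = u" "erase t = W @ v"
    using h(1) map_eq_append_conv[of _ lw u "W @ v"] by auto
  obtain w' v' where wv: "t = w' @ v'" "erase w' = W" "erase v' = v"
    using ut(3) map_eq_append_conv[of _ t W v] by auto
  obtain y1 V1 V1' where r1: "run R u' xs y1 V1" "run R (w' @ v') y1 ys V1'" "V = V1 \<union> V1'"
    using h(2) unfolding ut(1) wv(1) run_append[of _ u'] by blast
  obtain y2 V2 V3 where r2: "run R w' y1 y2 V2" "run R v' y2 ys V3" "V1' = V2 \<union> V3"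
    using r1(2) unfolding run_append by blast
  obtain l V4 where l: "erase l = W'" "run R l y1 y2 V4" "set (labels l) = set (labels w')"
    "distinct (labels w') \<longrightarrow> distinct (labels l)" "V2 \<subseteq> set y1 \<union> V4"
    by (rule isotopicE[OF assms wv(2) r2(1)]) (rule that)
  have e: "erase (u' @ l @ v') = u @ W' @ v" by (simp add: ut wv l)
  have r: "run R (u' @ l @ v') xs ys (V1 \<union> (V4 \<union> V3))"
    unfolding run_append using r1(1) r2(2) l(2) by blast
  have s: "set (labels (u' @ l @ v')) = set (labels lw)" by (simp add: ut(1) wv(1) l(3))
  have d: "distinct (labels lw) \<longrightarrow> distinct (labels (u' @ l @ v'))"
    using l(3,4) by (simp add: ut(1) wv(1))
  have v: "V \<subseteq> set xs \<union> (V1 \<union> (V4 \<union> V3))"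
    using run_visited[OF r1(1)] l(5) r1(3) r2(3) by blast
  show "\<exists>lw' V'. erase lw' = u @ W' @ v \<and> run R lw' xs ys V' \<and> set (labels lw') = set (labels lw) \<and>
        (distinct (labels lw) \<longrightarrow> distinct (labels lw')) \<and> V \<subseteq> set xs \<union> V'"
    by (intro exI[of _ "u' @ l @ v'"] exI[of _ "V1 \<union> (V4 \<union> V3)"] conjI e r s d v)
qed

lemma bounded_isotopic:
  assumes "isotopic W W'" "bounded_word m (u @ W' @ v) a b"
  shows "bounded_word m (u @ W @ v) a b"
proof -
  have "represents m (u @ W' @ v) S v1 P" if rep: "represents m (u @ W @ v) S v1 P" for S v1 P
  proof -
    have st: "S \<subseteq> {..<ncross D}" "v1 \<inter> S = {}" "v1 \<subseteq> {..<ncross D}" "P \<subseteq> closed_circles S v1"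
      using rep unfolding represents_def by blast+
    obtain lw xs V where h: "erase lw = u @ W @ v" "run (conn D S v1) lw xs xs V" "length xs = m"
      "distinct (labels lw)" "set (labels lw) = S" "closed_circles S v1 \<subseteq> P \<union> set xs \<union> V"
      using rep unfolding represents_def by blast
    obtain l V' where l: "erase l = u @ W' @ v" "run (conn D S v1) l xs xs V'" "set (labels l) = set (labels lw)"
      "distinct (labels lw) \<longrightarrow> distinct (labels l)" "V \<subseteq> set xs \<union> V'"
      by (rule isotopicE[OF isotopic_context[OF assms(1)] h(1,2)]) (rule that)
    have c: "closed_circles S v1 \<subseteq> P \<union> set xs \<union> V'" using h(6) l(5) by blast
    show ?thesis
      unfolding represents_def
      by (intro conjI st exI[of _ l] exI[of _ xs] exI[of _ V'] l(1,2) c h(3) l(4)[rule_format, OF h(4)]) (simp add: l(3) h(5))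
  qed
  then show ?thesis using assms(2) unfolding bounded_word_def by blast
qed

lemma split_prefix:
  assumes "p @ r = p0 @ w @ s0" "length p0 + length w \<le> length p"
  obtains q where "p = p0 @ w @ q" "s0 = q @ r"
proof -
  have "take (length (p0 @ w)) (p @ r) = p0 @ w" unfolding assms(1) by simp
  then have "take (length (p0 @ w)) p = p0 @ w" using assms(2) by simp
  then have p: "p = p0 @ w @ drop (length (p0 @ w)) p" by (metis append_assoc append_take_drop_id)
  then have "p0 @ w @ (drop (length (p0 @ w)) p @ r) = p0 @ w @ s0" using assms(1) by (metis append_assoc)
  then show thesis using that p by simp
qed

text \<open>Letters on disjoint strands commute; the one further to the right is shifted by the
  change of width at the other. The next lemma is the same with the order reversed.\<close>

lemma commute_left:
  assumes y: "step R y xs ms N1" and x: "step R x ms zs N2" and le: "position x + width_in x \<le> position y"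
  shows "\<exists>ns. step R x xs ns N2 \<and> step R (reposition (position y - width_in x + width_out x) y) ns zs N1"
proof -
  obtain p s u u' where 1: "length p = position y" "xs = p @ u @ s" "ms = p @ u' @ s" "local_step R y u u' N1"
    using y unfolding step_def by blast
  obtain p0 s0 w w' where 2: "length p0 = position x" "ms = p0 @ w @ s0" "zs = p0 @ w' @ s0" "local_step R x w w' N2"
    using x unfolding step_def by blast
  have len: "length w = width_in x" "length w' = width_out x" using local_step_length[OF 2(4)] by auto
  obtain q where q: "p = p0 @ w @ q" "s0 = q @ u' @ s"
    using split_prefix[of p "u' @ s" p0 w s0] 1(1,3) 2(1,2) len le by auto
  have "step R x xs (p0 @ w' @ q @ u @ s) N2"
    unfolding step_def by (intro exI[of _ p0] exI[of _ "q @ u @ s"] exI[of _ w] exI[of _ w'] conjI 2(1,4)) (simp_all add: 1(2) q(1))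
  moreover have "step R (reposition (position y - width_in x + width_out x) y) (p0 @ w' @ q @ u @ s) zs N1"
    unfolding step_def local_step_reposition
    by (intro exI[of _ "p0 @ w' @ q"] exI[of _ s] exI[of _ u] exI[of _ u'] conjI 1(4))
      (use 1(1) 2(1) len in \<open>simp_all add: 2(3) q\<close>)
  ultimately show ?thesis by blast
qed

lemma commute_right:
  assumes x: "step R x xs ms N1" and y: "step R y ms zs N2" and le: "position x + width_out x \<le> position y"
  shows "\<exists>ns. step R (reposition (position y - width_out x + width_in x) y) xs ns N2 \<and> step R x ns zs N1"
proof -
  obtain p s u u' where 1: "length p = position y" "ms = p @ u @ s" "zs = p @ u' @ s" "local_step R y u u' N2"
    using y unfolding step_def by blast
  obtain p0 s0 w w' where 2: "length p0 = position x" "xs = p0 @ w @ s0" "ms = p0 @ w' @ s0" "local_step R x w w' N1"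
    using x unfolding step_def by blast
  have len: "length w = width_in x" "length w' = width_out x" using local_step_length[OF 2(4)] by auto
  obtain q where q: "p = p0 @ w' @ q" "s0 = q @ u @ s"
    using split_prefix[of p "u @ s" p0 w' s0] 1(1,2) 2(1,3) len le by auto
  have "step R (reposition (position y - width_out x + width_in x) y) xs (p0 @ w @ q @ u' @ s) N2"
    unfolding step_def local_step_reposition
    by (intro exI[of _ "p0 @ w @ q"] exI[of _ s] exI[of _ u] exI[of _ u'] conjI 1(4))
      (use 1(1) 2(1) len in \<open>simp_all add: 2(2) q\<close>)
  moreover have "step R x (p0 @ w @ q @ u' @ s) zs N1"
    unfolding step_def by (intro exI[of _ p0] exI[of _ "q @ u' @ s"] exI[of _ w] exI[of _ w'] conjI 2(1,4)) (simp_all add: 1(3) q(1))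
  ultimately show ?thesis by blast
qed

lemma isotopic_commute_left:
  assumes "position x + width_in x \<le> position y"
  shows "isotopic [y, x] [x, reposition (position y - width_in x + width_out x) y]"
  unfolding isotopic_def
proof (intro allI impI)
  fix R lw xs ys V assume h: "erase lw = [y, x]" "run R lw xs ys V"
  obtain ly lx where l: "lw = [ly, lx]" "map_letter (\<lambda>_. ()) ly = y" "map_letter (\<lambda>_. ()) lx = x"
    using h(1) by (auto simp: map_eq_Cons_conv)
  obtain zs N N' where r: "step R ly xs zs N" "step R lx zs ys N'" "V = N \<union> N'" using h(2) unfolding l(1) run_two by blast
  let ?h = "position ly - width_in lx + width_out lx"
  obtain ns where ns: "step R lx xs ns N'" "step R (reposition ?h ly) ns ys N"
    using commute_left[OF r(1,2)] assms l(2,3) by auto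
  show "\<exists>lw' V'. erase lw' = [x, reposition (position y - width_in x + width_out x) y] \<and> run R lw' xs ys V' \<and>
      set (labels lw') = set (labels lw) \<and> (distinct (labels lw) \<longrightarrow> distinct (labels lw')) \<and> V \<subseteq> set xs \<union> V'"
  proof (intro exI[of _ "[lx, reposition ?h ly]"] exI[of _ "N' \<union> N"] conjI impI)
    show "erase [lx, reposition ?h ly] = [x, reposition (position y - width_in x + width_out x) y]"
      unfolding l(2,3)[symmetric] by (simp add: map_letter_reposition)
    show "run R [lx, reposition ?h ly] xs ys (N' \<union> N)" unfolding run_two using ns by blast
  qed (auto simp: l(1) r(3))
qed

lemma isotopic_commute_right:
  assumes "position x + width_out x \<le> position y"
  shows "isotopic [x, y] [reposition (position y - width_out x + width_in x) y, x]"
  unfolding isotopic_def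
proof (intro allI impI)
  fix R lw xs ys V assume h: "erase lw = [x, y]" "run R lw xs ys V"
  obtain ly lx where l: "lw = [lx, ly]" "map_letter (\<lambda>_. ()) ly = y" "map_letter (\<lambda>_. ()) lx = x"
    using h(1) by (auto simp: map_eq_Cons_conv)
  obtain zs N N' where r: "step R lx xs zs N" "step R ly zs ys N'" "V = N \<union> N'" using h(2) unfolding l(1) run_two by blast
  let ?h = "position ly - width_out lx + width_in lx"
  obtain ns where ns: "step R (reposition ?h ly) xs ns N'" "step R lx ns ys N"
    using commute_right[OF r(1,2)] assms l(2,3) by auto
  show "\<exists>lw' V'. erase lw' = [reposition (position y - width_out x + width_in x) y, x] \<and> run R lw' xs ys V' \<and>
      set (labels lw') = set (labels lw) \<and> (distinct (labels lw) \<longrightarrow> distinct (labels lw')) \<and> V \<subseteq> set xs \<union> V'"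
  proof (intro exI[of _ "[reposition ?h ly, lx]"] exI[of _ "N' \<union> N"] conjI impI)
    show "erase [reposition ?h ly, lx] = [reposition (position y - width_out x + width_in x) y, x]"
      unfolding l(2,3)[symmetric] by (simp add: map_letter_reposition)
    show "run R [reposition ?h ly, lx] xs ys (N' \<union> N)" unfolding run_two using ns by blast
  qed (auto simp: l(1) r(3))
qed

lemma isotopic_zigzag:
  "isotopic [Cup (Suc g), Cap g] []" "isotopic [Cup g, Cap (Suc g)] []"
proof -
  have 1: "ys = xs \<and> V \<subseteq> set xs" if r: "run R [Cup (Suc g), Cap g] xs ys V" for R xs ys V
  proof -
    obtain zs N N' where st: "step R (Cup (Suc g)) xs zs N" "step R (Cap g) zs ys N'" "V = N \<union> N'"
      using r unfolding run_two by blast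
    obtain p z s where p: "length p = g" "xs = p @ z # s" by (rule step_Suc_prefix[OF st(1), of g]) auto
    obtain q where q: "zs = p @ z # q # q # s" "N = {q}" using st(1) unfolding p(2) step_Cup_Suc[OF p(1)] by blast
    show ?thesis using st(2) unfolding q(1) step_Cap[OF p(1)] by (auto simp: p(2) st(3) q(2))
  qed
  have 2: "ys = xs \<and> V \<subseteq> set xs" if r: "run R [Cup g, Cap (Suc g)] xs ys V" for R xs ys V
  proof -
    obtain zs N N' where st: "step R (Cup g) xs zs N" "step R (Cap (Suc g)) zs ys N'" "V = N \<union> N'"
      using r unfolding run_two by blast
    obtain p t where p: "length p = g" "xs = p @ t" using step_prefix[OF st(1)] by auto
    obtain q where q: "zs = p @ q # q # t" "N = {q}" using st(1) unfolding p(2) step_Cup[OF p(1)] by blast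
    show ?thesis using st(2) unfolding q(1) step_Cap_Suc[OF p(1)] by (auto simp: p(2) st(3) q(2))
  qed
  show "isotopic [Cup (Suc g), Cap g] []"
    unfolding isotopic_def
  proof (intro allI impI)
    fix R lw xs ys V assume h: "erase lw = [Cup (Suc g), Cap g]" "run R lw xs ys V"
    have lw: "lw = [Cup (Suc g), Cap g]" using h(1) by (auto simp: map_eq_Cons_conv map_letter_simps)
    show "\<exists>lw' V'. erase lw' = [] \<and> run R lw' xs ys V' \<and> set (labels lw') = set (labels lw) \<and>
        (distinct (labels lw) \<longrightarrow> distinct (labels lw')) \<and> V \<subseteq> set xs \<union> V'"
      using 1[OF h(2)[unfolded lw]] by (intro exI[of _ "[]"] exI[of _ "{}"]) (simp add: lw)
  qed
  show "isotopic [Cup g, Cap (Suc g)] []"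
    unfolding isotopic_def
  proof (intro allI impI)
    fix R lw xs ys V assume h: "erase lw = [Cup g, Cap (Suc g)]" "run R lw xs ys V"
    have lw: "lw = [Cup g, Cap (Suc g)]" using h(1) by (auto simp: map_eq_Cons_conv map_letter_simps)
    show "\<exists>lw' V'. erase lw' = [] \<and> run R lw' xs ys V' \<and> set (labels lw') = set (labels lw) \<and>
        (distinct (labels lw) \<longrightarrow> distinct (labels lw')) \<and> V \<subseteq> set xs \<union> V'"
      using 2[OF h(2)[unfolded lw]] by (intro exI[of _ "[]"] exI[of _ "{}"]) (simp add: lw)
  qed
qed

text \<open>A closed word may be cut open at any height; \<open>m'\<close> is the number of strands
  at the new cut.\<close>

lemma bounded_rotate:
  assumes b: "bounded_word m' (v @ u) a b"
    and m: "m + sum_list (map width_out u) = m' + sum_list (map width_in u)"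
  shows "bounded_word m (u @ v) a b"
proof -
  have "represents m' (v @ u) S v1 P" if rep: "represents m (u @ v) S v1 P" for S v1 P
  proof -
    have st: "S \<subseteq> {..<ncross D}" "v1 \<inter> S = {}" "v1 \<subseteq> {..<ncross D}" "P \<subseteq> closed_circles S v1"
      using rep unfolding represents_def by blast+
    obtain lw xs V where h: "erase lw = u @ v" "run (conn D S v1) lw xs xs V" "length xs = m"
      "distinct (labels lw)" "set (labels lw) = S" "closed_circles S v1 \<subseteq> P \<union> set xs \<union> V"
      using rep unfolding represents_def by blast
    obtain u' v' where uv: "lw = u' @ v'" "erase u' = u" "erase v' = v"
      using h(1) map_eq_append_conv[of _ lw u v] by auto
    obtain ys V1 V2 where r: "run (conn D S v1) u' xs ys V1" "run (conn D S v1) v' ys xs V2" "V = V1 \<union> V2"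
      using h(2) unfolding uv(1) run_append by blast
    have e: "erase (v' @ u') = v @ u" using uv by simp
    have run: "run (conn D S v1) (v' @ u') ys ys (V2 \<union> V1)" unfolding run_append using r(1,2) by blast
    have w: "map width_in u' = map width_in u" "map width_out u' = map width_out u"
      unfolding uv(2)[symmetric] by simp_all
    have len: "length ys = m'" using run_width[OF r(1)] m h(3) unfolding w by simp
    have c: "closed_circles S v1 \<subseteq> P \<union> set ys \<union> (V2 \<union> V1)" using h(6) r(3) run_visited[OF r(2)] by blast
    have l: "distinct (labels (v' @ u'))" "set (labels (v' @ u')) = S" using h(4,5) uv(1) by auto
    show ?thesis unfolding represents_def
      by (intro conjI st exI[of _ "v' @ u'"] exI[of _ ys] exI[of _ "V2 \<union> V1"] e run len l c)
  qed
  then show ?thesis using b unfolding bounded_word_def by blast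
qed

definition crossing_word :: "nat list \<Rightarrow> unit letter list" where
  "crossing_word gs = map (Cross ()) gs"

text \<open>A half turn of the plane: the word is read backwards and the strands from right to left.
  A half turn does not change the type of a crossing, which is why \<open>corners\<close> admits
  both numberings.\<close>

lemma run_turn:
  "run R (map (\<lambda>(l, g). Cross l g) ps) xs ys V \<Longrightarrow> length xs = m \<Longrightarrow>
    \<exists>V'. run R (map (\<lambda>(l, g). Cross l (m - 2 - g)) (rev ps)) (rev ys) (rev xs) V' \<and> V \<subseteq> set ys \<union> V'"
proof (induction ps arbitrary: xs V)
  case Nil
  then show ?case by auto
next
  case (Cons lg ps)
  obtain l g where lg: "lg = (l, g)" by (cases lg)
  obtain zs N V1 where r: "step R (Cross l g) xs zs N" "run R (map (\<lambda>(l, g). Cross l g) ps) zs ys V1" "V = N \<union> V1"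
    using Cons.prems(1) by (auto simp: lg)
  obtain p t where p: "length p = g" "xs = p @ t" using step_prefix[OF r(1)] by auto
  obtain a b s c d where c: "t = a # b # s" "zs = p @ c # d # s" "corners R l a b c d" "N = {c, d}"
    using r(1) unfolding p(2) step_Cross[OF p(1)] by blast
  have "length zs = m" using Cons.prems(2) by (simp add: p(2) c(1,2))
  then obtain V' where V': "run R (map (\<lambda>(l, g). Cross l (m - 2 - g)) (rev ps)) (rev ys) (rev zs) V'" "V1 \<subseteq> set ys \<union> V'"
    using Cons.IH[OF r(2)] by blast
  have cor: "corners R l d c b a" using c(3) unfolding corners_def by blast
  have len: "length (rev s) = m - 2 - g" using Cons.prems(2) p(1) by (simp add: p(2) c(1))
  have "step R (Cross l (m - 2 - g)) (rev s @ d # c # rev p) (rev s @ b # a # rev p) {b, a}"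
    unfolding step_Cross[OF len] using cor by blast
  then have st: "step R (Cross l (m - 2 - g)) (rev zs) (rev xs) {b, a}" by (simp add: p(2) c(1,2))
  have "run R (map (\<lambda>(l, g). Cross l (m - 2 - g)) (rev (lg # ps))) (rev ys) (rev xs) (V' \<union> {b, a})"
    using V'(1) st by (auto simp: lg run_append run_single)
  moreover have "V \<subseteq> set ys \<union> (V' \<union> {b, a})"
    using run_visited[OF V'(1)] V'(2) by (auto simp: r(3) c(2,4))
  ultimately show ?case by blast
qed

lemma erase_crossings: "erase lw = crossing_word gs \<Longrightarrow> \<exists>ps. lw = map (\<lambda>(l, g). Cross l g) ps \<and> map snd ps = gs"
proof (induction gs arbitrary: lw)
  case Nil
  then show ?case by (auto simp: crossing_word_def)
next
  case (Cons g gs)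
  then obtain y ws where y: "lw = y # ws" "map_letter (\<lambda>_. ()) y = Cross () g" "erase ws = crossing_word gs"
    by (auto simp: crossing_word_def map_eq_Cons_conv)
  obtain l where l: "y = Cross l g" using y(2) by (auto simp: map_letter_simps)
  obtain ps where "ws = map (\<lambda>(l, g). Cross l g) ps" "map snd ps = gs" using Cons.IH[OF y(3)] by blast
  then show ?case by (intro exI[of _ "(l, g) # ps"]) (simp add: y(1) l)
qed

lemma bounded_turn:
  assumes b: "bounded_word m (crossing_word (rev (map (\<lambda>g. m - 2 - g) gs))) a b"
  shows "bounded_word m (crossing_word gs) a b"
proof -
  have lab: "labels (map (\<lambda>(l, g). Cross l (f g)) ps) = map fst ps" for f :: "nat \<Rightarrow> nat" and ps :: "(nat \<times> nat) list"
    by (induction ps) auto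
  have "represents m (crossing_word (rev (map (\<lambda>g. m - 2 - g) gs))) S v1 P" if rep: "represents m (crossing_word gs) S v1 P" for S v1 P
  proof -
    have st: "S \<subseteq> {..<ncross D}" "v1 \<inter> S = {}" "v1 \<subseteq> {..<ncross D}" "P \<subseteq> closed_circles S v1"
      using rep unfolding represents_def by blast+
    obtain lw xs V where h: "erase lw = crossing_word gs" "run (conn D S v1) lw xs xs V" "length xs = m"
      "distinct (labels lw)" "set (labels lw) = S" "closed_circles S v1 \<subseteq> P \<union> set xs \<union> V"
      using rep unfolding represents_def by blast
    obtain ps where ps: "lw = map (\<lambda>(l, g). Cross l g) ps" "map snd ps = gs" using erase_crossings[OF h(1)] by blast
    let ?lw = "map (\<lambda>(l, g). Cross l (m - 2 - g)) (rev ps)"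
    obtain V' where V': "run (conn D S v1) ?lw (rev xs) (rev xs) V'" "V \<subseteq> set xs \<union> V'"
      using run_turn[OF h(2)[unfolded ps(1)] h(3)] by blast
    have e: "erase ?lw = crossing_word (rev (map (\<lambda>g. m - 2 - g) gs))"
      unfolding ps(2)[symmetric] crossing_word_def by (simp add: rev_map case_prod_beta)
    have l: "distinct (labels ?lw)" "set (labels ?lw) = S"
      using h(4,5) lab[of "\<lambda>g. g" ps] lab[of "\<lambda>g. m - 2 - g" "rev ps"] unfolding ps(1) by (simp_all add: rev_map[symmetric])
    have c: "closed_circles S v1 \<subseteq> P \<union> set (rev xs) \<union> V'" using h(6) V'(2) by auto
    have len: "length (rev xs) = m" using h(3) by simp
    show ?thesis unfolding represents_def
      by (intro conjI st exI[of _ ?lw] exI[of _ "rev xs"] exI[of _ V'] e V'(1) len l c)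
  qed
  then show ?thesis using b unfolding bounded_word_def by blast
qed

end


section \<open>Cups passing through full rows\<close>

context source_sink_diagram
begin

abbreviation "ascent a b \<equiv> crossing_word [a..<b]"

definition torus_word :: "nat \<Rightarrow> nat \<Rightarrow> unit letter list" where
  "torus_word m N = concat (replicate N (ascent 0 (m - 1)))"

lemma crossing_word_append: "crossing_word (gs @ hs) = crossing_word gs @ crossing_word hs"
  by (simp add: crossing_word_def)

lemma crossing_word_Nil [simp]: "crossing_word [] = []"
  by (simp add: crossing_word_def)

lemma ascent_split: "a \<le> b \<Longrightarrow> b \<le> c \<Longrightarrow> ascent a c = ascent a b @ ascent b c"
  unfolding crossing_word_append[symmetric] using upt_add_eq_append[of a b "c - b"] by simp

lemma ascent_first: "a < b \<Longrightarrow> ascent a b = Cross () a # ascent (Suc a) b"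
  by (simp add: upt_conv_Cons crossing_word_def)

lemma ascent_last: "ascent 0 (Suc b) = ascent 0 b @ [Cross () b]"
  by (simp add: crossing_word_def)

lemma ascent_empty: "b \<le> a \<Longrightarrow> ascent a b = []"
  by (simp add: crossing_word_def)

lemma torus_word_add: "torus_word m (N + N') = torus_word m N @ torus_word m N'"
  by (simp add: torus_word_def replicate_add)

lemma torus_word_simps: "torus_word m 0 = []" "torus_word m (Suc N) = ascent 0 (m - 1) @ torus_word m N"
  by (simp_all add: torus_word_def)

lemma torus_word_Suc: "torus_word m (Suc N) = torus_word m N @ ascent 0 (m - 1)"
  using torus_word_add[of m N 1] by (simp add: torus_word_simps)

lemma move_low: "\<forall>g\<in>set gs. g + 2 \<le> position y \<Longrightarrow> isotopic ([y] @ crossing_word gs) (crossing_word gs @ [y])"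
proof (induction gs)
  case Nil
  show ?case by (simp add: crossing_word_def isotopic_refl)
next
  case (Cons g gs)
  have rp: "reposition (position y - 2 + 2) y = y" if "g + 2 \<le> position y" using that by (cases y) auto
  have "isotopic [y, Cross () g] [Cross () g, y]"
    using isotopic_commute_left[of "Cross () g" y] Cons.prems rp by simp
  from isotopic_context[OF this, of "[]" "crossing_word gs"]
  have "isotopic ([y] @ crossing_word (g # gs)) ([Cross () g] @ ([y] @ crossing_word gs))"
    by (simp add: crossing_word_def)
  moreover have "isotopic ([Cross () g] @ ([y] @ crossing_word gs)) (crossing_word (g # gs) @ [y])"
    using isotopic_context[OF Cons.IH, of "[Cross () g]" "[]"] Cons.prems by (simp add: crossing_word_def)
  ultimately show ?case by (rule isotopic_trans)
qed

text \<open>The letter changes the number of strands to its right, so the ascent is shifted by the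
  difference of the two widths.\<close>

lemma move_high:
  assumes "position x + width_out x \<le> a"
  shows "isotopic ([x] @ ascent a (a + n)) (ascent (a + width_in x - width_out x) (a + width_in x - width_out x + n) @ [x])"
proof (induction n)
  case 0
  show ?case by (simp add: ascent_empty isotopic_refl)
next
  case (Suc n)
  let ?a = "a + width_in x - width_out x"
  have s: "ascent c (c + Suc n) = ascent c (c + n) @ [Cross () (c + n)]" for c by (simp add: crossing_word_def)
  have "isotopic [x, Cross () (a + n)] [Cross () (?a + n), x]"
  proof -
    have "a + n + width_in x - width_out x = ?a + n" using assms by simp
    then show ?thesis using isotopic_commute_right[of x "Cross () (a + n)"] assms by simp
  qed
  from isotopic_context[OF this, of "ascent ?a (?a + n)" "[]"]
  have "isotopic ((ascent ?a (?a + n) @ [x]) @ [Cross () (a + n)]) (ascent ?a (?a + Suc n) @ [x])"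
    unfolding s by simp
  moreover have "isotopic ([x] @ ascent a (a + Suc n)) ((ascent ?a (?a + n) @ [x]) @ [Cross () (a + n)])"
    unfolding s using isotopic_context[OF Suc.IH, of "[]" "[Cross () (a + n)]"] by simp
  ultimately show ?case using isotopic_trans by blast
qed

lemma move_cup_high: "h + 2 \<le> a \<Longrightarrow> a \<le> b \<Longrightarrow> isotopic ([Cup h] @ ascent a b) (ascent (a - 2) (b - 2) @ [Cup h])"
  using move_high[of "Cup h" a "b - a"] by simp

lemma move_cap_high: "i + 2 \<le> a \<Longrightarrow> isotopic (ascent a (a + n) @ [Cap i]) ([Cap i] @ ascent (a - 2) (a - 2 + n))"
proof (induction n)
  case 0
  show ?case by (simp add: ascent_empty isotopic_refl)
next
  case (Suc n)
  have s: "ascent c (c + Suc n) = ascent c (c + n) @ [Cross () (c + n)]" for c by (simp add: crossing_word_def)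
  have "isotopic [Cross () (a + n), Cap i] [Cap i, Cross () (a - 2 + n)]"
    using isotopic_commute_left[of "Cap i" "Cross () (a + n)"] Suc.prems by simp
  from isotopic_context[OF this, of "ascent a (a + n)" "[]"]
  have "isotopic (ascent a (a + Suc n) @ [Cap i]) ((ascent a (a + n) @ [Cap i]) @ [Cross () (a - 2 + n)])"
    unfolding s by simp
  moreover have "isotopic ((ascent a (a + n) @ [Cap i]) @ [Cross () (a - 2 + n)]) ([Cap i] @ ascent (a - 2) (a - 2 + Suc n))"
    unfolding s using isotopic_context[OF Suc.IH[OF Suc.prems], of "[]" "[Cross () (a - 2 + n)]"] by simp
  ultimately show ?case by (rule isotopic_trans)
qed

lemma move_cross_low: "k + 2 \<le> a \<Longrightarrow> isotopic (crossing_word [a..<b] @ [Cross () k]) ([Cross () k] @ crossing_word [a..<b])"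
proof (induction b)
  case 0
  show ?case by (simp add: ascent_empty isotopic_refl)
next
  case (Suc b)
  show ?case
  proof (cases "a \<le> b")
    case False
    then show ?thesis by (simp add: ascent_empty isotopic_refl)
  next
    case True
    have s: "ascent a (Suc b) = ascent a b @ [Cross () b]" using True by (simp add: crossing_word_def)
    have "isotopic [Cross () b, Cross () k] [Cross () k, Cross () b]"
    proof -
      have "Suc (Suc (b - 2)) = b" using Suc.prems True by simp
      then show ?thesis using isotopic_commute_left[of "Cross () k" "Cross () b"] Suc.prems True by simp
    qed
    from isotopic_context[OF this, of "ascent a b" "[]"]
    have "isotopic (ascent a (Suc b) @ [Cross () k]) ((ascent a b @ [Cross () k]) @ [Cross () b])"
      unfolding s by simp
    moreover have "isotopic ((ascent a b @ [Cross () k]) @ [Cross () b]) ([Cross () k] @ ascent a (Suc b))"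
      unfolding s using isotopic_context[OF Suc.IH[OF Suc.prems], of "[]" "[Cross () b]"] by simp
    ultimately show ?thesis by (rule isotopic_trans)
  qed
qed

text \<open>Here the cup climbs from position \<open>k\<close> to \<open>l\<close> by pairing the crossings of the two ascents.\<close>

lemma climb:
  assumes "l < n" "k \<le> l"
    and "bounded_word m (u @ [Cup l] @ ascent (Suc l) n @ v) (a - int (l - k)) (b - int (l - k))"
  shows "bounded_word m (u @ [Cup k] @ ascent (Suc k) n @ ascent k l @ v) a b"
  using assms(2,3)
proof (induction "l - k" arbitrary: k a b)
  case 0
  then show ?case by (simp add: ascent_empty)
next
  case (Suc d)
  then have kl: "k < l" by simp
  have "bounded_word m (u @ [Cup (Suc k)] @ ascent (Suc (Suc k)) n @ ascent (Suc k) l @ v) (a - 1) (b - 1)"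
  proof (rule Suc.hyps(1))
    have e: "int (l - k) = 1 + int (l - Suc k)" using kl by simp
    show "bounded_word m (u @ [Cup l] @ ascent (Suc l) n @ v) (a - 1 - int (l - Suc k)) (b - 1 - int (l - Suc k))"
      using Suc.prems(2) unfolding e by (simp add: algebra_simps)
  qed (use Suc.hyps(2) kl in simp_all)
  then have "bounded_word m (u @ [Cup k, Cross () (Suc k), Cross () k] @ ascent (Suc (Suc k)) n @ ascent (Suc k) l @ v) a b"
    by (rule_tac bounded_slide_word[where g = k and h = "Suc k"]) simp_all
  then have "bounded_word m ((u @ [Cup k, Cross () (Suc k)]) @ ([Cross () k] @ ascent (Suc (Suc k)) n) @ (ascent (Suc k) l @ v)) a b"
    by simp
  then have "bounded_word m ((u @ [Cup k, Cross () (Suc k)]) @ (ascent (Suc (Suc k)) n @ [Cross () k]) @ (ascent (Suc k) l @ v)) a b"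
    by (rule bounded_isotopic[OF move_cross_low, rotated]) simp
  then show ?case using kl assms(1) ascent_first[of "Suc k" n] ascent_first[of k l] by simp
qed

text \<open>The crossings to the left of the cup commute with it, two crossings are used up by a
  slide, and those to the right commute with it after a shift by two. The row loses two crossings
  and the cup moves down by one position.\<close>

lemma row_single:
  assumes j: "Suc j \<le> m - 2" "2 \<le> m"
    and b: "bounded_word n (u @ ascent 0 (m - 3) @ [Cup j] @ v) (a - 1) (b - 1)"
  shows "bounded_word n (u @ [Cup (Suc j)] @ ascent 0 (m - 1) @ v) a b"
proof -
  have s1: "ascent 0 (m - 3) = ascent 0 j @ ascent j (m - 3)" using j by (intro ascent_split) auto
  have s2: "ascent 0 (m - 1) = ascent 0 j @ [Cross () j, Cross () (Suc j)] @ ascent (Suc (Suc j)) (m - 1)"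
    using j ascent_split[of 0 j "m - 1"] ascent_first[of j "m - 1"] ascent_first[of "Suc j" "m - 1"] by simp
  have hi: "isotopic ([Cup j] @ ascent (Suc (Suc j)) (m - 1)) (ascent j (m - 3) @ [Cup j])"
    using move_cup_high[of j "Suc (Suc j)" "m - 1"] j by (simp add: numeral_eq_Suc)
  have lo: "isotopic ([Cup (Suc j)] @ ascent 0 j) (ascent 0 j @ [Cup (Suc j)])"
    by (rule move_low) simp
  have "bounded_word n ((u @ ascent 0 j) @ (ascent j (m - 3) @ [Cup j]) @ v) (a - 1) (b - 1)"
    using b by (simp add: s1)
  from bounded_isotopic[OF hi this]
  have "bounded_word n ((u @ ascent 0 j) @ [Cup j] @ (ascent (Suc (Suc j)) (m - 1) @ v)) (a - 1) (b - 1)" by simp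
  then have "bounded_word n ((u @ ascent 0 j) @ [Cup (Suc j), Cross () j, Cross () (Suc j)] @ (ascent (Suc (Suc j)) (m - 1) @ v)) a b"
    by (rule_tac bounded_slide_word[where g = j and h = j]) simp_all
  then have "bounded_word n (u @ (ascent 0 j @ [Cup (Suc j)]) @ ([Cross () j, Cross () (Suc j)] @ ascent (Suc (Suc j)) (m - 1) @ v)) a b"
    by simp
  from bounded_isotopic[OF lo this] show ?thesis by (simp only: s2 append.assoc append_Cons append_Nil)
qed

text \<open>At position 0 no slide is available. With two rows, the first crossing is a curl, the
  cup then climbs \<open>m - 2\<close> positions with one crossing of each row per step, and the
  last crossing is a second curl. Both rows are used up, at cost \<open>1 + (m - 2) + 1\<close> and
  \<open>2 + (m - 2) + 2\<close>.\<close>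

lemma row_double:
  assumes m: "2 \<le> m"
    and b: "bounded_word n (u @ [Cup (m - 2)] @ v) (a - int m) (b - int (m + 2))"
  shows "bounded_word n (u @ [Cup 0] @ ascent 0 (m - 1) @ ascent 0 (m - 1) @ v) a b"
proof -
  have e1: "ascent (Suc (m - 2)) (m - 1) = []" by (rule ascent_empty) simp
  have "bounded_word n (u @ [Cup (m - 2), Cross () (m - 2)] @ v) (a - int m + 1) (b - int (m + 2) + 2)"
    by (rule bounded_curl) (use b in \<open>simp add: algebra_simps\<close>)
  then have "bounded_word n (u @ [Cup (m - 2)] @ ascent (Suc (m - 2)) (m - 1) @ ([Cross () (m - 2)] @ v))
      (a - 1 - int (m - 2 - 0)) (b - 2 - int (m - 2 - 0))"
    unfolding e1 using m by (simp add: of_nat_diff algebra_simps)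
  then have "bounded_word n (u @ [Cup 0] @ ascent (Suc 0) (m - 1) @ ascent 0 (m - 2) @ ([Cross () (m - 2)] @ v)) (a - 1) (b - 2)"
    by (rule_tac climb) (use m in auto)
  then have b': "bounded_word n (u @ [Cup 0, Cross () 0] @ (ascent (Suc 0) (m - 1) @ ascent 0 (m - 2) @ ([Cross () (m - 2)] @ v))) a b"
    by (rule_tac bounded_curl) simp
  have l: "ascent 0 (m - 1) = ascent 0 (m - 2) @ [Cross () (m - 2)]"
  proof -
    have "m - 1 = Suc (m - 2)" using m by simp
    then show ?thesis by (simp only: ascent_last)
  qed
  have f: "ascent 0 (m - 1) = Cross () 0 # ascent (Suc 0) (m - 1)" using m by (intro ascent_first) simp
  have "ascent 0 (m - 1) @ ascent 0 (m - 1) = Cross () 0 # ascent (Suc 0) (m - 1) @ ascent 0 (m - 2) @ [Cross () (m - 2)]"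
    using f l by (metis append_Cons)
  then show ?thesis using b' by (metis append.assoc append_Cons append_Nil)
qed

lemma rows_single:
  assumes "r \<le> j" "j \<le> m - 2" "2 \<le> m"
    and "bounded_word n (u @ torus_word (m - 2) r @ [Cup (j - r)] @ v) (a - int r) (b - int r)"
  shows "bounded_word n (u @ [Cup j] @ torus_word m r @ v) a b"
  using assms(1,2,4)
proof (induction r arbitrary: j u a b)
  case 0
  then show ?case by (simp add: torus_word_simps)
next
  case (Suc r)
  obtain j' where j': "j = Suc j'" using Suc.prems(1) by (cases j) auto
  have "bounded_word n ((u @ ascent 0 (m - 3)) @ [Cup j'] @ torus_word m r @ v) (a - 1) (b - 1)"
    using Suc.prems by (rule_tac Suc.IH) (auto simp: j' torus_word_simps algebra_simps numeral_3_eq_3)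
  then have "bounded_word n (u @ [Cup (Suc j')] @ ascent 0 (m - 1) @ (torus_word m r @ v)) a b"
    using Suc.prems(2) assms(3) by (rule_tac row_single) (auto simp: j')
  then show ?case by (simp add: j' torus_word_simps)
qed

text \<open>\<open>j\<close> single rows bring the cup to position 0, two rows carry it to position
  \<open>m - 2\<close>, and the other \<open>r - j - 2\<close> rows are single again. The costs add
  up to \<open>m + r - 2\<close> and \<open>m + r\<close>.\<close>

lemma past_bottom:
  assumes r: "j + 2 \<le> r" "r \<le> m + j" and m: "j \<le> m - 2" "2 \<le> m"
    and b: "bounded_word n (u @ torus_word (m - 2) (r - 2) @ [Cup (m + j - r)] @ v) (a - int (m + r - 2)) (b - int (m + r))"
  shows "bounded_word n (u @ [Cup j] @ torus_word m r @ v) a b"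
proof -
  define s where "s = r - j - 2"
  have rs: "r = j + Suc (Suc s)" using r by (simp add: s_def)
  have "torus_word (m - 2) (r - 2) = torus_word (m - 2) j @ torus_word (m - 2) s"
    unfolding torus_word_add[symmetric] using rs by simp
  then have "bounded_word n ((u @ torus_word (m - 2) j) @ torus_word (m - 2) s @ [Cup (m - 2 - s)] @ v)
      (a - int j - int m - int s) (b - int j - int (m + 2) - int s)"
    using b r m by (simp add: rs algebra_simps of_nat_diff)
  then have "bounded_word n ((u @ torus_word (m - 2) j) @ [Cup (m - 2)] @ torus_word m s @ v)
      (a - int j - int m) (b - int j - int (m + 2))"
    by (rule_tac rows_single) (use r m rs in auto)
  then have "bounded_word n ((u @ torus_word (m - 2) j) @ [Cup 0] @ ascent 0 (m - 1) @ ascent 0 (m - 1) @ (torus_word m s @ v))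
      (a - int j) (b - int j)"
    by (rule_tac row_double) (use m in simp_all)
  then have "bounded_word n (u @ [Cup j] @ torus_word m j @ (ascent 0 (m - 1) @ ascent 0 (m - 1) @ torus_word m s @ v)) a b"
    by (rule_tac rows_single) (use m in simp_all)
  then show ?thesis unfolding rs torus_word_add by (simp add: torus_word_simps)
qed

text \<open>This iterates the case \<open>r = m\<close> of \<open>past_bottom\<close>, in which the
  cup returns to its position \<open>j\<close> and \<open>m\<close> rows become \<open>m - 2\<close>
  rows on two strands fewer, a full twist again.\<close>

lemma full_twists:
  assumes m: "j \<le> m - 2" "2 \<le> m"
    and "bounded_word n (u @ torus_word (m - 2) ((m - 2) * t) @ [Cup j] @ v) (a - int t * (2 * int m - 2)) (b - int t * (2 * int m))"
  shows "bounded_word n (u @ [Cup j] @ torus_word m (m * t) @ v) a b"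
  using assms(3)
proof (induction t arbitrary: u a b)
  case 0
  then show ?case by (simp add: torus_word_simps)
next
  case (Suc t)
  have e: "torus_word (m - 2) ((m - 2) * Suc t) = torus_word (m - 2) (m - 2) @ torus_word (m - 2) ((m - 2) * t)"
    unfolding torus_word_add[symmetric] by simp
  have "bounded_word n ((u @ torus_word (m - 2) (m - 2)) @ [Cup j] @ torus_word m (m * t) @ v) (a - (2 * int m - 2)) (b - 2 * int m)"
  proof (rule Suc.IH)
    have ab: "a - int (Suc t) * (2 * int m - 2) = a - (2 * int m - 2) - int t * (2 * int m - 2)"
      "b - int (Suc t) * (2 * int m) = b - 2 * int m - int t * (2 * int m)" by (simp_all add: algebra_simps)
    show "bounded_word n ((u @ torus_word (m - 2) (m - 2)) @ torus_word (m - 2) ((m - 2) * t) @ [Cup j] @ v)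
        (a - (2 * int m - 2) - int t * (2 * int m - 2)) (b - 2 * int m - int t * (2 * int m))"
      using Suc.prems unfolding e ab by (simp only: append.assoc)
  qed
  then have "bounded_word n (u @ torus_word (m - 2) (m - 2) @ [Cup (m + j - m)] @ (torus_word m (m * t) @ v))
      (a - int (m + m - 2)) (b - int (m + m))"
    using m by (simp add: of_nat_diff)
  then have "bounded_word n (u @ [Cup j] @ torus_word m m @ (torus_word m (m * t) @ v)) a b"
    by (rule past_bottom[rotated -1]) (use m in auto)
  then show ?case by (simp add: torus_word_add)
qed

lemma widths: "sum_list (map width_in (crossing_word gs)) = 2 * length gs" "sum_list (map width_out (crossing_word gs)) = 2 * length gs"
  by (induction gs) (auto simp: crossing_word_def)

lemma torus_word_crossing: "\<exists>gs. torus_word m N = crossing_word gs"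
proof (induction N)
  case 0
  show ?case by (rule exI[of _ "[]"]) (simp add: torus_word_simps crossing_word_def)
next
  case (Suc N)
  then obtain gs where "torus_word m N = crossing_word gs" by blast
  then show ?case by (intro exI[of _ "[0..<m - 1] @ gs"]) (simp add: torus_word_simps crossing_word_append)
qed

lemma widths_torus: "sum_list (map width_in (torus_word m N)) = sum_list (map width_out (torus_word m N))"
  using torus_word_crossing[of m N] widths by auto

lemma rotate_crossings:
  assumes "bounded_word m (v @ crossing_word gs) a b" shows "bounded_word m (crossing_word gs @ v) a b"
  by (rule bounded_rotate[OF assms]) (simp add: widths)

section \<open>How the cup meets the cap after the last full row\<close>

lemma cup_to_front:
  assumes "bounded_word m ([Cup j] @ torus_word p M @ ascent 0 i @ [Cap i']) a b"
  shows "bounded_word (m + 2) (torus_word p M @ ascent 0 i @ [Cap i', Cup j]) a b"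
  using bounded_rotate[of m "[Cup j]" "torus_word p M @ ascent 0 i @ [Cap i']" a b "m + 2"] assms
  by (simp add: widths widths_torus)

text \<open>The cup misses the cap: it passes the ascent and the cap and comes round the closure to
  the bottom of the word, two positions lower because the cap has removed two strands.\<close>

lemma end_far_above:
  assumes j: "i + 2 \<le> j"
    and b: "bounded_word m ([Cup (j - 2)] @ torus_word p M @ ascent 0 i @ [Cap i]) a b"
  shows "bounded_word (m + 2) (torus_word p M @ [Cup j] @ ascent 0 i @ [Cap i]) a b"
proof -
  have i1: "isotopic [Cup j, Cap i] [Cap i, Cup (j - 2)]"
    using isotopic_commute_left[of "Cap i" "Cup j"] j by simp
  have i2: "isotopic ([Cup j] @ ascent 0 i) (ascent 0 i @ [Cup j])" by (rule move_low) (use j in auto)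
  from cup_to_front[OF b] have "bounded_word (m + 2) ((torus_word p M @ ascent 0 i) @ [Cap i, Cup (j - 2)] @ []) a b" by simp
  from bounded_isotopic[OF i1 this]
  have "bounded_word (m + 2) (torus_word p M @ (ascent 0 i @ [Cup j]) @ [Cap i]) a b" by simp
  from bounded_isotopic[OF i2 this] show ?thesis by simp
qed

text \<open>Cup and cap share exactly one strand and straighten to a vertical one.\<close>

lemma end_above:
  assumes b: "bounded_word m (torus_word p M @ ascent 0 i) a b"
  shows "bounded_word m (torus_word p M @ [Cup (Suc i)] @ ascent 0 i @ [Cap i]) a b"
proof -
  have i2: "isotopic ([Cup (Suc i)] @ ascent 0 i) (ascent 0 i @ [Cup (Suc i)])" by (rule move_low) auto
  have "bounded_word m ((torus_word p M @ ascent 0 i) @ [] @ []) a b" using b by simp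
  from bounded_isotopic[OF isotopic_zigzag(1) this]
  have "bounded_word m (torus_word p M @ (ascent 0 i @ [Cup (Suc i)]) @ [Cap i]) a b" by simp
  from bounded_isotopic[OF i2 this] show ?thesis by simp
qed

text \<open>The last crossing of the ascent lies beside cup and cap and forms a kink with them,
  which accounts for \<open>b + 1\<close>.\<close>

lemma end_same:
  assumes b: "bounded_word m (torus_word p M @ ascent 0 i) a (b + 1)"
  shows "bounded_word m (torus_word p M @ [Cup (Suc i)] @ ascent 0 (Suc i) @ [Cap (Suc i)]) a b"
proof -
  have i2: "isotopic ([Cup (Suc i)] @ ascent 0 i) (ascent 0 i @ [Cup (Suc i)])" by (rule move_low) auto
  have "bounded_word m ((torus_word p M @ ascent 0 i) @ [Cup (Suc i), Cross () i, Cap (Suc i)] @ []) a b"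
    by (rule bounded_kink[where g = i]) (use b in simp_all)
  then have "bounded_word m (torus_word p M @ (ascent 0 i @ [Cup (Suc i)]) @ [Cross () i, Cap (Suc i)]) a b" by simp
  from bounded_isotopic[OF i2 this] show ?thesis by (simp only: ascent_last append.assoc append_Cons append_Nil)
qed

text \<open>The cup passes the ascent as it passes a row, at cost one, and then lies to the left of
  the cap, which is shifted by two when the cup moves round the closure.\<close>

lemma end_below:
  assumes j: "Suc j < i"
    and b: "bounded_word m ([Cup j] @ torus_word p M @ ascent 0 (i - 2) @ [Cap (i - 2)]) (a - 1) (b - 1)"
  shows "bounded_word (m + 2) (torus_word p M @ [Cup (Suc j)] @ ascent 0 i @ [Cap i]) a b"
proof -
  have i1: "isotopic [Cup j, Cap i] [Cap (i - 2), Cup j]"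
    using isotopic_commute_right[of "Cup j" "Cap i"] j by simp
  have s1: "ascent 0 (i - 2) = ascent 0 j @ ascent j (i - 2)" using j by (intro ascent_split) auto
  have s2: "ascent 0 i = ascent 0 j @ [Cross () j, Cross () (Suc j)] @ ascent (Suc (Suc j)) i"
    using j ascent_split[of 0 j i] ascent_first[of j i] ascent_first[of "Suc j" i] by simp
  have hi: "isotopic ([Cup j] @ ascent (Suc (Suc j)) i) (ascent j (i - 2) @ [Cup j])"
    using move_cup_high[of j "Suc (Suc j)" i] j by simp
  have lo: "isotopic ([Cup (Suc j)] @ ascent 0 j) (ascent 0 j @ [Cup (Suc j)])" by (rule move_low) simp
  from cup_to_front[OF b]
  have "bounded_word (m + 2) ((torus_word p M @ ascent 0 (i - 2)) @ [Cap (i - 2), Cup j] @ []) (a - 1) (b - 1)" by simp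
  from bounded_isotopic[OF i1 this]
  have "bounded_word (m + 2) ((torus_word p M @ ascent 0 j) @ (ascent j (i - 2) @ [Cup j]) @ [Cap i]) (a - 1) (b - 1)"
    by (simp add: s1)
  from bounded_isotopic[OF hi this]
  have "bounded_word (m + 2) ((torus_word p M @ ascent 0 j) @ [Cup j] @ (ascent (Suc (Suc j)) i @ [Cap i])) (a - 1) (b - 1)" by simp
  then have "bounded_word (m + 2) ((torus_word p M @ ascent 0 j) @ [Cup (Suc j), Cross () j, Cross () (Suc j)] @ (ascent (Suc (Suc j)) i @ [Cap i])) a b"
    by (rule_tac bounded_slide_word[where g = j and h = j]) simp_all
  then have "bounded_word (m + 2) (torus_word p M @ (ascent 0 j @ [Cup (Suc j)]) @ ([Cross () j, Cross () (Suc j)] @ ascent (Suc (Suc j)) i @ [Cap i])) a b"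
    by simp
  from bounded_isotopic[OF lo this] show ?thesis by (simp only: s2 append.assoc append_Cons append_Nil)
qed

text \<open>A half turn maps full rows to full rows and the last part of a row to a first part of
  equal length; rotating the closed word brings that part back to the end.\<close>

lemma mirrored_ascent:
  assumes b: "bounded_word m (torus_word m M @ ascent 0 (m - 1 - i)) a b"
  shows "bounded_word m (torus_word m M @ ascent i (m - 1)) a b"
proof -
  have refl_upt: "rev (map (\<lambda>g. m - 2 - g) [i..<m - 1]) = [0..<m - 1 - i]" for i
    by (rule nth_equalityI) (auto simp: rev_nth)
  have "\<exists>gs. torus_word m M = crossing_word gs \<and> rev (map (\<lambda>g. m - 2 - g) gs) = gs"
  proof (induction M)
    case 0
    show ?case by (rule exI[of _ "[]"]) (simp add: torus_word_simps crossing_word_def)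
  next
    case (Suc M)
    then obtain gs where gs: "torus_word m M = crossing_word gs" "rev (map (\<lambda>g. m - 2 - g) gs) = gs" by blast
    have "torus_word m (Suc M) = crossing_word ([0..<m - 1] @ gs)"
      by (simp add: torus_word_simps crossing_word_append gs(1))
    moreover have "torus_word m (Suc M) = crossing_word (gs @ [0..<m - 1])"
      by (simp add: torus_word_Suc crossing_word_append gs(1))
    moreover have "inj (Cross () :: nat \<Rightarrow> unit letter)" by (simp add: inj_def)
    ultimately have comm: "[0..<m - 1] @ gs = gs @ [0..<m - 1]" by (simp add: crossing_word_def inj_map_eq_map del: map_append)
    have "rev (map (\<lambda>g. m - 2 - g) (gs @ [0..<m - 1])) = [0..<m - 1] @ gs"
      using refl_upt[of 0] gs(2) by simp
    then show ?case using comm \<open>torus_word m (Suc M) = crossing_word (gs @ [0..<m - 1])\<close> by metis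
  qed
  then obtain gs where gs: "torus_word m M = crossing_word gs" "rev (map (\<lambda>g. m - 2 - g) gs) = gs" by blast
  have "rev (map (\<lambda>g. m - 2 - g) (gs @ [i..<m - 1])) = [0..<m - 1 - i] @ gs" using refl_upt gs(2) by simp
  moreover have "bounded_word m (crossing_word ([0..<m - 1 - i] @ gs)) a b"
    unfolding crossing_word_append by (rule rotate_crossings) (use b gs(1) in simp)
  ultimately have "bounded_word m (crossing_word (gs @ [i..<m - 1])) a b" by (rule_tac bounded_turn) simp
  then show ?thesis by (simp add: crossing_word_append gs(1))
qed

lemma end_bottom:
  assumes i: "1 \<le> i" "i \<le> p"
    and b: "bounded_word p (torus_word p M @ ascent 0 (p - i)) (a - int i) (b - int i - 1)"
  shows "bounded_word p (torus_word p (Suc M) @ [Cup 0] @ ascent 0 i @ [Cap i]) a b"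
proof -
  have lo: "isotopic ([Cap i] @ ascent 0 (i - 1)) (ascent 0 (i - 1) @ [Cap i])" by (rule move_low) auto
  have z: "isotopic [Cup (i - 1), Cap i] []" using isotopic_zigzag(2)[of "i - 1"] i by simp
  have e: "ascent (Suc (i - 1)) i = []" by (rule ascent_empty) simp
  have s: "ascent 0 (p - 1) = ascent 0 (i - 1) @ ascent (i - 1) (p - 1)" using i by (intro ascent_split) auto
  have s': "ascent 0 i = Cross () 0 # ascent (Suc 0) i" using i by (intro ascent_first) simp
  have "bounded_word p (torus_word p M @ ascent (i - 1) (p - 1)) (a - int i) (b - int i - 1)"
    by (rule mirrored_ascent) (use b i in simp)
  moreover obtain gs where gs: "torus_word p M = crossing_word gs" using torus_word_crossing by blast
  ultimately have "bounded_word p (ascent (i - 1) (p - 1) @ torus_word p M) (a - int i) (b - int i - 1)"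
    unfolding gs by (rule_tac rotate_crossings)
  then have "bounded_word p ([] @ [] @ (ascent (i - 1) (p - 1) @ torus_word p M)) (a - int i) (b - int i - 1)" by simp
  from bounded_isotopic[OF z this]
  have "bounded_word p ([] @ [Cup (i - 1)] @ ascent (Suc (i - 1)) i @ ([Cap i] @ ascent (i - 1) (p - 1) @ torus_word p M))
      (a - 1 - int (i - 1 - 0)) (b - 2 - int (i - 1 - 0))"
    unfolding e using i by (simp add: of_nat_diff algebra_simps)
  then have "bounded_word p ([] @ [Cup 0] @ ascent (Suc 0) i @ ascent 0 (i - 1) @ ([Cap i] @ ascent (i - 1) (p - 1) @ torus_word p M)) (a - 1) (b - 2)"
    by (rule_tac climb) (use i in auto)
  then have "bounded_word p ([] @ [Cup 0, Cross () 0] @ (ascent (Suc 0) i @ ascent 0 (i - 1) @ ([Cap i] @ ascent (i - 1) (p - 1) @ torus_word p M))) a b"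
    by (rule_tac bounded_curl) simp
  then have "bounded_word p (([Cup 0] @ ascent 0 i) @ (ascent 0 (i - 1) @ [Cap i]) @ (ascent (i - 1) (p - 1) @ torus_word p M)) a b"
    by (simp add: s')
  from bounded_isotopic[OF lo this]
  have "bounded_word p (([Cup 0] @ ascent 0 i @ [Cap i]) @ torus_word p (Suc M)) a b"
    by (simp only: torus_word_simps s append.assoc)
  moreover obtain hs where hs: "torus_word p (Suc M) = crossing_word hs" using torus_word_crossing by blast
  ultimately show ?thesis using rotate_crossings[of p "[Cup 0] @ ascent 0 i @ [Cap i]" hs a b] by simp
qed

text \<open>For \<open>i = 1\<close> there is no climb, so no full row is opened; this covers the
  word without full rows as well.\<close>

lemma end_bottom_one:
  assumes b: "bounded_word p (torus_word p' M) (a - 1) (b - 2)"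
  shows "bounded_word p (torus_word p' M @ [Cup 0] @ ascent 0 1 @ [Cap 1]) a b"
proof -
  have "bounded_word p (torus_word p' M @ [] @ []) (a - 1) (b - 2)" using b by simp
  from bounded_isotopic[OF isotopic_zigzag(2)[of 0] this]
  have "bounded_word p (torus_word p' M @ [Cup 0] @ [Cap 1]) (a - 1) (b - 2)" by simp
  then have "bounded_word p (torus_word p' M @ [Cup 0, Cross () 0] @ [Cap 1]) a b" by (rule bounded_curl)
  then show ?thesis by (simp add: crossing_word_def)
qed

text \<open>The cup is at position 0 with a single full row ahead, and the ascent to the cap plays
  the part of the second row. A curl and \<open>i\<close> steps bring the cup to the position of the
  cap. For \<open>i = p\<close> the row is exhausted and they form a circle; otherwise the next
  crossing of the row forms a kink, and the rest of the row passes the cap.\<close>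

lemma end_stuck:
  assumes i: "i \<le> p"
    and b1: "i = p \<Longrightarrow> bounded_word p (torus_word p M) (a - 1 - int i) (b - 3 - int i)"
    and b2: "i < p \<Longrightarrow> bounded_word p (torus_word p M @ ascent 0 (p - 1 - i)) (a - 1 - int i) (b - 1 - int i)"
  shows "bounded_word p (torus_word p M @ [Cup 0] @ ascent 0 (Suc p) @ ascent 0 i @ [Cap i]) a b"
proof -
  have "bounded_word p (torus_word p M @ [Cup i] @ ascent (Suc i) (Suc p) @ [Cap i]) (a - 1 - int i) (b - 2 - int i)"
  proof (cases "i = p")
    case True
    have e: "ascent (Suc i) (Suc p) = []" using True by (simp add: ascent_empty)
    have "bounded_word p (torus_word p M @ [Cup i, Cap i] @ []) (a - 1 - int i) (b - 2 - int i)"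
      by (rule bounded_circle) (use b1[OF True] in \<open>simp add: algebra_simps\<close>)
    then show ?thesis by (simp only: e append.assoc append_Cons append_Nil append_Nil2)
  next
    case False
    then have ip: "i < p" using i by simp
    have s: "ascent (Suc i) (Suc p) = Cross () (Suc i) # ascent (Suc (Suc i)) (Suc p)" using ip by (intro ascent_first) simp
    have hi: "isotopic (ascent (Suc (Suc i)) (Suc p) @ [Cap i]) ([Cap i] @ ascent i (p - 1))"
      using move_cap_high[of i "Suc (Suc i)" "p - 1 - i"] ip by simp
    have "bounded_word p (torus_word p M @ ascent i (p - 1)) (a - 1 - int i) (b - 2 - int i + 1)"
      by (rule mirrored_ascent) (use b2[OF ip] in \<open>simp add: algebra_simps\<close>)
    then have "bounded_word p (torus_word p M @ [Cup i, Cross () (Suc i), Cap i] @ ascent i (p - 1)) (a - 1 - int i) (b - 2 - int i)"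
      by (rule_tac bounded_kink[where g = i]) simp_all
    then have "bounded_word p ((torus_word p M @ [Cup i, Cross () (Suc i)]) @ ([Cap i] @ ascent i (p - 1)) @ []) (a - 1 - int i) (b - 2 - int i)"
      by simp
    from bounded_isotopic[OF hi this] show ?thesis by (simp only: s append.assoc append_Cons append_Nil append_Nil2)
  qed
  then have "bounded_word p (torus_word p M @ [Cup 0] @ ascent (Suc 0) (Suc p) @ ascent 0 i @ [Cap i]) (a - 1) (b - 2)"
    using i by (rule_tac climb) (simp_all add: algebra_simps)
  then have "bounded_word p (torus_word p M @ [Cup 0, Cross () 0] @ (ascent (Suc 0) (Suc p) @ ascent 0 i @ [Cap i])) a b"
    by (rule bounded_curl)
  moreover have "ascent 0 (Suc p) = Cross () 0 # ascent (Suc 0) (Suc p)" by (intro ascent_first) simp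
  ultimately show ?thesis by simp
qed

lemma end_circle:
  assumes "bounded_word p (torus_word p' M) a (b - 1)"
  shows "bounded_word p (torus_word p' M @ [Cup 0] @ ascent 0 0 @ [Cap 0]) a b"
  using bounded_circle[of p "torus_word p' M" "[]" a b 0] assms by (simp add: ascent_empty)

end


section \<open>Recursion on the number of strands\<close>

context source_sink_diagram
begin

text \<open>This value and the next are \<open>n_minus\<close> and
  \<open>2 * n_minus - n_plus\<close> of the reversed link for \<open>n = 1\<close>, that is, the
  degree shifts of one full twist.\<close>

definition top_degree :: "nat \<Rightarrow> int" where "top_degree k = 2 * int k * int k"
definition top_quantum :: "nat \<Rightarrow> int" where "top_quantum k = 2 * int k * int k + 2 * int k"

text \<open>One bound for all words within \<open>n\<close> full twists, where a started row counts
  as a full one. This uniformity allows crossings to be added one at a time without raising the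
  bound.\<close>

definition torus_bounded :: "nat \<Rightarrow> bool" where
  "torus_bounded k \<longleftrightarrow> (\<forall>n N i. 1 \<le> n \<longrightarrow> i \<le> 2 * k - 1 \<longrightarrow> N + (if i > 0 then 1 else 0) \<le> 2 * k * n \<longrightarrow>
     bounded_word (2 * k) (torus_word (2 * k) N @ ascent 0 i) (top_degree k * int n) (top_quantum k * int n))"

text \<open>The word left by the 1-smoothing of a last crossing, with the cup moved round to the
  front; the \<open>- 1\<close> pays for that 1-smoothing. It arises with \<open>i = j\<close>, but
  removing strands separates the two positions. The two side conditions hold for
  \<open>i = j\<close> and are reproduced by the recursion.\<close>

definition cap_bounded :: "nat \<Rightarrow> bool" where
  "cap_bounded k \<longleftrightarrow> (\<forall>n r i j. r < 2 * k \<longrightarrow> i \<le> 2 * k - 2 \<longrightarrow> j \<le> 2 * k - 2 \<longrightarrow> (r = 2 * k - 1 \<longrightarrow> j \<le> i) \<longrightarrow>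
     (2 * k * n + r = 0 \<longrightarrow> i \<le> j) \<longrightarrow>
     bounded_word (2 * k - 2) ([Cup j] @ torus_word (2 * k) (2 * k * n + r) @ ascent 0 i @ [Cap i])
       (top_degree k * int (n + 1) - 1) (top_quantum k * int (n + 1) - 1))"

lemma torus_boundedD:
  "torus_bounded k \<Longrightarrow> 1 \<le> n \<Longrightarrow> i \<le> 2 * k - 1 \<Longrightarrow> N + (if i > 0 then 1 else 0) \<le> 2 * k * n \<Longrightarrow>
    top_degree k * int n \<le> a \<Longrightarrow> top_quantum k * int n \<le> b \<Longrightarrow> bounded_word (2 * k) (torus_word (2 * k) N @ ascent 0 i) a b"
  unfolding torus_bounded_def using bounded_word_mono by blast

lemma cap_boundedD:
  assumes "cap_bounded k" "r < 2 * k" "i \<le> 2 * k - 2" "j \<le> 2 * k - 2" "r = 2 * k - 1 \<longrightarrow> j \<le> i"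
    "2 * k * n + r = 0 \<longrightarrow> i \<le> j" "top_degree k * int (n + 1) - 1 \<le> a" "top_quantum k * int (n + 1) - 1 \<le> b"
  shows "bounded_word (2 * k - 2) ([Cup j] @ torus_word (2 * k) (2 * k * n + r) @ ascent 0 i @ [Cap i]) a b"
  by (rule bounded_word_mono[OF assms(1)[unfolded cap_bounded_def, THEN spec, THEN spec, THEN spec, THEN spec,
    THEN mp, THEN mp, THEN mp, THEN mp, THEN mp, OF assms(2-6)] assms(7,8)])

lemma torus_bounded_0: "torus_bounded 0"
  unfolding torus_bounded_def
proof (intro allI impI)
  fix n N i :: nat
  assume "i \<le> 2 * 0 - 1" "N + (if i > 0 then 1 else 0) \<le> 2 * 0 * n"
  then have "i = 0" "N = 0" by simp_all
  then show "bounded_word (2 * 0) (torus_word (2 * 0) N @ ascent 0 i) (top_degree 0 * int n) (top_quantum 0 * int n)"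
    using bounded_Nil[of 0] by (simp add: torus_word_simps top_degree_def top_quantum_def)
qed

text \<open>The cup has reached position \<open>j'\<close> below the ascent, where all full rows have lost two strands.\<close>

lemma cap_terminal:
  assumes P: "torus_bounded k" and E: "k > 0 \<Longrightarrow> cap_bounded k"
    and ranges: "i \<le> 2 * k" "j' \<le> 2 * k" "r < 2 * k \<or> r = 2 * k \<and> j' = 0"
    and far: "i + 2 \<le> j' \<Longrightarrow> r = 2 * k - 1 \<Longrightarrow> j' - 2 \<le> i"
    and low: "j' < i \<Longrightarrow> 0 < 2 * k * n + r"
    and near: "0 < j' \<Longrightarrow> j' < i \<Longrightarrow> r = 2 * k - 1 \<Longrightarrow> j' - 1 \<le> i - 2"
    and a: "top_degree k * int (n + 1) + int i \<le> a \<or> j' > 0 \<and> top_degree k * int (n + 1) \<le> a"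
    and b: "top_quantum k * int (n + 1) + int i + 1 \<le> b \<or> j' > 0 \<and> top_quantum k * int (n + 1) \<le> b"
  shows "bounded_word (2 * k) (torus_word (2 * k) (2 * k * n + r) @ [Cup j'] @ ascent 0 i @ [Cap i]) a b"
proof -
  let ?M = "2 * k * n + r"
  have e: "2 * k * (n + 1) = 2 * k * n + 2 * k" by simp
  have M: "?M \<le> 2 * k * (n + 1)" "j' > 0 \<Longrightarrow> ?M < 2 * k * (n + 1)" using ranges(3) unfolding e by auto
  have a0: "top_degree k * int (n + 1) \<le> a" using a by auto
  have b0: "top_quantum k * int (n + 1) \<le> b" using b by auto
  \<comment> \<open>In the first and fifth case the cup misses the cap and
    \<open>cap_bounded\<close> for \<open>k\<close> applies; in all others the two disappear and
    \<open>torus_bounded\<close> for \<open>k\<close> applies.\<close>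
  consider "i + 2 \<le> j'" | "j' = Suc i" | "j' = i" "i > 0" | "j' = 0" "i = 0" | "0 < j'" "j' < i" | "j' = 0" "i = 1" | "j' = 0" "i \<ge> 2"
    by linarith
  then show ?thesis
  proof cases
    case 1
    then have k: "k > 0" using ranges by auto
    then have w: "2 * k - 2 + 2 = 2 * k" by simp
    have "bounded_word (2 * k - 2) ([Cup (j' - 2)] @ torus_word (2 * k) ?M @ ascent 0 i @ [Cap i]) a b"
      by (rule cap_boundedD[OF E[OF k]]) (use 1 ranges far a0 b0 k in auto)
    from end_far_above[OF 1 this] show ?thesis unfolding w .
  next
    case 2
    then have k: "k > 0" using ranges by auto
    have "bounded_word (2 * k) (torus_word (2 * k) ?M @ ascent 0 i) a b"
      by (rule torus_boundedD[OF P, of "n + 1"]) (use 2 ranges M a0 b0 k in \<open>auto simp del: of_nat_add\<close>)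
    from end_above[OF this] show ?thesis unfolding 2 .
  next
    case 3
    then obtain i' where i': "i = Suc i'" by (cases i) auto
    then have k: "k > 0" using ranges by auto
    have "bounded_word (2 * k) (torus_word (2 * k) ?M @ ascent 0 i') a (b + 1)"
      by (rule torus_boundedD[OF P, of "n + 1"]) (use 3 i' ranges M a0 b0 k in \<open>auto simp del: of_nat_add\<close>)
    from end_same[OF this] show ?thesis unfolding 3 i' .
  next
    case 4
    have "bounded_word (2 * k) (torus_word (2 * k) ?M @ ascent 0 0) a (b - 1)"
      by (rule torus_boundedD[OF P, of "n + 1"]) (use 4 ranges M a0 b in \<open>auto simp del: of_nat_add\<close>)
    then have "bounded_word (2 * k) (torus_word (2 * k) ?M) a (b - 1)" by simp
    from end_circle[OF this] show ?thesis unfolding 4 .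
  next
    case 5
    then have k: "k > 0" using ranges by auto
    then have w: "2 * k - 2 + 2 = 2 * k" by simp
    obtain j where j: "j' = Suc j" using 5 by (cases j') auto
    have "bounded_word (2 * k - 2) ([Cup j] @ torus_word (2 * k) ?M @ ascent 0 (i - 2) @ [Cap (i - 2)]) (a - 1) (b - 1)"
      by (rule cap_boundedD[OF E[OF k]]) (use 5 ranges near low j a0 b0 k in auto)
    from end_below[OF _ this] show ?thesis using 5 unfolding w j by simp
  next
    case 6
    have "bounded_word (2 * k) (torus_word (2 * k) ?M @ ascent 0 0) (a - 1) (b - 2)"
      by (rule torus_boundedD[OF P, of "n + 1"]) (use 6 ranges M a b in \<open>auto simp del: of_nat_add\<close>)
    then have "bounded_word (2 * k) (torus_word (2 * k) ?M) (a - 1) (b - 2)" by simp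
    from end_bottom_one[OF this] show ?thesis unfolding 6 .
  next
    case 7
    \<comment> \<open>\<open>low\<close> guarantees a full row, part of which
      \<open>end_bottom\<close> pairs with the ascent.\<close>
    then obtain M' where M': "?M = Suc M'" using low by (cases ?M) auto
    have k: "k > 0" using 7 ranges by auto
    have "bounded_word (2 * k) (torus_word (2 * k) M' @ ascent 0 (2 * k - i)) (a - int i) (b - int i - 1)"
      by (rule torus_boundedD[OF P, of "n + 1"]) (use 7 ranges M M' a b in \<open>auto simp del: of_nat_add\<close>)
    from end_bottom[OF _ ranges(1) this] show ?thesis using 7 unfolding M' 7 by simp
  qed
qed

lemma cap_stuck:
  assumes P: "torus_bounded k"
    and ranges: "i \<le> 2 * k" "r < 2 * k \<or> r = 2 * k \<and> i = 2 * k"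
    and a: "top_degree k * int (n + 1) + 1 + int i \<le> a" and b: "top_quantum k * int (n + 1) + int i + 1 + (if i = 2 * k then 2 else 0) \<le> b"
  shows "bounded_word (2 * k) (torus_word (2 * k) (2 * k * n + r) @ [Cup 0] @ ascent 0 (Suc (2 * k)) @ ascent 0 i @ [Cap i]) a b"
proof (rule end_stuck[OF ranges(1)])
  assume i: "i = 2 * k"
  have "bounded_word (2 * k) (torus_word (2 * k) (2 * k * n + r) @ ascent 0 0) (a - 1 - int i) (b - 3 - int i)"
    by (rule torus_boundedD[OF P, of "n + 1"]) (use i ranges a b in \<open>auto simp del: of_nat_add\<close>)
  then show "bounded_word (2 * k) (torus_word (2 * k) (2 * k * n + r)) (a - 1 - int i) (b - 3 - int i)" by simp
next
  assume i: "i < 2 * k"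
  show "bounded_word (2 * k) (torus_word (2 * k) (2 * k * n + r) @ ascent 0 (2 * k - 1 - i)) (a - 1 - int i) (b - 1 - int i)"
    by (rule torus_boundedD[OF P, of "n + 1"]) (use i ranges a b in \<open>auto simp del: of_nat_add\<close>)
qed

text \<open>For \<open>m = 2 * k + 2\<close> strands the increments are \<open>2 * m - 2\<close> and
  \<open>2 * m\<close>, the cost of one full twist in \<open>full_twists\<close>.\<close>

lemma degree_Suc:
  "top_degree (Suc k) = top_degree k + 4 * int k + 2" "top_quantum (Suc k) = top_quantum k + 4 * int k + 4"
  by (simp_all add: top_degree_def top_quantum_def algebra_simps)

text \<open>After the full twists the cup faces \<open>r\<close> more rows. According to
  \<open>r \<le> j\<close>, \<open>r = j + 1\<close> or \<open>r \<ge> j + 2\<close> it keeps moving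
  down, is stuck at position 0 before the last row, or goes past the bottom.\<close>

lemma cap_bounded_Suc:
  assumes P: "torus_bounded k" and E: "k > 0 \<Longrightarrow> cap_bounded k"
  shows "cap_bounded (Suc k)"
  unfolding cap_bounded_def
proof (intro allI impI)
  fix n r i j
  define m where "m = 2 * Suc k"
  assume h: "r < 2 * Suc k" "i \<le> 2 * Suc k - 2" "j \<le> 2 * Suc k - 2" "r = 2 * Suc k - 1 \<longrightarrow> j \<le> i" "2 * Suc k * n + r = 0 \<longrightarrow> i \<le> j"
  have m2: "m - 2 = 2 * k" "m - 1 = Suc (2 * k)" "2 \<le> m" "m = 2 * k + 2" by (simp_all add: m_def)
  have h': "r \<le> 2 * k + 1" "i \<le> 2 * k" "j \<le> 2 * k" "r \<noteq> 2 * k + 1 \<or> j \<le> i" "n = 0 \<and> r = 0 \<longrightarrow> i \<le> j" using h by auto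
  define A B where "A = top_degree k * int (n + 1)" and "B = top_quantum k * int (n + 1)"
  \<comment> \<open>What is left of the bounds after \<open>n\<close> full twists: of the
    \<open>n + 1\<close> increments in \<open>degree_Suc\<close> one remains, less the
    \<open>1\<close> in \<open>cap_bounded\<close>.\<close>
  let ?a = "A + 2 * int m - 3" and ?b = "B + 2 * int m - 1"
  let ?T = "torus_word (2 * k) (2 * k * n)"
  have "bounded_word (2 * k) (?T @ [Cup j] @ torus_word m r @ ascent 0 i @ [Cap i]) ?a ?b"
  proof -
    consider "r \<le> j" | "r = Suc j" | "j + 2 \<le> r" by linarith
    then show ?thesis
    proof cases
      case 1
      have "bounded_word (2 * k) (torus_word (2 * k) (2 * k * n + r) @ [Cup (j - r)] @ ascent 0 i @ [Cap i]) (?a - int r) (?b - int r)"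
        by (rule cap_terminal[OF P E]) (use 1 h' m2 A_def B_def in \<open>auto simp del: of_nat_add\<close>)
      then have "bounded_word (2 * k) (?T @ torus_word (m - 2) r @ [Cup (j - r)] @ ascent 0 i @ [Cap i]) (?a - int r) (?b - int r)"
        by (simp add: torus_word_add m2)
      then show ?thesis by (intro rows_single[OF 1]) (use h' m2 in auto)
    next
      case 2
      have "bounded_word (2 * k) (torus_word (2 * k) (2 * k * n + j) @ [Cup 0] @ ascent 0 (Suc (2 * k)) @ ascent 0 i @ [Cap i]) (?a - int j) (?b - int j)"
        by (rule cap_stuck[OF P]) (use 2 h' m2 A_def B_def in \<open>auto simp del: of_nat_add\<close>)
      then have "bounded_word (2 * k) (?T @ torus_word (m - 2) j @ [Cup (j - j)] @ ascent 0 (m - 1) @ ascent 0 i @ [Cap i]) (?a - int j) (?b - int j)"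
        by (simp add: torus_word_add m2)
      then have "bounded_word (2 * k) (?T @ [Cup j] @ torus_word m j @ (ascent 0 (m - 1) @ ascent 0 i @ [Cap i])) ?a ?b"
        by (intro rows_single) (use h' m2 in auto)
      then show ?thesis by (simp only: 2 torus_word_Suc append.assoc)
    next
      case 3
      have "bounded_word (2 * k) (torus_word (2 * k) (2 * k * n + (r - 2)) @ [Cup (m + j - r)] @ ascent 0 i @ [Cap i]) (?a - int (m + r - 2)) (?b - int (m + r))"
        by (rule cap_terminal[OF P E]) (use 3 h' m2 A_def B_def in \<open>auto simp del: of_nat_add\<close>)
      then have "bounded_word (2 * k) (?T @ torus_word (m - 2) (r - 2) @ [Cup (m + j - r)] @ ascent 0 i @ [Cap i]) (?a - int (m + r - 2)) (?b - int (m + r))"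
        by (simp only: torus_word_add m2(1) append.assoc)
      then show ?thesis by (intro past_bottom[OF 3]) (use h' m2 in auto)
    qed
  qed
  moreover have ab: "top_degree (Suc k) * int (n + 1) - 1 - int n * (2 * int m - 2) = ?a"
    "top_quantum (Suc k) * int (n + 1) - 1 - int n * (2 * int m) = ?b"
    by (simp_all add: degree_Suc A_def B_def m2 algebra_simps)
  ultimately have "bounded_word (2 * k) ([] @ torus_word (m - 2) ((m - 2) * n) @ [Cup j] @ (torus_word m r @ ascent 0 i @ [Cap i]))
      (top_degree (Suc k) * int (n + 1) - 1 - int n * (2 * int m - 2)) (top_quantum (Suc k) * int (n + 1) - 1 - int n * (2 * int m))"
    unfolding ab m2(1) by simp
  from full_twists[OF _ m2(3) this]
  have "bounded_word (2 * k) ([] @ [Cup j] @ torus_word m (m * n) @ (torus_word m r @ ascent 0 i @ [Cap i]))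
      (top_degree (Suc k) * int (n + 1) - 1) (top_quantum (Suc k) * int (n + 1) - 1)"
    using h'(3) m2(1) by simp
  then show "bounded_word (2 * Suc k - 2) ([Cup j] @ torus_word (2 * Suc k) (2 * Suc k * n + r) @ ascent 0 i @ [Cap i])
      (top_degree (Suc k) * int (n + 1) - 1) (top_quantum (Suc k) * int (n + 1) - 1)"
    unfolding m_def torus_word_add by simp
qed

text \<open>\<open>climb_row\<close> adds the crossings of one row, each 1-smoothing being covered
  by \<open>cap_bounded\<close>; a completed row counts as the next \<open>N\<close>. The start is
  the word without crossings.\<close>

lemma torus_bounded_step:
  assumes k: "k > 0" and E: "cap_bounded k"
  shows "torus_bounded k"
proof -
  have climb_row: "bounded_word (2 * k) (torus_word (2 * k) N @ ascent 0 i) (top_degree k * int n) (top_quantum k * int n)"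
    if "bounded_word (2 * k) (torus_word (2 * k) N @ ascent 0 0) (top_degree k * int n) (top_quantum k * int n)"
      "i \<le> 2 * k - 1" "N + (if i > 0 then 1 else 0) \<le> 2 * k * n" for n N i
    using that(2,3)
  proof (induction i)
    case 0
    show ?case using that(1) .
  next
    case (Suc i)
    \<comment> \<open>\<open>n0\<close> is the number of complete full twists among the
      \<open>N\<close> rows. As the new crossing still belongs to the first \<open>n\<close> full
      twists, \<open>n0 + 1 \<le> n\<close>, and the bound of \<open>cap_bounded\<close> for
      \<open>n0\<close> is good enough.\<close>
    define n0 r where "n0 = N div (2 * k)" and "r = N mod (2 * k)"
    have N: "2 * k * n0 + r = N" "r < 2 * k" using k by (simp_all add: n0_def r_def)
    have "\<not> n \<le> n0"
    proof
      assume "n \<le> n0"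
      then have "2 * k * n \<le> 2 * k * n0" by (rule mult_le_mono2)
      moreover have "Suc N \<le> 2 * k * n" using Suc.prems(2) by simp
      ultimately show False using N(1) by linarith
    qed
    then have n0: "int (n0 + 1) \<le> int n" by simp
    have "top_degree k * int (n0 + 1) \<le> top_degree k * int n" "top_quantum k * int (n0 + 1) \<le> top_quantum k * int n"
      using n0 by (intro mult_left_mono; simp add: top_degree_def top_quantum_def)+
    then have "bounded_word (2 * k - 2) ([Cup i] @ torus_word (2 * k) (2 * k * n0 + r) @ ascent 0 i @ [Cap i])
        (top_degree k * int n - 1) (top_quantum k * int n - 1)"
      by (intro cap_boundedD[OF E]) (use N Suc.prems in auto)
    have w: "2 * k - 2 + 2 = 2 * k" using k by simp
    from cup_to_front[OF \<open>bounded_word (2 * k - 2) _ _ _\<close>]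
    have "bounded_word (2 * k) ((torus_word (2 * k) N @ ascent 0 i) @ [Cap i, Cup i] @ []) (top_degree k * int n - 1) (top_quantum k * int n - 1)"
      unfolding w N(1) by simp
    moreover have "bounded_word (2 * k) ((torus_word (2 * k) N @ ascent 0 i) @ []) (top_degree k * int n) (top_quantum k * int n)"
      using Suc.IH Suc.prems by (simp split: if_splits)
    ultimately have "bounded_word (2 * k) ((torus_word (2 * k) N @ ascent 0 i) @ [Cross () i] @ []) (top_degree k * int n) (top_quantum k * int n)"
      by (rule bounded_naive[rotated])
    then show ?case by (simp only: ascent_last append.assoc append_Nil2)
  qed
  have main: "bounded_word (2 * k) (torus_word (2 * k) N @ ascent 0 i) (top_degree k * int n) (top_quantum k * int n)"
    if "1 \<le> n" "i \<le> 2 * k - 1" "N + (if i > 0 then 1 else 0) \<le> 2 * k * n" for n N i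
    using that(2,3)
  proof (induction N arbitrary: i)
    case 0
    have "0 \<le> top_degree k * int n" by (simp add: top_degree_def)
    \<comment> \<open>The closure of the empty word consists of \<open>2 * k\<close> circles;
      \<open>1 \<le> n\<close> leaves room for their q-degree.\<close>
    moreover have "int (2 * k) \<le> top_quantum k * int n"
      using \<open>1 \<le> n\<close> mult_mono[of "int (2 * k)" "top_quantum k" 1 "int n"] by (simp add: top_quantum_def)
    ultimately have "bounded_word (2 * k) (torus_word (2 * k) 0 @ ascent 0 0) (top_degree k * int n) (top_quantum k * int n)"
      using bounded_word_mono[OF bounded_Nil[of "2 * k"]] by (simp add: torus_word_simps)
    from climb_row[OF this] show ?case using 0 .
  next
    case (Suc N)
    have "bounded_word (2 * k) (torus_word (2 * k) N @ ascent 0 (2 * k - 1)) (top_degree k * int n) (top_quantum k * int n)"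
      by (rule Suc.IH) (use Suc.prems in \<open>auto split: if_splits\<close>)
    then have "bounded_word (2 * k) (torus_word (2 * k) (Suc N) @ ascent 0 0) (top_degree k * int n) (top_quantum k * int n)"
      by (simp add: torus_word_Suc)
    from climb_row[OF this] show ?case using Suc.prems .
  qed
  then show ?thesis by (simp add: torus_bounded_def)
qed

theorem torus_bounded: "torus_bounded k"
proof -
  have "torus_bounded k \<and> (k > 0 \<longrightarrow> cap_bounded k)"
  proof (induction k)
    case 0
    show ?case using torus_bounded_0 by simp
  next
    case (Suc k)
    then have "cap_bounded (Suc k)" using cap_bounded_Suc by blast
    then show ?case using torus_bounded_step by blast
  qed
  then show ?thesis by blast
qed

end


section \<open>Passage to homology groups\<close>

lemma (in group) trivial_group_self_quotient: "trivial_group (G Mod carrier G)"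
proof -
  have n: "carrier G \<lhd> G" by (rule normal_invI[OF subgroup_self]) simp
  have "rcosets carrier G = {carrier G}"
    using coset_join2[OF _ subgroup_self] one_closed by (auto simp: RCOSETS_def)
  then show ?thesis using normal.factorgroup_is_group[OF n] by (simp add: trivial_group_def FactGroup_def)
qed

lemma obtain_poly_mapping:
  fixes f :: "'c \<Rightarrow> int"
  assumes "finite {a. f a \<noteq> 0}"
  obtains p where "Poly_Mapping.lookup p = f"
proof (rule that)
  show "Poly_Mapping.lookup (Abs_poly_mapping f) = f" by (rule Abs_poly_mapping_inverse) (use assms in simp)
qed

context source_sink_diagram
begin

text \<open>The link between the formal sums defining the boundary and the matrix studied so
  far.\<close>

lemma lookup_boundary_basis: "Poly_Mapping.lookup (boundary_basis D a) b = coeff a b"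
proof -
  obtain v x where a: "a = (v, x)" by (cases a)
  obtain w y where b: "b = (w, y)" by (cases b)
  have "(-1) ^ card {l \<in> v. l < m} * (\<Sum>y'\<in>{y \<in> labellings D (insert m v). edge_entry D v x (insert m v) y}. if b = (insert m v, y') then 1 else 0) =
      (if w = insert m v \<and> y \<in> labellings D w \<and> merge_or_split (circles D v) (circles D (insert m v)) x y then (-1) ^ card {l \<in> v. l < m} else (0::int))" for m
  proof -
    have e: "edge_entry D v x (insert m v) y \<longleftrightarrow> merge_or_split (circles D v) (circles D (insert m v)) x y"
      unfolding edge_entry_def merge_or_split_def ..
    have fin: "finite {y \<in> labellings D (insert m v). edge_entry D v x (insert m v) y}" using finite_labellings by simp
    have "(\<Sum>y'\<in>{y \<in> labellings D (insert m v). edge_entry D v x (insert m v) y}. if b = (insert m v, y') then 1 else 0) =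
        (if w = insert m v then \<Sum>y'\<in>{y \<in> labellings D (insert m v). edge_entry D v x (insert m v) y}. if y = y' then 1 else 0 else (0::int))"
      by (simp add: b)
    also have "\<dots> = (if w = insert m v \<and> y \<in> labellings D (insert m v) \<and> edge_entry D v x (insert m v) y then 1 else 0)"
      using fin by (simp add: sum.delta')
    finally show ?thesis unfolding e by (cases "w = insert m v") simp_all
  qed
  then show ?thesis
    unfolding a boundary_basis_def coeff_def fst_conv by (simp add: lookup_sum b)
qed

lemma lookup_boundary:
  assumes "Poly_Mapping.keys c \<subseteq> cells"
  shows "Poly_Mapping.lookup (boundary D c) b = (\<Sum>a\<in>cells. Poly_Mapping.lookup c a * coeff a b)"
  unfolding boundary_def frag_extend_def lookup_sum lookup_frag_cmul lookup_boundary_basis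
  by (rule sum.mono_neutral_left) (use assms finite_cells in \<open>auto simp: in_keys_iff\<close>)

lemma basis_cells: "basis D i j = {a \<in> cells. hdeg a = i \<and> qdeg a = j}"
  unfolding basis_def cells_def hdeg_def qdeg_def by auto

lemma boundary_degree:
  assumes "a \<in> basis D i j" "coeff a b \<noteq> 0" shows "b \<in> basis D (i + 1) j"
proof -
  have a: "a \<in> cells" using assms(1) by (simp add: basis_cells)
  obtain v x w y where e: "a = (v, x)" "b = (w, y)" by (cases a, cases b)
  obtain m where "m < ncross D" "w = insert m v" "y \<in> labellings D w" using coeff_nonzeroD assms(2) unfolding e by metis
  then have b: "b \<in> cells" using a by (auto simp: cells_def e)
  then have "bd a b \<noteq> 0" using a assms(2) by (simp add: bd_def)
  then have "hdeg b = hdeg a + 1" "qdeg b = qdeg a"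
    using graded_bd[unfolded graded_by_def, rule_format, of a b] qdeg_bd[of a b] by blast+
  then show ?thesis using b assms(1) by (simp add: basis_cells)
qed

lemma boundary_carrier: "boundary D \<in> hom (chain_group D i j) (chain_group D (i + 1) j)"
proof (rule homI)
  fix c assume c: "c \<in> carrier (chain_group D i j)"
  then have k: "Poly_Mapping.keys c \<subseteq> basis D i j" by (simp add: chain_group_def free_Abelian_group_def)
  have "Poly_Mapping.keys (boundary D c) \<subseteq> basis D (i + 1) j"
  proof
    fix b assume "b \<in> Poly_Mapping.keys (boundary D c)"
    moreover have "Poly_Mapping.keys c \<subseteq> cells" using k by (auto simp: basis_cells)
    ultimately have "(\<Sum>a\<in>cells. Poly_Mapping.lookup c a * coeff a b) \<noteq> 0" by (simp add: in_keys_iff lookup_boundary)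
    then obtain a where "Poly_Mapping.lookup c a * coeff a b \<noteq> 0" by (rule sum.not_neutral_contains_not_neutral)
    then show "b \<in> basis D (i + 1) j" using k boundary_degree[of a i j b] by (auto simp: in_keys_iff)
  qed
  then show "boundary D c \<in> carrier (chain_group D (i + 1) j)" by (simp add: chain_group_def free_Abelian_group_def)
next
  fix c c'
  show "boundary D (c \<otimes>\<^bsub>chain_group D i j\<^esub> c') = boundary D c \<otimes>\<^bsub>chain_group D (i + 1) j\<^esub> boundary D c'"
    by (simp add: chain_group_def free_Abelian_group_def boundary_def frag_extend_add)
qed

lemma boundary_boundary:
  assumes "Poly_Mapping.keys c \<subseteq> basis D i j" shows "boundary D (boundary D c) = 0"
proof (rule poly_mapping_eqI)
  fix e
  have c: "Poly_Mapping.keys c \<subseteq> cells" using assms by (auto simp: basis_cells)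
  have "c \<in> carrier (chain_group D i j)" using assms by (simp add: chain_group_def free_Abelian_group_def)
  then have "boundary D c \<in> carrier (chain_group D (i + 1) j)" by (rule hom_in_carrier[OF boundary_carrier])
  then have k: "Poly_Mapping.keys (boundary D c) \<subseteq> cells"
    by (auto simp: chain_group_def free_Abelian_group_def basis_cells)
  have z: "(\<Sum>b\<in>cells. coeff a b * coeff b e) = 0" if "a \<in> cells" for a
  proof (cases "e \<in> cells")
    case True
    then show ?thesis using chain_complex_cells that by (simp add: chain_complex_on_def)
  next
    case False
    have "coeff b e = 0" if "b \<in> cells" for b
      using boundary_degree[of b "hdeg b" "qdeg b" e] that False by (auto simp: basis_cells)
    then show ?thesis by simp
  qed
  have "Poly_Mapping.lookup (boundary D (boundary D c)) e =
      (\<Sum>b\<in>cells. \<Sum>a\<in>cells. Poly_Mapping.lookup c a * (coeff a b * coeff b e))"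
    by (simp add: lookup_boundary[OF k] lookup_boundary[OF c] sum_distrib_right mult.assoc)
  also have "\<dots> = (\<Sum>a\<in>cells. Poly_Mapping.lookup c a * (\<Sum>b\<in>cells. coeff a b * coeff b e))"
    by (subst sum.swap) (simp add: sum_distrib_left)
  also have "\<dots> = 0" using z by (intro sum.neutral) auto
  finally show "Poly_Mapping.lookup (boundary D (boundary D c)) e = Poly_Mapping.lookup 0 e" by simp
qed

text \<open>Cells of other degrees do not occur in cycles of degree \<open>(i, j)\<close>, so
  exactness of the matrix makes kernel and image equal. Finiteness of the set of cells turns the
  function \<open>y\<close> back into a formal sum.\<close>

lemma trivial_homology:
  assumes "exact_at hdeg bd (cells \<inter> layer j) i"
  shows "trivial_group (diagram_homology D i j)"
proof -
  let ?A = "chain_group D i j" and ?B = "chain_group D (i + 1) j" and ?C = "chain_group D (i - 1) j"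
  have car: "c \<in> carrier (chain_group D i' j) \<longleftrightarrow> Poly_Mapping.keys c \<subseteq> basis D i' j" for c i'
    by (simp add: chain_group_def free_Abelian_group_def)
  have gr: "group (chain_group D i' j)" for i' by (simp add: chain_group_def)
  interpret f: group_hom ?A ?B "boundary D"
    by (intro group_hom.intro gr group_hom_axioms.intro boundary_carrier)
  have one: "\<one>\<^bsub>?B\<^esub> = 0" by (simp add: chain_group_def free_Abelian_group_def)
  let ?K = "kernel ?A ?B (boundary D)"
  let ?U = "cells \<inter> layer j"
  have restrict: "(\<Sum>a\<in>?U. Poly_Mapping.lookup c a * bd a b) = Poly_Mapping.lookup (boundary D c) b"
    if c: "Poly_Mapping.keys c \<subseteq> basis D i' j" and b: "b \<in> cells" for c i' b
  proof -
    have kc: "Poly_Mapping.keys c \<subseteq> cells" using c by (auto simp: basis_cells)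
    have "(\<Sum>a\<in>?U. Poly_Mapping.lookup c a * bd a b) = (\<Sum>a\<in>?U. Poly_Mapping.lookup c a * coeff a b)"
      using b by (intro sum.cong refl) (simp add: bd_def)
    also have "\<dots> = (\<Sum>a\<in>cells. Poly_Mapping.lookup c a * coeff a b)"
      by (rule sum.mono_neutral_left) (use finite_cells c in \<open>auto simp: in_keys_iff basis_cells layer_def\<close>)
    finally show ?thesis by (simp add: lookup_boundary[OF kc])
  qed
  have "boundary D ` carrier ?C = ?K"
  proof (intro equalityI subsetI)
    fix z assume "z \<in> boundary D ` carrier ?C"
    then obtain y where y: "z = boundary D y" "y \<in> carrier ?C" by blast
    have "z \<in> carrier ?A" using hom_in_carrier[OF boundary_carrier y(2)] y(1) by simp
    moreover have "boundary D z = 0" using boundary_boundary y car by blast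
    ultimately show "z \<in> ?K" by (simp add: kernel_def one)
  next
    fix z assume "z \<in> ?K"
    then have z: "Poly_Mapping.keys z \<subseteq> basis D i j" "boundary D z = 0" by (auto simp: kernel_def one car)
    have "\<exists>y. (\<forall>a. y a \<noteq> 0 \<longrightarrow> a \<in> ?U \<and> hdeg a = i - 1) \<and> (\<forall>b\<in>?U. Poly_Mapping.lookup z b = (\<Sum>a\<in>?U. y a * bd a b))"
    proof (rule assms[unfolded exact_at_def, rule_format], intro conjI allI ballI impI)
      fix a assume "Poly_Mapping.lookup z a \<noteq> 0"
      then show "a \<in> ?U" "hdeg a = i" using z(1) by (auto simp: in_keys_iff basis_cells layer_def)
    next
      fix b assume "b \<in> ?U"
      then show "(\<Sum>a\<in>?U. Poly_Mapping.lookup z a * bd a b) = 0" using restrict[OF z(1), of b] z(2) by simp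
    qed
    then obtain y where y: "\<And>a. y a \<noteq> 0 \<Longrightarrow> a \<in> ?U \<and> hdeg a = i - 1"
      "\<And>b. b \<in> ?U \<Longrightarrow> Poly_Mapping.lookup z b = (\<Sum>a\<in>?U. y a * bd a b)" by blast
    have "finite {a. y a \<noteq> 0}" by (rule finite_subset[OF _ finite_cells]) (use y(1) in auto)
    then obtain p where p: "Poly_Mapping.lookup p = y" by (rule obtain_poly_mapping)
    have kp: "Poly_Mapping.keys p \<subseteq> basis D (i - 1) j"
      using y(1) by (auto simp: in_keys_iff p basis_cells layer_def)
    have kb: "Poly_Mapping.keys (boundary D p) \<subseteq> basis D i j"
      using hom_in_carrier[OF boundary_carrier, of p "i - 1" j] kp by (simp add: car)
    have "boundary D p = z"
    proof (rule poly_mapping_eqI)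
      fix b
      show "Poly_Mapping.lookup (boundary D p) b = Poly_Mapping.lookup z b"
      proof (cases "b \<in> ?U")
        case True
        then show ?thesis using y(2)[OF True] restrict[OF kp, of b] by (simp add: p)
      next
        case False
        then have "b \<notin> basis D i j" by (auto simp: basis_cells layer_def)
        then have "b \<notin> Poly_Mapping.keys (boundary D p)" "b \<notin> Poly_Mapping.keys z" using kb z(1) by auto
        then show ?thesis by (simp add: in_keys_iff)
      qed
    qed
    then show "z \<in> boundary D ` carrier ?C" using kp car by blast
  qed
  moreover have "carrier (subgroup_generated ?A ?K) = ?K"
    by (rule subgroup.carrier_subgroup_generated_subgroup[OF f.subgroup_kernel])
  ultimately show ?thesis
    unfolding diagram_homology_def using group.trivial_group_self_quotient[OF f.G.group_subgroup_generated, of ?K] by simp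
qed

end


section \<open>Closed braids\<close>

lemma touches_Nil [simp]: "touches [] s = 0"
  by (simp add: touches_def)

lemma touches_take_Suc:
  "t < length w \<Longrightarrow> touches (take (Suc t) w) s = touches (take t w) s + (if s = w ! t - 1 \<or> s = w ! t then 1 else 0)"
  by (simp add: touches_def take_Suc_conv_app_nth)

lemma touches_mono: "t \<le> t' \<Longrightarrow> touches (take t w) s \<le> touches (take t' w) s"
proof (induction t' rule: dec_induct)
  case (step t')
  then show ?case by (cases "t' < length w") (auto simp: touches_take_Suc)
qed simp

lemma touches_le: "touches (take t w) s \<le> touches w s"
  using touches_mono[of t "max t (length w)" w s] by simp

lemma touches_less: "t < length w \<Longrightarrow> s = w ! t - 1 \<or> s = w ! t \<Longrightarrow> touches (take t w) s < touches w s"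
  using touches_le[of "Suc t" w s] by (simp add: touches_take_Suc)

text \<open>\<open>touches (take t w) s\<close> numbers the crossings on position \<open>s\<close>
  consecutively from 0; this lemma and \<open>touches_surj\<close> say that the numbering is
  bijective.\<close>

lemma touches_inj:
  assumes "t < length w" "t' < length w" "s = w ! t - 1 \<or> s = w ! t" "s = w ! t' - 1 \<or> s = w ! t'"
    "touches (take t w) s = touches (take t' w) s"
  shows "t = t'"
proof (rule ccontr)
  assume "t \<noteq> t'"
  then consider "t < t'" | "t' < t" by linarith
  then show False
  proof cases
    case 1
    then show ?thesis using touches_mono[of "Suc t" t' w s] assms by (auto simp: touches_take_Suc)
  next
    case 2
    then show ?thesis using touches_mono[of "Suc t'" t w s] assms by (auto simp: touches_take_Suc)
  qed
qed

lemma touches_surj: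
  assumes "i < touches (take t w) s" "t \<le> length w"
  shows "\<exists>t'<t. (s = w ! t' - 1 \<or> s = w ! t') \<and> touches (take t' w) s = i"
  using assms
proof (induction t)
  case (Suc t)
  show ?case
  proof (cases "i < touches (take t w) s")
    case True
    then show ?thesis using Suc by (metis Suc_leD less_SucI)
  next
    case False
    then have "s = w ! t - 1 \<or> s = w ! t" "touches (take t w) s = i"
      using Suc.prems by (auto simp: touches_take_Suc split: if_splits)
    then show ?thesis by blast
  qed
qed simp

locale braid =
  fixes p :: nat and w :: "nat list"
  assumes letters: "set w \<subseteq> {1..<p}"
begin

abbreviation "D \<equiv> braid_closure p w"

lemma letter: "t < length w \<Longrightarrow> 1 \<le> w ! t \<and> w ! t < p"
  using letters nth_mem by fastforce

lemma length_crossings [simp]: "length (crossings D) = length w"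
  by (simp add: braid_closure_def)

lemma crossing_nth: "t < length w \<Longrightarrow> crossings D ! t = braid_crossing w t"
  by (simp add: braid_closure_def)

text \<open>By \<open>braid_crossing\<close>, corners 0 and 1 lie on the right of a crossing and 2
  and 3 on the left; 0 and 3 lie at the bottom.\<close>

definition column :: "nat \<times> nat \<Rightarrow> nat" where
  "column e = (if snd e < 2 then w ! fst e else w ! fst e - 1)"

definition below :: "nat \<times> nat \<Rightarrow> bool" where
  "below e \<longleftrightarrow> snd e = 0 \<or> snd e = 3"

lemma less_4_cases: "k < 4 \<Longrightarrow> k = 0 \<or> k = 1 \<or> k = 2 \<or> k = (3 :: nat)"
  by auto

lemma end_arc_braid:
  assumes "t < length w" "k < 4"
  shows "end_arc D (t, k) = braid_arc w (if below (t, k) then t else Suc t) (column (t, k))"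
  using less_4_cases[OF assms(2)] assms(1)
  by (auto simp: end_arc_def crossing_nth braid_crossing_def Let_def below_def column_def)

lemma end_column: "t < length w \<Longrightarrow> column (t, k) = w ! t - 1 \<or> column (t, k) = w ! t"
  by (simp add: column_def)

text \<open>The source-sink orientation runs upwards in even columns and downwards in odd ones, so
  the direction of an end depends only on its column and on whether it is a lower or an upper
  end.\<close>

lemma end_inward:
  assumes "t < length w" "k < 4"
  shows "(even k = even (w ! t)) \<longleftrightarrow> (below (t, k) = even (column (t, k)))"
proof -
  obtain g where g: "w ! t = Suc g" using letter[OF assms(1)] by (cases "w ! t") auto
  show ?thesis using less_4_cases[OF assms(2)] by (auto simp: below_def column_def g)
qed

lemma end_exists:
  assumes "t < length w" "s = w ! t - 1 \<or> s = w ! t"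
  obtains k where "k < 4" "column (t, k) = s" "below (t, k) = b"
proof (cases "s = w ! t")
  case True
  show ?thesis by (rule that[of "if b then 0 else 1"]) (auto simp: column_def below_def True)
next
  case False
  then show ?thesis using assms(2) by (intro that[of "if b then 3 else 2"]) (auto simp: column_def below_def)
qed

lemma braid_arc_in: "s < p \<Longrightarrow> braid_arc w t s \<in> arcs D"
  by (cases "touches w s = 0") (use touches_le[of t w s] in \<open>auto simp: braid_arc_def braid_closure_def\<close>)

text \<open>Within a column, each arc at a crossing runs from the upper end of one crossing to the
  lower end of the next, cyclically because of the closure. So it has exactly one end of each
  kind.\<close>

lemma source_sink: "source_sink_diagram D (\<lambda>t. even (w ! t))"
proof
  have "arcs D \<subseteq> Sigma {..<p} (\<lambda>s. {..<max 1 (touches w s)})" by (auto simp: braid_closure_def)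
  then show "finite (arcs D)" by (rule finite_subset) auto
next
  fix e assume "e \<in> ends {..<length (crossings D)}"
  then obtain t k where e: "e = (t, k)" "t < length w" "k < 4" by (auto simp: ends_def)
  have "column (t, k) < p" using end_column[OF e(2), of k] letter[OF e(2)] by auto
  then show "end_arc D e \<in> arcs D" unfolding e(1) end_arc_braid[OF e(2,3)] by (rule braid_arc_in)
next
  fix e e'
  assume ee: "e \<in> ends {..<length (crossings D)}" "e' \<in> ends {..<length (crossings D)}"
    "(even (snd e) = even (w ! fst e)) = (even (snd e') = even (w ! fst e'))" "end_arc D e = end_arc D e'"
  obtain t k where e: "e = (t, k)" "t < length w" "k < 4" using ee(1) by (auto simp: ends_def)
  obtain t' k' where e': "e' = (t', k')" "t' < length w" "k' < 4" using ee(2) by (auto simp: ends_def)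
  have arc: "braid_arc w (if below (t, k) then t else Suc t) (column (t, k)) = braid_arc w (if below (t', k') then t' else Suc t') (column (t', k'))"
    using ee(4) unfolding e(1) e'(1) end_arc_braid[OF e(2,3)] end_arc_braid[OF e'(2,3)] .
  then have c: "column (t, k) = column (t', k')" by (simp add: braid_arc_def)
  have b: "below (t, k) = below (t', k')"
    using ee(3) end_inward[OF e(2,3)] end_inward[OF e'(2,3)] c unfolding e(1) e'(1) fst_conv snd_conv by argo
  let ?s = "column (t', k')"
  have s: "?s = w ! t - 1 \<or> ?s = w ! t" "?s = w ! t' - 1 \<or> ?s = w ! t'"
    using end_column[OF e(2), of k] end_column[OF e'(2), of k'] c by auto
  have less: "touches (take t w) ?s < touches w ?s" "touches (take t' w) ?s < touches w ?s"
    using touches_less[OF e(2) s(1)] touches_less[OF e'(2) s(2)] by auto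
  have mod_Suc_inj: "a = a'" if "a < T" "a' < T" "Suc a mod T = Suc a' mod T" for a a' T :: nat
    using that by (auto simp: mod_Suc split: if_splits)
  have "touches (take t w) ?s = touches (take t' w) ?s"
  proof (cases "below (t', k')")
    case True
    then show ?thesis using arc less b c by (simp add: braid_arc_def)
  next
    case False
    then have "Suc (touches (take t w) ?s) mod touches w ?s = Suc (touches (take t' w) ?s) mod touches w ?s"
      using arc b c s e(2) e'(2) by (simp add: braid_arc_def touches_take_Suc)
    then show ?thesis by (rule mod_Suc_inj[OF less])
  qed
  then have t: "t = t'" using touches_inj[OF e(2) e'(2) s] by simp
  obtain g where g: "w ! t' = Suc g" using letter[OF e'(2)] by (cases "w ! t'") auto
  have "k = k'" using less_4_cases[OF e(3)] less_4_cases[OF e'(3)] c b by (auto simp: t column_def below_def g)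
  then show "e = e'" using t e(1) e'(1) by simp
next
  fix e assume "e \<in> ends {..<length (crossings D)}"
  then obtain t k where e: "e = (t, k)" "t < length w" "k < 4" by (auto simp: ends_def)
  let ?s = "column (t, k)" and ?b = "below (t, k)"
  let ?T = "touches w ?s" and ?i = "touches (take t w) ?s"
  have s: "?s = w ! t - 1 \<or> ?s = w ! t" by (rule end_column[OF e(2)])
  have less: "?i < ?T" by (rule touches_less[OF e(2) s])
  \<comment> \<open>The number of the crossing at the other end of the arc: the previous one for a
    lower end, the next one for an upper end, both cyclically.\<close>
  define i where "i = (if ?b then (if ?i = 0 then ?T - 1 else ?i - 1) else Suc ?i mod ?T)"
  have "i < touches (take (length w) w) ?s" using less by (auto simp: i_def)
  from touches_surj[OF this]
  obtain t' where t': "t' < length w" "?s = w ! t' - 1 \<or> ?s = w ! t'" "touches (take t' w) ?s = i" by auto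
  obtain k' where k': "k' < 4" "column (t', k') = ?s" "below (t', k') = (\<not> ?b)" using end_exists[OF t'(1,2)] by metis
  have "braid_arc w (if ?b then t else Suc t) ?s = braid_arc w (if \<not> ?b then t' else Suc t') ?s"
  proof (cases ?b)
    case True
    have "?i mod ?T = Suc i mod ?T" using less by (auto simp: i_def True)
    then show ?thesis using t' by (simp add: braid_arc_def True touches_take_Suc)
  next
    case False
    have "Suc ?i mod ?T = i mod ?T" using less by (simp add: i_def False)
    then show ?thesis using t' s e(2) by (simp add: braid_arc_def False touches_take_Suc)
  qed
  then have "end_arc D e = end_arc D (t', k')"
    unfolding e(1) end_arc_braid[OF e(2,3)] end_arc_braid[OF t'(1) k'(1)] k' .
  moreover have "(even k' = even (w ! t')) \<noteq> (even k = even (w ! t))"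
    unfolding end_inward[OF e(2,3)] end_inward[OF t'(1) k'(1)] k' by argo
  ultimately show "\<exists>e'\<in>ends {..<length (crossings D)}. (even (snd e') = even (w ! fst e')) \<noteq> (even (snd e) = even (w ! fst e)) \<and>
      end_arc D e = end_arc D e'"
    using t'(1) k'(1) by (intro bexI[of _ "(t', k')"]) (auto simp: e(1) ends_def)
qed

sublocale source_sink_diagram D "\<lambda>t. even (w ! t)"
  by (rule source_sink)

lemma conn_all: "conn D {..<length w} v = Id"
  by (simp add: conn_def eq_closure_def)

definition strands :: "nat \<Rightarrow> (nat \<times> nat) set list" where
  "strands t = map (\<lambda>s. {braid_arc w t s}) [0..<p]"

lemma braid_arc_Suc:
  "t < length w \<Longrightarrow> s \<noteq> w ! t - 1 \<Longrightarrow> s \<noteq> w ! t \<Longrightarrow> braid_arc w (Suc t) s = braid_arc w t s"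
  by (simp add: braid_arc_def touches_take_Suc)

lemma strands_step:
  assumes t: "t < length w"
  shows "\<exists>N. step Id (Cross t (w ! t - 1)) (strands t) (strands (Suc t)) N"
proof -
  obtain g where g: "w ! t = Suc g" using letter[OF t] by (cases "w ! t") auto
  have gp: "Suc g < p" using letter[OF t] g by simp
  have "[0..<p] = [0..<g] @ [g..<p]" using gp upt_add_eq_append[of 0 g "p - g"] by simp
  then have u: "[0..<p] = [0..<g] @ [g, Suc g] @ [Suc (Suc g)..<p]" using gp by (simp add: upt_conv_Cons)
  let ?low = "map (\<lambda>s. {braid_arc w t s}) [0..<g]" and ?high = "map (\<lambda>s. {braid_arc w t s}) [Suc (Suc g)..<p]"
  have low: "map (\<lambda>s. {braid_arc w (Suc t) s}) [0..<g] = ?low"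
    "map (\<lambda>s. {braid_arc w (Suc t) s}) [Suc (Suc g)..<p] = ?high"
    using braid_arc_Suc[OF t] g by auto
  have s: "strands t = ?low @ {braid_arc w t g} # {braid_arc w t (Suc g)} # ?high"
    "strands (Suc t) = ?low @ {braid_arc w (Suc t) g} # {braid_arc w (Suc t) (Suc g)} # ?high"
    unfolding strands_def u map_append low by simp_all
  have "corners Id t {braid_arc w t g} {braid_arc w t (Suc g)} {braid_arc w (Suc t) g} {braid_arc w (Suc t) (Suc g)}"
    unfolding corners_def using end_arc_braid[OF t] by (simp add: below_def column_def g)
  moreover have "length ?low = g" by simp
  ultimately have "step Id (Cross t g) (strands t) (strands (Suc t)) {{braid_arc w (Suc t) g}, {braid_arc w (Suc t) (Suc g)}}"
    unfolding s by (subst step_Cross) auto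
  then show ?thesis using g by auto
qed

lemma strands_run:
  "t \<le> length w \<Longrightarrow> \<exists>V. run Id (map (\<lambda>t. Cross t (w ! t - 1)) [0..<t]) (strands 0) (strands t) V"
proof (induction t)
  case (Suc t)
  obtain V where V: "run Id (map (\<lambda>t. Cross t (w ! t - 1)) [0..<t]) (strands 0) (strands t) V" using Suc by auto
  obtain N where "step Id (Cross t (w ! t - 1)) (strands t) (strands (Suc t)) N" using strands_step[of t] Suc.prems by (auto simp: Suc_le_eq)
  then have "run Id [Cross t (w ! t - 1)] (strands t) (strands (Suc t)) N" by auto
  then show ?case using V by (auto simp: run_append)
qed auto

lemma braid_arc_length: "braid_arc w (length w) s = braid_arc w 0 s"
  by (simp add: braid_arc_def)

text \<open>With no crossing resolved, strands are single arcs and the word is the braid itself. The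
  only closed circles are columns without crossings, and their arcs occur in the bottom
  list.\<close>

lemma represents_braid: "represents p (crossing_word (map (\<lambda>g. g - 1) w)) {..<length w} {} {}"
  unfolding represents_def
proof (intro conjI)
  have closed: "strands (length w) = strands 0" by (simp add: strands_def braid_arc_length)
  obtain V where V: "run Id (map (\<lambda>t. Cross t (w ! t - 1)) [0..<length w]) (strands 0) (strands 0) V"
    using strands_run[of "length w"] closed by auto
  have lab: "labels (map (\<lambda>t. Cross t (w ! t - 1)) ts) = ts" for ts by (induction ts) auto
  have "erase (map (\<lambda>t. Cross t (w ! t - 1)) [0..<length w]) = crossing_word (map (\<lambda>g. g - 1) w)"
    unfolding crossing_word_def by (rule nth_equalityI) auto
  moreover have "closed_circles {..<length w} {} \<subseteq> set (strands 0)"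
  proof
    fix C assume "C \<in> closed_circles {..<length w} {}"
    then obtain a where a: "a \<in> arcs D" "C = {a}" and free: "\<And>e. e \<in> ends {..<length w} \<Longrightarrow> end_arc D e \<noteq> a"
      by (auto simp: closed_circles_def conn_all quotient_def)
    obtain s l where sl: "a = (s, l)" "s < p" "l < max 1 (touches w s)" using a(1) by (auto simp: braid_closure_def)
    have "\<not> l < touches w s"
    proof
      assume l: "l < touches w s"
      then have "l < touches (take (length w) w) s" by simp
      from touches_surj[OF this] obtain t where t: "t < length w" "s = w ! t - 1 \<or> s = w ! t" "touches (take t w) s = l" by auto
      obtain k where k: "k < 4" "column (t, k) = s" "below (t, k) = True" using end_exists[OF t(1,2)] by metis
      have "end_arc D (t, k) = a" unfolding end_arc_braid[OF t(1) k(1)] k sl(1) using l t(3) by (simp add: braid_arc_def)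
      then show False using free[of "(t, k)"] t(1) k(1) by (simp add: ends_def)
    qed
    then have "l = 0" "touches w s = 0" using sl(3) by auto
    then have "a = braid_arc w 0 s" by (simp add: sl(1) braid_arc_def)
    then show "C \<in> set (strands 0)" using a(2) sl(2) by (auto simp: strands_def)
  qed
  ultimately show "\<exists>lw xs V. erase lw = crossing_word (map (\<lambda>g. g - 1) w) \<and> length xs = p \<and> run (conn D {..<length w} {}) lw xs xs V \<and>
      distinct (labels lw) \<and> set (labels lw) = {..<length w} \<and> closed_circles {..<length w} {} \<subseteq> {} \<union> set xs \<union> V"
    using V unfolding conn_all
    by (intro exI[of _ "map (\<lambda>t. Cross t (w ! t - 1)) [0..<length w]"] exI[of _ "strands 0"] exI[of _ V])
      (auto simp: lab[simplified] strands_def)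
qed auto

lemma homology_bound:
  assumes "bounded_word p (crossing_word (map (\<lambda>g. g - 1) w)) I J" "i > I \<or> j > J"
  shows "trivial_group (diagram_homology D i j)"
proof (rule trivial_homology)
  have "state_cells {..<length w} {} {} lab = cells" for lab by (auto simp: state_cells_def cells_def)
  then have "bounded_by cells I J" using bounded_wordD[OF assms(1) represents_braid] by simp
  then show "exact_at hdeg bd (cells \<inter> layer j) i" using assms(2) unfolding bounded_by_def by blast
qed

end

lemma torus_link_bound:
  assumes "n > 0" "i > 2 * int k * int k * int n \<or> j > (2 * int k * int k + 2 * int k) * int n"
  shows "trivial_group (diagram_homology (torus_link (2 * k) (2 * k * n)) i j)"
proof -
  let ?w = "concat (replicate (2 * k * n) [1..<2 * k])"
  interpret braid "2 * k" ?w by unfold_locales auto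
  \<comment> \<open>Braid generators are numbered from 1, positions of letters from 0.\<close>
  have "map (\<lambda>g. g - 1) (concat (replicate N [1..<m])) = concat (replicate N [0..<m - 1])" for N m :: nat
  proof -
    have "map (\<lambda>g. g - 1) [1..<m] = [0..<m - 1]" by (rule nth_equalityI) auto
    then show ?thesis by (induction N) auto
  qed
  moreover have "crossing_word (concat (replicate N gs)) = concat (replicate N (crossing_word gs))" for N gs
    by (induction N) (auto simp: crossing_word_append)
  ultimately have w: "crossing_word (map (\<lambda>g. g - 1) ?w) = torus_word (2 * k) (2 * k * n) @ ascent 0 0"
    by (simp add: torus_word_def)
  have "bounded_word (2 * k) (crossing_word (map (\<lambda>g. g - 1) ?w)) (top_degree k * int n) (top_quantum k * int n)"
    unfolding w by (rule torus_boundedD[OF torus_bounded, where n = n]) (use assms(1) in auto)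
  then show ?thesis
    unfolding torus_link_def by (rule homology_bound) (use assms(2) in \<open>simp add: top_degree_def top_quantum_def\<close>)
qed


section \<open>Reversal of components\<close>

lemma connected_classes_cong: "r \<union> r\<inverse> = s \<union> s\<inverse> \<Longrightarrow> connected_classes A r = connected_classes A s"
  by (simp add: connected_classes_def)

text \<open>Moving the start to the other end of the under-strand rotates the list of arcs by two
  places; this permutes the pairs of a smoothing and may turn them round, which the symmetric
  closure does not notice.\<close>

lemma smoothing_reverse_crossing:
  "smoothing0 (reverse_crossing R X) = smoothing0 X"
  "smoothing1 (reverse_crossing R X) = smoothing1 X \<or> smoothing1 (reverse_crossing R X) = (smoothing1 X)\<inverse>"
  by (cases X; auto)+

lemma circles_reverse: "circles (reverse_components K D) v = circles D v"
proof -
  let ?X = "reverse_crossing (\<Union>K)"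
  let ?s = "\<lambda>X m. if m \<in> v then smoothing1 X else smoothing0 X"
  have "?s (?X X) m \<union> (?s (?X X) m)\<inverse> = ?s X m \<union> (?s X m)\<inverse>" for X m
    using smoothing_reverse_crossing[of "\<Union>K" X] by auto
  then have "(\<Union>m<length (crossings D). ?s (?X (crossings D ! m)) m) \<union> (\<Union>m<length (crossings D). ?s (?X (crossings D ! m)) m)\<inverse> =
      (\<Union>m<length (crossings D). ?s (crossings D ! m) m) \<union> (\<Union>m<length (crossings D). ?s (crossings D ! m) m)\<inverse>"
    unfolding converse_UNION UN_Un_distrib[symmetric] by (intro SUP_cong refl)
  then have "connected_classes (arcs D) (\<Union>m<length (crossings D). ?s (?X (crossings D ! m)) m) =
      connected_classes (arcs D) (\<Union>m<length (crossings D). ?s (crossings D ! m) m)"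
    by (rule connected_classes_cong)
  moreover have "(\<Union>m<length (crossings D). ?s (map ?X (crossings D) ! m) m) = (\<Union>m<length (crossings D). ?s (?X (crossings D ! m)) m)"
    by (intro SUP_cong refl) simp
  ultimately show ?thesis unfolding circles_def reverse_components_def by simp
qed

lemma diagram_homology_reverse: "diagram_homology (reverse_components K D) i j = diagram_homology D i j"
proof -
  let ?D = "reverse_components K D"
  have l: "length (crossings ?D) = length (crossings D)" by (simp add: reverse_components_def)
  have lab: "labellings ?D = labellings D" by (rule ext) (simp add: labellings_def circles_reverse)
  have "basis ?D = basis D" by (intro ext) (simp add: basis_def circles_reverse lab l)
  moreover have "edge_entry ?D = edge_entry D" by (intro ext) (simp add: edge_entry_def circles_reverse)
  then have "boundary_basis ?D = boundary_basis D" by (simp add: boundary_basis_def lab l)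
  ultimately show ?thesis by (simp add: diagram_homology_def chain_group_def boundary_def)
qed

definition exchange :: "'a \<Rightarrow> 'a \<Rightarrow> 'a \<Rightarrow> 'a" where
  "exchange a b s = (if s = a then b else if s = b then a else s)"

context braid
begin

text \<open>The strand in position \<open>s\<close> after \<open>t\<close> crossings started in position \<open>source t s\<close>.\<close>

fun source :: "nat \<Rightarrow> nat \<Rightarrow> nat" where
  "source 0 = id"
| "source (Suc t) = source t \<circ> exchange (w ! t - 1) (w ! t)"

declare source.simps(2) [simp del]

lemma source_cross:
  assumes "t < length w"
  shows "source (Suc t) (w ! t - 1) = source t (w ! t)" "source (Suc t) (w ! t) = source t (w ! t - 1)"
  unfolding source.simps comp_apply exchange_def using letter[OF assms] by simp_all

lemma exchange_letter_range: "t < length w \<Longrightarrow> s < p \<Longrightarrow> exchange (w ! t - 1) (w ! t) s < p"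
  using letter[of t] by (auto simp: exchange_def)

lemma source_range: "t \<le> length w \<Longrightarrow> s < p \<Longrightarrow> source t s < p"
proof (induction t arbitrary: s)
  case (Suc t)
  have "exchange (w ! t - 1) (w ! t) s < p" by (rule exchange_letter_range) (use Suc.prems in simp_all)
  then have "source t (exchange (w ! t - 1) (w ! t) s) < p" using Suc.prems(1) by (intro Suc.IH) simp_all
  then show ?case by (simp only: source.simps comp_apply)
qed simp

lemma source_untouched:
  "t \<le> t' \<Longrightarrow> t' \<le> length w \<Longrightarrow> touches (take t w) s = touches (take t' w) s \<Longrightarrow> source t' s = source t s"
proof (induction t' rule: dec_induct)
  case (step t')
  have m: "touches (take t w) s \<le> touches (take t' w) s" by (rule touches_mono[OF step.hyps(1)])
  have "touches (take (Suc t') w) s = touches (take t' w) s + (if s = w ! t' - 1 \<or> s = w ! t' then 1 else 0)"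
    using step.prems by (intro touches_take_Suc) simp
  then have n: "s \<noteq> w ! t' - 1" "s \<noteq> w ! t'" and e: "touches (take t w) s = touches (take t' w) s"
    using step.prems m by (auto split: if_splits)
  then show ?case using step.IH[OF _ e] step.prems by (simp add: source.simps exchange_def)
qed simp

section \<open>Components of the closure of a pure braid\<close>

abbreviation "linked \<equiv> eq_closure (\<Union>X \<in> set (crossings D). through X)"

lemma linked_equiv: "equiv UNIV linked"
  by (rule equiv_eq_closure)

lemma through_linked: "t < length w \<Longrightarrow> through (braid_crossing w t) \<subseteq> linked"
proof -
  assume "t < length w"
  then have "braid_crossing w t \<in> set (crossings D)" by (simp add: braid_closure_def)
  then show ?thesis by (rule subset_trans[OF UN_upper eq_closure_superset])
qed

lemma linked_source: "t \<le> length w \<Longrightarrow> (braid_arc w 0 (source t s), braid_arc w t s) \<in> linked"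
proof (induction t arbitrary: s)
  case 0
  show ?case using equivD(1)[OF linked_equiv] by simp
next
  case (Suc t)
  let ?s = "exchange (w ! t - 1) (w ! t) s"
  have t: "t < length w" using Suc.prems by simp
  have "(braid_arc w t ?s, braid_arc w (Suc t) s) \<in> linked"
  proof -
    consider "s = w ! t - 1" | "s = w ! t" | "s \<noteq> w ! t - 1" "s \<noteq> w ! t" by blast
    then show ?thesis
    proof cases
      case 1
      have e: "?s = w ! t" unfolding exchange_def 1 by (rule if_P) (rule refl)
      have "(braid_arc w t (w ! t), braid_arc w (Suc t) (w ! t - 1)) \<in> through (braid_crossing w t)"
        by (simp add: braid_crossing_def Let_def)
      then show ?thesis unfolding e unfolding 1 by (rule subsetD[OF through_linked[OF t]])
    next
      case 2
      have e: "?s = w ! t - 1" using letter[OF t] unfolding exchange_def 2 by simp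
      have "(braid_arc w (Suc t) (w ! t), braid_arc w t (w ! t - 1)) \<in> through (braid_crossing w t)"
        by (simp add: braid_crossing_def Let_def)
      then have "(braid_arc w (Suc t) (w ! t), braid_arc w t (w ! t - 1)) \<in> linked" by (rule subsetD[OF through_linked[OF t]])
      then show ?thesis unfolding e unfolding 2 by (rule equivD(2)[OF linked_equiv])
    next
      case 3
      then show ?thesis using braid_arc_Suc[OF t 3] equivD(1)[OF linked_equiv] by (simp add: exchange_def)
    qed
  qed
  moreover have "(braid_arc w 0 (source t ?s), braid_arc w t ?s) \<in> linked" using Suc by simp
  ultimately show ?case unfolding source.simps comp_apply by (rule equivD(3)[OF linked_equiv, rotated])
qed

lemma arc_eq_braid_arc:
  assumes "a \<in> arcs D"
  obtains s t where "s < p" "t \<le> length w" "a = braid_arc w t s"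
proof -
  obtain s l where a: "a = (s, l)" "s < p" "l < max 1 (touches w s)" using assms by (auto simp: braid_closure_def)
  show thesis
  proof (cases "l < touches w s")
    case True
    then have "l < touches (take (length w) w) s" by simp
    from touches_surj[OF this] obtain t where "t < length w" "touches (take t w) s = l" by auto
    then show ?thesis using that[of s t] a True by (simp add: braid_arc_def)
  next
    case False
    then show ?thesis using that[of s 0] a by (simp add: braid_arc_def)
  qed
qed

context
  assumes pure: "\<forall>s<p. source (length w) s = s"
begin

text \<open>Two descriptions of an arc in one column have equal numbers of touches, and then equal
  sources by \<open>source_untouched\<close>, or they are the bottom and the top piece identified by
  the closure, where purity gives equal sources.\<close>

lemma source_eq:
  assumes "s < p" "t \<le> length w" "t' \<le> length w" "braid_arc w t s = braid_arc w t' s"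
  shows "source t s = source t' s"
proof -
  have ord: "source t s = source t' s" if "t \<le> t'" "t' \<le> length w" "braid_arc w t s = braid_arc w t' s" for t t'
  proof (cases "touches (take t w) s = touches (take t' w) s")
    case True
    show ?thesis by (rule source_untouched[OF that(1,2) True, symmetric])
  next
    case False
    let ?T = "touches w s"
    have lt: "touches (take t w) s < touches (take t' w) s" "touches (take t' w) s \<le> ?T"
      using False touches_mono[OF that(1), of w s] touches_le[of t' w s] by linarith+
    have md: "touches (take t w) s mod ?T = touches (take t' w) s mod ?T" using that(3) by (simp add: braid_arc_def)
    have mod_eq: "a = 0 \<and> b = T" if "a < b" "b \<le> T" "a mod T = b mod T" for a b T :: nat
      using that by (cases "b = T") auto
    have z: "touches (take t w) s = 0" "touches (take t' w) s = ?T" using mod_eq[OF lt md] by blast+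
    have "source t s = source 0 s" by (rule source_untouched) (use that(1,2) z(1) in simp_all)
    moreover have "source (length w) s = source t' s" by (rule source_untouched) (use that(2) z(2) in simp_all)
    moreover have "source (length w) s = s" using pure assms(1) by blast
    ultimately show ?thesis by simp
  qed
  show ?thesis
  proof (cases "t \<le> t'")
    case True
    then show ?thesis by (rule ord[OF _ assms(3,4)])
  next
    case False
    then have "t' \<le> t" by simp
    from ord[OF this assms(2) assms(4)[symmetric]] show ?thesis by (rule sym)
  qed
qed

text \<open>By \<open>source_eq\<close> all candidates agree on arcs of the diagram. The value is an
  invariant of components that separates them.\<close>

definition strand :: "nat \<times> nat \<Rightarrow> nat" where
  "strand a = (SOME x. \<exists>t\<le>length w. a = braid_arc w t (fst a) \<and> x = source t (fst a))"

lemma strand_braid_arc: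
  assumes "s < p" "t \<le> length w" shows "strand (braid_arc w t s) = source t s"
  unfolding strand_def
proof (rule some_equality)
  have f: "fst (braid_arc w t s) = s" by (simp add: braid_arc_def)
  show "\<exists>t'\<le>length w. braid_arc w t s = braid_arc w t' (fst (braid_arc w t s)) \<and> source t s = source t' (fst (braid_arc w t s))"
    using assms(2) by (intro exI[of _ t]) (simp add: f)
  fix x assume "\<exists>t'\<le>length w. braid_arc w t s = braid_arc w t' (fst (braid_arc w t s)) \<and> x = source t' (fst (braid_arc w t s))"
  then obtain t' where "t' \<le> length w" "braid_arc w t s = braid_arc w t' s" "x = source t' s" unfolding f by blast
  then show "x = source t s" using source_eq[OF assms(1,2)] by metis
qed

lemma linked_strand: "linked \<subseteq> {(a, b). strand a = strand b}"
proof (rule eq_closure_least)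
  show "equiv UNIV {(a, b). strand a = strand b}" by (auto simp: equiv_def refl_on_def sym_def trans_def)
  have "strand a = strand b" if t: "t < length w" and ab: "(a, b) \<in> through (braid_crossing w t)" for t a b
  proof -
    have p: "w ! t < p" "w ! t - 1 < p" using letter[OF t] by auto
    have "(a, b) = (braid_arc w t (w ! t), braid_arc w (Suc t) (w ! t - 1)) \<or> (a, b) = (braid_arc w (Suc t) (w ! t), braid_arc w t (w ! t - 1))"
      using ab by (simp add: braid_crossing_def Let_def)
    moreover have "strand (braid_arc w t (w ! t)) = strand (braid_arc w (Suc t) (w ! t - 1))"
      "strand (braid_arc w (Suc t) (w ! t)) = strand (braid_arc w t (w ! t - 1))"
      using strand_braid_arc[OF p(1), of t] strand_braid_arc[OF p(2), of t] strand_braid_arc[OF p(1), of "Suc t"]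
        strand_braid_arc[OF p(2), of "Suc t"] source_cross[OF t] t by simp_all
    ultimately show ?thesis by (elim disjE) (simp_all only: prod.inject)
  qed
  note strand_eq = this
  show "(\<Union>X \<in> set (crossings D). through X) \<subseteq> {(a, b). strand a = strand b}"
  proof (rule UN_least, rule subrelI)
    fix X a b assume "X \<in> set (crossings D)" "(a, b) \<in> through X"
    then obtain t where "t < length w" "(a, b) \<in> through (braid_crossing w t)" by (auto simp: braid_closure_def)
    then show "(a, b) \<in> {(a, b). strand a = strand b}" using strand_eq by simp
  qed
qed

definition component :: "nat \<Rightarrow> (nat \<times> nat) set" where
  "component x = linked `` {braid_arc w 0 x}"

lemma link_components_eq: "link_components D = component ` {..<p}"
proof -
  have "link_components D = arcs D // linked" by (simp add: link_components_def connected_classes_def eq_closure_def)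
  also have "\<dots> = component ` {..<p}"
  proof (intro equalityI subsetI)
    fix C assume "C \<in> arcs D // linked"
    then obtain a where a: "a \<in> arcs D" "C = linked `` {a}" by (auto elim: quotientE)
    obtain s t where st: "s < p" "t \<le> length w" "a = braid_arc w t s" by (rule arc_eq_braid_arc[OF a(1)])
    have "C = component (source t s)"
      unfolding component_def a(2) st(3) using equiv_class_eq[OF linked_equiv linked_source[OF st(2), of s]] by simp
    then show "C \<in> component ` {..<p}" using source_range[OF st(2,1)] by auto
  next
    fix C assume "C \<in> component ` {..<p}"
    then obtain x where "x < p" "C = linked `` {braid_arc w 0 x}" by (auto simp: component_def)
    then show "C \<in> arcs D // linked" using braid_arc_in by (auto intro: quotientI)
  qed
  finally show ?thesis .
qed

lemma braid_arc_in_component: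
  assumes "x < p" "s < p" "t \<le> length w"
  shows "braid_arc w t s \<in> component x \<longleftrightarrow> source t s = x"
proof
  assume "braid_arc w t s \<in> component x"
  then have "strand (braid_arc w 0 x) = strand (braid_arc w t s)" using linked_strand by (auto simp: component_def)
  then show "source t s = x" using assms by (simp add: strand_braid_arc)
next
  assume "source t s = x"
  then show "braid_arc w t s \<in> component x" using linked_source[OF assms(3), of s] by (simp add: component_def)
qed

lemma component_inj: "inj_on component {..<p}"
proof (rule inj_onI)
  fix x y assume "x \<in> {..<p}" "y \<in> {..<p}" "component x = component y"
  then show "x = y" using braid_arc_in_component[of x x 0] braid_arc_in_component[of y x 0] by simp
qed

lemma subfamily_strands:
  assumes "K \<subseteq> link_components D"
  obtains Y where "Y \<subseteq> {..<p}" "card Y = card K"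
    "\<And>s t. s < p \<Longrightarrow> t \<le> length w \<Longrightarrow> braid_arc w t s \<in> \<Union>K \<longleftrightarrow> source t s \<in> Y"
proof -
  obtain Y where Y: "Y \<subseteq> {..<p}" "K = component ` Y"
    using assms unfolding link_components_eq by (auto simp: subset_image_iff)
  have "card Y = card K" using card_image[OF inj_on_subset[OF component_inj Y(1)]] Y(2) by simp
  moreover have "braid_arc w t s \<in> \<Union>K \<longleftrightarrow> source t s \<in> Y" if "s < p" "t \<le> length w" for s t
    using Y braid_arc_in_component[OF _ that] by auto
  ultimately show thesis using that Y(1) by blast
qed

text \<open>A crossing becomes negative exactly when one of its two strands is reversed; the
  over-strand is recognised by its upper arc.\<close>

lemma n_minus_reverse:
  assumes "\<And>s t. s < p \<Longrightarrow> t \<le> length w \<Longrightarrow> braid_arc w t s \<in> \<Union>K \<longleftrightarrow> source t s \<in> Y"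
  shows "n_minus (reverse_components K D) = length (filter (\<lambda>t. (source t (w ! t) \<in> Y) \<noteq> (source t (w ! t - 1) \<in> Y)) [0..<length w])"
proof -
  have "is_negative (reverse_crossing (\<Union>K) (braid_crossing w t)) \<longleftrightarrow> (source t (w ! t) \<in> Y) \<noteq> (source t (w ! t - 1) \<in> Y)"
    if t: "t < length w" for t
  proof -
    have p: "w ! t < p" "w ! t - 1 < p" using letter[OF t] by auto
    have "is_negative (reverse_crossing (\<Union>K) (braid_crossing w t)) \<longleftrightarrow>
        (braid_arc w t (w ! t) \<in> \<Union>K) \<noteq> (braid_arc w (Suc t) (w ! t) \<in> \<Union>K)"
      by (simp add: braid_crossing_def Let_def)
    moreover have "braid_arc w t (w ! t) \<in> \<Union>K \<longleftrightarrow> source t (w ! t) \<in> Y" by (rule assms[OF p(1)]) (use t in simp)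
    moreover have "braid_arc w (Suc t) (w ! t) \<in> \<Union>K \<longleftrightarrow> source t (w ! t - 1) \<in> Y"
      unfolding source_cross(2)[OF t, symmetric] by (rule assms[OF p(1)]) (use t in simp)
    ultimately show ?thesis by argo
  qed
  then have "filter (is_negative \<circ> (reverse_crossing (\<Union>K) \<circ> braid_crossing w)) [0..<length w] =
      filter (\<lambda>t. (source t (w ! t) \<in> Y) \<noteq> (source t (w ! t - 1) \<in> Y)) [0..<length w]"
    by (intro filter_cong) auto
  then show ?thesis by (simp add: n_minus_def reverse_components_def braid_closure_def filter_map comp_assoc)
qed

end

end


section \<open>Counting the negative crossings of the reversed torus link row by row\<close>

lemma filter_upt_mult:
  "length (filter P [0..<N * m]) = (\<Sum>r<N. card {c. c < m \<and> P (r * m + c)})"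
proof (induction N)
  case (Suc N)
  have "[0..<Suc N * m] = [0..<N * m] @ map (\<lambda>c. c + N * m) [0..<m]"
    using upt_add_eq_append[of 0 "N * m" m] map_add_upt[of "N * m" m] by (simp add: add.commute)
  moreover have "length (filter P (map (\<lambda>c. c + N * m) [0..<m])) = card {c. c < m \<and> P (N * m + c)}"
  proof -
    have "{c. c < m \<and> P (c + N * m)} = set (filter (P \<circ> (\<lambda>c. c + N * m)) [0..<m])" by auto
    then have "card {c. c < m \<and> P (c + N * m)} = length (filter (P \<circ> (\<lambda>c. c + N * m)) [0..<m])"
      by (simp only: distinct_card distinct_filter distinct_upt)
    then show ?thesis by (simp add: filter_map add.commute)
  qed
  ultimately show ?case using Suc by simp
qed simp

lemma nth_concat_replicate:
  "r < N \<Longrightarrow> c < length xs \<Longrightarrow> concat (replicate N xs) ! (r * length xs + c) = xs ! c"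
proof (induction N arbitrary: r)
  case (Suc N)
  then show ?case by (cases r) (auto simp: nth_append)
qed simp

lemma length_concat_replicate: "length (concat (replicate N xs)) = N * length xs"
  by (induction N) auto

text \<open>In row \<open>r\<close> the strand numbered \<open>r mod p\<close> crosses every other
  strand once; at its crossing number \<open>c\<close> the other one is numbered
  \<open>(c + 1 + r) mod p\<close>. For \<open>p = 2 * k\<close> and \<open>card Y = k\<close> both
  alternatives of the result are \<open>k\<close>.\<close>

lemma card_shift:
  fixes r p :: nat
  assumes "Y \<subseteq> {..<p}" "p > 0"
  shows "card {c. c < p - 1 \<and> ((c + 1 + r) mod p \<in> Y) \<noteq> (r mod p \<in> Y)} = (if r mod p \<in> Y then p - card Y else card Y)"
proof -
  let ?f = "\<lambda>c. (c + 1 + r) mod p" and ?x = "r mod p"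
  have dvd: "p dvd d - c" if "c \<le> d" "(c + r) mod p = (d + r) mod p" for c d
    using that mod_eq_dvd_iff_nat[of "c + r" "d + r" p] by simp
  have eq: "c = d" if "c \<le> d" "d < p - 1" "?f c = ?f d" for c d
    using dvd[of "c + 1" "d + 1"] that by (auto dest: dvd_imp_le)
  have inj: "inj_on ?f {..<p - 1}"
  proof (rule inj_onI)
    fix c d assume "c \<in> {..<p - 1}" "d \<in> {..<p - 1}" "?f c = ?f d"
    then show "c = d" using eq[of c d] eq[of d c] by (cases "c \<le> d") auto
  qed
  have "?f c \<noteq> ?x" if "c < p - 1" for c
  proof
    assume "?f c = ?x"
    then have "p dvd c + 1" using dvd[of 0 "c + 1"] by simp
    then have "p \<le> c + 1" by (rule dvd_imp_le) simp
    then show False using that by simp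
  qed
  then have "?f ` {..<p - 1} \<subseteq> {..<p} - {?x}" using assms(2) by auto
  moreover have "card (?f ` {..<p - 1}) = card ({..<p} - {?x})"
    unfolding card_image[OF inj] using assms(2) by simp
  ultimately have im: "?f ` {..<p - 1} = {..<p} - {?x}" by (intro card_subset_eq) auto
  let ?C = "{c. c < p - 1 \<and> (?f c \<in> Y) \<noteq> (?x \<in> Y)}"
  have "card ?C = card (?f ` ?C)"
    by (rule card_image[symmetric], rule inj_on_subset[OF inj]) auto
  also have "?f ` ?C = {y \<in> ?f ` {..<p - 1}. (y \<in> Y) \<noteq> (?x \<in> Y)}" by auto
  also have "\<dots> = (if ?x \<in> Y then {..<p} - Y else Y)" unfolding im using assms(1) by auto
  finally show ?thesis using card_Diff_subset[of Y "{..<p}"] assms(1) finite_subset[OF assms(1)] by simp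
qed

context braid
begin

text \<open>A row carries the strand from position 0 across all the others, which move one position
  to the left; after \<open>c\<close> crossings it is at position \<open>c\<close>.\<close>

lemma source_row:
  assumes w: "w = concat (replicate N [1..<p])" and r: "r < N" and start: "\<And>s. s < p \<Longrightarrow> source (r * (p - 1)) s = (s + r) mod p"
  shows "c \<le> p - 1 \<Longrightarrow> s < p \<Longrightarrow> source (r * (p - 1) + c) s =
    (if s < c then (s + 1 + r) mod p else if s = c then r mod p else (s + r) mod p)"
proof (induction c arbitrary: s)
  case 0
  then show ?case using start[of s] by auto
next
  case (Suc c)
  have "w ! (r * (p - 1) + c) = Suc c"
    using nth_concat_replicate[of r N c "[1..<p]"] r Suc.prems by (simp add: w)
  then have "source (r * (p - 1) + Suc c) s = source (r * (p - 1) + c) (exchange c (Suc c) s)" by (simp add: source.simps)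
  moreover have "exchange c (Suc c) s < p" using Suc.prems by (auto simp: exchange_def)
  ultimately show ?case using Suc by (auto simp: exchange_def)
qed

lemma source_start:
  assumes w: "w = concat (replicate N [1..<p])"
  shows "r \<le> N \<Longrightarrow> s < p \<Longrightarrow> source (r * (p - 1)) s = (s + r) mod p"
proof (induction r arbitrary: s)
  case (Suc r)
  have "source (Suc r * (p - 1)) s = source (r * (p - 1) + (p - 1)) s" by (simp add: add.commute)
  also have "\<dots> = (if s < p - 1 then (s + 1 + r) mod p else if s = p - 1 then r mod p else (s + r) mod p)"
    using Suc by (intro source_row[OF w]) auto
  also have "\<dots> = (s + Suc r) mod p"
  proof (cases "s < p - 1")
    case False
    then have "s + Suc r = r + p" using Suc.prems by simp
    then show ?thesis using False Suc.prems by simp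
  qed simp
  finally show ?case .
qed simp

end

text \<open>Each of the \<open>2 * k * n\<close> rows contains exactly \<open>k\<close> negative
  crossings, whether or not the strand crossing all others in it is reversed.\<close>

lemma n_minus_torus_link:
  assumes "k > 0" "K \<subseteq> link_components (torus_link (2 * k) (2 * k * n))" "card K = k"
  shows "n_minus (reverse_components K (torus_link (2 * k) (2 * k * n))) = 2 * k * n * k"
proof -
  let ?p = "2 * k" and ?N = "2 * k * n"
  let ?w = "concat (replicate ?N [1..<?p])"
  interpret braid ?p ?w by unfold_locales auto
  have len: "length ?w = ?N * (?p - 1)" by (simp only: length_concat_replicate length_upt)
  \<comment> \<open>Each row rotates the numbering by one, and \<open>2 * k * n\<close> is a
    multiple of the number of strands.\<close>
  have pure: "\<forall>s<?p. source (length ?w) s = s"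
  proof (intro allI impI)
    fix s assume "s < ?p"
    then have "source (?N * (?p - 1)) s = (s + ?N) mod ?p" by (rule source_start[OF refl order_refl])
    then show "source (length ?w) s = s" unfolding len using \<open>s < ?p\<close> by simp
  qed
  obtain Y where Y: "Y \<subseteq> {..<?p}" "card Y = k"
    "\<And>s t. s < ?p \<Longrightarrow> t \<le> length ?w \<Longrightarrow> braid_arc ?w t s \<in> \<Union>K \<longleftrightarrow> source t s \<in> Y"
    using subfamily_strands[OF pure assms(2)[unfolded torus_link_def]] assms(3) by metis
  let ?neg = "\<lambda>t. (source t (?w ! t) \<in> Y) \<noteq> (source t (?w ! t - 1) \<in> Y)"
  have "card {c. c < ?p - 1 \<and> ?neg (r * (?p - 1) + c)} = k" if r: "r < ?N" for r
  proof -
    have "?neg (r * (?p - 1) + c) \<longleftrightarrow> ((c + 1 + r) mod ?p \<in> Y) \<noteq> (r mod ?p \<in> Y)" if c: "c < ?p - 1" for c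
    proof -
      have l: "?w ! (r * (?p - 1) + c) = c + 1"
        using nth_concat_replicate[of r ?N c "[1..<?p]"] r c by simp
      have "source (r * (?p - 1) + c) s =
          (if s < c then (s + 1 + r) mod ?p else if s = c then r mod ?p else (s + r) mod ?p)" if "s < ?p" for s
        by (rule source_row[OF refl r]) (use source_start[OF refl] r c that in auto)
      from this[of "c + 1"] this[of c] show ?thesis unfolding l using c by simp
    qed
    then have "{c. c < ?p - 1 \<and> ?neg (r * (?p - 1) + c)} =
        {c. c < ?p - 1 \<and> ((c + 1 + r) mod ?p \<in> Y) \<noteq> (r mod ?p \<in> Y)}" by blast
    then show ?thesis using card_shift[OF Y(1), of r] assms(1) Y(2) by simp
  qed
  then have "(\<Sum>r<?N. card {c. c < ?p - 1 \<and> ?neg (r * (?p - 1) + c)}) = ?N * k" by simp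
  moreover have "n_minus (reverse_components K D) = length (filter ?neg [0..<?N * (?p - 1)])"
    unfolding len[symmetric] by (rule n_minus_reverse[OF pure Y(3)])
  ultimately show ?thesis unfolding filter_upt_mult torus_link_def by simp
qed

lemma n_plus_n_minus:
  fixes D :: "'a diagram"
  shows "n_plus D + n_minus D = length (crossings D)"
proof -
  have neg: "is_negative = (\<lambda>X :: 'a crossing. \<not> is_positive X)"
  proof
    show "is_negative X = (\<not> is_positive X)" for X :: "'a crossing" by (cases X) auto
  qed
  show ?thesis unfolding n_plus_def n_minus_def neg by (rule sum_length_filter_compl)
qed

theorem corollary2:
  fixes k n :: nat and i j :: int and K :: "(nat \<times> nat) set set"
  assumes "k > 0" and "n > 0"
    and "K \<subseteq> link_components (torus_link (2 * k) (2 * k * n))" and "card K = k"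
    and "i > 0 \<or> j > 0"
  shows "trivial_group
    (khovanov_homology (reverse_components K (torus_link (2 * k) (2 * k * n))) i j)"
proof -
  let ?D = "reverse_components K (torus_link (2 * k) (2 * k * n))"
  have minus: "n_minus ?D = 2 * k * n * k" by (rule n_minus_torus_link[OF assms(1,3,4)])
  have "n_plus ?D + n_minus ?D = 2 * k * n * (2 * k - 1)"
    unfolding n_plus_n_minus
    by (simp add: reverse_components_def torus_link_def braid_closure_def length_concat_replicate)
  moreover have "int (2 * k - 1) = 2 * int k - 1" using assms(1) by simp
  ultimately have "int (n_plus ?D) + int (n_minus ?D) = 2 * int k * int n * (2 * int k - 1)"
    by (metis of_nat_add of_nat_mult of_nat_numeral)
  \<comment> \<open>From \<open>n_minus = 2k^2 n\<close> and the total number of crossings,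
    \<open>n_plus = 2k(k-1)n\<close>; so \<open>2 * n_minus - n_plus\<close> is
    \<open>(2k^2 + 2k)n\<close>, the q-bound for the torus diagram.\<close>
  then have plus: "j - int (n_plus ?D) + 2 * int (n_minus ?D) = j + (2 * int k * int k + 2 * int k) * int n"
    unfolding minus by (simp add: algebra_simps)
  have "i + int (n_minus ?D) > 2 * int k * int k * int n \<or>
      j - int (n_plus ?D) + 2 * int (n_minus ?D) > (2 * int k * int k + 2 * int k) * int n"
    using assms(5) unfolding plus unfolding minus by (simp add: algebra_simps)
  then show ?thesis
    unfolding khovanov_homology_def diagram_homology_reverse by (rule torus_link_bound[OF assms(2)])
qed


end
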